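(* Let $\kappa$ be an infinite cardinal. Assigning to each coarse space $\mathbf X$ of coarse cardinality at most $\kappa$ the $K$-theory groups $K_*(C^*_{\kappa,\mathrm{Roe}}(\mathbf X))$, and to each proper coarse map $\mathbf f\colon\mathbf X\to\mathbf Y$ the homomorphism $$(\phi_{\kappa,\mathbf f})_*\colon K_*(C^*_{\kappa,\mathrm{Roe}}(\mathbf X))\to K_*(C^*_{\kappa,\mathrm{Roe}}(\mathbf Y)),$$ gives a functor from the category of coarse spaces of coarse cardinality at most $\kappa$ and proper coarse maps to the category of $\mathbb Z/2\mathbb Z$-graded abelian groups. Moreover, this functor is well-defined up to natural isomorphism (different choices of the defining modules and of the covering isometries yield naturally isomorphic functors).
   Context: Relations. A relation from $X$ to $Y$ is a subset $R\subseteq Y\times X$; $R^{T}=\{(x,y):(y,x)\in R\}$; $R_2\circ R_1=\{(z,x):\exists y,\ (z,y)\in R_2,\ (y,x)\in R_1\}$; $R(A)=\{y:\exists a\in A,\ (y,a)\in R\}$. $B\subseteq Y$ and $A\subseteq X$ are $R$-separated if $B\cap R(A)=\emptyset$. A coarse structure on $X$ is a non-empty family $\mathcal E$ of subsets of $X\times X$, closed under subsets and finite unions, containing the diagonal $\Delta_X$, and closed under $E\mapsto E^T$ and under composition; $\mathbf X=(X,\mathcal E)$ is a coarse space. A gauge is a symmetric element of $\mathcal E$ containing $\Delta_X$. $A\subseteq X$ is $E$-bounded if $A\times A\subseteq E$, and bounded if $A\times A\in\mathcal E$. $A\subseteq X$ is coarsely dense if $X=E(A)$ for some $E\in\mathcal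 E$. For coarse spaces $(X,\mathcal E),(Y,\mathcal F)$ and relations $R,R'\subseteq Y\times X$ write $R'\preccurlyeq R$ if $R'\subseteq F\circ R\circ E$ for some $F\in\mathcal F$, $E\in\mathcal E$, and $R\asymp R'$ if $R\preccurlyeq R'\preccurlyeq R$; a coarse subspace of $\mathbf Y\times\mathbf X$ is an $\asymp$-class $[R]$. $R$ is controlled if $R\circ E\circ R^T\in\mathcal F$ for all $E\in\mathcal E$; a coarse map $\mathbf f\colon\mathbf X\to\mathbf Y$ is the class $[R]$ of a controlled relation whose projection to $X$ is coarsely dense. Coarse maps can be represented by (relations $\{(f(x),x)\}$ of) functions $f\colon X\to Y$, and are composed by composing representing functions. $\mathbf f=[R]$ is proper if $R^T(B)$ is bounded for every bounded $B\subseteq Y$. $\mathbf f$ is a coarse equivalence if it has an inverse coarse map (compositions equal to $[\Delta_X]$, $[\Delta_Y]$). The coarse cardinality of $\mathbf X$ is the least cardinality $|Y|$ of a coarse space coarsely equivalent to $\mathbf X$. An $\mathbf X$-module consists of a Boolean algebra $\mathfrak A$ of subsets of $X$ with $X\in\mathfrak A$ (its members are called measurable), a Hilbert space $\mathcal H$, and a map $\mathbb 1_\bullet$ from $\mathfrak A$ to projections in $\mathcal B(\mathcal H)$ with $\mathbb 1_\emptyset=0$, $\mathbb 1_X=1$, $\mathbb 1_{A\cap B}=\mathbb 1_A\mathbb 1_B$, $\mathbb 1_{A\cup B}=\mathbb 1_A+\mathbb 1_B-\mathbb 1_A\mathbb 1_B$, non-degenerate: for some gauge $\widetilde E$ the subspaces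 $\mathbb 1_A(\mathcal H)$ with $A$ measurable and $\widetilde E$-bounded span a dense subspace. It is $\kappa$-ample if for some gauge $\widetilde E$ the union of all measurable $\widetilde E$-bounded $A$ with $\mathbb 1_A\neq0$ is coarsely dense and $\mathbb 1_A$ has rank at least $\kappa$ for each such $A$. The rank of a Hilbert space (or module) is the cardinality of an orthonormal basis. The module is discrete if there are a gauge $\widetilde E$ and a partition $X=\bigsqcup_{i\in I}A_i$ into measurable $\widetilde E$-bounded sets with $\sum_i\mathbb 1_{A_i}=1$ strongly, and such that every $C\subseteq X$ with $C\cap A_i\in\mathfrak A$ for all $i$ is in $\mathfrak A$. For a bounded operator $t\colon\mathcal H_{\mathbf X}\to\mathcal H_{\mathbf Y}$ between an $\mathbf X$-module and a $\mathbf Y$-module and $S\subseteq Y\times X$, $\mathrm{Supp}(t)\subseteq S$ means $\mathbb 1_Bt\mathbb 1_A=0$ for all $S$-separated measurable $B\subseteq Y$, $A\subseteq X$. The coarse support $\mathbf{Supp}(t)$ is the (unique, always existing) coarse subspace $[S]$ with $\mathrm{Supp}(t)\subseteq S$ and $S\preccurlyeq R$ whenever $\mathrm{Supp}(t)\subseteq R$. $t$ covers $\mathbf f$ if $\mathbf{Supp}(t)=\mathbf f$. $t\in\mathcal B(\mathcal H_{\mathbf X})$ has controlled propagation if $\mathrm{Supp}(t)\subseteq E$ for some $E\in\mathcal E$; it is locally compact if $\mathbb 1_At$ and $t\mathbb 1_A$ are compact for every bounded measurable $A$. $C^*_{\mathrm{Roe}}(\mathcal H_{\mathbf X})$ is the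 norm closure of the locally compact operators of controlled propagation. $C^*_{\kappa,\mathrm{Roe}}(\mathbf X)=C^*_{\mathrm{Roe}}(\mathcal H_{\mathbf X})$, where $\mathcal H_{\mathbf X}$ is a chosen discrete $\kappa$-ample $\mathbf X$-module of rank $\kappa$ (one exists when the coarse cardinality is at most $\kappa$). For a proper coarse map $\mathbf f$, $\phi_{\kappa,\mathbf f}=\mathrm{Ad}(t)\colon x\mapsto txt^*$, where $t\colon\mathcal H_{\mathbf X}\to\mathcal H_{\mathbf Y}$ is a chosen isometry covering $\mathbf f$ (one exists, and $\mathrm{Ad}(t)$ maps $C^*_{\kappa,\mathrm{Roe}}(\mathbf X)$ into $C^*_{\kappa,\mathrm{Roe}}(\mathbf Y)$). *)

theory Defs
  imports
    "HOL-Analysis.Analysis"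
    "HOL-Algebra.Coset"
    "HOL-Library.Disjoint_Sets"
begin

unbundle cardinal_syntax

section \<open>Coarse spaces\<close>

text \<open>A relation from \<open>X\<close> to \<open>Y\<close> is a set of pairs \<open>(y, x)\<close>, target first.  With this
  orientation the composition \<open>R\<^sub>2 \<circ> R\<^sub>1\<close> is the library's \<open>R\<^sub>2 O R\<^sub>1\<close>, the transpose is \<open>R\<inverse>\<close>,
  and the image \<open>R(A)\<close> is \<open>R\<inverse> `` A\<close>.\<close>

definition rel_img :: "('b \<times> 'a) set \<Rightarrow> 'a set \<Rightarrow> 'b set" where
  "rel_img R A = {y. \<exists>a\<in>A. (y, a) \<in> R}"

definition separated :: "('b \<times> 'a) set \<Rightarrow> 'b set \<Rightarrow> 'a set \<Rightarrow> bool" where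
  "separated R B A \<longleftrightarrow> B \<inter> rel_img R A = {}"

record 'a coarse =
  points :: "'a set"
  ents :: "('a \<times> 'a) set set"

definition coarse_space :: "'a coarse \<Rightarrow> bool" where
  "coarse_space X \<longleftrightarrow>
     ents X \<noteq> {} \<and>
     (\<forall>E\<in>ents X. E \<subseteq> points X \<times> points X) \<and>
     (\<forall>E\<in>ents X. \<forall>E'. E' \<subseteq> E \<longrightarrow> E' \<in> ents X) \<and>
     (\<forall>E\<in>ents X. \<forall>E'\<in>ents X. E \<union> E' \<in> ents X) \<and>
     Id_on (points X) \<in> ents X \<and>
     (\<forall>E\<in>ents X. E\<inverse> \<in> ents X) \<and>
     (\<forall>E\<in>ents X. \<forall>E'\<in>ents X. E O E' \<in> ents X)"

definition gauge_of :: "'a coarse \<Rightarrow> ('a \<times> 'a) set \<Rightarrow> bool" where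
  "gauge_of X E \<longleftrightarrow> E \<in> ents X \<and> E\<inverse> = E \<and> Id_on (points X) \<subseteq> E"

definition ent_bounded :: "'a coarse \<Rightarrow> ('a \<times> 'a) set \<Rightarrow> 'a set \<Rightarrow> bool" where
  "ent_bounded X E A \<longleftrightarrow> A \<subseteq> points X \<and> A \<times> A \<subseteq> E"

definition cbounded :: "'a coarse \<Rightarrow> 'a set \<Rightarrow> bool" where
  "cbounded X A \<longleftrightarrow> A \<subseteq> points X \<and> A \<times> A \<in> ents X"

definition coarsely_dense :: "'a coarse \<Rightarrow> 'a set \<Rightarrow> bool" where
  "coarsely_dense X A \<longleftrightarrow> A \<subseteq> points X \<and> (\<exists>E\<in>ents X. points X = rel_img E A)"

definition coarse_le ::
    "'a coarse \<Rightarrow> 'b coarse \<Rightarrow> ('b \<times> 'a) set \<Rightarrow> ('b \<times> 'a) set \<Rightarrow> bool" where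
  "coarse_le X Y R' R \<longleftrightarrow> (\<exists>F\<in>ents Y. \<exists>E\<in>ents X. R' \<subseteq> F O R O E)"

text \<open>The coarse subspace \<open>[R]\<close> of \<open>Y \<times> X\<close>.\<close>

definition coarse_class ::
    "'a coarse \<Rightarrow> 'b coarse \<Rightarrow> ('b \<times> 'a) set \<Rightarrow> ('b \<times> 'a) set set" where
  "coarse_class X Y R =
     {R'. R' \<subseteq> points Y \<times> points X \<and> coarse_le X Y R' R \<and> coarse_le X Y R R'}"

definition controlled_rel :: "'a coarse \<Rightarrow> 'b coarse \<Rightarrow> ('b \<times> 'a) set \<Rightarrow> bool" where
  "controlled_rel X Y R \<longleftrightarrow>
     R \<subseteq> points Y \<times> points X \<and> (\<forall>E\<in>ents X. R O E O R\<inverse> \<in> ents Y)"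

definition coarse_map :: "'a coarse \<Rightarrow> 'b coarse \<Rightarrow> ('b \<times> 'a) set set \<Rightarrow> bool" where
  "coarse_map X Y f \<longleftrightarrow>
     (\<exists>R. controlled_rel X Y R \<and> coarsely_dense X (snd ` R) \<and> f = coarse_class X Y R)"

definition proper_coarse_map :: "'a coarse \<Rightarrow> 'b coarse \<Rightarrow> ('b \<times> 'a) set set \<Rightarrow> bool" where
  "proper_coarse_map X Y f \<longleftrightarrow>
     coarse_map X Y f \<and> (\<forall>R\<in>f. \<forall>B. cbounded Y B \<longrightarrow> cbounded X (rel_img (R\<inverse>) B))"

definition fun_rel :: "'a coarse \<Rightarrow> ('a \<Rightarrow> 'b) \<Rightarrow> ('b \<times> 'a) set" where
  "fun_rel X f = {(f x, x) | x. x \<in> points X}"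

definition represents ::
    "'a coarse \<Rightarrow> 'b coarse \<Rightarrow> ('a \<Rightarrow> 'b) \<Rightarrow> ('b \<times> 'a) set set \<Rightarrow> bool" where
  "represents X Y f F \<longleftrightarrow> f \<in> points X \<rightarrow> points Y \<and> F = coarse_class X Y (fun_rel X f)"

definition coarse_comp ::
    "'a coarse \<Rightarrow> 'b coarse \<Rightarrow> 'c coarse \<Rightarrow> ('c \<times> 'b) set set \<Rightarrow> ('b \<times> 'a) set set
      \<Rightarrow> ('c \<times> 'a) set set" where
  "coarse_comp X Y Z G F =
     coarse_class X Z (fun_rel X ((SOME g. represents Y Z g G) \<circ> (SOME f. represents X Y f F)))"

definition coarse_id :: "'a coarse \<Rightarrow> ('a \<times> 'a) set set" where
  "coarse_id X = coarse_class X X (Id_on (points X))"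

definition coarsely_equivalent :: "'a coarse \<Rightarrow> 'b coarse \<Rightarrow> bool" where
  "coarsely_equivalent X Y \<longleftrightarrow>
     (\<exists>F G. coarse_map X Y F \<and> coarse_map Y X G \<and>
        coarse_comp X Y X G F = coarse_id X \<and> coarse_comp Y X Y F G = coarse_id Y)"

text \<open>The competitors \<open>Y\<close> are taken over the type of points of \<open>X\<close>.  This loses nothing: if \<open>g\<close>
  represents a coarse equivalence from \<open>Y\<close> to \<open>X\<close>, then the image of \<open>g\<close>, with the induced
  structure, is coarsely equivalent to \<open>X\<close> and has at most \<open>|Y|\<close> points.\<close>

definition coarse_card :: "'a coarse \<Rightarrow> 'a rel" where
  "coarse_card X =
     |points (SOME Y :: 'a coarse. coarse_space Y \<and> coarsely_equivalent X Y \<and>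
        (\<forall>Z :: 'a coarse. coarse_space Z \<and> coarsely_equivalent X Z \<longrightarrow>
           |points Y| \<le>o |points Z| ))|"


section \<open>Hilbert spaces and operators\<close>

class chilbert_space = real_inner + banach +
  fixes scaleC :: "complex \<Rightarrow> 'a \<Rightarrow> 'a"  (infixr \<open>*\<^sub>C\<close> 75)
    and cinner :: "'a \<Rightarrow> 'a \<Rightarrow> complex"
  assumes scaleC_add_right: "c *\<^sub>C (x + y) = c *\<^sub>C x + c *\<^sub>C y"
    and scaleC_add_left: "(c + d) *\<^sub>C x = c *\<^sub>C x + d *\<^sub>C x"
    and scaleC_scaleC: "c *\<^sub>C (d *\<^sub>C x) = (c * d) *\<^sub>C x"
    and scaleC_of_real: "complex_of_real r *\<^sub>C x = r *\<^sub>R x"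
    and cinner_add_left: "cinner (x + y) z = cinner x z + cinner y z"
    and cinner_scaleC_left: "cinner (c *\<^sub>C x) z = c * cinner x z"
    and cinner_commute: "cinner x y = cnj (cinner y x)"
    and inner_eq_Re_cinner: "x \<bullet> y = Re (cinner x y)"

global_interpretation complex_vector:
  vector_space "scaleC :: complex \<Rightarrow> 'a \<Rightarrow> 'a::chilbert_space"
  defines cspan = complex_vector.span
    and csubspace = complex_vector.subspace
  using scaleC_of_real[of 1]
  by unfold_locales (simp_all add: scaleC_add_right scaleC_add_left scaleC_scaleC)

text \<open>The Hilbert spaces under consideration are the closed complex subspaces of a type of class
  \<^class>\<open>chilbert_space\<close>; any set-indexed family of Hilbert spaces can be realised in this way
  inside its \<open>\<ell>\<^sup>2\<close>-sum.\<close>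

definition hilbert_sub :: "'h::chilbert_space set \<Rightarrow> bool" where
  "hilbert_sub H \<longleftrightarrow> csubspace H \<and> closed H"

definition corthonormal :: "'h::chilbert_space set \<Rightarrow> bool" where
  "corthonormal B \<longleftrightarrow> (\<forall>x\<in>B. \<forall>y\<in>B. cinner x y = (if x = y then 1 else 0))"

definition orthonormal_basis :: "'h::chilbert_space set \<Rightarrow> 'h set \<Rightarrow> bool" where
  "orthonormal_basis H B \<longleftrightarrow> corthonormal B \<and> B \<subseteq> H \<and> closure (cspan B) = H"

definition hilbert_rank :: "'h::chilbert_space set \<Rightarrow> 'h rel" where
  "hilbert_rank H = |SOME B. orthonormal_basis H B|"

text \<open>A bounded operator from \<open>H\<close> to \<open>K\<close> is identified with its extension by zero on the
  orthogonal complement of \<open>H\<close>.  This makes equality, operator norm, composition and adjoint of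
  operators agree with those of the extensions.\<close>

definition bops :: "'h::chilbert_space set \<Rightarrow> 'k::chilbert_space set \<Rightarrow> ('h \<Rightarrow>\<^sub>L 'k) set" where
  "bops H K =
     {t. (\<forall>c v. blinfun_apply t (c *\<^sub>C v) = c *\<^sub>C blinfun_apply t v) \<and>
         (\<forall>v. blinfun_apply t v \<in> K) \<and>
         (\<forall>v. (\<forall>w\<in>H. cinner v w = 0) \<longrightarrow> blinfun_apply t v = 0)}"

definition op_adj :: "('h::chilbert_space \<Rightarrow>\<^sub>L 'k::chilbert_space) \<Rightarrow> ('k \<Rightarrow>\<^sub>L 'h)" where
  "op_adj t = (THE s. \<forall>x y. cinner (blinfun_apply t x) y = cinner x (blinfun_apply s y))"

definition op_scale :: "complex \<Rightarrow> ('h::chilbert_space \<Rightarrow>\<^sub>L 'k::chilbert_space) \<Rightarrow> ('h \<Rightarrow>\<^sub>L 'k)" where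
  "op_scale c t = Blinfun (\<lambda>v. c *\<^sub>C blinfun_apply t v)"

definition hilbert_projection :: "'h::chilbert_space set \<Rightarrow> ('h \<Rightarrow>\<^sub>L 'h) \<Rightarrow> bool" where
  "hilbert_projection H p \<longleftrightarrow> p \<in> bops H H \<and> p o\<^sub>L p = p \<and> op_adj p = p"

definition hilbert_isometry ::
    "'h::chilbert_space set \<Rightarrow> 'k::chilbert_space set \<Rightarrow> ('h \<Rightarrow>\<^sub>L 'k) \<Rightarrow> bool" where
  "hilbert_isometry H K t \<longleftrightarrow>
     t \<in> bops H K \<and> (\<forall>v\<in>H. norm (blinfun_apply t v) = norm v)"

definition compact_op ::
    "'h::chilbert_space set \<Rightarrow> 'k::chilbert_space set \<Rightarrow> ('h \<Rightarrow>\<^sub>L 'k) \<Rightarrow> bool" where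
  "compact_op H K t \<longleftrightarrow> t \<in> bops H K \<and> compact (closure (blinfun_apply t ` (H \<inter> cball 0 1)))"


section \<open>Coarse modules\<close>

record (overloaded) ('a, 'h) cmodule =
  meas :: "'a set set"
  hsp :: "'h set"
  chi :: "'a set \<Rightarrow> ('h \<Rightarrow>\<^sub>L 'h)"

definition coarse_module :: "'a coarse \<Rightarrow> ('a, 'h::chilbert_space) cmodule \<Rightarrow> bool" where
  "coarse_module X M \<longleftrightarrow>
     algebra (points X) (meas M) \<and>
     hilbert_sub (hsp M) \<and>
     (\<forall>A\<in>meas M. hilbert_projection (hsp M) (chi M A)) \<and>
     chi M {} = 0 \<and>
     (\<forall>v\<in>hsp M. blinfun_apply (chi M (points X)) v = v) \<and>
     (\<forall>A\<in>meas M. \<forall>B\<in>meas M. chi M (A \<inter> B) = chi M A o\<^sub>L chi M B) \<and>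
     (\<forall>A\<in>meas M. \<forall>B\<in>meas M. chi M (A \<union> B) = chi M A + chi M B - (chi M A o\<^sub>L chi M B)) \<and>
     (\<exists>E. gauge_of X E \<and>
        closure (cspan (\<Union>A\<in>{A \<in> meas M. ent_bounded X E A}. blinfun_apply (chi M A) ` hsp M))
          = hsp M)"

definition ample_module ::
    "'k rel \<Rightarrow> 'a coarse \<Rightarrow> ('a, 'h::chilbert_space) cmodule \<Rightarrow> bool" where
  "ample_module \<kappa> X M \<longleftrightarrow>
     (\<exists>E. gauge_of X E \<and>
        coarsely_dense X (\<Union>{A \<in> meas M. ent_bounded X E A \<and> chi M A \<noteq> 0}) \<and>
        (\<forall>A\<in>meas M. ent_bounded X E A \<and> chi M A \<noteq> 0 \<longrightarrow>
           \<kappa> \<le>o hilbert_rank (blinfun_apply (chi M A) ` hsp M)))"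

definition discrete_module :: "'a coarse \<Rightarrow> ('a, 'h::chilbert_space) cmodule \<Rightarrow> bool" where
  "discrete_module X M \<longleftrightarrow>
     (\<exists>E P. gauge_of X E \<and> partition_on (points X) P \<and> P \<subseteq> meas M \<and>
        (\<forall>A\<in>P. ent_bounded X E A) \<and>
        (\<forall>v\<in>hsp M. ((\<lambda>A. blinfun_apply (chi M A) v) has_sum v) P) \<and>
        (\<forall>C. C \<subseteq> points X \<and> (\<forall>A\<in>P. C \<inter> A \<in> meas M) \<longrightarrow> C \<in> meas M))"

text \<open>The only module over the empty coarse space is zero, so the condition on the rank is
  imposed for non-empty spaces only.\<close>

definition roe_module ::
    "'k rel \<Rightarrow> 'a coarse \<Rightarrow> ('a, 'h::chilbert_space) cmodule \<Rightarrow> bool" where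
  "roe_module \<kappa> X M \<longleftrightarrow>
     coarse_module X M \<and> discrete_module X M \<and> ample_module \<kappa> X M \<and>
     (points X \<noteq> {} \<longrightarrow> hilbert_rank (hsp M) =o \<kappa>)"

definition supp_in ::
    "('a, 'h::chilbert_space) cmodule \<Rightarrow> ('b, 'k::chilbert_space) cmodule
      \<Rightarrow> ('h \<Rightarrow>\<^sub>L 'k) \<Rightarrow> ('b \<times> 'a) set \<Rightarrow> bool" where
  "supp_in M N t S \<longleftrightarrow>
     (\<forall>B\<in>meas N. \<forall>A\<in>meas M. separated S B A \<longrightarrow> chi N B o\<^sub>L t o\<^sub>L chi M A = 0)"

text \<open>\<open>F\<close> is the coarse support of \<open>t\<close>.  The defining property determines \<open>F\<close> uniquely.\<close>

definition is_coarse_support ::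
    "'a coarse \<Rightarrow> 'b coarse \<Rightarrow> ('a, 'h::chilbert_space) cmodule
      \<Rightarrow> ('b, 'k::chilbert_space) cmodule \<Rightarrow> ('h \<Rightarrow>\<^sub>L 'k) \<Rightarrow> ('b \<times> 'a) set set \<Rightarrow> bool" where
  "is_coarse_support X Y M N t F \<longleftrightarrow>
     (\<exists>S. S \<subseteq> points Y \<times> points X \<and> F = coarse_class X Y S \<and> supp_in M N t S \<and>
        (\<forall>R. R \<subseteq> points Y \<times> points X \<and> supp_in M N t R \<longrightarrow> coarse_le X Y S R))"

definition covering_isometry ::
    "'a coarse \<Rightarrow> 'b coarse \<Rightarrow> ('a, 'h::chilbert_space) cmodule
      \<Rightarrow> ('b, 'k::chilbert_space) cmodule \<Rightarrow> ('b \<times> 'a) set set \<Rightarrow> ('h \<Rightarrow>\<^sub>L 'k) \<Rightarrow> bool" where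
  "covering_isometry X Y M N F t \<longleftrightarrow>
     hilbert_isometry (hsp M) (hsp N) t \<and> is_coarse_support X Y M N t F"

definition controlled_propagation ::
    "'a coarse \<Rightarrow> ('a, 'h::chilbert_space) cmodule \<Rightarrow> ('h \<Rightarrow>\<^sub>L 'h) \<Rightarrow> bool" where
  "controlled_propagation X M t \<longleftrightarrow> (\<exists>E\<in>ents X. supp_in M M t E)"

definition locally_compact_op ::
    "'a coarse \<Rightarrow> ('a, 'h::chilbert_space) cmodule \<Rightarrow> ('h \<Rightarrow>\<^sub>L 'h) \<Rightarrow> bool" where
  "locally_compact_op X M t \<longleftrightarrow>
     (\<forall>A\<in>meas M. cbounded X A \<longrightarrow>
        compact_op (hsp M) (hsp M) (chi M A o\<^sub>L t) \<and>
        compact_op (hsp M) (hsp M) (t o\<^sub>L chi M A))"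


section \<open>K-theory of C*-algebras\<close>

text \<open>The additive structure and the topology of an algebra are those of the type of its
  elements; the record holds the rest.\<close>

record 'b star_alg =
  elems :: "'b set"
  amult :: "'b \<Rightarrow> 'b \<Rightarrow> 'b"
  ascale :: "complex \<Rightarrow> 'b \<Rightarrow> 'b"
  astar :: "'b \<Rightarrow> 'b"

definition complex_alg :: "complex star_alg" where
  "complex_alg = \<lparr>elems = UNIV, amult = (*), ascale = (*), astar = cnj\<rparr>"

text \<open>The unit \<open>(1, 0)\<close> is adjoined even if \<open>A\<close> already has one.  The product topology on
  pairs is the topology of the C*-norm of the unitization.\<close>

definition unitize :: "'b::real_normed_vector star_alg \<Rightarrow> (complex \<times> 'b) star_alg" where
  "unitize A =
     \<lparr>elems = UNIV \<times> elems A,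
      amult = (\<lambda>(l, a) (m, b). (l * m, ascale A l b + ascale A m a + amult A a b)),
      ascale = (\<lambda>c (l, a). (c * l, ascale A c a)),
      astar = (\<lambda>(l, a). (cnj l, astar A a))\<rparr>"

text \<open>Entries outside the stated format are zero, so that equality of matrices is equality of
  functions.  Square matrices of arbitrary size are pairs \<open>(n, M)\<close>; size \<open>0\<close> is allowed and
  represents the zero class.\<close>

type_synonym 'u mtx = "nat \<Rightarrow> nat \<Rightarrow> 'u"

definition mats :: "'u::real_normed_vector star_alg \<Rightarrow> nat \<Rightarrow> nat \<Rightarrow> 'u mtx set" where
  "mats U m n =
     {M. (\<forall>i<m. \<forall>j<n. M i j \<in> elems U) \<and> (\<forall>i j. \<not> (i < m \<and> j < n) \<longrightarrow> M i j = 0)}"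

text \<open>In \<open>mtx_mult U k M N\<close> the number \<open>k\<close> is the number of columns of \<open>M\<close> and of rows of \<open>N\<close>.\<close>

definition mtx_mult ::
    "'u::real_normed_vector star_alg \<Rightarrow> nat \<Rightarrow> 'u mtx \<Rightarrow> 'u mtx \<Rightarrow> 'u mtx" where
  "mtx_mult U k M N = (\<lambda>i j. \<Sum>l<k. amult U (M i l) (N l j))"

definition mtx_star :: "'u::real_normed_vector star_alg \<Rightarrow> 'u mtx \<Rightarrow> 'u mtx" where
  "mtx_star U M = (\<lambda>i j. astar U (M j i))"

definition mtx_one :: "nat \<Rightarrow> (complex \<times> 'b::real_normed_vector) mtx" where
  "mtx_one n = (\<lambda>i j. if i = j \<and> i < n then (1, 0) else 0)"

definition dsum ::
    "nat \<times> 'u::real_normed_vector mtx \<Rightarrow> nat \<times> 'u mtx \<Rightarrow> nat \<times> 'u mtx"  (infixr \<open>\<oplus>\<^sub>m\<close> 65) where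
  "p \<oplus>\<^sub>m q =
     (fst p + fst q,
      \<lambda>i j. if i < fst p \<and> j < fst p then snd p i j
            else if fst p \<le> i \<and> fst p \<le> j then snd q (i - fst p) (j - fst p)
            else 0)"

definition mtx_map :: "('u \<Rightarrow> 'v) \<Rightarrow> nat \<times> 'u mtx \<Rightarrow> nat \<times> 'v mtx" where
  "mtx_map h p = (fst p, \<lambda>i j. h (snd p i j))"

subsection \<open>The group \<open>K\<^sub>0\<close>\<close>

definition projs :: "'u::real_normed_vector star_alg \<Rightarrow> (nat \<times> 'u mtx) set" where
  "projs U = {(n, p). p \<in> mats U n n \<and> mtx_star U p = p \<and> mtx_mult U n p p = p}"

text \<open>Murray--von Neumann equivalence.\<close>

definition mvn ::
    "'u::real_normed_vector star_alg \<Rightarrow> nat \<times> 'u mtx \<Rightarrow> nat \<times> 'u mtx \<Rightarrow> bool" where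
  "mvn U p q \<longleftrightarrow>
     (\<exists>v\<in>mats U (fst q) (fst p).
        mtx_mult U (fst q) (mtx_star U v) v = snd p \<and>
        mtx_mult U (fst p) v (mtx_star U v) = snd q)"

type_synonym 'u K0_elt = "((nat \<times> 'u mtx) \<times> (nat \<times> 'u mtx)) set"

text \<open>For a unital algebra \<open>U\<close>, \<open>K00 U\<close> is the Grothendieck group of the monoid of
  Murray--von Neumann classes of projections over \<open>U\<close>; the pair \<open>(p, q)\<close> stands for \<open>[p] - [q]\<close>.\<close>

definition K00_rel ::
    "'u::real_normed_vector star_alg
      \<Rightarrow> (((nat \<times> 'u mtx) \<times> (nat \<times> 'u mtx)) \<times> ((nat \<times> 'u mtx) \<times> (nat \<times> 'u mtx))) set" where
  "K00_rel U =
     {((p, q), (p', q')). p \<in> projs U \<and> q \<in> projs U \<and> p' \<in> projs U \<and> q' \<in> projs U \<and>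
        (\<exists>r\<in>projs U. mvn U (p \<oplus>\<^sub>m q' \<oplus>\<^sub>m r) (p' \<oplus>\<^sub>m q \<oplus>\<^sub>m r))}"

definition K00 :: "'u::real_normed_vector star_alg \<Rightarrow> 'u K0_elt monoid" where
  "K00 U =
     \<lparr>carrier = (projs U \<times> projs U) // K00_rel U,
      mult = (\<lambda>C D. \<Union>(p, q)\<in>C. \<Union>(p', q')\<in>D. K00_rel U `` {(p \<oplus>\<^sub>m p', q \<oplus>\<^sub>m q')}),
      one = K00_rel U `` {((0, \<lambda>_ _. 0), (0, \<lambda>_ _. 0))}\<rparr>"

definition K00_map ::
    "'v::real_normed_vector star_alg \<Rightarrow> ('u \<Rightarrow> 'v) \<Rightarrow> 'u K0_elt \<Rightarrow> 'v K0_elt" where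
  "K00_map V h C = (\<Union>(p, q)\<in>C. K00_rel V `` {(mtx_map h p, mtx_map h q)})"

text \<open>\<open>K\<^sub>0\<close> of a possibly non-unital algebra is the kernel of the map induced by the character
  \<open>fst\<close> of the unitization.\<close>

definition K0 :: "'b::real_normed_vector star_alg \<Rightarrow> (complex \<times> 'b) K0_elt monoid" where
  "K0 A =
     (K00 (unitize A))
       \<lparr>carrier := kernel (K00 (unitize A)) (K00 complex_alg) (K00_map complex_alg fst)\<rparr>"

definition K0_map ::
    "'c::real_normed_vector star_alg \<Rightarrow> ('b::real_normed_vector \<Rightarrow> 'c)
      \<Rightarrow> (complex \<times> 'b) K0_elt \<Rightarrow> (complex \<times> 'c) K0_elt" where
  "K0_map B h = K00_map (unitize B) (map_prod id h)"

subsection \<open>The group \<open>K\<^sub>1\<close>\<close>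

definition unitaries ::
    "'b::real_normed_vector star_alg \<Rightarrow> nat \<Rightarrow> (complex \<times> 'b) mtx set" where
  "unitaries A n =
     {u \<in> mats (unitize A) n n.
        mtx_mult (unitize A) n (mtx_star (unitize A) u) u = mtx_one n \<and>
        mtx_mult (unitize A) n u (mtx_star (unitize A) u) = mtx_one n}"

text \<open>Norm continuity of a path of matrices is continuity of its entries.\<close>

definition unitary_homotopic ::
    "'b::real_normed_vector star_alg \<Rightarrow> nat \<Rightarrow> (complex \<times> 'b) mtx \<Rightarrow> (complex \<times> 'b) mtx \<Rightarrow> bool"
  where
  "unitary_homotopic A n u v \<longleftrightarrow>
     (\<exists>\<gamma> :: real \<Rightarrow> (complex \<times> 'b) mtx.
        (\<forall>s\<in>{0..1}. \<gamma> s \<in> unitaries A n) \<and> \<gamma> 0 = u \<and> \<gamma> 1 = v \<and>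
        (\<forall>i j. continuous_on {0..1} (\<lambda>s. \<gamma> s i j)))"

type_synonym 'b K1_elt = "(nat \<times> (complex \<times> 'b) mtx) set"

definition all_unitaries :: "'b::real_normed_vector star_alg \<Rightarrow> 'b K1_elt" where
  "all_unitaries A = {(n, u). u \<in> unitaries A n}"

definition K1_rel ::
    "'b::real_normed_vector star_alg
      \<Rightarrow> ((nat \<times> (complex \<times> 'b) mtx) \<times> (nat \<times> (complex \<times> 'b) mtx)) set" where
  "K1_rel A =
     {(u, v). u \<in> all_unitaries A \<and> v \<in> all_unitaries A \<and>
        (\<exists>k. fst u \<le> k \<and> fst v \<le> k \<and>
           unitary_homotopic A k
             (snd (u \<oplus>\<^sub>m (k - fst u, mtx_one (k - fst u))))
             (snd (v \<oplus>\<^sub>m (k - fst v, mtx_one (k - fst v)))))}"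

definition K1 :: "'b::real_normed_vector star_alg \<Rightarrow> 'b K1_elt monoid" where
  "K1 A =
     \<lparr>carrier = all_unitaries A // K1_rel A,
      mult = (\<lambda>C D. \<Union>u\<in>C. \<Union>v\<in>D. K1_rel A `` {u \<oplus>\<^sub>m v}),
      one = K1_rel A `` {(0, mtx_one 0)}\<rparr>"

definition K1_map ::
    "'c::real_normed_vector star_alg \<Rightarrow> ('b::real_normed_vector \<Rightarrow> 'c)
      \<Rightarrow> 'b K1_elt \<Rightarrow> 'c K1_elt" where
  "K1_map B h C = (\<Union>u\<in>C. K1_rel B `` {mtx_map (map_prod id h) u})"


section \<open>Functors to graded abelian groups\<close>

text \<open>A group graded by the integers modulo 2 is the pair of its homogeneous components.\<close>

type_synonym ('p, 'q) graded = "'p monoid \<times> 'q monoid"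

definition graded_ab_group :: "('p, 'q) graded \<Rightarrow> bool" where
  "graded_ab_group G \<longleftrightarrow> comm_group (fst G) \<and> comm_group (snd G)"

definition graded_hom ::
    "('p, 'q) graded \<Rightarrow> ('r, 's) graded \<Rightarrow> (('p \<Rightarrow> 'r) \<times> ('q \<Rightarrow> 's)) set" where
  "graded_hom G H = hom (fst G) (fst H) \<times> hom (snd G) (snd H)"

definition graded_iso ::
    "('p, 'q) graded \<Rightarrow> ('r, 's) graded \<Rightarrow> (('p \<Rightarrow> 'r) \<times> ('q \<Rightarrow> 's)) set" where
  "graded_iso G H = iso (fst G) (fst H) \<times> iso (snd G) (snd H)"

definition graded_comp ::
    "(('r \<Rightarrow> 't) \<times> ('s \<Rightarrow> 'u)) \<Rightarrow> (('p \<Rightarrow> 'r) \<times> ('q \<Rightarrow> 's)) \<Rightarrow> (('p \<Rightarrow> 't) \<times> ('q \<Rightarrow> 'u))" where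
  "graded_comp g f = (fst g \<circ> fst f, snd g \<circ> snd f)"

definition graded_eq ::
    "('p, 'q) graded \<Rightarrow> (('p \<Rightarrow> 'r) \<times> ('q \<Rightarrow> 's)) \<Rightarrow> (('p \<Rightarrow> 'r) \<times> ('q \<Rightarrow> 's)) \<Rightarrow> bool" where
  "graded_eq G f g \<longleftrightarrow>
     (\<forall>x\<in>carrier (fst G). fst f x = fst g x) \<and> (\<forall>x\<in>carrier (snd G). snd f x = snd g x)"

record ('o, 'm) category =
  Ob :: "'o set"
  Hom :: "'o \<Rightarrow> 'o \<Rightarrow> 'm set"
  Idn :: "'o \<Rightarrow> 'm"
  Comp :: "'o \<Rightarrow> 'o \<Rightarrow> 'o \<Rightarrow> 'm \<Rightarrow> 'm \<Rightarrow> 'm"  \<comment> \<open>\<open>Comp C X Y Z g f\<close> is \<open>g \<circ> f\<close> for \<open>f : X \<rightarrow> Y\<close>, \<open>g : Y \<rightarrow> Z\<close>\<close>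

locale category =
  fixes C :: "('o, 'm) category"
  assumes id_in: "X \<in> Ob C \<Longrightarrow> Idn C X \<in> Hom C X X"
    and comp_in:
      "\<lbrakk>X \<in> Ob C; Y \<in> Ob C; Z \<in> Ob C; f \<in> Hom C X Y; g \<in> Hom C Y Z\<rbrakk>
        \<Longrightarrow> Comp C X Y Z g f \<in> Hom C X Z"
    and id_right: "\<lbrakk>X \<in> Ob C; Y \<in> Ob C; f \<in> Hom C X Y\<rbrakk> \<Longrightarrow> Comp C X X Y f (Idn C X) = f"
    and id_left: "\<lbrakk>X \<in> Ob C; Y \<in> Ob C; f \<in> Hom C X Y\<rbrakk> \<Longrightarrow> Comp C X Y Y (Idn C Y) f = f"
    and comp_assoc:
      "\<lbrakk>W \<in> Ob C; X \<in> Ob C; Y \<in> Ob C; Z \<in> Ob C; f \<in> Hom C W X; g \<in> Hom C X Y; h \<in> Hom C Y Z\<rbrakk>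
        \<Longrightarrow> Comp C W Y Z h (Comp C W X Y g f) = Comp C W X Z (Comp C X Y Z h g) f"

locale graded_functor = category C
  for C :: "('o, 'm) category"
    and F :: "'o \<Rightarrow> ('p, 'q) graded"
    and Fm :: "'o \<Rightarrow> 'o \<Rightarrow> 'm \<Rightarrow> ('p \<Rightarrow> 'p) \<times> ('q \<Rightarrow> 'q)" +
  assumes ob: "X \<in> Ob C \<Longrightarrow> graded_ab_group (F X)"
    and mor: "\<lbrakk>X \<in> Ob C; Y \<in> Ob C; f \<in> Hom C X Y\<rbrakk> \<Longrightarrow> Fm X Y f \<in> graded_hom (F X) (F Y)"
    and map_id: "X \<in> Ob C \<Longrightarrow> graded_eq (F X) (Fm X X (Idn C X)) (id, id)"
    and map_comp:
      "\<lbrakk>X \<in> Ob C; Y \<in> Ob C; Z \<in> Ob C; f \<in> Hom C X Y; g \<in> Hom C Y Z\<rbrakk>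
        \<Longrightarrow> graded_eq (F X) (Fm X Z (Comp C X Y Z g f)) (graded_comp (Fm Y Z g) (Fm X Y f))"

definition naturally_isomorphic ::
    "('o, 'm) category
      \<Rightarrow> ('o \<Rightarrow> ('p, 'q) graded) \<Rightarrow> ('o \<Rightarrow> 'o \<Rightarrow> 'm \<Rightarrow> ('p \<Rightarrow> 'p) \<times> ('q \<Rightarrow> 'q))
      \<Rightarrow> ('o \<Rightarrow> ('r, 's) graded) \<Rightarrow> ('o \<Rightarrow> 'o \<Rightarrow> 'm \<Rightarrow> ('r \<Rightarrow> 'r) \<times> ('s \<Rightarrow> 's)) \<Rightarrow> bool" where
  "naturally_isomorphic C F Fm G Gm \<longleftrightarrow>
     (\<exists>\<eta>. (\<forall>X\<in>Ob C. \<eta> X \<in> graded_iso (F X) (G X)) \<and>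
        (\<forall>X\<in>Ob C. \<forall>Y\<in>Ob C. \<forall>f\<in>Hom C X Y.
           graded_eq (F X) (graded_comp (\<eta> Y) (Fm X Y f)) (graded_comp (Gm X Y f) (\<eta> X))))"


section \<open>Roe algebras and the functor\<close>

definition roe_algebra ::
    "'a coarse \<Rightarrow> ('a, 'h::chilbert_space) cmodule \<Rightarrow> ('h \<Rightarrow>\<^sub>L 'h) star_alg" where
  "roe_algebra X M =
     \<lparr>elems = closure {t \<in> bops (hsp M) (hsp M).
                locally_compact_op X M t \<and> controlled_propagation X M t},
      amult = (o\<^sub>L), ascale = op_scale, astar = op_adj\<rparr>"

definition Ad :: "('h::chilbert_space \<Rightarrow>\<^sub>L 'k::chilbert_space) \<Rightarrow> ('h \<Rightarrow>\<^sub>L 'h) \<Rightarrow> ('k \<Rightarrow>\<^sub>L 'k)" where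
  "Ad t x = t o\<^sub>L x o\<^sub>L op_adj t"

definition coarse_cat :: "'k rel \<Rightarrow> ('a coarse, ('a \<times> 'a) set set) category" where
  "coarse_cat \<kappa> =
     \<lparr>Ob = {X. coarse_space X \<and> coarse_card X \<le>o \<kappa>},
      Hom = (\<lambda>X Y. {f. proper_coarse_map X Y f}),
      Idn = coarse_id,
      Comp = coarse_comp\<rparr>"

text \<open>A choice of the data defining the functor: a module for every object, an isometry for every
  morphism.\<close>

definition roe_choice ::
    "'k rel \<Rightarrow> ('a coarse \<Rightarrow> ('a, 'h::chilbert_space) cmodule)
      \<Rightarrow> ('a coarse \<Rightarrow> 'a coarse \<Rightarrow> ('a \<times> 'a) set set \<Rightarrow> ('h \<Rightarrow>\<^sub>L 'h)) \<Rightarrow> bool" where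
  "roe_choice \<kappa> M t \<longleftrightarrow>
     (\<forall>X\<in>Ob (coarse_cat \<kappa>). roe_module \<kappa> X (M X)) \<and>
     (\<forall>X\<in>Ob (coarse_cat \<kappa>). \<forall>Y\<in>Ob (coarse_cat \<kappa>). \<forall>f\<in>Hom (coarse_cat \<kappa>) X Y.
        covering_isometry X Y (M X) (M Y) f (t X Y f))"

definition K_Roe ::
    "('a coarse \<Rightarrow> ('a, 'h::chilbert_space) cmodule) \<Rightarrow> 'a coarse
      \<Rightarrow> ((complex \<times> ('h \<Rightarrow>\<^sub>L 'h)) K0_elt, ('h \<Rightarrow>\<^sub>L 'h) K1_elt) graded" where
  "K_Roe M X = (K0 (roe_algebra X (M X)), K1 (roe_algebra X (M X)))"

definition K_Roe_map ::
    "('a coarse \<Rightarrow> ('a, 'h::chilbert_space) cmodule)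
      \<Rightarrow> ('a coarse \<Rightarrow> 'a coarse \<Rightarrow> ('a \<times> 'a) set set \<Rightarrow> ('h \<Rightarrow>\<^sub>L 'h))
      \<Rightarrow> 'a coarse \<Rightarrow> 'a coarse \<Rightarrow> ('a \<times> 'a) set set
      \<Rightarrow> ((complex \<times> ('h \<Rightarrow>\<^sub>L 'h)) K0_elt \<Rightarrow> (complex \<times> ('h \<Rightarrow>\<^sub>L 'h)) K0_elt)
        \<times> (('h \<Rightarrow>\<^sub>L 'h) K1_elt \<Rightarrow> ('h \<Rightarrow>\<^sub>L 'h) K1_elt)" where
  "K_Roe_map M t X Y f =
     (K0_map (roe_algebra Y (M Y)) (Ad (t X Y f)), K1_map (roe_algebra Y (M Y)) (Ad (t X Y f)))"

end

theory Submission
  imports Defs "HOL-Library.Function_Algebras"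
begin

text \<open>Coarse maps are closeness classes of controlled functions, and an isometry covers the class of
  \<open>f\<close> only if it is supported near the graph of \<open>f\<close>.  If \<open>s\<close> and \<open>t\<close> are supported near the graph of
  one proper controlled function, then all of \<open>s x s*\<close>, \<open>s x t*\<close>, \<open>t x s*\<close>, \<open>t x t*\<close> lie in the
  Roe algebra, so that \<open>Ad s\<close> and \<open>Ad t\<close> are the two diagonal corners of one homomorphism into
  \<open>2 \<times> 2\<close> matrices.  They therefore agree on \<open>K\<^sub>0\<close>, by an explicit partial isometry, and on \<open>K\<^sub>1\<close>, by a
  rotation of one corner into the other.  Identities and composites of covering isometries are
  supported near the identity and the composite functions, which gives functoriality; an isometry
  between two modules of the same space that covers the identity gives the natural isomorphism.
  Covering isometries exist because the pieces of a discrete module of rank \<open>\<kappa>\<close> can be mapped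
  injectively, basis vector by basis vector, into nearby pieces of rank at least \<open>\<kappa>\<close>.\<close>

section \<open>Coarse maps as closeness classes of controlled functions\<close>

text \<open>The obstacle in comparing \<open>Ad s\<close> and \<open>Ad t\<close> is that the
  operator \<open>t s*\<close> intertwining them is only a multiplier of the Roe algebra and in
  general not in the unitization over which K-theory is formed. Matrices over the unitization have
  scalar parts, and the mixed maps sending \<open>x\<close> to \<open>s x t*\<close> make sense only
  on entries whose scalar part vanishes. Projections are therefore compared with their own scalar
  parts, and unitaries are divided by theirs; what then remains off the diagonal has scalar part
  zero. Functoriality uses only an upper bound of the support by a neighbourhood of the graph. The
  exact coarse support of a composite is never computed: a composite of covering isometries and the
  isometry chosen for the composite map satisfy the same upper bound, and this makes them
  comparable. Minimality of the support matters only when covering isometries are constructed.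
  Discreteness enters through one device: every set lies in a union of pieces, which is measurable
  and larger by one gauge only. Supports can thus be composed although images of measurable sets
  need not be measurable.\<close>

lemma ents_subset: "coarse_space X \<Longrightarrow> E \<in> ents X \<Longrightarrow> E \<subseteq> points X \<times> points X"
  and ents_downward: "coarse_space X \<Longrightarrow> E \<in> ents X \<Longrightarrow> E' \<subseteq> E \<Longrightarrow> E' \<in> ents X"
  and ents_Un: "coarse_space X \<Longrightarrow> E \<in> ents X \<Longrightarrow> E' \<in> ents X \<Longrightarrow> E \<union> E' \<in> ents X"
  and ents_Id: "coarse_space X \<Longrightarrow> Id_on (points X) \<in> ents X"
  and ents_converse: "coarse_space X \<Longrightarrow> E \<in> ents X \<Longrightarrow> E\<inverse> \<in> ents X"
  and ents_relcomp: "coarse_space X \<Longrightarrow> E \<in> ents X \<Longrightarrow> E' \<in> ents X \<Longrightarrow> E O E' \<in> ents X"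
  unfolding coarse_space_def by blast+

lemmas ents_rules = ents_Un ents_Id ents_converse ents_relcomp

definition controlled_fun :: "'a coarse \<Rightarrow> 'b coarse \<Rightarrow> ('a \<Rightarrow> 'b) \<Rightarrow> bool" where
  "controlled_fun X Y f \<longleftrightarrow>
     f \<in> points X \<rightarrow> points Y \<and> (\<forall>E\<in>ents X. map_prod f f ` E \<in> ents Y)"

definition close_fun :: "'a coarse \<Rightarrow> 'b coarse \<Rightarrow> ('a \<Rightarrow> 'b) \<Rightarrow> ('a \<Rightarrow> 'b) \<Rightarrow> bool" where
  "close_fun X Y f g \<longleftrightarrow> (\<lambda>x. (f x, g x)) ` points X \<in> ents Y"

definition proper_fun :: "'a coarse \<Rightarrow> 'b coarse \<Rightarrow> ('a \<Rightarrow> 'b) \<Rightarrow> bool" where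
  "proper_fun X Y f \<longleftrightarrow> (\<forall>B. cbounded Y B \<longrightarrow> cbounded X {x \<in> points X. f x \<in> B})"

abbreviation fun_class :: "'a coarse \<Rightarrow> 'b coarse \<Rightarrow> ('a \<Rightarrow> 'b) \<Rightarrow> ('b \<times> 'a) set set" where
  "fun_class X Y f \<equiv> coarse_class X Y (fun_rel X f)"

lemma close_fun_sym: "coarse_space Y \<Longrightarrow> close_fun X Y f g \<Longrightarrow> close_fun X Y g f"
  unfolding close_fun_def by (frule (1) ents_converse) (auto elim: ents_downward)

lemma controlled_fun_comp:
  assumes "controlled_fun X Y f" "controlled_fun Y Z g"
  shows "controlled_fun X Z (g \<circ> f)"
  using assms unfolding controlled_fun_def
  by (auto simp: Pi_iff simp flip: map_prod.comp image_image)

lemma controlled_fun_id: "coarse_space X \<Longrightarrow> controlled_fun X X id"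
  unfolding controlled_fun_def by (simp add: map_prod.id)

text \<open>The chain runs from \<open>g (f x)\<close> to \<open>g' (f x)\<close> by closeness of
  \<open>g\<close> and \<open>g'\<close>, and on to \<open>g' (f' x)\<close> because the controlled
  \<open>g'\<close> carries the entourage witnessing closeness of \<open>f\<close> and
  \<open>f'\<close> to an entourage of \<open>Z\<close>.\<close>

lemma close_fun_comp:
  assumes "coarse_space Y" "coarse_space Z" and f: "f \<in> points X \<rightarrow> points Y"
    and "close_fun X Y f f'" "close_fun Y Z g g'" "controlled_fun Y Z g'"
  shows "close_fun X Z (g \<circ> f) (g' \<circ> f')"
proof -
  have "(\<lambda>x. (g x, g' x)) ` points Y O map_prod g' g' ` ((\<lambda>x. (f x, f' x)) ` points X) \<in> ents Z"
    using assms unfolding close_fun_def controlled_fun_def by (intro ents_relcomp) auto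
  then show ?thesis unfolding close_fun_def
    by (rule ents_downward[OF assms(2)]) (use f in \<open>force simp: Pi_iff\<close>)
qed

section \<open>Relations up to thickening on both sides\<close>

lemma coarse_le_refl:
  assumes "coarse_space X" "coarse_space Y" "R \<subseteq> points Y \<times> points X"
  shows "coarse_le X Y R R"
proof -
  have "R \<subseteq> Id_on (points Y) O R O Id_on (points X)" using assms(3) by blast
  then show ?thesis
    unfolding coarse_le_def using ents_Id[OF assms(1)] ents_Id[OF assms(2)] by blast
qed

lemma coarse_le_trans:
  assumes X: "coarse_space X" and Y: "coarse_space Y"
    and "coarse_le X Y R S" "coarse_le X Y S T"
  shows "coarse_le X Y R T"
proof -
  obtain F E F' E' where *: "F \<in> ents Y" "E \<in> ents X" "F' \<in> ents Y" "E' \<in> ents X"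
    "R \<subseteq> F O S O E" "S \<subseteq> F' O T O E'"
    using assms(3,4) unfolding coarse_le_def by blast
  then have "R \<subseteq> (F O F') O T O (E' O E)" by blast
  with * show ?thesis unfolding coarse_le_def
    using ents_relcomp[OF X] ents_relcomp[OF Y] by blast
qed

lemma coarse_class_eqI:
  assumes "coarse_space X" "coarse_space Y" "coarse_le X Y R S" "coarse_le X Y S R"
  shows "coarse_class X Y R = coarse_class X Y S"
  unfolding coarse_class_def using assms coarse_le_trans by blast

lemma coarse_class_self:
  assumes "coarse_space X" "coarse_space Y" "R \<subseteq> points Y \<times> points X"
  shows "R \<in> coarse_class X Y R"
  unfolding coarse_class_def using assms coarse_le_refl by blast

lemma fun_rel_subset: "f \<in> points X \<rightarrow> points Y \<Longrightarrow> fun_rel X f \<subseteq> points Y \<times> points X"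
  unfolding fun_rel_def by auto

lemma in_relcomp_fun_rel: "(y, x) \<in> E O fun_rel X f \<longleftrightarrow> x \<in> points X \<and> (y, f x) \<in> E"
  unfolding fun_rel_def by auto

lemma fun_rel_conj:
  "E \<subseteq> points X \<times> points X \<Longrightarrow> fun_rel X f O E O (fun_rel X f)\<inverse> = map_prod f f ` E"
  unfolding fun_rel_def by force

text \<open>A controlled function turns an entourage \<open>E\<close> of the source into its image
  under \<open>map_prod f f\<close>, an entourage of the target. The thickening on the source side
  of the graph can therefore be moved to the target side.\<close>

lemma coarse_le_fun_rel_iff:
  assumes X: "coarse_space X" and Y: "coarse_space Y" and f: "controlled_fun X Y f"
  shows "coarse_le X Y R (fun_rel X f) \<longleftrightarrow> (\<exists>E\<in>ents Y. R \<subseteq> E O fun_rel X f)"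
proof
  assume "coarse_le X Y R (fun_rel X f)"
  then obtain F E where *: "F \<in> ents Y" "E \<in> ents X" "R \<subseteq> F O fun_rel X f O E"
    unfolding coarse_le_def by blast
  have "fun_rel X f O E \<subseteq> map_prod f f ` E O fun_rel X f"
    using ents_subset[OF X *(2)] unfolding fun_rel_def by force
  then have "R \<subseteq> (F O map_prod f f ` E) O fun_rel X f" using *(3) by blast
  moreover have "F O map_prod f f ` E \<in> ents Y"
    using * f Y unfolding controlled_fun_def by (intro ents_relcomp) auto
  ultimately show "\<exists>E\<in>ents Y. R \<subseteq> E O fun_rel X f" by blast
next
  assume "\<exists>E\<in>ents Y. R \<subseteq> E O fun_rel X f"
  moreover have "E O fun_rel X f \<subseteq> E O fun_rel X f O Id_on (points X)" for E :: "('b \<times> 'b) set"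
    unfolding fun_rel_def by blast
  ultimately show "coarse_le X Y R (fun_rel X f)"
    unfolding coarse_le_def using ents_Id[OF X] by (metis subset_trans)
qed

lemma fun_rel_subset_iff_close:
  assumes "coarse_space Y"
  shows "(\<exists>E\<in>ents Y. fun_rel X g \<subseteq> E O fun_rel X f) \<longleftrightarrow> close_fun X Y g f"
proof
  assume "\<exists>E\<in>ents Y. fun_rel X g \<subseteq> E O fun_rel X f"
  then obtain E where "E \<in> ents Y" "fun_rel X g \<subseteq> E O fun_rel X f" by blast
  then have "(\<lambda>x. (g x, f x)) ` points X \<subseteq> E" unfolding fun_rel_def by auto
  with \<open>E \<in> ents Y\<close> show "close_fun X Y g f"
    unfolding close_fun_def using assms ents_downward by blast
next
  assume "close_fun X Y g f"
  moreover have "fun_rel X g \<subseteq> (\<lambda>x. (g x, f x)) ` points X O fun_rel X f"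
    unfolding fun_rel_def by auto
  ultimately show "\<exists>E\<in>ents Y. fun_rel X g \<subseteq> E O fun_rel X f" unfolding close_fun_def by blast
qed

lemma fun_class_eq_iff:
  assumes "coarse_space X" "coarse_space Y" "controlled_fun X Y f" "controlled_fun X Y g"
  shows "fun_class X Y f = fun_class X Y g \<longleftrightarrow> close_fun X Y f g"
proof
  assume "fun_class X Y f = fun_class X Y g"
  then have "fun_rel X f \<in> fun_class X Y g"
    using coarse_class_self[OF assms(1,2) fun_rel_subset, of f] assms(3)
    unfolding controlled_fun_def by simp
  then have "coarse_le X Y (fun_rel X f) (fun_rel X g)" unfolding coarse_class_def by blast
  then show "close_fun X Y f g"
    using assms coarse_le_fun_rel_iff fun_rel_subset_iff_close by metis
next
  assume "close_fun X Y f g"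
  moreover from this have "close_fun X Y g f" using assms(2) close_fun_sym by blast
  ultimately show "fun_class X Y f = fun_class X Y g"
    using assms by (intro coarse_class_eqI) (simp_all add: coarse_le_fun_rel_iff fun_rel_subset_iff_close)
qed

text \<open>Conjugating \<open>E\<close> by a thickening of \<open>R\<close> is the same as
  conjugating a larger entourage by \<open>R\<close> and thickening the result; both are harmless
  when \<open>R\<close> is controlled.\<close>

lemma controlled_fun_coarse_le:
  assumes X: "coarse_space X" and Y: "coarse_space Y" and R: "controlled_rel X Y R"
    and f: "f \<in> points X \<rightarrow> points Y" "coarse_le X Y (fun_rel X f) R"
  shows "controlled_fun X Y f"
  unfolding controlled_fun_def
proof (intro conjI ballI f(1))
  fix E assume E: "E \<in> ents X"
  obtain F G where *: "F \<in> ents Y" "G \<in> ents X" "fun_rel X f \<subseteq> F O R O G"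
    using f(2) unfolding coarse_le_def by blast
  have "map_prod f f ` E = fun_rel X f O E O (fun_rel X f)\<inverse>"
    using fun_rel_conj ents_subset[OF X E] by metis
  also have "\<dots> \<subseteq> (F O R O G) O E O (F O R O G)\<inverse>"
    using *(3) by (intro relcomp_mono) auto
  also have "\<dots> = F O (R O (G O E O G\<inverse>) O R\<inverse>) O F\<inverse>" by (simp add: converse_relcomp O_assoc)
  also have "\<dots> \<in> ents Y"
    using R * E X Y unfolding controlled_rel_def by (auto intro!: ents_rules)
  finally (ents_downward[OF Y, rotated]) show "map_prod f f ` E \<in> ents Y" .
qed

lemma controlled_rel_fun_rel:
  assumes "coarse_space X" "controlled_fun X Y f"
  shows "controlled_rel X Y (fun_rel X f)"
  unfolding controlled_rel_def
proof (intro conjI ballI)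
  show "fun_rel X f \<subseteq> points Y \<times> points X"
    using assms(2) by (intro fun_rel_subset) (simp add: controlled_fun_def)
  show "fun_rel X f O E O (fun_rel X f)\<inverse> \<in> ents Y" if "E \<in> ents X" for E
    using that assms(2) unfolding fun_rel_conj[OF ents_subset[OF assms(1) that]] controlled_fun_def
    by blast
qed

section \<open>Representing coarse maps by functions, and their composition\<close>

lemma coarse_map_fun_class:
  assumes "coarse_space X" "controlled_fun X Y f"
  shows "coarse_map X Y (fun_class X Y f)"
proof -
  have "points X = rel_img (Id_on (points X)) (snd ` fun_rel X f)"
    unfolding rel_img_def fun_rel_def by force
  moreover have "snd ` fun_rel X f \<subseteq> points X" unfolding fun_rel_def by auto
  ultimately show ?thesis
    using controlled_rel_fun_rel[OF assms] ents_Id[OF assms(1)]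
    unfolding coarse_map_def coarsely_dense_def by blast
qed

text \<open>The function sends \<open>x\<close> to an \<open>R\<close>-value over some point
  \<open>x'\<close> that is \<open>E\<close>-near to \<open>x\<close>; coarse density of the domain
  of \<open>R\<close> supplies \<open>x'\<close>. Values of \<open>R\<close> over
  \<open>E\<close>-near points differ by \<open>R O E O R\<inverse>\<close>, an entourage because
  \<open>R\<close> is controlled, so the class does not change.\<close>

lemma coarse_map_obtain_fun:
  assumes X: "coarse_space X" and Y: "coarse_space Y" and "coarse_map X Y F"
  obtains f where "controlled_fun X Y f" "F = fun_class X Y f"
proof -
  obtain R E where R: "controlled_rel X Y R" and E: "E \<in> ents X"
    and dense: "points X = rel_img E (snd ` R)" and F: "F = coarse_class X Y R"
    using assms(3) unfolding coarse_map_def coarsely_dense_def by blast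
  have Rsub: "R \<subseteq> points Y \<times> points X" using R unfolding controlled_rel_def by blast
  have "\<exists>y x'. (x, x') \<in> E \<and> (y, x') \<in> R" if "x \<in> points X" for x
    using that unfolding dense rel_img_def by fastforce
  then obtain f where f: "\<And>x. x \<in> points X \<Longrightarrow> \<exists>x'. (x, x') \<in> E \<and> (f x, x') \<in> R" by metis
  have fXY: "f \<in> points X \<rightarrow> points Y" using f Rsub by blast
  have "fun_rel X f \<subseteq> Id_on (points Y) O R O E\<inverse>"
    using f Rsub unfolding fun_rel_def by blast
  then have le: "coarse_le X Y (fun_rel X f) R"
    unfolding coarse_le_def using E X Y ents_Id ents_converse by blast
  have contr: "controlled_fun X Y f" by (rule controlled_fun_coarse_le[OF X Y R fXY le])
  have "R \<subseteq> (R O E O R\<inverse>) O fun_rel X f"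
  proof clarify
    fix y x assume "(y, x) \<in> R"
    then have "x \<in> points X" using Rsub by blast
    then show "(y, x) \<in> (R O E O R\<inverse>) O fun_rel X f"
      using f[of x] \<open>(y, x) \<in> R\<close> unfolding in_relcomp_fun_rel by (meson converseI relcompI)
  qed
  moreover have "R O E O R\<inverse> \<in> ents Y"
    using R E unfolding controlled_rel_def by blast
  ultimately have "coarse_le X Y R (fun_rel X f)"
    using coarse_le_fun_rel_iff[OF X Y contr] by blast
  then have "F = fun_class X Y f" unfolding F using le X Y by (intro coarse_class_eqI) auto
  with contr show ?thesis by (rule that)
qed

text \<open>\<open>coarse_comp\<close> composes functions picked by \<open>SOME\<close>, and
  \<open>represents\<close> does not ask them to be controlled. This is recovered from the fact that
  the picked function lies in the class of a controlled one.\<close>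

lemma coarse_map_obtain_rep:
  assumes X: "coarse_space X" and Y: "coarse_space Y" and F: "coarse_map X Y F"
  defines "f \<equiv> SOME f. represents X Y f F"
  shows "controlled_fun X Y f" "F = fun_class X Y f"
proof -
  obtain f0 where f0: "controlled_fun X Y f0" "F = fun_class X Y f0"
    using coarse_map_obtain_fun[OF X Y F] .
  then have "represents X Y f0 F" unfolding represents_def controlled_fun_def by blast
  then have f: "represents X Y f F" unfolding f_def by (rule someI[where P = "\<lambda>f. represents X Y f F"])
  then show "F = fun_class X Y f" unfolding represents_def by blast
  have fXY: "f \<in> points X \<rightarrow> points Y" using f unfolding represents_def by blast
  have "fun_rel X f \<in> fun_class X Y f0"
    using f coarse_class_self[OF X Y fun_rel_subset[OF fXY]] f0(2) unfolding represents_def by simp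
  then have "coarse_le X Y (fun_rel X f) (fun_rel X f0)" unfolding coarse_class_def by blast
  then show "controlled_fun X Y f"
    using controlled_fun_coarse_le[OF X Y controlled_rel_fun_rel[OF X f0(1)] fXY] by blast
qed

text \<open>The functions picked inside \<open>coarse_comp\<close> are close to the given ones, and
  composition respects closeness.\<close>

lemma coarse_comp_fun_class:
  assumes X: "coarse_space X" and Y: "coarse_space Y" and Z: "coarse_space Z"
    and f: "controlled_fun X Y f" and g: "controlled_fun Y Z g"
  shows "coarse_comp X Y Z (fun_class Y Z g) (fun_class X Y f) = fun_class X Z (g \<circ> f)"
proof -
  define f' where "f' = (SOME f'. represents X Y f' (fun_class X Y f))"
  define g' where "g' = (SOME g'. represents Y Z g' (fun_class Y Z g))"
  have f': "controlled_fun X Y f'" "fun_class X Y f = fun_class X Y f'"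
    unfolding f'_def by (rule coarse_map_obtain_rep[OF X Y coarse_map_fun_class[OF X f]])+
  have g': "controlled_fun Y Z g'" "fun_class Y Z g = fun_class Y Z g'"
    unfolding g'_def by (rule coarse_map_obtain_rep[OF Y Z coarse_map_fun_class[OF Y g]])+
  have "close_fun X Y f' f" "close_fun Y Z g' g"
    using f'(2) g'(2) fun_class_eq_iff X Y Z f g f'(1) g'(1) by metis+
  then have "close_fun X Z (g' \<circ> f') (g \<circ> f)"
    using Y Z g f'(1) unfolding controlled_fun_def
    by (intro close_fun_comp[OF Y Z]) (auto simp: controlled_fun_def)
  then have "fun_class X Z (g' \<circ> f') = fun_class X Z (g \<circ> f)"
    using fun_class_eq_iff[OF X Z] controlled_fun_comp f f'(1) g g'(1) by metis
  then show ?thesis unfolding coarse_comp_def f'_def g'_def .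
qed

lemma fun_rel_id: "fun_rel X id = Id_on (points X)"
  unfolding fun_rel_def by auto

lemma coarse_id_fun_class: "coarse_id X = fun_class X X id"
  unfolding coarse_id_def fun_rel_id ..

section \<open>Properness and the category of coarse spaces\<close>

lemma cbounded_thicken:
  assumes Y: "coarse_space Y" and E: "E \<in> ents Y" and B: "cbounded Y B"
  shows "cbounded Y (rel_img E B)"
proof -
  have "rel_img E B \<times> rel_img E B \<subseteq> E O (B \<times> B) O E\<inverse>" unfolding rel_img_def by blast
  moreover have "E O (B \<times> B) O E\<inverse> \<in> ents Y"
    using B E Y unfolding cbounded_def by (auto intro!: ents_rules)
  moreover have "rel_img E B \<subseteq> points Y" using ents_subset[OF Y E] unfolding rel_img_def by blast
  ultimately show ?thesis unfolding cbounded_def using ents_downward[OF Y] by blast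
qed

lemma cbounded_subset: "coarse_space X \<Longrightarrow> cbounded X B \<Longrightarrow> A \<subseteq> B \<Longrightarrow> cbounded X A"
  unfolding cbounded_def by (blast intro: ents_downward)

text \<open>Any member of the class lies in \<open>E O fun_rel X f\<close> for an entourage
  \<open>E\<close> of \<open>Y\<close>, so the preimage of \<open>B\<close> under it is contained in
  the preimage under \<open>f\<close> of a thickening of \<open>B\<close>, which is again
  bounded.\<close>

lemma proper_fun_class_iff:
  assumes X: "coarse_space X" and Y: "coarse_space Y" and f: "controlled_fun X Y f"
  shows "proper_coarse_map X Y (fun_class X Y f) \<longleftrightarrow> proper_fun X Y f"
proof
  assume p: "proper_coarse_map X Y (fun_class X Y f)"
  have "fun_rel X f \<in> fun_class X Y f"
    using f by (intro coarse_class_self[OF X Y] fun_rel_subset) (simp add: controlled_fun_def)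
  moreover have "rel_img ((fun_rel X f)\<inverse>) B = {x \<in> points X. f x \<in> B}" for B
    unfolding fun_rel_def rel_img_def by auto
  ultimately show "proper_fun X Y f"
    using p unfolding proper_coarse_map_def proper_fun_def by metis
next
  assume p: "proper_fun X Y f"
  have "cbounded X (rel_img (R\<inverse>) B)" if R: "R \<in> fun_class X Y f" and B: "cbounded Y B" for R B
  proof -
    obtain E where E: "E \<in> ents Y" "R \<subseteq> E O fun_rel X f"
      using R coarse_le_fun_rel_iff[OF X Y f] unfolding coarse_class_def by blast
    have "rel_img (R\<inverse>) B \<subseteq> {x \<in> points X. f x \<in> rel_img (E\<inverse>) B}"
      using E(2) unfolding rel_img_def fun_rel_def by blast
    then show ?thesis
      using p cbounded_thicken[OF Y ents_converse[OF Y E(1)] B] cbounded_subset[OF X]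
      unfolding proper_fun_def by blast
  qed
  then show "proper_coarse_map X Y (fun_class X Y f)"
    unfolding proper_coarse_map_def using coarse_map_fun_class[OF X f] by blast
qed

lemma proper_coarse_map_obtain_fun:
  assumes X: "coarse_space X" and Y: "coarse_space Y" and "proper_coarse_map X Y F"
  obtains f where "controlled_fun X Y f" "proper_fun X Y f" "F = fun_class X Y f"
proof -
  have "coarse_map X Y F" using assms(3) unfolding proper_coarse_map_def by blast
  then obtain f where f: "controlled_fun X Y f" "F = fun_class X Y f"
    using coarse_map_obtain_fun[OF X Y] by blast
  then show ?thesis using that proper_fun_class_iff[OF X Y f(1)] assms(3) by blast
qed

lemma proper_fun_comp:
  assumes "proper_fun X Y f" "proper_fun Y Z g" "f \<in> points X \<rightarrow> points Y"
  shows "proper_fun X Z (g \<circ> f)"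
  unfolding proper_fun_def
proof (intro allI impI)
  fix B assume "cbounded Z B"
  then have "cbounded X {x \<in> points X. f x \<in> {y \<in> points Y. g y \<in> B}}"
    using assms unfolding proper_fun_def by blast
  moreover have "{x \<in> points X. f x \<in> {y \<in> points Y. g y \<in> B}} = {x \<in> points X. (g \<circ> f) x \<in> B}"
    using assms(3) by auto
  ultimately show "cbounded X {x \<in> points X. (g \<circ> f) x \<in> B}" by simp
qed

lemma proper_fun_id: "proper_fun X X id"
proof -
  have "{x \<in> points X. id x \<in> B} = B" if "cbounded X B" for B
    using that unfolding cbounded_def by auto
  then show ?thesis unfolding proper_fun_def by simp
qed

lemma coarse_comp_id:
  assumes "coarse_space X" "coarse_space Y" "coarse_map X Y F"
  shows "coarse_comp X X Y F (coarse_id X) = F" "coarse_comp X Y Y (coarse_id Y) F = F"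
proof -
  obtain f where f: "controlled_fun X Y f" "F = fun_class X Y f"
    using coarse_map_obtain_fun[OF assms] .
  show "coarse_comp X X Y F (coarse_id X) = F" "coarse_comp X Y Y (coarse_id Y) F = F"
    using coarse_comp_fun_class[OF assms(1,1,2) controlled_fun_id[OF assms(1)] f(1)]
      coarse_comp_fun_class[OF assms(1,2,2) f(1) controlled_fun_id[OF assms(2)]]
    unfolding coarse_id_fun_class f(2) by simp_all
qed

lemma category_coarse_cat: "category (coarse_cat \<kappa> :: ('a coarse, ('a \<times> 'a) set set) category)"
proof
  fix X :: "'a coarse" assume "X \<in> Ob (coarse_cat \<kappa>)"
  then have "coarse_space X" unfolding coarse_cat_def by simp
  then show "Idn (coarse_cat \<kappa>) X \<in> Hom (coarse_cat \<kappa>) X X"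
    unfolding coarse_cat_def
    by (simp add: coarse_id_fun_class proper_fun_class_iff controlled_fun_id proper_fun_id)
next
  fix X Y Z :: "'a coarse" and f g
  assume "X \<in> Ob (coarse_cat \<kappa>)" "Y \<in> Ob (coarse_cat \<kappa>)" "Z \<in> Ob (coarse_cat \<kappa>)"
    "f \<in> Hom (coarse_cat \<kappa>) X Y" "g \<in> Hom (coarse_cat \<kappa>) Y Z"
  then have c: "coarse_space X" "coarse_space Y" "coarse_space Z"
    and "proper_coarse_map X Y f" "proper_coarse_map Y Z g"
    unfolding coarse_cat_def by simp_all
  then obtain f' g' where f': "controlled_fun X Y f'" "proper_fun X Y f'" "f = fun_class X Y f'"
    and g': "controlled_fun Y Z g'" "proper_fun Y Z g'" "g = fun_class Y Z g'"
    using proper_coarse_map_obtain_fun by metis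
  have "f' \<in> points X \<rightarrow> points Y" using f' unfolding controlled_fun_def by blast
  then show "Comp (coarse_cat \<kappa>) X Y Z g f \<in> Hom (coarse_cat \<kappa>) X Z"
    using f' g' c unfolding coarse_cat_def
    by (simp add: coarse_comp_fun_class proper_fun_class_iff controlled_fun_comp[OF f'(1) g'(1)]
        proper_fun_comp[of X Y f' Z g'])
next
  fix X Y :: "'a coarse" and f
  assume "X \<in> Ob (coarse_cat \<kappa>)" "Y \<in> Ob (coarse_cat \<kappa>)" "f \<in> Hom (coarse_cat \<kappa>) X Y"
  then show "Comp (coarse_cat \<kappa>) X X Y f (Idn (coarse_cat \<kappa>) X) = f"
    and "Comp (coarse_cat \<kappa>) X Y Y (Idn (coarse_cat \<kappa>) Y) f = f"
    unfolding coarse_cat_def by (simp_all add: coarse_comp_id proper_coarse_map_def)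
next
  fix W X Y Z :: "'a coarse" and f g h
  assume "W \<in> Ob (coarse_cat \<kappa>)" "X \<in> Ob (coarse_cat \<kappa>)" "Y \<in> Ob (coarse_cat \<kappa>)"
    "Z \<in> Ob (coarse_cat \<kappa>)" "f \<in> Hom (coarse_cat \<kappa>) W X" "g \<in> Hom (coarse_cat \<kappa>) X Y"
    "h \<in> Hom (coarse_cat \<kappa>) Y Z"
  then have c: "coarse_space W" "coarse_space X" "coarse_space Y" "coarse_space Z"
    and "coarse_map W X f" "coarse_map X Y g" "coarse_map Y Z h"
    unfolding coarse_cat_def proper_coarse_map_def by simp_all
  then obtain f' g' h' where "controlled_fun W X f'" "f = fun_class W X f'"
    "controlled_fun X Y g'" "g = fun_class X Y g'" "controlled_fun Y Z h'" "h = fun_class Y Z h'"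
    using coarse_map_obtain_fun by metis
  moreover from this have "controlled_fun W Y (g' \<circ> f')" "controlled_fun X Z (h' \<circ> g')"
    using controlled_fun_comp by blast+
  ultimately show "Comp (coarse_cat \<kappa>) W Y Z h (Comp (coarse_cat \<kappa>) W X Y g f) =
      Comp (coarse_cat \<kappa>) W X Z (Comp (coarse_cat \<kappa>) X Y Z h g) f"
    using c unfolding coarse_cat_def by (simp add: coarse_comp_fun_class comp_assoc)
qed

text \<open>For a coarse equivalence with a smallest competitor, represented by \<open>f\<close> and
  \<open>g\<close>, the map \<open>g \<circ> f\<close> is close to the identity and takes at most as
  many values as the competitor has points. Its values are the places where the basis vectors of the
  module constructed below are put.\<close>

lemma coarse_card_obtain_net:
  fixes X :: "'a coarse"
  assumes X: "coarse_space X" and card: "coarse_card X \<le>o \<kappa>"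
  obtains r where "r ` points X \<subseteq> points X" "|r ` points X| \<le>o \<kappa>" "close_fun X X r id"
proof -
  define P where "P = (\<lambda>Y :: 'a coarse. coarse_space Y \<and> coarsely_equivalent X Y)"
  define Q where "Q = (\<lambda>Y :: 'a coarse. P Y \<and> (\<forall>Z. P Z \<longrightarrow> |points Y| \<le>o |points Z| ))"
  have "coarse_comp X X X (coarse_id X) (coarse_id X) = coarse_id X"
    using coarse_comp_fun_class[OF X X X controlled_fun_id[OF X] controlled_fun_id[OF X]]
    unfolding coarse_id_fun_class by simp
  then have PX: "P X"
    unfolding P_def coarsely_equivalent_def coarse_id_fun_class
    using X coarse_map_fun_class controlled_fun_id by blast
  \<comment> \<open>The choice in \<open>coarse_card\<close> picks a smallest competitor only if
    there is one. The cardinals of the competitors form a set of cardinal orders, non-empty because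
    \<open>X\<close> itself competes, and so have a least member.\<close>
  let ?A = "(\<lambda>Y. |points Y| ) ` Collect P"
  have "?A \<noteq> {}" "\<forall>r\<in>?A. Card_order r"
    using PX by (auto simp: card_of_Card_order)
  then obtain r where "r \<in> ?A" "\<forall>r'\<in>?A. r \<le>o r'"
    using exists_minim_Card_order[of ?A] by (metis (lifting))
  then have "\<exists>Y. Q Y" unfolding Q_def by auto
  define Y where "Y = (SOME Y. Q Y)"
  have "Q Y" unfolding Y_def using \<open>\<exists>Y. Q Y\<close> by (rule someI_ex)
  then have Y: "coarse_space Y" "coarsely_equivalent X Y" unfolding Q_def P_def by simp_all
  have "coarse_card X = |points Y|"
    unfolding coarse_card_def Y_def Q_def P_def by (simp add: conj_assoc)
  with card have cardY: "|points Y| \<le>o \<kappa>" by simp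
  obtain F G where FG: "coarse_map X Y F" "coarse_map Y X G" "coarse_comp X Y X G F = coarse_id X"
    using Y(2) unfolding coarsely_equivalent_def by blast
  obtain f g where f: "controlled_fun X Y f" "F = fun_class X Y f"
    and g: "controlled_fun Y X g" "G = fun_class Y X g"
    using coarse_map_obtain_fun[OF X Y(1) FG(1)] coarse_map_obtain_fun[OF Y(1) X FG(2)] by metis
  have "fun_class X X (g \<circ> f) = fun_class X X id"
    using FG(3) coarse_comp_fun_class[OF X Y(1) X f(1) g(1)]
    unfolding coarse_id_fun_class f(2) g(2) by simp
  then have "close_fun X X (g \<circ> f) id"
    using fun_class_eq_iff[OF X X] controlled_fun_comp[OF f(1) g(1)] controlled_fun_id[OF X] by blast
  moreover have "|(g \<circ> f) ` points X| \<le>o |points Y|"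
  proof -
    have "(g \<circ> f) ` points X \<subseteq> g ` points Y" using f(1) unfolding controlled_fun_def by auto
    then show ?thesis using card_of_mono1 card_of_image ordLeq_transitive by metis
  qed
  moreover have "(g \<circ> f) ` points X \<subseteq> points X"
    using f(1) g(1) unfolding controlled_fun_def by auto
  ultimately show ?thesis using that ordLeq_transitive[OF _ cardY] by blast
qed

section \<open>Hilbert spaces\<close>

lemma cinner_add_right: "cinner x (y + z) = cinner x y + cinner x (z::'a::chilbert_space)"
  by (metis cinner_add_left cinner_commute complex_cnj_add)

lemma cinner_scaleC_right: "cinner x (c *\<^sub>C y) = cnj c * cinner x (y::'a::chilbert_space)"
  by (metis cinner_commute cinner_scaleC_left complex_cnj_mult)

lemma cinner_self: "cinner x x = of_real ((norm (x::'a::chilbert_space))\<^sup>2)"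
proof (rule complex_eqI)
  show "Re (cinner x x) = Re (of_real ((norm x)\<^sup>2))"
    by (simp flip: inner_eq_Re_cinner add: power2_norm_eq_inner)
  show "Im (cinner x x) = Im (of_real ((norm x)\<^sup>2))"
    using arg_cong[OF cinner_commute[of x x], of Im] by simp
qed

lemma norm_scaleC: "norm (c *\<^sub>C (x::'a::chilbert_space)) = cmod c * norm x"
proof -
  have "of_real ((norm (c *\<^sub>C x))\<^sup>2) = c * cnj c * cinner x x"
    by (simp only: cinner_self[symmetric] cinner_scaleC_left cinner_scaleC_right) (simp add: mult.assoc)
  also have "\<dots> = of_real ((cmod c * norm x)\<^sup>2)"
    by (simp add: cinner_self complex_norm_square power_mult_distrib del: of_real_power
        flip: complex_norm_square)
  finally have "(norm (c *\<^sub>C x))\<^sup>2 = (cmod c * norm x)\<^sup>2" by (simp only: of_real_eq_iff)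
  then show ?thesis by (simp add: power2_eq_iff_nonneg)
qed

text \<open>After multiplying \<open>x\<close> by a complex number of modulus one, the inner product
  is real and non-negative, and the real Cauchy-Schwarz inequality applies.\<close>

lemma cinner_norm_le: "cmod (cinner x y) \<le> norm x * norm (y::'a::chilbert_space)"
proof (cases "cinner x y = 0")
  case False
  define c where "c = cnj (sgn (cinner x y))"
  have "cmod c = 1" using False by (simp add: c_def norm_sgn)
  have "c * cinner x y = of_real (cmod (cinner x y))"
    unfolding c_def sgn_eq using False
    by (simp add: complex_norm_square[symmetric] field_simps power2_eq_square)
  then have "cmod (cinner x y) = Re (cinner (c *\<^sub>C x) y)" by (simp add: cinner_scaleC_left)
  also have "\<dots> \<le> norm (c *\<^sub>C x) * norm y"
    unfolding inner_eq_Re_cinner[symmetric] by (rule norm_cauchy_schwarz)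
  finally show ?thesis by (simp add: norm_scaleC \<open>cmod c = 1\<close>)
qed simp

lemma scaleR_scaleC_eq: "r *\<^sub>R x = complex_of_real r *\<^sub>C (x::'a::chilbert_space)"
  by (simp add: scaleC_of_real)

lemma bounded_bilinear_cinner: "bounded_bilinear (cinner :: 'a::chilbert_space \<Rightarrow> _)"
proof
  show "\<exists>K. \<forall>a b :: 'a. norm (cinner a b) \<le> norm a * norm b * K"
    by (intro exI[of _ 1]) (simp add: cinner_norm_le)
qed (simp_all add: cinner_add_left cinner_add_right scaleR_scaleC_eq cinner_scaleC_left
    cinner_scaleC_right scaleR_conv_of_real)

lemma bounded_bilinear_scaleC: "bounded_bilinear (scaleC :: _ \<Rightarrow> 'a::chilbert_space \<Rightarrow> 'a)"
proof
  show "\<exists>K. \<forall>a. \<forall>b :: 'a. norm (a *\<^sub>C b) \<le> norm a * norm b * K"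
    by (intro exI[of _ 1]) (simp add: norm_scaleC)
qed (simp_all add: scaleC_add_left scaleC_add_right scaleR_scaleC_eq scaleC_scaleC
    scaleR_conv_of_real mult.commute)

interpretation cinner: bounded_bilinear "cinner :: 'a::chilbert_space \<Rightarrow> 'a \<Rightarrow> complex"
  by (rule bounded_bilinear_cinner)

interpretation scaleC: bounded_bilinear "scaleC :: complex \<Rightarrow> 'a::chilbert_space \<Rightarrow> 'a"
  by (rule bounded_bilinear_scaleC)

lemmas cinner_simps = cinner_add_left cinner_add_right cinner.diff_left cinner.diff_right
  cinner.minus_left cinner.minus_right cinner.zero_left cinner.zero_right
  cinner_scaleC_left cinner_scaleC_right cinner.sum_left cinner.sum_right

lemma cinner_eq_zero_commute: "cinner x y = 0 \<longleftrightarrow> cinner y (x::'a::chilbert_space) = 0"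
  by (metis cinner_commute complex_cnj_zero_iff)

lemma cinner_self_zero: "cinner x x = 0 \<longleftrightarrow> (x::'a::chilbert_space) = 0"
  by (simp add: cinner_self)

lemma cmod_cinner_self: "cmod (cinner x x) = (norm (x::'a::chilbert_space))\<^sup>2"
  by (simp add: cinner_self norm_power)

lemma hilbert_sub_add: "hilbert_sub H \<Longrightarrow> x \<in> H \<Longrightarrow> y \<in> H \<Longrightarrow> x + y \<in> H"
  and hilbert_sub_scaleC: "hilbert_sub H \<Longrightarrow> x \<in> H \<Longrightarrow> c *\<^sub>C x \<in> H"
  and hilbert_sub_zero: "hilbert_sub H \<Longrightarrow> 0 \<in> H"
  and hilbert_sub_closed: "hilbert_sub H \<Longrightarrow> closed H"
  unfolding hilbert_sub_def complex_vector.subspace_def by auto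

lemma hilbert_sub_minus: "hilbert_sub H \<Longrightarrow> x \<in> H \<Longrightarrow> - x \<in> H"
  using hilbert_sub_scaleC[of H x "-1"] by (simp add: scaleC.minus_left)

lemma hilbert_sub_diff: "hilbert_sub H \<Longrightarrow> x \<in> H \<Longrightarrow> y \<in> H \<Longrightarrow> x - y \<in> H"
  using hilbert_sub_add[of H x "- y"] hilbert_sub_minus by auto

lemma hilbert_sub_scaleR: "hilbert_sub H \<Longrightarrow> x \<in> H \<Longrightarrow> r *\<^sub>R x \<in> H"
  by (simp add: scaleR_scaleC_eq hilbert_sub_scaleC)

lemma hilbert_sub_closure_cspan: "hilbert_sub (closure (cspan S))"
proof -
  have "csubspace (closure (cspan S))"
    unfolding complex_vector.subspace_def
  proof (intro conjI ballI allI)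
    show "0 \<in> closure (cspan S)" using closure_subset complex_vector.span_zero by blast
  next
    fix x y assume "x \<in> closure (cspan S)" "y \<in> closure (cspan S)"
    then obtain a b where "\<forall>n. a n \<in> cspan S" "a \<longlonglongrightarrow> x" "\<forall>n. b n \<in> cspan S" "b \<longlonglongrightarrow> y"
      unfolding closure_sequential by blast
    then show "x + y \<in> closure (cspan S)"
      unfolding closure_sequential
      by (intro exI[of _ "\<lambda>n. a n + b n"]) (auto intro: complex_vector.span_add tendsto_add)
  next
    fix x c assume "x \<in> closure (cspan S)"
    then obtain a where "\<forall>n. a n \<in> cspan S" "a \<longlonglongrightarrow> x"
      unfolding closure_sequential by blast
    then show "c *\<^sub>C x \<in> closure (cspan S)"
      unfolding closure_sequential
      by (intro exI[of _ "\<lambda>n. c *\<^sub>C a n"])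
        (auto intro: complex_vector.span_scale scaleC.tendsto[OF tendsto_const])
  qed
  then show ?thesis unfolding hilbert_sub_def by simp
qed

lemma closure_cspan_minimal: "hilbert_sub H \<Longrightarrow> S \<subseteq> H \<Longrightarrow> closure (cspan S) \<subseteq> H"
  unfolding hilbert_sub_def by (intro closure_minimal complex_vector.span_minimal) simp_all

lemma subset_closure_cspan: "S \<subseteq> closure (cspan S)"
  using complex_vector.span_superset closure_subset by blast

lemma hilbert_sub_orthogonal: "hilbert_sub {v. \<forall>w\<in>S. cinner v w = 0}"
proof -
  have "closed (\<Inter>w\<in>S. {v. cinner v w = 0})"
    by (intro closed_INT ballI closed_Collect_eq cinner.continuous_on continuous_intros)
  then have "closed {v. \<forall>w\<in>S. cinner v w = 0}" by (simp add: Collect_ball_eq)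
  then show ?thesis
    unfolding hilbert_sub_def complex_vector.subspace_def by (simp add: cinner_simps)
qed

lemma orthogonal_closure_cspan:
  assumes "\<And>s. s \<in> S \<Longrightarrow> cinner v s = 0" "w \<in> closure (cspan S)"
  shows "cinner v w = 0"
proof -
  have "S \<subseteq> {w. \<forall>u\<in>{v}. cinner w u = 0}" using assms(1) cinner_eq_zero_commute by blast
  then have "w \<in> {w. \<forall>u\<in>{v}. cinner w u = 0}"
    using closure_cspan_minimal[OF hilbert_sub_orthogonal] assms(2) by blast
  then show ?thesis using cinner_eq_zero_commute by blast
qed

subsection \<open>Orthogonal projections\<close>

text \<open>Subtracting from \<open>u\<close> its real projection onto the line of \<open>w\<close>
  would shorten \<open>u\<close> unless \<open>u \<bullet> w = 0\<close>. This settles the real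
  part; the imaginary part is the same argument for \<open>\<i> *\<^sub>C w\<close>.\<close>

lemma orthogonal_if_minimal:
  fixes u :: "'a::chilbert_space"
  assumes H: "hilbert_sub H" and min: "\<And>w. w \<in> H \<Longrightarrow> norm u \<le> norm (u - w)" and w: "w \<in> H"
  shows "cinner u w = 0"
proof -
  have real: "u \<bullet> w = 0" if "w \<in> H" for w
  proof (cases "w = 0")
    case False
    define r where "r = (u \<bullet> w) / (w \<bullet> w)"
    have ww: "w \<bullet> w > 0" using False by simp
    have "norm u \<le> norm (u - r *\<^sub>R w)" by (rule min[OF hilbert_sub_scaleR[OF H that]])
    then have "u \<bullet> u \<le> (u - r *\<^sub>R w) \<bullet> (u - r *\<^sub>R w)" by (simp add: norm_le)
    also have "\<dots> = u \<bullet> u - (u \<bullet> w)\<^sup>2 / (w \<bullet> w)"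
      using ww by (simp add: r_def inner_diff_left inner_diff_right inner_commute power2_eq_square)
    finally show ?thesis using ww by (simp add: divide_le_0_iff)
  qed simp
  show ?thesis
  proof (rule complex_eqI)
    show "Re (cinner u w) = Re 0" using real[OF w] by (simp add: inner_eq_Re_cinner)
    show "Im (cinner u w) = Im 0"
      using real[OF hilbert_sub_scaleC[OF H w, of \<i>]] by (simp add: inner_eq_Re_cinner cinner_simps)
  qed
qed

text \<open>A nearest point of \<open>H\<close> exists: by the parallelogram law a minimizing
  sequence is Cauchy, since midpoints stay in \<open>H\<close> and are no nearer than the infimum
  \<open>d\<close>. Minimality then gives orthogonality.\<close>

lemma ex_orthogonal_projection:
  fixes v :: "'a::chilbert_space"
  assumes H: "hilbert_sub H"
  shows "\<exists>s\<in>H. \<forall>w\<in>H. cinner (v - s) w = 0"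
proof -
  define d where "d = (INF s\<in>H. norm (v - s))"
  have d_le: "d \<le> norm (v - s)" if "s \<in> H" for s
    unfolding d_def by (rule cINF_lower[OF _ that]) (auto intro!: bdd_belowI[of _ 0])
  have d0: "0 \<le> d" unfolding d_def
    using hilbert_sub_zero[OF H] by (intro cINF_greatest) auto
  have "\<exists>s\<in>H. norm (v - s) < d + e" if "e > 0" for e
  proof (rule ccontr)
    assume "\<not> (\<exists>s\<in>H. norm (v - s) < d + e)"
    then have "d + e \<le> d"
      unfolding d_def using hilbert_sub_zero[OF H] by (intro cINF_greatest) auto
    with that show False by simp
  qed
  then have "\<forall>n::nat. \<exists>s. s \<in> H \<and> norm (v - s) < d + inverse (Suc n)"
    by (metis inverse_positive_iff_positive of_nat_0_less_iff zero_less_Suc)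
  then obtain s where s: "\<And>n::nat. s n \<in> H" "\<And>n. norm (v - s n) < d + inverse (Suc n)" by metis
  \<comment> \<open>The excess of the square of \<open>d + inverse (Suc n)\<close> over the square
    of \<open>d\<close>.\<close>
  define q where "q n = 2 * d * inverse (real (Suc n)) + (inverse (real (Suc n)))\<^sup>2" for n
  have s2: "(norm (v - s n))\<^sup>2 \<le> d\<^sup>2 + q n" for n
  proof -
    have "(norm (v - s n))\<^sup>2 \<le> (d + inverse (real (Suc n)))\<^sup>2"
      using s(2)[of n] by (intro power_mono) auto
    then show ?thesis by (simp add: q_def power2_eq_square algebra_simps)
  qed
  have "q \<longlonglongrightarrow> 2 * d * 0 + 0\<^sup>2"
    unfolding q_def by (intro tendsto_intros LIMSEQ_inverse_real_of_nat)
  then have q0: "q \<longlonglongrightarrow> 0" by simp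
  have par: "(norm (s m - s n))\<^sup>2 \<le> 2 * (q m + q n)" for m n
  proof -
    have mid: "(1 / 2) *\<^sub>R (s m + s n) \<in> H" by (intro hilbert_sub_scaleR hilbert_sub_add H s(1))
    have "d\<^sup>2 \<le> (norm (v - (1 / 2) *\<^sub>R (s m + s n)))\<^sup>2"
      using d_le[OF mid] d0 by (intro power_mono) auto
    moreover have "(norm (s m - s n))\<^sup>2 + 4 * (norm (v - (1 / 2) *\<^sub>R (s m + s n)))\<^sup>2
        = 2 * (norm (v - s m))\<^sup>2 + 2 * (norm (v - s n))\<^sup>2"
      by (simp add: power2_norm_eq_inner inner_diff_left inner_diff_right inner_add_left
          inner_add_right inner_commute algebra_simps)
    ultimately show ?thesis using s2[of m] s2[of n] by (simp add: algebra_simps)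
  qed
  have "Cauchy s"
  proof (rule metric_CauchyI)
    fix e :: real assume "e > 0"
    then have "eventually (\<lambda>n. q n < e\<^sup>2 / 4) sequentially" using q0 by (intro order_tendstoD) auto
    then obtain N where N: "\<And>n. n \<ge> N \<Longrightarrow> q n < e\<^sup>2 / 4" unfolding eventually_sequentially by blast
    have "dist (s m) (s n) < e" if "m \<ge> N" "n \<ge> N" for m n
    proof -
      have "(norm (s m - s n))\<^sup>2 < e\<^sup>2" using par[of m n] N[OF that(1)] N[OF that(2)] by simp
      then show ?thesis using \<open>e > 0\<close> by (simp add: dist_norm power_less_imp_less_base)
    qed
    then show "\<exists>M. \<forall>m\<ge>M. \<forall>n\<ge>M. dist (s m) (s n) < e" by blast
  qed
  then obtain s' where lim: "s \<longlonglongrightarrow> s'" using Cauchy_convergent_iff convergent_def by blast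
  then have s'H: "s' \<in> H"
    using closed_sequentially[OF hilbert_sub_closed[OF H]] s(1) by blast
  have "norm (v - s') \<le> d"
  proof (rule LIMSEQ_le)
    show "(\<lambda>n. norm (v - s n)) \<longlonglongrightarrow> norm (v - s')" by (intro tendsto_intros lim)
    show "(\<lambda>n. d + inverse (real (Suc n))) \<longlonglongrightarrow> d"
      using LIMSEQ_inverse_real_of_nat_add by simp
    show "\<exists>N. \<forall>n\<ge>N. norm (v - s n) \<le> d + inverse (real (Suc n))" using s(2) less_imp_le by blast
  qed
  then have "norm (v - s') \<le> norm (v - s' - w)" if "w \<in> H" for w
    using d_le[OF hilbert_sub_add[OF H s'H that]] by (simp add: diff_diff_eq)
  then show ?thesis using orthogonal_if_minimal[OF H] s'H by blast
qed

text \<open>Since operators on \<open>H\<close> are extended by zero on the orthogonal complement,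
  this is also the identity operator of \<open>H\<close>, and it appears below mostly in that
  role.\<close>

definition orth_proj :: "'h::chilbert_space set \<Rightarrow> 'h \<Rightarrow>\<^sub>L 'h" where
  "orth_proj H = Blinfun (\<lambda>v. SOME s. s \<in> H \<and> (\<forall>w\<in>H. cinner (v - s) w = 0))"

text \<open>The elements of the operator type are real-linear, so complex linearity is a property to
  be carried along.\<close>

definition clin :: "('h::chilbert_space \<Rightarrow>\<^sub>L 'k::chilbert_space) \<Rightarrow> bool" where
  "clin t \<longleftrightarrow> (\<forall>c v. blinfun_apply t (c *\<^sub>C v) = c *\<^sub>C blinfun_apply t v)"

lemma orthogonal_projection_unique:
  assumes "hilbert_sub H" "s \<in> H" "s' \<in> H"
    "\<forall>w\<in>H. cinner (v - s) w = 0" "\<forall>w\<in>H. cinner (v - s') w = 0"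
  shows "s = s'"
proof -
  have "s' - s \<in> H" by (intro hilbert_sub_diff assms)
  then have "cinner (v - s) (s' - s) = 0" "cinner (v - s') (s' - s) = 0"
    by (rule bspec[OF assms(4)], rule bspec[OF assms(5)])
  moreover have "s' - s = (v - s) - (v - s')" by simp
  ultimately have "cinner (s' - s) (s' - s) = 0" by (metis cinner.diff_left diff_self)
  then show ?thesis by (simp add: cinner_self_zero)
qed

lemma orth_proj_props:
  assumes H: "hilbert_sub H"
  shows orth_proj_in: "blinfun_apply (orth_proj H) v \<in> H"
    and orth_proj_orthogonal: "w \<in> H \<Longrightarrow> cinner (v - blinfun_apply (orth_proj H) v) w = 0"
    and orth_proj_clin: "clin (orth_proj H)"
proof -
  define P where "P v = (SOME s. s \<in> H \<and> (\<forall>w\<in>H. cinner (v - s) w = 0))" for v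
  have P: "P v \<in> H \<and> (\<forall>w\<in>H. cinner (v - P v) w = 0)" for v
    unfolding P_def by (rule someI_ex) (use ex_orthogonal_projection[OF H, of v] in blast)
  have PI: "P v = s" if "s \<in> H" "\<forall>w\<in>H. cinner (v - s) w = 0" for v s
    using orthogonal_projection_unique[OF H _ that(1) _ that(2), of "P v"] P[of v] by blast
  have scale: "P (c *\<^sub>C v) = c *\<^sub>C P v" for c v
    using P[of v] by (intro PI) (auto simp: hilbert_sub_scaleC[OF H] cinner_simps right_diff_distrib[symmetric])
  have add: "P (v + w) = P v + P w" for v w
  proof (intro PI ballI)
    show "P v + P w \<in> H" using P by (intro hilbert_sub_add H) simp_all
    fix u assume "u \<in> H"
    then show "cinner (v + w - (P v + P w)) u = 0"
      using P[of v] P[of w] by (simp add: cinner_simps)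
  qed
  have "norm (P v) \<le> norm v" for v
  proof -
    have "cinner (v - P v) (P v) = 0" using P by blast
    then have "(v - P v) \<bullet> P v = 0" by (simp add: inner_eq_Re_cinner)
    then have "v \<bullet> v = P v \<bullet> P v + (v - P v) \<bullet> (v - P v)"
      by (simp add: inner_diff_left inner_diff_right inner_commute)
    then have "P v \<bullet> P v \<le> v \<bullet> v" by simp
    then show ?thesis by (simp add: norm_le)
  qed
  then have "bounded_linear P"
    by (intro bounded_linear_intro[where K = 1]) (simp_all add: add scale scaleR_scaleC_eq)
  then have eq: "blinfun_apply (orth_proj H) = P"
    unfolding orth_proj_def P_def[symmetric] by (simp add: bounded_linear_Blinfun_apply P_def[abs_def])
  show "blinfun_apply (orth_proj H) v \<in> H"
    "w \<in> H \<Longrightarrow> cinner (v - blinfun_apply (orth_proj H) v) w = 0" "clin (orth_proj H)"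
    using P scale by (simp_all add: eq clin_def)
qed

lemma orth_proj_eqI:
  assumes "hilbert_sub H" "s \<in> H" "\<And>w. w \<in> H \<Longrightarrow> cinner (v - s) w = 0"
  shows "blinfun_apply (orth_proj H) v = s"
  by (rule orthogonal_projection_unique[OF assms(1) _ assms(2), where v = v])
    (simp_all add: orth_proj_in[OF assms(1)] orth_proj_orthogonal[OF assms(1)] assms(3))

lemma orth_proj_id: "hilbert_sub H \<Longrightarrow> v \<in> H \<Longrightarrow> blinfun_apply (orth_proj H) v = v"
  by (rule orth_proj_eqI) (simp_all add: cinner_simps)

lemma orth_proj_zero:
  "hilbert_sub H \<Longrightarrow> (\<And>w. w \<in> H \<Longrightarrow> cinner v w = 0) \<Longrightarrow> blinfun_apply (orth_proj H) v = 0"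
  by (rule orth_proj_eqI) (auto intro: hilbert_sub_zero)

text \<open>The difference of \<open>x\<close> and its projection is orthogonal to \<open>H\<close>,
  hence by assumption to \<open>x\<close>, and hence to itself.\<close>

lemma in_hilbert_sub_if_orthogonal:
  assumes H: "hilbert_sub H" and "\<And>v. (\<And>w. w \<in> H \<Longrightarrow> cinner v w = 0) \<Longrightarrow> cinner v x = 0"
  shows "x \<in> H"
proof -
  let ?p = "blinfun_apply (orth_proj H) x"
  have "cinner (x - ?p) x = 0" "cinner (x - ?p) ?p = 0"
    using assms(2) orth_proj_orthogonal[OF H] orth_proj_in[OF H] by blast+
  then have "cinner (x - ?p) (x - ?p) = 0" by (simp add: cinner.diff_right[of "x - ?p"])
  then show ?thesis using orth_proj_in[OF H, of x] by (simp add: cinner_self_zero)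
qed

subsection \<open>Adjoints\<close>

text \<open>The complement of the closed kernel is a line: for a vector \<open>z\<close> orthogonal
  to the kernel with \<open>\<phi> z \<noteq> 0\<close>, the vector
  \<open>v - (\<phi> v / \<phi> z) *\<^sub>C z\<close> lies in the kernel for every
  \<open>v\<close>, and pairing it with \<open>z\<close> computes \<open>\<phi> v\<close>.\<close>

lemma riesz_representation:
  fixes \<phi> :: "'h::chilbert_space \<Rightarrow> complex"
  assumes \<phi>: "bounded_linear \<phi>" "\<And>c v. \<phi> (c *\<^sub>C v) = c * \<phi> v"
  shows "\<exists>y. \<forall>v. \<phi> v = cinner v y"
proof (cases "\<forall>v. \<phi> v = 0")
  case True
  then show ?thesis by (intro exI[of _ 0]) (simp add: cinner_simps)
next
  case False
  interpret bounded_linear \<phi> by (rule \<phi>(1))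
  define N where "N = {v. \<phi> v = 0}"
  have N: "hilbert_sub N"
    unfolding N_def hilbert_sub_def complex_vector.subspace_def
    by (auto simp: \<phi>(2) add zero intro!: closed_Collect_eq continuous_intros
        linear_continuous_on[OF \<phi>(1)])
  obtain u where u: "\<phi> u \<noteq> 0" using False by blast
  define z where "z = u - blinfun_apply (orth_proj N) u"
  have z: "\<phi> z \<noteq> 0" "\<And>w. w \<in> N \<Longrightarrow> cinner w z = 0"
    using orth_proj_in[OF N, of u] orth_proj_orthogonal[OF N, of _ u] u cinner_eq_zero_commute
    unfolding z_def by (auto simp: diff N_def)
  then have zz: "cinner z z \<noteq> 0" using zero by (auto simp: cinner_self_zero)
  have "\<phi> v = cinner v (cnj (\<phi> z / cinner z z) *\<^sub>C z)" for v
  proof -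
    have "v - (\<phi> v / \<phi> z) *\<^sub>C z \<in> N" using z(1) by (simp add: N_def diff \<phi>(2))
    then have "cinner v z = \<phi> v / \<phi> z * cinner z z" using z(2) by (force simp: cinner_simps)
    then show ?thesis using z(1) zz by (simp add: cinner_simps)
  qed
  then show ?thesis by blast
qed

lemma cinner_left_ext: "(\<And>x. cinner x y = cinner x z) \<Longrightarrow> y = (z::'h::chilbert_space)"
  using cinner_self_zero[of "y - z"] by (simp add: cinner.diff_right)

lemma op_adj_unique:
  assumes "\<And>x y. cinner (blinfun_apply t x) y = cinner x (blinfun_apply s y)"
  shows "op_adj t = s"
  unfolding op_adj_def
proof (rule the_equality)
  show "\<forall>x y. cinner (blinfun_apply t x) y = cinner x (blinfun_apply s y)" by (simp add: assms)
  fix s' assume *: "\<forall>x y. cinner (blinfun_apply t x) y = cinner x (blinfun_apply s' y)"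
  show "s' = s"
  proof (intro blinfun_eqI cinner_left_ext)
    fix y x show "cinner x (blinfun_apply s' y) = cinner x (blinfun_apply s y)"
      using * assms[of x y] by simp
  qed
qed

text \<open>The values of the adjoint come pointwise from Riesz representation; the bound comes from
  testing the defining equation at \<open>x = S y\<close>.\<close>

lemma op_adj_ex:
  fixes t :: "'h::chilbert_space \<Rightarrow>\<^sub>L 'k::chilbert_space"
  assumes t: "clin t"
  shows "\<exists>s. \<forall>x y. cinner (blinfun_apply t x) y = cinner x (blinfun_apply s y)"
proof -
  have "\<exists>z. \<forall>x. cinner (blinfun_apply t x) y = cinner x z" for y
  proof (rule riesz_representation)
    show "bounded_linear (\<lambda>x. cinner (blinfun_apply t x) y)"
      by (rule bounded_linear_compose[OF cinner.bounded_linear_left blinfun.bounded_linear_right])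
    show "cinner (blinfun_apply t (c *\<^sub>C x)) y = c * cinner (blinfun_apply t x) y" for c x
      using t by (simp add: clin_def cinner_simps)
  qed
  then obtain S where S: "\<And>x y. cinner (blinfun_apply t x) y = cinner x (S y)" by metis
  have "norm (S y) \<le> norm y * norm t" for y
  proof (cases "S y = 0")
    case False
    have "(norm (S y))\<^sup>2 = cmod (cinner (S y) (S y))" by (simp add: cmod_cinner_self)
    also have "\<dots> = cmod (cinner (blinfun_apply t (S y)) y)" by (simp add: S)
    also have "\<dots> \<le> norm (blinfun_apply t (S y)) * norm y" by (rule cinner_norm_le)
    also have "\<dots> \<le> norm t * norm (S y) * norm y" by (intro mult_right_mono norm_blinfun) simp
    finally show ?thesis using False by (simp add: power2_eq_square mult.commute)
  qed simp
  moreover have "S (x + y) = S x + S y" for x y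
    by (rule cinner_left_ext) (simp add: S[symmetric] cinner_simps)
  moreover have "S (r *\<^sub>R x) = r *\<^sub>R S x" for r x
    by (rule cinner_left_ext) (simp add: S[symmetric] cinner_simps scaleR_scaleC_eq)
  ultimately have "bounded_linear S" by (intro bounded_linear_intro)
  then show ?thesis using S by (intro exI[of _ "Blinfun S"]) (simp add: bounded_linear_Blinfun_apply)
qed

lemma cinner_op_adj:
  assumes "clin t"
  shows "cinner (blinfun_apply t x) y = cinner x (blinfun_apply (op_adj t) y)"
proof -
  obtain s where s: "\<And>x y. cinner (blinfun_apply t x) y = cinner x (blinfun_apply s y)"
    using op_adj_ex[OF assms] by blast
  then have "op_adj t = s" by (rule op_adj_unique)
  with s show ?thesis by simp
qed

lemma cinner_op_adj':
  assumes "clin t"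
  shows "cinner (blinfun_apply (op_adj t) y) x = cinner y (blinfun_apply t x)"
  using cinner_op_adj[OF assms, of x y] cinner_commute[of y] cinner_commute[of _ x] by metis

lemma clin_op_adj: "clin t \<Longrightarrow> clin (op_adj t)"
  unfolding clin_def[of "op_adj t"]
  by (intro allI cinner_left_ext) (simp add: cinner_op_adj[symmetric] cinner_simps)

lemma op_adj_op_adj: "clin t \<Longrightarrow> op_adj (op_adj t) = t"
  by (rule op_adj_unique) (rule cinner_op_adj')

lemma op_adj_compose: "clin s \<Longrightarrow> clin t \<Longrightarrow> op_adj (s o\<^sub>L t) = op_adj t o\<^sub>L op_adj s"
  by (rule op_adj_unique) (simp add: cinner_op_adj)

lemma op_adj_add: "clin s \<Longrightarrow> clin t \<Longrightarrow> op_adj (s + t) = op_adj s + op_adj t"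
  by (rule op_adj_unique) (simp add: cinner_op_adj blinfun.add_left cinner_simps)

lemma op_adj_diff: "clin s \<Longrightarrow> clin t \<Longrightarrow> op_adj (s - t) = op_adj s - op_adj t"
  by (rule op_adj_unique) (simp add: cinner_op_adj blinfun.diff_left cinner_simps)

lemma op_adj_zero: "op_adj 0 = 0"
  by (rule op_adj_unique) (simp add: cinner_simps)

lemma op_scale_apply [simp]: "blinfun_apply (op_scale c t) v = c *\<^sub>C blinfun_apply t v"
  unfolding op_scale_def
  by (simp add: bounded_linear_Blinfun_apply
      bounded_linear_compose[OF scaleC.bounded_linear_right blinfun.bounded_linear_right])

lemma op_adj_scale: "clin t \<Longrightarrow> op_adj (op_scale c t) = op_scale (cnj c) (op_adj t)"
  by (rule op_adj_unique) (simp add: cinner_op_adj cinner_simps)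

lemma norm_op_adj_le: "clin t \<Longrightarrow> norm (op_adj t) \<le> norm t"
proof (rule norm_blinfun_bound)
  fix y assume t: "clin t"
  let ?z = "blinfun_apply (op_adj t) y"
  have "(norm ?z)\<^sup>2 = cmod (cinner (blinfun_apply t ?z) y)"
    by (simp add: cinner_op_adj[OF t] cmod_cinner_self)
  also have "\<dots> \<le> norm (blinfun_apply t ?z) * norm y" by (rule cinner_norm_le)
  also have "\<dots> \<le> norm t * norm ?z * norm y" by (intro mult_right_mono norm_blinfun) simp
  finally have "norm ?z * norm ?z \<le> norm ?z * (norm t * norm y)"
    by (simp add: power2_eq_square mult_ac)
  then show "norm ?z \<le> norm t * norm y"
    by (cases "?z = 0") (auto simp: mult_le_cancel_left)
qed simp

lemma norm_op_scale: "norm (op_scale c t) = cmod c * norm t"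
proof (rule antisym)
  show le: "norm (op_scale c t) \<le> cmod c * norm t" for c and t :: "'a \<Rightarrow>\<^sub>L 'b"
    by (rule norm_blinfun_bound)
      (simp_all add: norm_scaleC mult.assoc mult_left_mono norm_blinfun)
  show "cmod c * norm t \<le> norm (op_scale c t)"
  proof (cases "c = 0")
    case False
    have "op_scale (inverse c) (op_scale c t) = t"
      by (rule blinfun_eqI) (simp add: scaleC_scaleC False)
    then have "norm t \<le> inverse (cmod c) * norm (op_scale c t)" using le by (metis norm_inverse)
    then show ?thesis using False by (simp add: field_simps)
  qed simp
qed

lemma bounded_bilinear_op_scale:
  "bounded_bilinear (op_scale :: _ \<Rightarrow> ('h::chilbert_space \<Rightarrow>\<^sub>L 'k::chilbert_space) \<Rightarrow> _)"
proof
  show "\<exists>K. \<forall>a. \<forall>b :: 'h \<Rightarrow>\<^sub>L 'k. norm (op_scale a b) \<le> norm a * norm b * K"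
    by (intro exI[of _ 1]) (simp add: norm_op_scale)
qed (auto intro!: blinfun_eqI simp: scaleC_add_left scaleC_add_right blinfun.add_left
    blinfun.scaleR_left scaleR_scaleC_eq scaleC_scaleC scaleR_conv_of_real mult.commute)

subsection \<open>Operators between closed subspaces\<close>

lemma bops_clin: "t \<in> bops H K \<Longrightarrow> clin t"
  and bops_in: "t \<in> bops H K \<Longrightarrow> blinfun_apply t v \<in> K"
  and bops_zero: "t \<in> bops H K \<Longrightarrow> (\<And>w. w \<in> H \<Longrightarrow> cinner v w = 0) \<Longrightarrow> blinfun_apply t v = 0"
  unfolding bops_def clin_def by blast+

lemma bopsI:
  assumes "clin t" "\<And>v. blinfun_apply t v \<in> K"
    "\<And>v. (\<And>w. w \<in> H \<Longrightarrow> cinner v w = 0) \<Longrightarrow> blinfun_apply t v = 0"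
  shows "t \<in> bops H K"
  using assms unfolding bops_def clin_def by blast

lemma orth_proj_bops: "hilbert_sub H \<Longrightarrow> orth_proj H \<in> bops H H"
  by (intro bopsI orth_proj_clin orth_proj_in orth_proj_zero)

lemma zero_bops: "hilbert_sub K \<Longrightarrow> 0 \<in> bops H K"
  by (intro bopsI) (auto simp: clin_def hilbert_sub_zero scaleC.zero_right)

lemma add_bops: "hilbert_sub K \<Longrightarrow> s \<in> bops H K \<Longrightarrow> t \<in> bops H K \<Longrightarrow> s + t \<in> bops H K"
  unfolding bops_def by (simp add: blinfun.add_left scaleC_add_right hilbert_sub_add)

lemma scale_bops: "hilbert_sub K \<Longrightarrow> t \<in> bops H K \<Longrightarrow> op_scale c t \<in> bops H K"
  unfolding bops_def
  by (simp add: hilbert_sub_scaleC scaleC_scaleC scaleC.zero_right mult.commute)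

lemma compose_bops: "s \<in> bops K L \<Longrightarrow> t \<in> bops H K \<Longrightarrow> s o\<^sub>L t \<in> bops H L"
  unfolding bops_def by (simp add: blinfun.zero_right)

lemma op_adj_bops:
  assumes H: "hilbert_sub H" and t: "t \<in> bops H K"
  shows "op_adj t \<in> bops K H"
proof (rule bopsI)
  note c = bops_clin[OF t]
  show "clin (op_adj t)" by (rule clin_op_adj[OF c])
  show "blinfun_apply (op_adj t) v \<in> H" for v
    by (rule in_hilbert_sub_if_orthogonal[OF H])
      (simp add: cinner_op_adj[OF c, symmetric] bops_zero[OF t] cinner_simps)
  show "blinfun_apply (op_adj t) v = 0" if "\<And>w. w \<in> K \<Longrightarrow> cinner v w = 0" for v
  proof (rule cinner_left_ext)
    fix x
    have "cinner (blinfun_apply t x) v = 0"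
      using that[OF bops_in[OF t]] cinner_eq_zero_commute by blast
    then show "cinner x (blinfun_apply (op_adj t) v) = cinner x 0"
      by (simp add: cinner_op_adj[OF c, symmetric] cinner_simps)
  qed
qed

lemma bops_orth_proj_right: "hilbert_sub H \<Longrightarrow> t \<in> bops H K \<Longrightarrow> t o\<^sub>L orth_proj H = t"
proof (rule blinfun_eqI)
  fix v assume H: "hilbert_sub H" and t: "t \<in> bops H K"
  have "blinfun_apply t (v - blinfun_apply (orth_proj H) v) = 0"
    by (rule bops_zero[OF t orth_proj_orthogonal[OF H]])
  then show "blinfun_apply (t o\<^sub>L orth_proj H) v = blinfun_apply t v"
    by (simp add: blinfun.diff_right)
qed

lemma bops_orth_proj_left: "hilbert_sub K \<Longrightarrow> t \<in> bops H K \<Longrightarrow> orth_proj K o\<^sub>L t = t"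
  by (rule blinfun_eqI) (simp add: orth_proj_id bops_in)

lemma bops_eqI:
  assumes "hilbert_sub H" "s \<in> bops H K" "t \<in> bops H K"
    "\<And>v. v \<in> H \<Longrightarrow> blinfun_apply s v = blinfun_apply t v"
  shows "s = t"
proof (rule blinfun_eqI)
  fix v
  have "blinfun_apply (s o\<^sub>L orth_proj H) v = blinfun_apply (t o\<^sub>L orth_proj H) v"
    by (simp add: assms(4) orth_proj_in[OF assms(1)])
  then show "blinfun_apply s v = blinfun_apply t v"
    by (simp only: bops_orth_proj_right[OF assms(1,2)] bops_orth_proj_right[OF assms(1,3)])
qed

lemma closed_bops:
  fixes H :: "'a::chilbert_space set" and K :: "'b::chilbert_space set"
  assumes "hilbert_sub K"
  shows "closed (bops H K)"
proof -
  have ap: "continuous_on UNIV (\<lambda>t::'a \<Rightarrow>\<^sub>L 'b. blinfun_apply t v)" for v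
    by (rule linear_continuous_on[OF blinfun.bounded_linear_left])
  have sc: "continuous_on UNIV (\<lambda>t::'a \<Rightarrow>\<^sub>L 'b. c *\<^sub>C blinfun_apply t v)" for c v
    by (rule scaleC.continuous_on[OF continuous_on_const ap])
  have "bops H K = (\<Inter>c v. {t. blinfun_apply t (c *\<^sub>C v) = c *\<^sub>C blinfun_apply t v}) \<inter>
      (\<Inter>v. {t. blinfun_apply t v \<in> K}) \<inter>
      (\<Inter>v\<in>{v. \<forall>w\<in>H. cinner v w = 0}. {t. blinfun_apply t v = 0})"
    unfolding bops_def by blast
  moreover have "closed {t::'a \<Rightarrow>\<^sub>L 'b. blinfun_apply t v \<in> K}" for v
    using closed_vimage[OF hilbert_sub_closed[OF assms] ap[of v]] by (simp add: vimage_def)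
  ultimately show ?thesis
    by (auto intro!: closed_Int closed_INT closed_Collect_eq ap sc continuous_on_const)
qed

text \<open>\<open>op_adj\<close> is known to be an adjoint only for complex-linear operators. There
  it is additive and does not increase the norm, so it does not increase distances.\<close>

lemma continuous_on_op_adj: "continuous_on (Collect clin) op_adj"
  unfolding continuous_on_iff
proof (intro ballI allI impI)
  fix s :: "'a \<Rightarrow>\<^sub>L 'b" and e :: real assume s: "s \<in> Collect clin" and e: "0 < e"
  have "dist (op_adj t) (op_adj s) \<le> dist t s" if "t \<in> Collect clin" for t
  proof -
    have "clin (t - s)"
      using s that by (simp add: clin_def blinfun.diff_left scaleC.diff_right)
    then show ?thesis
      using s that norm_op_adj_le[of "t - s"] by (simp add: dist_norm op_adj_diff)
  qed
  then show "\<exists>d>0. \<forall>t\<in>Collect clin. dist t s < d \<longrightarrow> dist (op_adj t) (op_adj s) < e"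
    using e by (intro exI[of _ e]) (meson le_less_trans)
qed

subsection \<open>Isometries\<close>

lemma isometry_bops: "hilbert_isometry H K t \<Longrightarrow> t \<in> bops H K"
  unfolding hilbert_isometry_def by blast

text \<open>Polarization for the real inner product gives equality of the real parts; replacing
  \<open>w\<close> by \<open>\<i> *\<^sub>C w\<close> gives the imaginary parts.\<close>

lemma isometry_cinner:
  assumes H: "hilbert_sub H" and t: "hilbert_isometry H K t" and vw: "v \<in> H" "w \<in> H"
  shows "cinner (blinfun_apply t v) (blinfun_apply t w) = cinner v w"
proof -
  have real: "blinfun_apply t v \<bullet> blinfun_apply t w = v \<bullet> w" if "v \<in> H" "w \<in> H" for v w
    using t that hilbert_sub_add[OF H that]
    unfolding hilbert_isometry_def by (simp add: dot_norm blinfun.add_right[symmetric])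
  have scale: "blinfun_apply t (\<i> *\<^sub>C w) = \<i> *\<^sub>C blinfun_apply t w"
    using bops_clin[OF isometry_bops[OF t]] unfolding clin_def by blast
  show ?thesis
  proof (rule complex_eqI)
    show "Re (cinner (blinfun_apply t v) (blinfun_apply t w)) = Re (cinner v w)"
      using real[OF vw] by (simp add: inner_eq_Re_cinner)
    show "Im (cinner (blinfun_apply t v) (blinfun_apply t w)) = Im (cinner v w)"
      using real[OF vw(1) hilbert_sub_scaleC[OF H vw(2), of \<i>]]
      by (simp add: inner_eq_Re_cinner scale cinner_simps)
  qed
qed

lemma isometry_adj_compose:
  assumes H: "hilbert_sub H" and t: "hilbert_isometry H K t"
  shows "op_adj t o\<^sub>L t = orth_proj H"
proof (rule bops_eqI[OF H])
  note b = isometry_bops[OF t]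
  show "op_adj t o\<^sub>L t \<in> bops H H" by (rule compose_bops[OF op_adj_bops[OF H b] b])
  show "orth_proj H \<in> bops H H" by (rule orth_proj_bops[OF H])
  fix v assume v: "v \<in> H"
  let ?u = "blinfun_apply (op_adj t) (blinfun_apply t v)"
  have u: "?u \<in> H" by (rule bops_in[OF op_adj_bops[OF H b]])
  have "cinner (?u - v) w = 0" if "w \<in> H" for w
    using isometry_cinner[OF H t v that] by (simp add: cinner_simps cinner_op_adj'[OF bops_clin[OF b]])
  then have "cinner (?u - v) (?u - v) = 0" using hilbert_sub_diff[OF H u v] by blast
  then show "blinfun_apply (op_adj t o\<^sub>L t) v = blinfun_apply (orth_proj H) v"
    by (simp add: cinner_self_zero orth_proj_id[OF H v])
qed

lemma blinfun_compose_assoc: "(a o\<^sub>L b) o\<^sub>L c = a o\<^sub>L (b o\<^sub>L c)"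
  by (rule blinfun_eqI) simp

lemma isometry_adj_cancel:
  assumes "hilbert_sub H" "hilbert_isometry H K t" "x \<in> bops L H"
  shows "op_adj t o\<^sub>L (t o\<^sub>L x) = x"
  using bops_orth_proj_left[OF assms(1,3)] isometry_adj_compose[OF assms(1,2)]
  by (simp flip: blinfun_compose_assoc)

lemma isometry_orth_proj: "hilbert_sub H \<Longrightarrow> hilbert_isometry H H (orth_proj H)"
  unfolding hilbert_isometry_def by (simp add: orth_proj_bops orth_proj_id)

lemma isometry_compose:
  "hilbert_isometry H K t \<Longrightarrow> hilbert_isometry K L s \<Longrightarrow> hilbert_isometry H L (s o\<^sub>L t)"
  unfolding hilbert_isometry_def by (simp add: compose_bops[of s K L t H] bops_in[of t H K])

subsection \<open>Orthonormal bases\<close>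

lemma norm_sum_orthonormal:
  assumes "corthonormal (\<beta> ` F)" "inj_on \<beta> F" "finite F"
  shows "(norm (\<Sum>b\<in>F. a b *\<^sub>C \<beta> b))\<^sup>2 = (\<Sum>b\<in>F. (cmod (a b))\<^sup>2)"
proof -
  have on: "cinner (\<beta> b) (\<beta> c) = (if b = c then 1 else 0)" if "b \<in> F" "c \<in> F" for b c
    using that assms(1,2) unfolding corthonormal_def inj_on_def by auto
  have "of_real ((norm (\<Sum>b\<in>F. a b *\<^sub>C \<beta> b))\<^sup>2) =
      (\<Sum>b\<in>F. \<Sum>c\<in>F. a b * (cnj (a c) * cinner (\<beta> b) (\<beta> c)))"
    by (simp add: cinner_self[symmetric] cinner_simps sum_distrib_left del: of_real_power)
      (subst sum.swap, simp add: mult_ac)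
  also have "\<dots> = (\<Sum>b\<in>F. \<Sum>c\<in>F. if b = c then a b * cnj (a b) else 0)"
    by (intro sum.cong refl) (simp add: on)
  also have "\<dots> = (\<Sum>b\<in>F. a b * cnj (a b))" using assms(3) by (simp add: sum.delta')
  also have "\<dots> = of_real (\<Sum>b\<in>F. (cmod (a b))\<^sup>2)" by (simp add: complex_norm_square del: of_real_power)
  finally show ?thesis by (simp only: of_real_eq_iff)
qed

lemma corthonormal_subset: "corthonormal B \<Longrightarrow> A \<subseteq> B \<Longrightarrow> corthonormal A"
  unfolding corthonormal_def by blast

lemma cinner_sum_orthonormal:
  assumes "corthonormal B" "finite F" "F \<subseteq> B" "c \<in> B"
  shows "cinner (\<Sum>b\<in>F. a b *\<^sub>C b) c = (if c \<in> F then a c else 0)"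
proof -
  have "cinner (\<Sum>b\<in>F. a b *\<^sub>C b) c = (\<Sum>b\<in>F. if b = c then a b else 0)"
    unfolding cinner.sum_left using assms
    by (intro sum.cong) (auto simp: cinner_scaleC_left corthonormal_def subset_iff)
  then show ?thesis using assms(2) by simp
qed

lemma bessel:
  assumes "corthonormal F" "finite F"
  shows "(\<Sum>b\<in>F. (cmod (cinner v b))\<^sup>2) \<le> (norm v)\<^sup>2"
proof -
  let ?s = "\<Sum>b\<in>F. cinner v b *\<^sub>C b"
  have "cinner (v - ?s) ?s = 0"
    using cinner_sum_orthonormal[OF assms subset_refl]
    unfolding cinner.sum_right by (intro sum.neutral) (simp add: cinner_simps)
  then have "(v - ?s) \<bullet> ?s = 0" by (simp add: inner_eq_Re_cinner)
  then have "(norm v)\<^sup>2 = (norm ?s)\<^sup>2 + (norm (v - ?s))\<^sup>2"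
    by (simp add: power2_norm_eq_inner inner_diff_left inner_diff_right inner_commute)
  moreover have "(norm ?s)\<^sup>2 = (\<Sum>b\<in>F. (cmod (cinner v b))\<^sup>2)"
    using norm_sum_orthonormal[of "\<lambda>b. b" F "cinner v"] assms by simp
  ultimately show ?thesis by simp
qed

text \<open>The squared norm of a finite block of the sum is the corresponding block of the series
  of squares, whose finite sums are bounded. So the net of partial sums is Cauchy, and completeness
  finishes the argument.\<close>

lemma summable_on_orthonormal:
  fixes \<beta> :: "'i \<Rightarrow> 'k::chilbert_space"
  assumes on: "corthonormal (\<beta> ` B)" "inj_on \<beta> B"
    and bound: "\<And>F. finite F \<Longrightarrow> F \<subseteq> B \<Longrightarrow> (\<Sum>b\<in>F. (cmod (a b))\<^sup>2) \<le> C"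
  shows "(\<lambda>b. a b *\<^sub>C \<beta> b) summable_on B"
proof -
  let ?g = "\<lambda>b. (cmod (a b))\<^sup>2" and ?f = "\<lambda>b. a b *\<^sub>C \<beta> b"
  have "?g summable_on B"
    using bound by (intro nonneg_bdd_above_summable_on bdd_aboveI[of _ C]) auto
  then obtain L where "(?g has_sum L) B" by (auto simp: summable_on_def)
  then have lim: "(sum ?g \<longlongrightarrow> L) (finite_subsets_at_top B)" unfolding has_sum_def .
  have "\<exists>P. eventually P (finite_subsets_at_top B) \<and>
      (\<forall>F1 F2. P F1 \<and> P F2 \<longrightarrow> dist (sum ?f F1) (sum ?f F2) < e)" if e: "e > 0" for e
  proof -
    \<comment> \<open>The sums of squares over \<open>F\<close> and over \<open>F0\<close> may each
      miss the limit by \<open>d\<close>, and their difference must stay below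
      \<open>(e / 2)\<^sup>2\<close>.\<close>
    define d where "d = (e / 2)\<^sup>2 / 2"
    have d: "d > 0" using e by (simp add: d_def)
    have "eventually (\<lambda>F. dist (sum ?g F) L < d) (finite_subsets_at_top B)"
      using tendstoD[OF lim d] .
    then have "\<exists>F0. finite F0 \<and> F0 \<subseteq> B \<and>
        (\<forall>F. finite F \<and> F0 \<subseteq> F \<and> F \<subseteq> B \<longrightarrow> dist (sum ?g F) L < d)"
      unfolding eventually_finite_subsets_at_top .
    then obtain F0 where F0: "finite F0" "F0 \<subseteq> B" and
      "\<forall>F. finite F \<and> F0 \<subseteq> F \<and> F \<subseteq> B \<longrightarrow> dist (sum ?g F) L < d"
      by (elim exE conjE)
    then have close: "dist (sum ?g F) L < d" if "finite F" "F0 \<subseteq> F" "F \<subseteq> B" for F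
      using that by simp
    have near: "dist (sum ?f F) (sum ?f F0) < e / 2" if F: "finite F" "F0 \<subseteq> F" "F \<subseteq> B" for F
    proof -
      have "(norm (sum ?f (F - F0)))\<^sup>2 = sum ?g (F - F0)"
      proof (rule norm_sum_orthonormal)
        show "corthonormal (\<beta> ` (F - F0))" by (rule corthonormal_subset[OF on(1)]) (use F in blast)
        show "inj_on \<beta> (F - F0)" by (rule inj_on_subset[OF on(2)]) (use F in blast)
      qed (use F in simp)
      also have "\<dots> = sum ?g F - sum ?g F0" using F by (simp add: sum_diff)
      also have "\<dots> < (e / 2)\<^sup>2"
        using close[OF F] close[OF F0(1) subset_refl F0(2)] unfolding dist_real_def d_def
        by linarith
      finally have "norm (sum ?f (F - F0)) < e / 2"
        by (rule power_less_imp_less_base) (use e in simp)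
      then show ?thesis using F by (simp add: dist_norm sum_diff)
    qed
    show ?thesis
    proof (intro exI conjI allI impI)
      show "eventually (\<lambda>F. finite F \<and> F0 \<subseteq> F \<and> F \<subseteq> B) (finite_subsets_at_top B)"
        unfolding eventually_finite_subsets_at_top using F0 by blast
      fix F1 F2 assume "(finite F1 \<and> F0 \<subseteq> F1 \<and> F1 \<subseteq> B) \<and> (finite F2 \<and> F0 \<subseteq> F2 \<and> F2 \<subseteq> B)"
      then show "dist (sum ?f F1) (sum ?f F2) < e"
        using near[of F1] near[of F2] dist_triangle_half_l by blast
    qed
  qed
  then have "cauchy_filter (filtermap (sum ?f) (finite_subsets_at_top B))"
    by (simp add: cauchy_filter_metric_filtermap)
  moreover have "complete (UNIV :: 'k set)"
    by (meson Cauchy_convergent UNIV_I complete_def convergent_def)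
  ultimately obtain L' where "(sum ?f \<longlongrightarrow> L') (finite_subsets_at_top B)"
    using complete_uniform[where S = UNIV] by (force simp: filterlim_def)
  then show ?thesis unfolding summable_on_def has_sum_def by blast
qed

lemma orthonormal_basis_corthonormal: "orthonormal_basis H B \<Longrightarrow> corthonormal B"
  and orthonormal_basis_subset: "orthonormal_basis H B \<Longrightarrow> B \<subseteq> H"
  and orthonormal_basis_closure: "orthonormal_basis H B \<Longrightarrow> closure (cspan B) = H"
  unfolding orthonormal_basis_def by blast+

lemma orthonormal_basis_hilbert_sub: "orthonormal_basis H B \<Longrightarrow> hilbert_sub H"
  using hilbert_sub_closure_cspan orthonormal_basis_closure by metis

lemma hilbert_sub_has_sum:
  assumes K: "hilbert_sub K" and f: "(f has_sum s) B" and mem: "\<And>b. b \<in> B \<Longrightarrow> f b \<in> K"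
  shows "s \<in> K"
proof (rule Lim_in_closed_set[OF hilbert_sub_closed[OF K] _ _ f[unfolded has_sum_def]])
  have "sum f F \<in> K" if "finite F" "F \<subseteq> B" for F
    using that
  proof (induction F rule: finite_induct)
    case (insert b F)
    then show ?case by (auto intro!: hilbert_sub_add[OF K] mem)
  qed (simp add: hilbert_sub_zero[OF K])
  then show "eventually (\<lambda>F. sum f F \<in> K) (finite_subsets_at_top B)"
    by (intro eventually_finite_subsets_at_top_weakI)
qed simp

lemma orthonormal_expansion:
  assumes B: "orthonormal_basis H B" and v: "v \<in> H"
  shows "((\<lambda>b. cinner v b *\<^sub>C b) has_sum v) B"
proof -
  note on = orthonormal_basis_corthonormal[OF B] and H = orthonormal_basis_hilbert_sub[OF B]
  have "(\<lambda>b. cinner v b *\<^sub>C b) summable_on B"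
    using on by (intro summable_on_orthonormal[where C = "(norm v)\<^sup>2"] bessel) (auto intro: corthonormal_subset)
  then obtain w where w: "((\<lambda>b. cinner v b *\<^sub>C b) has_sum w) B" by (auto simp: summable_on_def)
  have "w \<in> H"
    by (rule hilbert_sub_has_sum[OF H w], rule hilbert_sub_scaleC[OF H])
      (use orthonormal_basis_subset[OF B] in blast)
  have "cinner (v - w) c = 0" if c: "c \<in> B" for c
  proof -
    have "((\<lambda>b. cinner (cinner v b *\<^sub>C b) c) has_sum cinner w c) B"
      using has_sum_bounded_linear[OF cinner.bounded_linear_left w] .
    moreover have "((\<lambda>b. cinner (cinner v b *\<^sub>C b) c) has_sum cinner v c) B"
      by (rule has_sum_finite_neutralI[of "{c}"])
        (use c on in \<open>auto simp: cinner_scaleC_left corthonormal_def\<close>)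
    ultimately show ?thesis using has_sum_unique by (force simp: cinner_simps)
  qed
  then have "cinner (v - w) (v - w) = 0"
    using orthogonal_closure_cspan[of B "v - w" "v - w"] hilbert_sub_diff[OF H v \<open>w \<in> H\<close>]
    unfolding orthonormal_basis_closure[OF B] by blast
  then show ?thesis using w by (simp add: cinner_self_zero)
qed

text \<open>The operator sends \<open>v\<close> to the sum of
  \<open>cinner v b *\<^sub>C \<beta> b\<close>. Bessel's inequality makes this converge for every
  vector of the type, and vectors orthogonal to \<open>H\<close> have no coefficients, so the
  extension by zero is built in.\<close>

lemma ex_isometry_of_orthonormal_bases:
  assumes B: "orthonormal_basis H B" and K: "hilbert_sub K"
    and \<beta>: "inj_on \<beta> B" "corthonormal (\<beta> ` B)" "\<beta> ` B \<subseteq> K"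
  shows "\<exists>t. hilbert_isometry H K t \<and> (\<forall>b\<in>B. blinfun_apply t b = \<beta> b)"
proof -
  note on = orthonormal_basis_corthonormal[OF B] and H = orthonormal_basis_hilbert_sub[OF B]
  define T where "T v = (\<Sum>\<^sub>\<infinity>b\<in>B. cinner v b *\<^sub>C \<beta> b)" for v
  have bes: "(\<Sum>b\<in>F. (cmod (cinner v b))\<^sup>2) \<le> (norm v)\<^sup>2" if "finite F" "F \<subseteq> B" for F v
    by (rule bessel[OF corthonormal_subset[OF on that(2)] that(1)])
  have sums: "((\<lambda>b. cinner v b *\<^sub>C \<beta> b) has_sum T v) B" for v
    unfolding T_def using summable_on_orthonormal[OF \<beta>(2,1) bes] by (simp add: has_sum_infsum)
  have partial: "(norm (\<Sum>b\<in>F. cinner v b *\<^sub>C \<beta> b))\<^sup>2 = (\<Sum>b\<in>F. (cmod (cinner v b))\<^sup>2)"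
    if "finite F" "F \<subseteq> B" for F v
    using that \<beta> by (intro norm_sum_orthonormal) (auto intro: corthonormal_subset inj_on_subset)
  have le: "norm (T v) \<le> norm v" for v
  proof (rule tendsto_upperbound)
    show "((\<lambda>F. norm (\<Sum>b\<in>F. cinner v b *\<^sub>C \<beta> b)) \<longlongrightarrow> norm (T v)) (finite_subsets_at_top B)"
      using sums[of v] unfolding has_sum_def by (rule tendsto_norm)
    show "\<forall>\<^sub>F F in finite_subsets_at_top B. norm (\<Sum>b\<in>F. cinner v b *\<^sub>C \<beta> b) \<le> norm v"
      by (rule eventually_finite_subsets_at_top_weakI, rule power2_le_imp_le)
        (simp_all add: partial bes)
  qed simp
  have "T (v + w) = T v + T w" for v w
    using has_sum_add[OF sums[of v] sums[of w]] sums[of "v + w"]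
    by (simp add: cinner_add_left scaleC_add_left has_sum_unique)
  moreover have scale: "T (c *\<^sub>C v) = c *\<^sub>C T v" for c v
    using has_sum_bounded_linear[OF scaleC.bounded_linear_right sums[of v], of c] sums[of "c *\<^sub>C v"]
    by (simp add: cinner_scaleC_left scaleC_scaleC has_sum_unique)
  ultimately have "bounded_linear T"
    using le by (intro bounded_linear_intro[where K = 1]) (simp_all add: scaleR_scaleC_eq)
  then have ap: "blinfun_apply (Blinfun T) = T" by (rule bounded_linear_Blinfun_apply)
  have "T v \<in> K" for v
    by (rule hilbert_sub_has_sum[OF K sums], rule hilbert_sub_scaleC[OF K]) (use \<beta>(3) in blast)
  moreover have "T v = 0" if "\<And>w. w \<in> H \<Longrightarrow> cinner v w = 0" for v
  proof -
    have "cinner v b = 0" if "b \<in> B" for b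
      using orthonormal_basis_subset[OF B] that \<open>\<And>w. w \<in> H \<Longrightarrow> cinner v w = 0\<close> by blast
    then have "T v = (\<Sum>\<^sub>\<infinity>b\<in>B. 0)"
      unfolding T_def by (intro infsum_cong) (simp add: scaleC.zero_left)
    then show ?thesis by simp
  qed
  ultimately have "Blinfun T \<in> bops H K"
    by (intro bopsI) (simp_all add: ap scale clin_def)
  moreover have "norm (T v) = norm v" if v: "v \<in> H" for v
  proof (rule tendsto_unique)
    show "((\<lambda>F. norm (\<Sum>b\<in>F. cinner v b *\<^sub>C \<beta> b)) \<longlongrightarrow> norm (T v)) (finite_subsets_at_top B)"
      using sums[of v] unfolding has_sum_def by (rule tendsto_norm)
    have lim: "((\<lambda>F. norm (\<Sum>b\<in>F. cinner v b *\<^sub>C b)) \<longlongrightarrow> norm v) (finite_subsets_at_top B)"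
      using orthonormal_expansion[OF B v] unfolding has_sum_def by (rule tendsto_norm)
    have eq: "norm (\<Sum>b\<in>F. cinner v b *\<^sub>C b) = norm (\<Sum>b\<in>F. cinner v b *\<^sub>C \<beta> b)"
      if "finite F" "F \<subseteq> B" for F
    proof -
      have "(norm (\<Sum>b\<in>F. cinner v b *\<^sub>C b))\<^sup>2 = (\<Sum>b\<in>F. (cmod (cinner v b))\<^sup>2)"
        using that norm_sum_orthonormal[of "\<lambda>b. b" F "cinner v"] corthonormal_subset[OF on, of F]
        by simp
      then have "(norm (\<Sum>b\<in>F. cinner v b *\<^sub>C b))\<^sup>2 = (norm (\<Sum>b\<in>F. cinner v b *\<^sub>C \<beta> b))\<^sup>2"
        by (simp only: partial[OF that])
      then show ?thesis by (simp only: power2_eq_iff_nonneg norm_ge_zero)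
    qed
    show "((\<lambda>F. norm (\<Sum>b\<in>F. cinner v b *\<^sub>C \<beta> b)) \<longlongrightarrow> norm v) (finite_subsets_at_top B)"
      by (rule Lim_transform_eventually[OF lim], rule eventually_finite_subsets_at_top_weakI, rule eq)
  qed simp
  moreover have "T b = \<beta> b" if b: "b \<in> B" for b
  proof (rule has_sum_unique[OF sums])
    show "((\<lambda>c. cinner b c *\<^sub>C \<beta> c) has_sum \<beta> b) B"
      by (rule has_sum_finite_neutralI[of "{b}"])
        (use b on in \<open>auto simp: corthonormal_def scaleC.zero_left\<close>)
  qed
  ultimately show ?thesis
    unfolding hilbert_isometry_def by (intro exI[of _ "Blinfun T"]) (simp add: ap)
qed

text \<open>By Zorn there is a maximal orthonormal subset of \<open>H\<close>. A vector of
  \<open>H\<close> outside its closed span would give one more element, after subtracting the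
  projection and normalizing.\<close>

lemma ex_orthonormal_basis:
  assumes H: "hilbert_sub (H :: 'h::chilbert_space set)"
  shows "\<exists>B. orthonormal_basis H B"
proof -
  define \<A> where "\<A> = {B. corthonormal B \<and> B \<subseteq> H}"
  have "\<exists>M\<in>\<A>. \<forall>X\<in>\<A>. M \<subseteq> X \<longrightarrow> X = M"
  proof (rule subset_Zorn_nonempty)
    show "\<A> \<noteq> {}" unfolding \<A>_def corthonormal_def by blast
    fix \<C> assume C: "\<C> \<noteq> {}" "subset.chain \<A> \<C>"
    have "cinner x y = (if x = y then 1 else 0)" if xy: "x \<in> \<Union>\<C>" "y \<in> \<Union>\<C>" for x y
    proof -
      obtain X Y where XY: "X \<in> \<C>" "Y \<in> \<C>" "x \<in> X" "y \<in> Y" using xy by blast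
      moreover have "X \<subseteq> Y \<or> Y \<subseteq> X" using C(2) XY unfolding subset_chain_def by blast
      ultimately obtain Z where "Z \<in> \<C>" "x \<in> Z" "y \<in> Z" by blast
      moreover from this have "corthonormal Z" using C(2) unfolding subset_chain_def \<A>_def by blast
      ultimately show ?thesis unfolding corthonormal_def by blast
    qed
    moreover have "\<Union>\<C> \<subseteq> H" using C(2) unfolding subset_chain_def \<A>_def by blast
    ultimately show "\<Union>\<C> \<in> \<A>" unfolding \<A>_def corthonormal_def by blast
  qed
  then obtain B where B: "B \<in> \<A>" and max: "\<And>X. X \<in> \<A> \<Longrightarrow> B \<subseteq> X \<Longrightarrow> X = B" by blast
  have on: "corthonormal B" and BH: "B \<subseteq> H" using B unfolding \<A>_def by auto
  define K where "K = closure (cspan B)"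
  have K: "hilbert_sub K" unfolding K_def by (rule hilbert_sub_closure_cspan)
  have KH: "K \<subseteq> H" unfolding K_def by (rule closure_cspan_minimal[OF H BH])
  have "H \<subseteq> K"
  proof (rule ccontr)
    assume "\<not> H \<subseteq> K"
    then obtain v where v: "v \<in> H" "v \<notin> K" by blast
    define u where "u = v - blinfun_apply (orth_proj K) v"
    define e where "e = of_real (inverse (norm u)) *\<^sub>C u"
    have "u \<in> H"
      unfolding u_def using orth_proj_in[OF K] KH by (intro hilbert_sub_diff[OF H v(1)]) blast
    have "u \<noteq> 0" unfolding u_def using v(2) orth_proj_in[OF K, of v] by auto
    have "cinner u b = 0" if "b \<in> B" for b
      unfolding u_def using that subset_closure_cspan[of B] orth_proj_orthogonal[OF K]
      unfolding K_def by blast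
    then have e1: "cinner e b = 0" "cinner b e = 0" if "b \<in> B" for b
      using that cinner_eq_zero_commute[of u b] unfolding e_def by (simp_all add: cinner_simps)
    have "norm e = 1" using \<open>u \<noteq> 0\<close> unfolding e_def by (simp add: norm_scaleC norm_inverse)
    then have e2: "cinner e e = 1" by (simp add: cinner_self)
    have "insert e B \<in> \<A>"
      using on BH e1 e2 hilbert_sub_scaleC[OF H \<open>u \<in> H\<close>]
      unfolding \<A>_def corthonormal_def e_def[symmetric] by (auto simp: e_def)
    then have "e \<in> B" using max by blast
    then show False using e1 e2 by force
  qed
  then have "orthonormal_basis H B"
    unfolding orthonormal_basis_def using on BH KH unfolding K_def by blast
  then show ?thesis by blast
qed

lemma hilbert_rank_obtain_basis:
  assumes "hilbert_sub H"
  obtains B where "orthonormal_basis H B" "hilbert_rank H = |B|"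
  using someI_ex[OF ex_orthonormal_basis[OF assms]] unfolding hilbert_rank_def by blast

text \<open>If \<open>B\<close> is infinite: each \<open>b\<close> has non-zero coefficients against
  only countably many elements of \<open>C\<close>, and these countable sets cover \<open>C\<close>.
  If \<open>B\<close> is finite: Parseval for elements of \<open>C\<close> and Bessel for elements
  of \<open>B\<close> bound every finite subset of \<open>C\<close> by \<open>card B\<close>. As
  \<open>hilbert_rank\<close> takes the size of an unspecified basis, this is what relates it to the
  size of a basis at hand.\<close>

lemma orthonormal_basis_card_le:
  assumes B: "orthonormal_basis H B" and C: "orthonormal_basis H C" and inf: "infinite C"
  shows "|C| \<le>o |B|"
proof (cases "finite B")
  case False
  have countable: "countable {c \<in> C. cinner b c \<noteq> 0}" for b
  proof -
    have "(\<lambda>c. (cmod (cinner b c))\<^sup>2) summable_on C"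
      using bessel[OF corthonormal_subset[OF orthonormal_basis_corthonormal[OF C]]]
      by (intro nonneg_bdd_above_summable_on bdd_aboveI[of _ "(norm b)\<^sup>2"]) auto
    then have "(\<lambda>c. norm ((cmod (cinner b c))\<^sup>2)) summable_on C" by simp
    from abs_summable_countable[OF this] show ?thesis by simp
  qed
  have "C \<subseteq> (\<Union>b\<in>B. {c \<in> C. cinner b c \<noteq> 0})"
  proof
    fix c assume c: "c \<in> C"
    have "cinner c c = 1" using c orthonormal_basis_corthonormal[OF C] unfolding corthonormal_def by auto
    then have "\<not> (\<forall>b\<in>B. cinner c b = 0)"
      using orthogonal_closure_cspan[of B c c] c orthonormal_basis_subset[OF C]
      unfolding orthonormal_basis_closure[OF B] by auto
    then show "c \<in> (\<Union>b\<in>B. {c \<in> C. cinner b c \<noteq> 0})" using c cinner_eq_zero_commute by blast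
  qed
  moreover have "|\<Union>b\<in>B. {c \<in> C. cinner b c \<noteq> 0}| \<le>o |B|"
  proof (rule card_of_UNION_ordLeq_infinite[OF False])
    show "|B| \<le>o |B|" by (rule card_of_mono1) simp
    have "|{c \<in> C. cinner b c \<noteq> 0}| \<le>o |B|" for b
    proof -
      have "|{c \<in> C. cinner b c \<noteq> 0}| \<le>o |UNIV :: nat set|"
        using countable[of b] card_of_ordLeq[of _ "UNIV :: nat set"] unfolding countable_def by blast
      moreover have "|UNIV :: nat set| \<le>o |B|" using False infinite_iff_card_of_nat by blast
      ultimately show ?thesis by (rule ordLeq_transitive)
    qed
    then show "\<forall>b\<in>B. |{c \<in> C. cinner b c \<noteq> 0}| \<le>o |B|" by blast
  qed
  ultimately show ?thesis using card_of_mono1 ordLeq_transitive by blast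
next
  case True
  have parseval: "(\<Sum>b\<in>B. (cmod (cinner c b))\<^sup>2) = 1" if c: "c \<in> C" for c
  proof -
    have cH: "c \<in> H" using c orthonormal_basis_subset[OF C] by blast
    have "c = (\<Sum>b\<in>B. cinner c b *\<^sub>C b)"
      using has_sum_unique[OF orthonormal_expansion[OF B cH] has_sum_finite[OF True]] .
    then have "(norm c)\<^sup>2 = (\<Sum>b\<in>B. (cmod (cinner c b))\<^sup>2)"
      using norm_sum_orthonormal[of "\<lambda>b. b" B "cinner c"] True orthonormal_basis_corthonormal[OF B]
      by simp
    moreover have "cinner c c = 1"
      using c orthonormal_basis_corthonormal[OF C] unfolding corthonormal_def by auto
    then have "(norm c)\<^sup>2 = 1" by (metis cmod_cinner_self norm_one)
    ultimately show ?thesis by simp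
  qed
  have "card F \<le> card B" if F: "finite F" "F \<subseteq> C" for F
  proof -
    have onF: "corthonormal F" using F corthonormal_subset[OF orthonormal_basis_corthonormal[OF C]] by simp
    have "real (card F) = (\<Sum>c\<in>F. \<Sum>b\<in>B. (cmod (cinner c b))\<^sup>2)" using parseval F by (simp add: subset_iff)
    also have "\<dots> = (\<Sum>b\<in>B. \<Sum>c\<in>F. (cmod (cinner b c))\<^sup>2)"
    proof -
      have "cmod (cinner c b) = cmod (cinner b c)" for b c :: 'a by (metis cinner_commute complex_mod_cnj)
      then show ?thesis by (subst sum.swap) simp
    qed
    also have "\<dots> \<le> (\<Sum>b\<in>B. (norm b)\<^sup>2)" by (intro sum_mono bessel onF F)
    also have "\<dots> = (\<Sum>b\<in>B. 1)"
    proof (rule sum.cong)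
      fix b assume "b \<in> B"
      then have "cinner b b = 1" using orthonormal_basis_corthonormal[OF B] unfolding corthonormal_def by auto
      then show "(norm b)\<^sup>2 = 1" by (metis cmod_cinner_self norm_one)
    qed simp
    finally show ?thesis by simp
  qed
  then have "finite C"
    by (intro finite_if_finite_subsets_card_bdd[of C "card B", THEN conjunct1]) simp
  with inf show ?thesis by blast
qed

subsection \<open>Compact operators\<close>

text \<open>An operator from \<open>H\<close> factors through the projection onto \<open>H\<close>,
  a contraction, so the full unit ball has the same image as that of \<open>H\<close>. Asking for
  some compact set around the image avoids closures in the stability lemmas below.\<close>

lemma compact_op_iff:
  assumes H: "hilbert_sub H"
  shows "compact_op H K t \<longleftrightarrow> t \<in> bops H K \<and> (\<exists>S. compact S \<and> blinfun_apply t ` cball 0 1 \<subseteq> S)"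
proof (cases "t \<in> bops H K")
  case t: True
  have le: "norm (blinfun_apply (orth_proj H) v) \<le> norm v" for v
  proof -
    let ?p = "blinfun_apply (orth_proj H) v"
    have "cinner (v - ?p) ?p = 0" by (rule orth_proj_orthogonal[OF H orth_proj_in[OF H]])
    then have "(v - ?p) \<bullet> ?p = 0" by (simp add: inner_eq_Re_cinner)
    then have "v \<bullet> v = ?p \<bullet> ?p + (v - ?p) \<bullet> (v - ?p)"
      by (simp add: inner_diff_left inner_diff_right inner_commute)
    then have "?p \<bullet> ?p \<le> v \<bullet> v" by simp
    then show ?thesis by (simp add: norm_le)
  qed
  have "blinfun_apply t ` (H \<inter> cball 0 1) = blinfun_apply t ` cball 0 1"
  proof
    show "blinfun_apply t ` cball 0 1 \<subseteq> blinfun_apply t ` (H \<inter> cball 0 1)"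
    proof
      fix y assume "y \<in> blinfun_apply t ` cball 0 1"
      then obtain v where v: "y = blinfun_apply t v" "norm v \<le> 1" by auto
      then have "y = blinfun_apply t (blinfun_apply (orth_proj H) v)"
        using bops_orth_proj_right[OF H t] by (metis blinfun_apply_blinfun_compose)
      moreover have "norm (blinfun_apply (orth_proj H) v) \<le> 1" using le[of v] v(2) by simp
      ultimately show "y \<in> blinfun_apply t ` (H \<inter> cball 0 1)" using orth_proj_in[OF H, of v] by auto
    qed
  qed blast
  moreover have "compact (closure T) \<longleftrightarrow> (\<exists>S. compact S \<and> T \<subseteq> S)" for T :: "'b set"
    by (metis closure_closed closure_mono closure_subset closed_closure compact_Int_closed
        compact_imp_closed inf.absorb2)
  ultimately show ?thesis unfolding compact_op_def using t by simp
qed (simp add: compact_op_def)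

lemma compact_op_bops: "compact_op H K t \<Longrightarrow> t \<in> bops H K"
  unfolding compact_op_def by blast

lemma compact_opE:
  assumes "compact_op H K t" "hilbert_sub H"
  obtains S where "compact S" "blinfun_apply t ` cball 0 1 \<subseteq> S"
  using assms(1) unfolding compact_op_iff[OF assms(2)] by blast

lemma compact_opI:
  assumes "hilbert_sub H" "t \<in> bops H K" "compact S" "blinfun_apply t ` cball 0 1 \<subseteq> S"
  shows "compact_op H K t"
  using assms(2-4) unfolding compact_op_iff[OF assms(1)] by blast

lemma compact_op_compose_left:
  assumes H: "hilbert_sub H" and t: "compact_op H K t" and s: "s \<in> bops K L"
  shows "compact_op H L (s o\<^sub>L t)"
proof -
  obtain S where S: "compact S" "blinfun_apply t ` cball 0 1 \<subseteq> S" using compact_opE[OF t H] .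
  have "compact (blinfun_apply s ` S)"
    by (rule compact_continuous_image[OF linear_continuous_on[OF blinfun.bounded_linear_right] S(1)])
  moreover have "blinfun_apply (s o\<^sub>L t) ` cball 0 1 \<subseteq> blinfun_apply s ` S" using S(2) by auto
  ultimately show ?thesis
    by (intro compact_opI[OF H compose_bops[OF s compact_op_bops[OF t]]])
qed

lemma compact_op_compose_right:
  assumes H: "hilbert_sub H" and K: "hilbert_sub K" and t: "compact_op K L t" and s: "s \<in> bops H K"
  shows "compact_op H L (t o\<^sub>L s)"
proof -
  obtain S where S: "compact S" "blinfun_apply t ` cball 0 1 \<subseteq> S" using compact_opE[OF t K] .
  \<comment> \<open>The summand \<open>1\<close> keeps \<open>r\<close> positive when
    \<open>s = 0\<close>, so that one may divide by it.\<close>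
  define r where "r = norm s + 1"
  have r: "r > 0" unfolding r_def by (simp add: add_nonneg_pos)
  have "blinfun_apply (t o\<^sub>L s) v \<in> (\<lambda>x. r *\<^sub>R x) ` S" if v: "norm v \<le> 1" for v
  proof
    have "norm (blinfun_apply s v) \<le> norm s * 1"
      using norm_blinfun[of s v] mult_left_mono[OF v norm_ge_zero[of s]] by simp
    then have "norm ((1 / r) *\<^sub>R blinfun_apply s v) \<le> 1" using r by (simp add: r_def field_simps)
    then show "blinfun_apply t ((1 / r) *\<^sub>R blinfun_apply s v) \<in> S"
      using S(2) by (auto simp: image_subset_iff)
    show "blinfun_apply (t o\<^sub>L s) v = r *\<^sub>R blinfun_apply t ((1 / r) *\<^sub>R blinfun_apply s v)"
      using r by (simp add: blinfun.scaleR_right)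
  qed
  then have "blinfun_apply (t o\<^sub>L s) ` cball 0 1 \<subseteq> (\<lambda>x. r *\<^sub>R x) ` S" by auto
  moreover have "compact ((\<lambda>x. r *\<^sub>R x) ` S)" by (rule compact_scaling[OF S(1)])
  ultimately show ?thesis
    by (intro compact_opI[OF H compose_bops[OF compact_op_bops[OF t] s]])
qed

lemma compact_op_add:
  assumes H: "hilbert_sub H" and K: "hilbert_sub K" and s: "compact_op H K s" and t: "compact_op H K t"
  shows "compact_op H K (s + t)"
proof -
  obtain S where S: "compact S" "blinfun_apply s ` cball 0 1 \<subseteq> S" using compact_opE[OF s H] .
  obtain T where T: "compact T" "blinfun_apply t ` cball 0 1 \<subseteq> T" using compact_opE[OF t H] .
  have "blinfun_apply (s + t) ` cball 0 1 \<subseteq> {x + y | x y. x \<in> S \<and> y \<in> T}"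
    using S(2) T(2) by (fastforce simp: blinfun.add_left image_subset_iff)
  then show ?thesis
    by (rule compact_opI[OF H add_bops[OF K compact_op_bops[OF s] compact_op_bops[OF t]]
          compact_sums[OF S(1) T(1)]])
qed

lemma compact_op_zero: "hilbert_sub H \<Longrightarrow> hilbert_sub K \<Longrightarrow> compact_op H K 0"
  by (rule compact_opI[where S = "{0}"]) (auto intro: zero_bops)

lemma compact_op_scale:
  assumes H: "hilbert_sub H" and K: "hilbert_sub K" and t: "compact_op H K t"
  shows "compact_op H K (op_scale c t)"
proof -
  have "op_scale c t = op_scale c (orth_proj K) o\<^sub>L t"
    by (rule blinfun_eqI) (simp add: orth_proj_id[OF K] bops_in[OF compact_op_bops[OF t]])
  then show ?thesis
    using compact_op_compose_left[OF H t scale_bops[OF K orth_proj_bops[OF K], of c]] by simp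
qed

lemma norm_adj_square_le:
  assumes "clin t"
  shows "(norm (blinfun_apply (op_adj t) y))\<^sup>2 \<le> norm (blinfun_apply (t o\<^sub>L op_adj t) y) * norm y"
proof -
  have "(norm (blinfun_apply (op_adj t) y))\<^sup>2 = cmod (cinner (blinfun_apply (t o\<^sub>L op_adj t) y) y)"
    by (simp add: cinner_op_adj[OF assms] cmod_cinner_self)
  then show ?thesis using cinner_norm_le by metis
qed

text \<open>The squared norm of \<open>t* y\<close> is at most the product of the norms of
  \<open>t t* y\<close> and \<open>y\<close>. Hence a net for the image of the unit ball under the
  compact operator \<open>t t*\<close>, at scale \<open>e\<^sup>2 / 8\<close>, pulls back to a net
  for \<open>t*\<close> at scale \<open>e\<close>: centres give images less than
  \<open>e\<^sup>2 / 4\<close> apart, and the arguments differ by at most \<open>2\<close>.\<close>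

lemma compact_op_adj:
  assumes H: "hilbert_sub H" and K: "hilbert_sub K" and t: "compact_op H K t"
  shows "compact_op K H (op_adj t)"
proof -
  note b = compact_op_bops[OF t]
  note adj = op_adj_bops[OF H b]
  let ?A = "blinfun_apply (op_adj t)" and ?T = "blinfun_apply (t o\<^sub>L op_adj t)"
  have "compact_op K K (t o\<^sub>L op_adj t)" by (rule compact_op_compose_right[OF K H t adj])
  then obtain S where S: "compact S" "?T ` cball 0 1 \<subseteq> S" using compact_opE[OF _ K] by blast
  have net: "\<exists>k. finite k \<and> ?A ` cball 0 1 \<subseteq> (\<Union>x\<in>k. ball x e)" if e: "e > 0" for e
  proof -
    define d where "d = e\<^sup>2 / 8"
    have d: "d > 0" using e by (simp add: d_def)
    obtain k where k: "finite k" "S \<subseteq> (\<Union>x\<in>k. ball x d)"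
      using S(1) d unfolding compact_eq_totally_bounded by metis
    \<comment> \<open>For centres whose ball misses the image the value is arbitrary; it merely adds
      a point to the net.\<close>
    define g where "g x = (SOME y. norm y \<le> 1 \<and> dist x (?T y) < d)" for x
    have "?A y \<in> (\<Union>x\<in>?A ` g ` k. ball x e)" if y: "norm y \<le> 1" for y
    proof -
      have "?T y \<in> S" using S(2) y by auto
      then obtain x where x: "x \<in> k" "dist x (?T y) < d" using k(2) by auto
      then have g: "norm (g x) \<le> 1 \<and> dist x (?T (g x)) < d"
        unfolding g_def using y by (intro someI_ex[of "\<lambda>y. norm y \<le> 1 \<and> dist x (?T y) < d"]) blast
      have "dist (?T (g x)) (?T y) < 2 * d"
        using dist_triangle2[of "?T (g x)" "?T y" x] g x(2) by (simp add: dist_commute)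
      then have *: "norm (?T (g x - y)) < 2 * d" by (simp add: blinfun.diff_right dist_norm)
      have "(norm (?A (g x - y)))\<^sup>2 \<le> norm (?T (g x - y)) * norm (g x - y)"
        by (rule norm_adj_square_le[OF bops_clin[OF b]])
      also have "\<dots> \<le> 2 * d * 2"
        using * g y norm_triangle_ineq4[of "g x" y] d by (intro mult_mono) auto
      also have "\<dots> < e\<^sup>2" using e by (simp add: d_def)
      finally have "norm (?A (g x - y)) < e" using e by (simp add: power_less_imp_less_base)
      then have "dist (?A (g x)) (?A y) < e" by (simp add: blinfun.diff_right dist_norm)
      then show ?thesis using x(1) by auto
    qed
    then show ?thesis using k(1) by (intro exI[of _ "?A ` g ` k"]) auto
  qed
  have "compact (closure (?A ` cball 0 1))"
    unfolding compact_eq_totally_bounded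
  proof (intro conjI allI impI)
    show "complete (closure (?A ` cball 0 1))" by (simp add: complete_eq_closed)
    fix e :: real assume e: "0 < e"
    then obtain k where k: "finite k" "?A ` cball 0 1 \<subseteq> (\<Union>x\<in>k. ball x (e / 2))"
      using net[of "e / 2"] by auto
    have "closure (?A ` cball 0 1) \<subseteq> (\<Union>x\<in>k. cball x (e / 2))"
    proof (rule closure_minimal)
      show "?A ` cball 0 1 \<subseteq> (\<Union>x\<in>k. cball x (e / 2))"
        using k(2) by (rule order_trans) (intro UN_mono subset_refl ball_subset_cball)
    qed (intro closed_UN k(1) ballI closed_cball)
    also have "\<dots> \<subseteq> (\<Union>x\<in>k. ball x e)" using e by force
    finally show "\<exists>k. finite k \<and> closure (?A ` cball 0 1) \<subseteq> (\<Union>x\<in>k. ball x e)" using k(1) by blast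
  qed
  then show ?thesis by (rule compact_opI[OF K adj]) (rule closure_subset)
qed

section \<open>Matrices over involutive rings\<close>

text \<open>This is the structure on which matrix calculus rests: no unit, and real scalars only,
  which suffice for rotations. Unitizations and \<open>complex_alg\<close> are both
  instances.\<close>

locale star_ring =
  fixes U :: "'u::real_normed_vector star_alg"
  assumes zero_closed: "0 \<in> elems U"
    and add_closed: "a \<in> elems U \<Longrightarrow> b \<in> elems U \<Longrightarrow> a + b \<in> elems U"
    and scaleR_closed: "a \<in> elems U \<Longrightarrow> r *\<^sub>R a \<in> elems U"
    and mult_closed: "a \<in> elems U \<Longrightarrow> b \<in> elems U \<Longrightarrow> amult U a b \<in> elems U"
    and star_closed: "a \<in> elems U \<Longrightarrow> astar U a \<in> elems U"
    and mult_assoc: "a \<in> elems U \<Longrightarrow> b \<in> elems U \<Longrightarrow> c \<in> elems U \<Longrightarrow>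
      amult U (amult U a b) c = amult U a (amult U b c)"
    and distrib_left: "a \<in> elems U \<Longrightarrow> b \<in> elems U \<Longrightarrow> c \<in> elems U \<Longrightarrow>
      amult U a (b + c) = amult U a b + amult U a c"
    and distrib_right: "a \<in> elems U \<Longrightarrow> b \<in> elems U \<Longrightarrow> c \<in> elems U \<Longrightarrow>
      amult U (a + b) c = amult U a c + amult U b c"
    and mult_scaleR_left: "a \<in> elems U \<Longrightarrow> b \<in> elems U \<Longrightarrow>
      amult U (r *\<^sub>R a) b = r *\<^sub>R amult U a b"
    and mult_scaleR_right: "a \<in> elems U \<Longrightarrow> b \<in> elems U \<Longrightarrow>
      amult U a (r *\<^sub>R b) = r *\<^sub>R amult U a b"
    and star_add: "a \<in> elems U \<Longrightarrow> b \<in> elems U \<Longrightarrow> astar U (a + b) = astar U a + astar U b"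
    and star_scaleR: "a \<in> elems U \<Longrightarrow> astar U (r *\<^sub>R a) = r *\<^sub>R astar U a"
    and star_mult: "a \<in> elems U \<Longrightarrow> b \<in> elems U \<Longrightarrow>
      astar U (amult U a b) = amult U (astar U b) (astar U a)"
    and star_star: "a \<in> elems U \<Longrightarrow> astar U (astar U a) = a"
begin

lemma mult_zero_left: "a \<in> elems U \<Longrightarrow> amult U 0 a = 0"
  using mult_scaleR_left[of 0 a 0] zero_closed by simp

lemma mult_zero_right: "a \<in> elems U \<Longrightarrow> amult U a 0 = 0"
  using mult_scaleR_right[of a 0 0] zero_closed by simp

lemma star_zero: "astar U 0 = 0"
  using star_scaleR[of 0 0] zero_closed by simp

lemma diff_closed: "a \<in> elems U \<Longrightarrow> b \<in> elems U \<Longrightarrow> a - b \<in> elems U"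
  using add_closed[of a "-1 *\<^sub>R b"] scaleR_closed[of b "-1"] by simp

lemma sum_closed: "(\<And>i. i \<in> I \<Longrightarrow> f i \<in> elems U) \<Longrightarrow> sum f I \<in> elems U"
  by (induction I rule: infinite_finite_induct) (auto intro: zero_closed add_closed)

lemma mult_sum_left:
  "(\<And>i. i \<in> I \<Longrightarrow> f i \<in> elems U) \<Longrightarrow> a \<in> elems U \<Longrightarrow> amult U (sum f I) a = (\<Sum>i\<in>I. amult U (f i) a)"
  by (induction I rule: infinite_finite_induct) (simp_all add: mult_zero_left distrib_right sum_closed)

lemma mult_sum_right:
  "(\<And>i. i \<in> I \<Longrightarrow> f i \<in> elems U) \<Longrightarrow> a \<in> elems U \<Longrightarrow> amult U a (sum f I) = (\<Sum>i\<in>I. amult U a (f i))"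
  by (induction I rule: infinite_finite_induct) (simp_all add: mult_zero_right distrib_left sum_closed)

lemma star_sum:
  "(\<And>i. i \<in> I \<Longrightarrow> f i \<in> elems U) \<Longrightarrow> astar U (sum f I) = (\<Sum>i\<in>I. astar U (f i))"
  by (induction I rule: infinite_finite_induct) (simp_all add: star_zero star_add sum_closed)

lemma matsI:
  assumes "\<And>i j. M i j \<in> elems U" "\<And>i j. \<not> (i < m \<and> j < n) \<Longrightarrow> M i j = 0"
  shows "M \<in> mats U m n"
  using assms unfolding mats_def by blast

text \<open>Entries outside the format are zero and hence elements too, so identities between
  matrices can be checked at all indices alike.\<close>

lemma mats_entry: "M \<in> mats U m n \<Longrightarrow> M i j \<in> elems U"
  by (cases "i < m \<and> j < n") (auto simp: mats_def zero_closed)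

lemma mats_outside: "M \<in> mats U m n \<Longrightarrow> \<not> (i < m \<and> j < n) \<Longrightarrow> M i j = 0"
  unfolding mats_def by blast

lemma mats_mono: "M \<in> mats U m n \<Longrightarrow> m \<le> m' \<Longrightarrow> n \<le> n' \<Longrightarrow> M \<in> mats U m' n'"
  by (rule matsI) (auto intro: mats_entry mats_outside)

lemma zero_mats: "0 \<in> mats U m n"
  by (rule matsI) (auto simp: zero_closed)

lemma add_mats: "M \<in> mats U m n \<Longrightarrow> N \<in> mats U m n \<Longrightarrow> M + N \<in> mats U m n"
  by (rule matsI) (auto simp: add_closed mats_entry mats_outside)

lemma diff_mats: "M \<in> mats U m n \<Longrightarrow> N \<in> mats U m n \<Longrightarrow> M - N \<in> mats U m n"
  by (rule matsI) (auto simp: diff_closed mats_entry mats_outside)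

lemma mult_mats:
  assumes "M \<in> mats U m k" "N \<in> mats U k n"
  shows "mtx_mult U k M N \<in> mats U m n"
proof (rule matsI)
  show "mtx_mult U k M N i j \<in> elems U" for i j
    unfolding mtx_mult_def by (intro sum_closed mult_closed mats_entry[OF assms(1)] mats_entry[OF assms(2)])
  show "mtx_mult U k M N i j = 0" if "\<not> (i < m \<and> j < n)" for i j
  proof (cases "i < m")
    case True
    then show ?thesis unfolding mtx_mult_def using that
      by (simp add: mats_outside[OF assms(2)] mult_zero_right mats_entry[OF assms(1)])
  next
    case False
    then show ?thesis unfolding mtx_mult_def
      by (simp add: mats_outside[OF assms(1)] mult_zero_left mats_entry[OF assms(2)])
  qed
qed

lemma star_mats: "M \<in> mats U m n \<Longrightarrow> mtx_star U M \<in> mats U n m"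
  unfolding mtx_star_def by (rule matsI) (auto simp: star_closed mats_entry mats_outside star_zero)

lemma mtx_assoc:
  assumes "M \<in> mats U a k" "N \<in> mats U k l" "P \<in> mats U l b"
  shows "mtx_mult U l (mtx_mult U k M N) P = mtx_mult U k M (mtx_mult U l N P)"
proof (intro ext)
  fix i j
  note e = mats_entry[OF assms(1)] mats_entry[OF assms(2)] mats_entry[OF assms(3)]
  have "mtx_mult U l (mtx_mult U k M N) P i j = (\<Sum>x<l. \<Sum>y<k. amult U (amult U (M i y) (N y x)) (P x j))"
    unfolding mtx_mult_def by (intro sum.cong refl mult_sum_left mult_closed e)
  also have "\<dots> = (\<Sum>x<l. \<Sum>y<k. amult U (M i y) (amult U (N y x) (P x j)))"
    by (intro sum.cong refl mult_assoc e)
  also have "\<dots> = (\<Sum>y<k. \<Sum>x<l. amult U (M i y) (amult U (N y x) (P x j)))" by (rule sum.swap)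
  also have "\<dots> = mtx_mult U k M (mtx_mult U l N P) i j"
    unfolding mtx_mult_def by (intro sum.cong refl mult_sum_right[symmetric] mult_closed e)
  finally show "mtx_mult U l (mtx_mult U k M N) P i j = mtx_mult U k M (mtx_mult U l N P) i j" .
qed

lemma mtx_distrib_right:
  assumes "M \<in> mats U a k" "M' \<in> mats U a k" "N \<in> mats U k b"
  shows "mtx_mult U k (M + M') N = mtx_mult U k M N + mtx_mult U k M' N"
  by (intro ext) (simp add: mtx_mult_def distrib_right assms[THEN mats_entry] sum.distrib)

lemma mtx_distrib_left:
  assumes "M \<in> mats U a k" "N \<in> mats U k b" "N' \<in> mats U k b"
  shows "mtx_mult U k M (N + N') = mtx_mult U k M N + mtx_mult U k M N'"
  by (intro ext) (simp add: mtx_mult_def distrib_left assms[THEN mats_entry] sum.distrib)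

lemma mtx_diff_right:
  assumes "M \<in> mats U a k" "M' \<in> mats U a k" "N \<in> mats U k b"
  shows "mtx_mult U k (M - M') N = mtx_mult U k M N - mtx_mult U k M' N"
  using mtx_distrib_right[OF diff_mats[OF assms(1,2)] assms(2,3)] by (simp add: algebra_simps)

lemma mtx_diff_left:
  assumes "M \<in> mats U a k" "N \<in> mats U k b" "N' \<in> mats U k b"
  shows "mtx_mult U k M (N - N') = mtx_mult U k M N - mtx_mult U k M N'"
  using mtx_distrib_left[OF assms(1) diff_mats[OF assms(2,3)] assms(3)] by (simp add: algebra_simps)

lemma mtx_star_mult:
  assumes "M \<in> mats U a k" "N \<in> mats U k b"
  shows "mtx_star U (mtx_mult U k M N) = mtx_mult U k (mtx_star U N) (mtx_star U M)"
  by (intro ext)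
    (simp add: mtx_mult_def mtx_star_def star_sum star_mult mult_closed assms[THEN mats_entry])

lemma mtx_star_star: "M \<in> mats U a k \<Longrightarrow> mtx_star U (mtx_star U M) = M"
  by (intro ext) (simp add: mtx_star_def star_star mats_entry)

lemma mtx_star_add:
  "M \<in> mats U a k \<Longrightarrow> N \<in> mats U a k \<Longrightarrow> mtx_star U (M + N) = mtx_star U M + mtx_star U N"
  by (intro ext) (simp add: mtx_star_def star_add mats_entry)

lemma mtx_star_diff:
  assumes "M \<in> mats U a k" "N \<in> mats U a k"
  shows "mtx_star U (M - N) = mtx_star U M - mtx_star U N"
  using mtx_star_add[OF diff_mats[OF assms] assms(2)] by simp

lemma mtx_star_zero: "mtx_star U 0 = 0"
  by (intro ext) (simp add: mtx_star_def star_zero)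

lemma mtx_mult_zero_left: "N \<in> mats U k b \<Longrightarrow> mtx_mult U k 0 N = 0"
  by (intro ext) (simp add: mtx_mult_def mult_zero_left mats_entry)

lemma mtx_mult_zero_right: "N \<in> mats U b k \<Longrightarrow> mtx_mult U k N 0 = 0"
  by (intro ext) (simp add: mtx_mult_def mult_zero_right mats_entry)

end

section \<open>Block matrices and direct sums\<close>

definition blk :: "nat \<Rightarrow> nat \<Rightarrow> 'u mtx \<Rightarrow> 'u mtx \<Rightarrow> 'u mtx \<Rightarrow> 'u mtx \<Rightarrow> 'u mtx" where
  "blk a n A B C D = (\<lambda>i j.
     if i < a then (if j < n then A i j else B i (j - n))
     else (if j < n then C (i - a) j else D (i - a) (j - n)))"

lemma dsum_blk: "(n, p) \<oplus>\<^sub>m (m, q) = (n + m, blk n n p 0 0 q)"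
  unfolding dsum_def blk_def by (auto simp: fun_eq_iff)

lemma dsum_assoc: "(p \<oplus>\<^sub>m q) \<oplus>\<^sub>m r = p \<oplus>\<^sub>m q \<oplus>\<^sub>m r"
  unfolding dsum_def by (auto simp: fun_eq_iff)

lemma sum_lessThan_plus:
  fixes f :: "nat \<Rightarrow> 'a::comm_monoid_add"
  shows "(\<Sum>l<n + m. f l) = (\<Sum>l<n. f l) + (\<Sum>l<m. f (n + l))"
  by (induct m) (simp_all add: add.assoc)

context star_ring
begin

lemma blk_mats:
  assumes "A \<in> mats U a n" "B \<in> mats U a m" "C \<in> mats U b n" "D \<in> mats U b m"
  shows "blk a n A B C D \<in> mats U (a + b) (n + m)"
  by (rule matsI)
    (auto simp: blk_def assms[THEN mats_entry] intro!: mats_outside[OF assms(1)]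
      mats_outside[OF assms(2)] mats_outside[OF assms(3)] mats_outside[OF assms(4)])

lemma blk_mult:
  "mtx_mult U (n + m) (blk a n A B C D) (blk n c A' B' C' D') =
     blk a c (mtx_mult U n A A' + mtx_mult U m B C') (mtx_mult U n A B' + mtx_mult U m B D')
       (mtx_mult U n C A' + mtx_mult U m D C') (mtx_mult U n C B' + mtx_mult U m D D')"
  unfolding mtx_mult_def blk_def sum_lessThan_plus by (auto simp: fun_eq_iff)

lemma blk_star:
  "mtx_star U (blk a n A B C D) =
     blk n a (mtx_star U A) (mtx_star U C) (mtx_star U B) (mtx_star U D)"
  unfolding mtx_star_def blk_def by (auto simp: fun_eq_iff)

end

section \<open>The Grothendieck group of projections\<close>

context star_ring
begin

lemma projsI:
  "p \<in> mats U n n \<Longrightarrow> mtx_star U p = p \<Longrightarrow> mtx_mult U n p p = p \<Longrightarrow> (n, p) \<in> projs U"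
  unfolding projs_def by blast

lemma projsD:
  assumes "p \<in> projs U"
  shows "snd p \<in> mats U (fst p) (fst p)" "mtx_star U (snd p) = snd p"
    "mtx_mult U (fst p) (snd p) (snd p) = snd p"
  using assms unfolding projs_def by auto

lemma dsum_projs:
  assumes "p \<in> projs U" "q \<in> projs U"
  shows "p \<oplus>\<^sub>m q \<in> projs U"
proof -
  obtain n P m Q where pq: "p = (n, P)" "q = (m, Q)" by (cases p, cases q)
  note P = projsD[OF assms(1)[unfolded pq], simplified]
  note Q = projsD[OF assms(2)[unfolded pq], simplified]
  show ?thesis unfolding pq dsum_blk
    by (intro projsI blk_mats zero_mats P Q)
      (simp_all add: blk_star blk_mult P Q mtx_star_zero mtx_mult_zero_left[OF P(1)]
        mtx_mult_zero_left[OF Q(1)] mtx_mult_zero_right[OF P(1)] mtx_mult_zero_right[OF Q(1)]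
        mtx_mult_zero_left[OF zero_mats])
qed

lemma zero_projs: "(0, \<lambda>_ _. 0) \<in> projs U"
  by (rule projsI) (auto simp: mats_def mtx_star_def mtx_mult_def star_zero)

lemma dsum_zero_left: "(0, \<lambda>_ _. 0) \<oplus>\<^sub>m p = p"
  unfolding dsum_def by (cases p) (auto simp: fun_eq_iff)

lemma dsum_zero_right: "p \<in> projs U \<Longrightarrow> p \<oplus>\<^sub>m (0, \<lambda>_ _. 0) = p"
  unfolding dsum_def by (cases p) (auto simp: fun_eq_iff projs_def mats_outside)

lemma mvn_refl: "p \<in> projs U \<Longrightarrow> mvn U p p"
  unfolding mvn_def using projsD[of p] by (intro bexI[of _ "snd p"]) simp_all

lemma mvn_sym: "mvn U p q \<Longrightarrow> mvn U q p"
  unfolding mvn_def by (metis star_mats mtx_star_star)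

text \<open>The product \<open>w v\<close> of the two partial isometries works. The middle
  projection is moved past \<open>v\<close> through \<open>v v* v\<close>, read once as
  \<open>q v\<close> and once as \<open>v p\<close>; likewise for \<open>w*\<close>.\<close>

lemma mvn_trans:
  assumes p: "p \<in> projs U" and q: "q \<in> projs U" and r: "r \<in> projs U"
    and "mvn U p q" "mvn U q r"
  shows "mvn U p r"
proof -
  define n m l where "n = fst p" "m = fst q" "l = fst r"
  obtain v w where v: "v \<in> mats U m n" "mtx_mult U m (mtx_star U v) v = snd p"
      "mtx_mult U n v (mtx_star U v) = snd q"
    and w: "w \<in> mats U l m" "mtx_mult U l (mtx_star U w) w = snd q"
      "mtx_mult U m w (mtx_star U w) = snd r"
    using assms(4,5) unfolding mvn_def n_m_l_def by blast
  note P = projsD[OF p] and Q = projsD[OF q] and R = projsD[OF r]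
  note P = P[folded n_m_l_def] and Q = Q[folded n_m_l_def] and R = R[folded n_m_l_def]
  note v' = star_mats[OF v(1)] and w' = star_mats[OF w(1)]
  have "mtx_mult U l (mtx_mult U m (mtx_star U v) (mtx_star U w)) (mtx_mult U m w v)
      = mtx_mult U m (mtx_star U v) (mtx_mult U m (snd q) v)"
    by (simp add: mtx_assoc[OF v' w' mult_mats[OF w(1) v(1)]]
        mtx_assoc[OF w' w(1) v(1), symmetric] w(2))
  also have "\<dots> = mtx_mult U m (mtx_star U v) (mtx_mult U n v (snd p))"
    by (simp add: mtx_assoc[OF v(1) v' v(1)] v(2) flip: v(3))
  also have "\<dots> = mtx_mult U n (snd p) (snd p)"
    by (simp add: mtx_assoc[OF v' v(1) P(1), symmetric] v(2))
  finally have 1: "mtx_mult U l (mtx_star U (mtx_mult U m w v)) (mtx_mult U m w v) = snd p"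
    by (simp add: mtx_star_mult[OF w(1) v(1)] P(3))
  have "mtx_mult U n (mtx_mult U m w v) (mtx_mult U m (mtx_star U v) (mtx_star U w))
      = mtx_mult U m w (mtx_mult U m (snd q) (mtx_star U w))"
    by (simp add: mtx_assoc[OF w(1) v(1) mult_mats[OF v' w']]
        mtx_assoc[OF v(1) v' w', symmetric] v(3))
  also have "\<dots> = mtx_mult U m w (mtx_mult U l (mtx_star U w) (snd r))"
    by (simp add: mtx_assoc[OF w' w(1) w'] w(3) flip: w(2))
  also have "\<dots> = mtx_mult U l (snd r) (snd r)"
    by (simp add: mtx_assoc[OF w(1) w' R(1), symmetric] w(3))
  finally have 2: "mtx_mult U n (mtx_mult U m w v) (mtx_star U (mtx_mult U m w v)) = snd r"
    by (simp add: mtx_star_mult[OF w(1) v(1)] R(3))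
  show ?thesis unfolding mvn_def n_m_l_def[symmetric]
    using 1 2 mult_mats[OF w(1) v(1)] by blast
qed

lemma mvnI:
  assumes "v \<in> mats U m n" "mtx_mult U m (mtx_star U v) v = p" "mtx_mult U n v (mtx_star U v) = q"
  shows "mvn U (n, p) (m, q)"
  unfolding mvn_def using assms by auto

lemma mvn_dsum:
  assumes "mvn U p p'" "mvn U q q'"
  shows "mvn U (p \<oplus>\<^sub>m q) (p' \<oplus>\<^sub>m q')"
proof -
  obtain n P m Q n' P' m' Q' where pq: "p = (n, P)" "q = (m, Q)" "p' = (n', P')" "q' = (m', Q')"
    by (cases p, cases q, cases p', cases q')
  obtain v w where v: "v \<in> mats U n' n" "mtx_mult U n' (mtx_star U v) v = P"
      "mtx_mult U n v (mtx_star U v) = P'"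
    and w: "w \<in> mats U m' m" "mtx_mult U m' (mtx_star U w) w = Q"
      "mtx_mult U m w (mtx_star U w) = Q'"
    using assms unfolding mvn_def pq by auto
  note z = mtx_star_zero mtx_mult_zero_left[OF v(1)] mtx_mult_zero_left[OF w(1)]
    mtx_mult_zero_right[OF v(1)] mtx_mult_zero_right[OF w(1)]
    mtx_mult_zero_left[OF star_mats[OF v(1)]] mtx_mult_zero_left[OF star_mats[OF w(1)]]
    mtx_mult_zero_right[OF star_mats[OF v(1)]] mtx_mult_zero_right[OF star_mats[OF w(1)]]
    mtx_mult_zero_left[OF zero_mats]
  show ?thesis unfolding pq dsum_blk
    by (rule mvnI[OF blk_mats[OF v(1) zero_mats zero_mats w(1)]])
      (simp_all add: blk_star blk_mult v w z)
qed

text \<open>The partial isometry is the flip of the two summands, cut down by the projections: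
  \<open>Q\<close> and \<open>P\<close> off the diagonal.\<close>

lemma mvn_dsum_commute:
  assumes "p \<in> projs U" "q \<in> projs U"
  shows "mvn U (p \<oplus>\<^sub>m q) (q \<oplus>\<^sub>m p)"
proof -
  obtain n P m Q where pq: "p = (n, P)" "q = (m, Q)" by (cases p, cases q)
  note P = projsD[OF assms(1)[unfolded pq], simplified]
  note Q = projsD[OF assms(2)[unfolded pq], simplified]
  note z = mtx_star_zero mtx_mult_zero_left[OF P(1)]
        mtx_mult_zero_left[OF Q(1)] mtx_mult_zero_right[OF P(1)] mtx_mult_zero_right[OF Q(1)]
        mtx_mult_zero_left[OF zero_mats]
  have "blk m n 0 Q P 0 \<in> mats U (m + n) (n + m)" by (intro blk_mats zero_mats P Q)
  then show ?thesis unfolding pq dsum_blk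
    by (rule mvnI) (simp_all add: blk_star blk_mult P Q z)
qed

section \<open>Stable equivalence of projections and cancellation\<close>

definition stably_mvn :: "nat \<times> 'u mtx \<Rightarrow> nat \<times> 'u mtx \<Rightarrow> bool" where
  "stably_mvn p q \<longleftrightarrow> p \<in> projs U \<and> q \<in> projs U \<and> (\<exists>r\<in>projs U. mvn U (p \<oplus>\<^sub>m r) (q \<oplus>\<^sub>m r))"

lemma stably_mvn_mvn: "p \<in> projs U \<Longrightarrow> q \<in> projs U \<Longrightarrow> mvn U p q \<Longrightarrow> stably_mvn p q"
  unfolding stably_mvn_def using zero_projs mvn_dsum[OF _ mvn_refl[OF zero_projs]] by blast

lemma stably_mvn_refl: "p \<in> projs U \<Longrightarrow> stably_mvn p p"
  by (intro stably_mvn_mvn mvn_refl)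

lemma stably_mvn_sym: "stably_mvn p q \<Longrightarrow> stably_mvn q p"
  unfolding stably_mvn_def using mvn_sym by blast

text \<open>Both stabilizing projections are added throughout and commuted so that each stands next
  to the summand that needs it.\<close>

lemma stably_mvn_trans [trans]:
  assumes "stably_mvn p q" "stably_mvn q r"
  shows "stably_mvn p r"
proof -
  have p: "p \<in> projs U" and q: "q \<in> projs U" and r: "r \<in> projs U"
    using assms unfolding stably_mvn_def by blast+
  obtain s t where s: "s \<in> projs U" "mvn U (p \<oplus>\<^sub>m s) (q \<oplus>\<^sub>m s)"
    and t: "t \<in> projs U" "mvn U (q \<oplus>\<^sub>m t) (r \<oplus>\<^sub>m t)"
    using assms unfolding stably_mvn_def by blast
  have 1: "mvn U (p \<oplus>\<^sub>m s \<oplus>\<^sub>m t) (q \<oplus>\<^sub>m s \<oplus>\<^sub>m t)"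
    using mvn_dsum[OF s(2) mvn_refl[OF t(1)]] by (simp add: dsum_assoc)
  have 2: "mvn U (q \<oplus>\<^sub>m s \<oplus>\<^sub>m t) (q \<oplus>\<^sub>m t \<oplus>\<^sub>m s)"
    by (rule mvn_dsum[OF mvn_refl[OF q] mvn_dsum_commute[OF s(1) t(1)]])
  have 3: "mvn U (q \<oplus>\<^sub>m t \<oplus>\<^sub>m s) (r \<oplus>\<^sub>m t \<oplus>\<^sub>m s)"
    using mvn_dsum[OF t(2) mvn_refl[OF s(1)]] by (simp add: dsum_assoc)
  have 4: "mvn U (r \<oplus>\<^sub>m t \<oplus>\<^sub>m s) (r \<oplus>\<^sub>m s \<oplus>\<^sub>m t)"
    by (rule mvn_dsum[OF mvn_refl[OF r] mvn_dsum_commute[OF t(1) s(1)]])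
  have "mvn U (p \<oplus>\<^sub>m s \<oplus>\<^sub>m t) (r \<oplus>\<^sub>m s \<oplus>\<^sub>m t)"
    by (rule mvn_trans[OF _ _ _ 1 mvn_trans[OF _ _ _ 2 mvn_trans[OF _ _ _ 3 4]]])
      (intro dsum_projs p q r s t)+
  then show ?thesis unfolding stably_mvn_def using dsum_projs[OF s(1) t(1)] p r by blast
qed

lemma stably_mvn_cancel:
  assumes pqr: "p \<in> projs U" "q \<in> projs U" "r \<in> projs U" and "stably_mvn (p \<oplus>\<^sub>m r) (q \<oplus>\<^sub>m r)"
  shows "stably_mvn p q"
proof -
  obtain s where "s \<in> projs U" "mvn U ((p \<oplus>\<^sub>m r) \<oplus>\<^sub>m s) ((q \<oplus>\<^sub>m r) \<oplus>\<^sub>m s)"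
    using assms(4) unfolding stably_mvn_def by blast
  then show ?thesis unfolding stably_mvn_def dsum_assoc using pqr dsum_projs[OF pqr(3)] by blast
qed

lemma stably_mvn_dsum_commute:
  "p \<in> projs U \<Longrightarrow> q \<in> projs U \<Longrightarrow> stably_mvn (p \<oplus>\<^sub>m q) (q \<oplus>\<^sub>m p)"
  by (intro stably_mvn_mvn mvn_dsum_commute dsum_projs)

lemma stably_mvn_dsum:
  assumes "stably_mvn p p'" "stably_mvn q q'"
  shows "stably_mvn (p \<oplus>\<^sub>m q) (p' \<oplus>\<^sub>m q')"
proof -
  have pr: "p \<in> projs U" "p' \<in> projs U" "q \<in> projs U" "q' \<in> projs U"
    using assms unfolding stably_mvn_def by blast+
  have right: "stably_mvn (a \<oplus>\<^sub>m b) (a \<oplus>\<^sub>m c)" if a: "a \<in> projs U" and bc: "stably_mvn b c" for a b c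
  proof -
    obtain r where r: "b \<in> projs U" "c \<in> projs U" "r \<in> projs U" "mvn U (b \<oplus>\<^sub>m r) (c \<oplus>\<^sub>m r)"
      using bc unfolding stably_mvn_def by blast
    show ?thesis unfolding stably_mvn_def dsum_assoc
      by (intro conjI bexI[OF _ r(3)] mvn_dsum[OF mvn_refl[OF a] r(4)] dsum_projs a r)
  qed
  have "stably_mvn (p \<oplus>\<^sub>m q) (p \<oplus>\<^sub>m q')" by (rule right[OF pr(1) assms(2)])
  also have "stably_mvn \<dots> (q' \<oplus>\<^sub>m p)" by (rule stably_mvn_dsum_commute[OF pr(1,4)])
  also have "stably_mvn \<dots> (q' \<oplus>\<^sub>m p')" by (rule right[OF pr(4) assms(1)])
  also have "stably_mvn \<dots> (p' \<oplus>\<^sub>m q')" by (rule stably_mvn_dsum_commute[OF pr(4,2)])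
  finally show ?thesis .
qed

lemma stably_mvn_interchange:
  assumes pr: "a \<in> projs U" "b \<in> projs U" "c \<in> projs U" "d \<in> projs U"
  shows "stably_mvn ((a \<oplus>\<^sub>m b) \<oplus>\<^sub>m (c \<oplus>\<^sub>m d)) ((a \<oplus>\<^sub>m c) \<oplus>\<^sub>m (b \<oplus>\<^sub>m d))"
proof -
  have "mvn U (a \<oplus>\<^sub>m (b \<oplus>\<^sub>m c) \<oplus>\<^sub>m d) (a \<oplus>\<^sub>m (c \<oplus>\<^sub>m b) \<oplus>\<^sub>m d)"
    by (intro mvn_dsum mvn_refl mvn_dsum_commute pr)
  then show ?thesis by (intro stably_mvn_mvn dsum_projs pr) (simp add: dsum_assoc)
qed

section \<open>Formal differences of projections as a group\<close>

lemma K00_rel_iff: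
  "((p, q), (p', q')) \<in> K00_rel U \<longleftrightarrow>
     p \<in> projs U \<and> q \<in> projs U \<and> p' \<in> projs U \<and> q' \<in> projs U \<and> stably_mvn (p \<oplus>\<^sub>m q') (p' \<oplus>\<^sub>m q)"
  unfolding K00_rel_def stably_mvn_def by (auto simp: dsum_assoc dsum_projs)

lemma equiv_K00_rel: "equiv (projs U \<times> projs U) (K00_rel U)"
proof (rule equivI)
  show "K00_rel U \<subseteq> (projs U \<times> projs U) \<times> (projs U \<times> projs U)" unfolding K00_rel_def by blast
  show "refl_on (projs U \<times> projs U) (K00_rel U)"
    by (rule refl_onI) (auto simp: K00_rel_iff stably_mvn_refl dsum_projs)
  show "sym (K00_rel U)"
    by (rule symI) (auto simp: K00_rel_iff stably_mvn_sym)
  show "trans (K00_rel U)"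
  proof (rule transI, clarify)
    fix p q p' q' p'' q''
    assume "((p, q), p', q') \<in> K00_rel U" "((p', q'), p'', q'') \<in> K00_rel U"
    then have pr: "p \<in> projs U" "q \<in> projs U" "p' \<in> projs U" "q' \<in> projs U" "p'' \<in> projs U" "q'' \<in> projs U"
      and 1: "stably_mvn (p \<oplus>\<^sub>m q') (p' \<oplus>\<^sub>m q)" and 2: "stably_mvn (p' \<oplus>\<^sub>m q'') (p'' \<oplus>\<^sub>m q')"
      by (auto simp: K00_rel_iff)
    note rules = stably_mvn_dsum stably_mvn_refl stably_mvn_dsum_commute dsum_projs pr
    \<comment> \<open>Adding \<open>q'\<close> and \<open>p'\<close> to both sides makes the two
      hypotheses applicable after a permutation of the summands; the addition is cancelled at the
      end.\<close>
    have "stably_mvn ((p \<oplus>\<^sub>m q'') \<oplus>\<^sub>m (q' \<oplus>\<^sub>m p')) ((p \<oplus>\<^sub>m q') \<oplus>\<^sub>m (q'' \<oplus>\<^sub>m p'))"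
      by (intro stably_mvn_interchange pr)
    also have "stably_mvn \<dots> ((p \<oplus>\<^sub>m q') \<oplus>\<^sub>m (p' \<oplus>\<^sub>m q''))"
      by (intro stably_mvn_dsum[OF stably_mvn_refl] rules)
    also have "stably_mvn \<dots> ((p' \<oplus>\<^sub>m q) \<oplus>\<^sub>m (p'' \<oplus>\<^sub>m q'))" by (rule stably_mvn_dsum[OF 1 2])
    also have "stably_mvn \<dots> ((q \<oplus>\<^sub>m p') \<oplus>\<^sub>m (p'' \<oplus>\<^sub>m q'))"
      by (intro stably_mvn_dsum[OF _ stably_mvn_refl] rules)
    also have "stably_mvn \<dots> ((q \<oplus>\<^sub>m p'') \<oplus>\<^sub>m (p' \<oplus>\<^sub>m q'))"
      by (intro stably_mvn_interchange pr)
    also have "stably_mvn \<dots> ((p'' \<oplus>\<^sub>m q) \<oplus>\<^sub>m (q' \<oplus>\<^sub>m p'))"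
      by (intro stably_mvn_dsum stably_mvn_dsum_commute pr)
    finally have "stably_mvn (p \<oplus>\<^sub>m q'') (p'' \<oplus>\<^sub>m q)"
      by (rule stably_mvn_cancel[rotated 3]) (intro dsum_projs pr)+
    then show "((p, q), p'', q'') \<in> K00_rel U" using pr by (simp add: K00_rel_iff)
  qed
qed

abbreviation K00_class :: "nat \<times> 'u mtx \<Rightarrow> nat \<times> 'u mtx \<Rightarrow> 'u K0_elt" where
  "K00_class p q \<equiv> K00_rel U `` {(p, q)}"

lemma K00_class_eq_iff:
  "p \<in> projs U \<Longrightarrow> q \<in> projs U \<Longrightarrow> p' \<in> projs U \<Longrightarrow> q' \<in> projs U \<Longrightarrow>
     K00_class p q = K00_class p' q' \<longleftrightarrow> stably_mvn (p \<oplus>\<^sub>m q') (p' \<oplus>\<^sub>m q)"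
  using eq_equiv_class_iff[OF equiv_K00_rel, of "(p, q)" "(p', q')"] by (simp add: K00_rel_iff)

lemma K00_class_carrier:
  "p \<in> projs U \<Longrightarrow> q \<in> projs U \<Longrightarrow> K00_class p q \<in> carrier (K00 U)"
  unfolding K00_def by (simp add: quotientI)

lemma K00_carrierE:
  assumes "C \<in> carrier (K00 U)"
  obtains p q where "p \<in> projs U" "q \<in> projs U" "C = K00_class p q"
  using assms unfolding K00_def by (auto elim: quotientE)

text \<open>The product in \<open>K00\<close> is a union over all pairs of representatives. By
  congruence all members of the union coincide, so one pair computes it.\<close>

lemma K00_mult_class:
  assumes "p \<in> projs U" "q \<in> projs U" "p' \<in> projs U" "q' \<in> projs U"
  shows "K00_class p q \<otimes>\<^bsub>K00 U\<^esub> K00_class p' q' = K00_class (p \<oplus>\<^sub>m p') (q \<oplus>\<^sub>m q')"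
proof -
  define f where "f = (\<lambda>(p, q). \<lambda>(p', q'). K00_class (p \<oplus>\<^sub>m p') (q \<oplus>\<^sub>m q'))"
  have "f x y = f x' y'" if "(x, x') \<in> K00_rel U" "(y, y') \<in> K00_rel U" for x x' y y'
  proof -
    obtain p q p' q' r s r' s' where x: "x = (p, q)" "x' = (p', q')" "y = (r, s)" "y' = (r', s')"
      by (cases x, cases x', cases y, cases y')
    have pr: "p \<in> projs U" "q \<in> projs U" "p' \<in> projs U" "q' \<in> projs U"
        "r \<in> projs U" "s \<in> projs U" "r' \<in> projs U" "s' \<in> projs U"
      and 1: "stably_mvn (p \<oplus>\<^sub>m q') (p' \<oplus>\<^sub>m q)" and 2: "stably_mvn (r \<oplus>\<^sub>m s') (r' \<oplus>\<^sub>m s)"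
      using that unfolding x by (auto simp: K00_rel_iff)
    have "stably_mvn ((p \<oplus>\<^sub>m r) \<oplus>\<^sub>m (q' \<oplus>\<^sub>m s')) ((p \<oplus>\<^sub>m q') \<oplus>\<^sub>m (r \<oplus>\<^sub>m s'))"
      by (intro stably_mvn_interchange pr)
    also have "stably_mvn \<dots> ((p' \<oplus>\<^sub>m q) \<oplus>\<^sub>m (r' \<oplus>\<^sub>m s))" by (rule stably_mvn_dsum[OF 1 2])
    also have "stably_mvn \<dots> ((p' \<oplus>\<^sub>m r') \<oplus>\<^sub>m (q \<oplus>\<^sub>m s))"
      by (intro stably_mvn_interchange pr)
    finally have "stably_mvn ((p \<oplus>\<^sub>m r) \<oplus>\<^sub>m (q' \<oplus>\<^sub>m s')) ((p' \<oplus>\<^sub>m r') \<oplus>\<^sub>m (q \<oplus>\<^sub>m s))" .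
    then show ?thesis unfolding f_def x by (simp add: K00_class_eq_iff dsum_projs pr)
  qed
  then have "congruent2 (K00_rel U) (K00_rel U) f" by (rule congruent2I')
  from UN_equiv_class2[OF equiv_K00_rel equiv_K00_rel this, of "(p, q)" "(p', q')"] assms
  show ?thesis unfolding K00_def f_def by (simp add: case_prod_unfold)
qed

lemma K00_one: "\<one>\<^bsub>K00 U\<^esub> = K00_class (0, \<lambda>_ _. 0) (0, \<lambda>_ _. 0)"
  unfolding K00_def by simp

lemma comm_group_K00: "comm_group (K00 U)"
proof (rule comm_groupI)
  fix x y z assume "x \<in> carrier (K00 U)" "y \<in> carrier (K00 U)" "z \<in> carrier (K00 U)"
  then obtain p q r s t u where
    x: "p \<in> projs U" "q \<in> projs U" "x = K00_class p q" and
    y: "r \<in> projs U" "s \<in> projs U" "y = K00_class r s" and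
    z: "t \<in> projs U" "u \<in> projs U" "z = K00_class t u"
    by (elim K00_carrierE)
  show "x \<otimes>\<^bsub>K00 U\<^esub> y \<otimes>\<^bsub>K00 U\<^esub> z = x \<otimes>\<^bsub>K00 U\<^esub> (y \<otimes>\<^bsub>K00 U\<^esub> z)"
    using x y z by (simp add: K00_mult_class dsum_projs dsum_assoc)
next
  fix x y assume "x \<in> carrier (K00 U)" "y \<in> carrier (K00 U)"
  then obtain p q r s where x: "p \<in> projs U" "q \<in> projs U" "x = K00_class p q" and
    y: "r \<in> projs U" "s \<in> projs U" "y = K00_class r s" by (elim K00_carrierE)
  show "x \<otimes>\<^bsub>K00 U\<^esub> y \<in> carrier (K00 U)"
    using x y by (simp add: K00_mult_class dsum_projs K00_class_carrier)
  have "stably_mvn ((p \<oplus>\<^sub>m r) \<oplus>\<^sub>m (s \<oplus>\<^sub>m q)) ((r \<oplus>\<^sub>m p) \<oplus>\<^sub>m (q \<oplus>\<^sub>m s))"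
    by (intro stably_mvn_dsum stably_mvn_dsum_commute x y)
  then show "x \<otimes>\<^bsub>K00 U\<^esub> y = y \<otimes>\<^bsub>K00 U\<^esub> x"
    using x y by (simp add: K00_mult_class dsum_projs K00_class_eq_iff)
next
  show "\<one>\<^bsub>K00 U\<^esub> \<in> carrier (K00 U)" unfolding K00_one by (intro K00_class_carrier zero_projs)
  fix x assume "x \<in> carrier (K00 U)"
  then obtain p q where x: "p \<in> projs U" "q \<in> projs U" "x = K00_class p q" by (elim K00_carrierE)
  show "\<one>\<^bsub>K00 U\<^esub> \<otimes>\<^bsub>K00 U\<^esub> x = x"
    unfolding K00_one x(3) by (simp only: K00_mult_class zero_projs x dsum_zero_left)
  have "K00_class q p \<otimes>\<^bsub>K00 U\<^esub> x = \<one>\<^bsub>K00 U\<^esub>"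
    unfolding K00_one x(3) using x
    by (simp add: K00_mult_class zero_projs K00_class_eq_iff dsum_projs dsum_zero_left dsum_zero_right
        stably_mvn_dsum_commute)
  then show "\<exists>y\<in>carrier (K00 U). y \<otimes>\<^bsub>K00 U\<^esub> x = \<one>\<^bsub>K00 U\<^esub>"
    using K00_class_carrier[OF x(2,1)] by blast
qed

lemma K00_class_eqI:
  assumes "stably_mvn p p'" "stably_mvn q q'"
  shows "K00_class p q = K00_class p' q'"
proof -
  have "p \<in> projs U" "p' \<in> projs U" "q \<in> projs U" "q' \<in> projs U"
    using assms unfolding stably_mvn_def by blast+
  then show ?thesis
    using stably_mvn_dsum[OF assms(1) stably_mvn_sym[OF assms(2)]] by (simp add: K00_class_eq_iff)
qed

end

section \<open>Functoriality of K-zero\<close>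

abbreviation (input) mtx_entries :: "('u \<Rightarrow> 'v) \<Rightarrow> 'u mtx \<Rightarrow> 'v mtx" where
  "mtx_entries f M \<equiv> (\<lambda>i j. f (M i j))"

locale star_ring_hom = U: star_ring U + V: star_ring V
  for U :: "'u::real_normed_vector star_alg" and V :: "'v::real_normed_vector star_alg" +
  fixes f :: "'u \<Rightarrow> 'v"
  assumes hom_closed: "a \<in> elems U \<Longrightarrow> f a \<in> elems V"
    and hom_add: "a \<in> elems U \<Longrightarrow> b \<in> elems U \<Longrightarrow> f (a + b) = f a + f b"
    and hom_mult: "a \<in> elems U \<Longrightarrow> b \<in> elems U \<Longrightarrow> f (amult U a b) = amult V (f a) (f b)"
    and hom_star: "a \<in> elems U \<Longrightarrow> f (astar U a) = astar V (f a)"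
begin

lemma hom_zero: "f 0 = 0"
  using hom_add[of 0 0] U.zero_closed by simp

lemma hom_sum: "(\<And>i. i \<in> I \<Longrightarrow> g i \<in> elems U) \<Longrightarrow> f (sum g I) = (\<Sum>i\<in>I. f (g i))"
  by (induction I rule: infinite_finite_induct) (simp_all add: hom_zero hom_add U.sum_closed)

lemma entries_mats: "M \<in> mats U m n \<Longrightarrow> mtx_entries f M \<in> mats V m n"
  by (rule V.matsI) (simp_all add: hom_closed U.mats_entry U.mats_outside hom_zero)

lemma entries_add:
  "M \<in> mats U m n \<Longrightarrow> N \<in> mats U m n \<Longrightarrow> mtx_entries f (M + N) = mtx_entries f M + mtx_entries f N"
  by (simp add: fun_eq_iff hom_add U.mats_entry)

lemma entries_diff:
  assumes "M \<in> mats U m n" "N \<in> mats U m n"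
  shows "mtx_entries f (M - N) = mtx_entries f M - mtx_entries f N"
  using entries_add[OF U.diff_mats[OF assms] assms(2)] by (simp add: algebra_simps)

lemma entries_mult:
  assumes "M \<in> mats U a k" "N \<in> mats U k b"
  shows "mtx_entries f (mtx_mult U k M N) = mtx_mult V k (mtx_entries f M) (mtx_entries f N)"
  unfolding mtx_mult_def
  by (simp add: fun_eq_iff hom_sum hom_mult U.mult_closed assms[THEN U.mats_entry])

lemma entries_star:
  "M \<in> mats U a k \<Longrightarrow> mtx_entries f (mtx_star U M) = mtx_star V (mtx_entries f M)"
  unfolding mtx_star_def by (simp add: fun_eq_iff hom_star U.mats_entry)

lemma mtx_map_projs:
  assumes "p \<in> projs U"
  shows "mtx_map f p \<in> projs V"
proof -
  note P = U.projsD[OF assms]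
  show ?thesis unfolding mtx_map_def
    by (rule V.projsI)
      (simp_all add: entries_mats[OF P(1)] P(2,3)
        flip: entries_star[OF P(1)] entries_mult[OF P(1) P(1)])
qed

lemma mtx_map_dsum: "mtx_map f (p \<oplus>\<^sub>m q) = mtx_map f p \<oplus>\<^sub>m mtx_map f q"
  unfolding mtx_map_def dsum_def by (auto simp: fun_eq_iff hom_zero)

lemma mtx_map_mvn:
  assumes "mvn U p q"
  shows "mvn V (mtx_map f p) (mtx_map f q)"
proof -
  obtain v where v: "v \<in> mats U (fst q) (fst p)" "mtx_mult U (fst q) (mtx_star U v) v = snd p"
    "mtx_mult U (fst p) v (mtx_star U v) = snd q" using assms unfolding mvn_def by blast
  note v' = U.star_mats[OF v(1)]
  show ?thesis unfolding mtx_map_def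
    by (rule V.mvnI[OF entries_mats[OF v(1)]])
      (simp_all add: v(2,3) flip: entries_star[OF v(1)] entries_mult[OF v' v(1)] entries_mult[OF v(1) v'])
qed

lemma mtx_map_stably_mvn: "U.stably_mvn p q \<Longrightarrow> V.stably_mvn (mtx_map f p) (mtx_map f q)"
  unfolding U.stably_mvn_def V.stably_mvn_def
  using mtx_map_projs mtx_map_mvn mtx_map_dsum by metis

lemma K00_map_class:
  assumes "p \<in> projs U" "q \<in> projs U"
  shows "K00_map V f (U.K00_class p q) = V.K00_class (mtx_map f p) (mtx_map f q)"
proof -
  define g where "g = (\<lambda>(p, q). V.K00_class (mtx_map f p) (mtx_map f q))"
  have "g respects K00_rel U"
  proof (rule congruentI)
    fix x y assume xy: "(x, y) \<in> K00_rel U"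
    obtain p q p' q' where x: "x = (p, q)" "y = (p', q')" by (cases x, cases y)
    show "g x = g y"
      using xy mtx_map_stably_mvn[of "p \<oplus>\<^sub>m q'" "p' \<oplus>\<^sub>m q"] unfolding x g_def
      by (simp add: U.K00_rel_iff V.K00_class_eq_iff mtx_map_projs mtx_map_dsum)
  qed
  from UN_equiv_class[OF U.equiv_K00_rel this, of "(p, q)"] assms
  show ?thesis unfolding K00_map_def g_def by (simp add: case_prod_unfold)
qed

lemma K00_map_hom: "K00_map V f \<in> hom (K00 U) (K00 V)"
proof (rule homI)
  fix x assume "x \<in> carrier (K00 U)"
  then obtain p q where "p \<in> projs U" "q \<in> projs U" "x = U.K00_class p q" by (rule U.K00_carrierE)
  then show "K00_map V f x \<in> carrier (K00 V)"
    by (simp add: K00_map_class mtx_map_projs V.K00_class_carrier)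
next
  fix x y assume "x \<in> carrier (K00 U)" "y \<in> carrier (K00 U)"
  then obtain p q r s where "p \<in> projs U" "q \<in> projs U" "x = U.K00_class p q"
    "r \<in> projs U" "s \<in> projs U" "y = U.K00_class r s" by (elim U.K00_carrierE)
  then show "K00_map V f (x \<otimes>\<^bsub>K00 U\<^esub> y) = K00_map V f x \<otimes>\<^bsub>K00 V\<^esub> K00_map V f y"
    by (simp add: U.K00_mult_class V.K00_mult_class K00_map_class mtx_map_projs mtx_map_dsum
        U.dsum_projs)
qed

end

subsection \<open>Unitizations\<close>

text \<open>Continuity of the operations is required along real-parameter families of elements, the
  form in which homotopies of unitaries use it. The restriction to elements is essential for
  \<open>op_adj\<close>, whose continuity is known on complex-linear operators.\<close>

locale star_algebra = star_ring A for A :: "'b::real_normed_vector star_alg" +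
  assumes ascale_closed: "a \<in> elems A \<Longrightarrow> ascale A c a \<in> elems A"
    and ascale_add_right: "a \<in> elems A \<Longrightarrow> b \<in> elems A \<Longrightarrow>
      ascale A c (a + b) = ascale A c a + ascale A c b"
    and ascale_add_left: "a \<in> elems A \<Longrightarrow> ascale A (c + d) a = ascale A c a + ascale A d a"
    and ascale_ascale: "a \<in> elems A \<Longrightarrow> ascale A c (ascale A d a) = ascale A (c * d) a"
    and ascale_of_real: "a \<in> elems A \<Longrightarrow> ascale A (complex_of_real r) a = r *\<^sub>R a"
    and mult_ascale_left: "a \<in> elems A \<Longrightarrow> b \<in> elems A \<Longrightarrow>
      amult A (ascale A c a) b = ascale A c (amult A a b)"
    and mult_ascale_right: "a \<in> elems A \<Longrightarrow> b \<in> elems A \<Longrightarrow>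
      amult A a (ascale A c b) = ascale A c (amult A a b)"
    and star_ascale: "a \<in> elems A \<Longrightarrow> astar A (ascale A c a) = ascale A (cnj c) (astar A a)"
    and continuous_mult: "\<And>(f :: real \<Rightarrow> 'b) g S. continuous_on S f \<Longrightarrow> continuous_on S g \<Longrightarrow>
      (\<And>s. s \<in> S \<Longrightarrow> f s \<in> elems A \<and> g s \<in> elems A) \<Longrightarrow>
      continuous_on S (\<lambda>s. amult A (f s) (g s))"
    and continuous_ascale: "\<And>(c :: real \<Rightarrow> complex) (f :: real \<Rightarrow> 'b) S.
      continuous_on S c \<Longrightarrow> continuous_on S f \<Longrightarrow>
      (\<And>s. s \<in> S \<Longrightarrow> f s \<in> elems A) \<Longrightarrow> continuous_on S (\<lambda>s. ascale A (c s) (f s))"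
    and continuous_star: "\<And>(f :: real \<Rightarrow> 'b) S. continuous_on S f \<Longrightarrow>
      (\<And>s. s \<in> S \<Longrightarrow> f s \<in> elems A) \<Longrightarrow> continuous_on S (\<lambda>s. astar A (f s))"

lemma unitize_simps [simp]:
  "elems (unitize A) = UNIV \<times> elems A"
  "amult (unitize A) (l, a) (m, b) = (l * m, ascale A l b + ascale A m a + amult A a b)"
  "astar (unitize A) (l, a) = (cnj l, astar A a)"
  unfolding unitize_def by simp_all

context star_algebra
begin

lemma ascale_one: "a \<in> elems A \<Longrightarrow> ascale A 1 a = a"
  using ascale_of_real[of a 1] by simp

lemma ascale_zero_left: "a \<in> elems A \<Longrightarrow> ascale A 0 a = 0"
  using ascale_of_real[of a 0] by simp

lemma ascale_zero_right: "ascale A c 0 = 0"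
  using ascale_ascale[OF zero_closed, of c 0] ascale_zero_left[OF zero_closed] by simp

lemma ascale_scaleR: "a \<in> elems A \<Longrightarrow> ascale A c (r *\<^sub>R a) = r *\<^sub>R ascale A c a"
  by (simp add: ascale_ascale ascale_closed mult.commute flip: ascale_of_real)

lemma ascale_scaleR_left: "a \<in> elems A \<Longrightarrow> ascale A (r *\<^sub>R c) a = r *\<^sub>R ascale A c a"
  by (simp add: ascale_ascale ascale_closed scaleR_conv_of_real flip: ascale_of_real)

sublocale U: star_ring "unitize A"
proof
  show "0 \<in> elems (unitize A)" by (simp add: zero_prod_def zero_closed)
  fix a b c r
  assume "a \<in> elems (unitize A)"
  then obtain l x where a: "a = (l, x)" "x \<in> elems A" by auto
  show "r *\<^sub>R a \<in> elems (unitize A)" "astar (unitize A) a \<in> elems (unitize A)"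
    "astar (unitize A) (r *\<^sub>R a) = r *\<^sub>R astar (unitize A) a" "astar (unitize A) (astar (unitize A) a) = a"
    using a by (simp_all add: scaleR_closed star_closed star_scaleR star_star scaleR_conv_of_real)
  assume "b \<in> elems (unitize A)"
  then obtain m y where b: "b = (m, y)" "y \<in> elems A" by auto
  show "a + b \<in> elems (unitize A)" "amult (unitize A) a b \<in> elems (unitize A)"
    "astar (unitize A) (a + b) = astar (unitize A) a + astar (unitize A) b"
    using a b by (simp_all add: add_closed mult_closed ascale_closed star_add)
  show "amult (unitize A) (r *\<^sub>R a) b = r *\<^sub>R amult (unitize A) a b"
    "amult (unitize A) a (r *\<^sub>R b) = r *\<^sub>R amult (unitize A) a b"
    using a b by (simp_all add: ascale_scaleR ascale_scaleR_left mult_scaleR_left mult_scaleR_right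
        scaleR_add_right)
  show "astar (unitize A) (amult (unitize A) a b) =
      amult (unitize A) (astar (unitize A) b) (astar (unitize A) a)"
    using a b by (simp add: star_add star_mult star_ascale add_closed mult_closed ascale_closed
        star_closed mult.commute add.commute)
  assume "c \<in> elems (unitize A)"
  then obtain n z where c: "c = (n, z)" "z \<in> elems A" by auto
  note simps = add_closed mult_closed ascale_closed ascale_add_right ascale_add_left ascale_ascale
    mult_ascale_left mult_ascale_right distrib_left distrib_right mult_assoc algebra_simps
  show "amult (unitize A) (amult (unitize A) a b) c = amult (unitize A) a (amult (unitize A) b c)"
    "amult (unitize A) a (b + c) = amult (unitize A) a b + amult (unitize A) a c"
    "amult (unitize A) (a + b) c = amult (unitize A) a c + amult (unitize A) b c"
    using a b c by (simp_all add: simps)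
qed

lemma unit_mult: "a \<in> elems (unitize A) \<Longrightarrow> amult (unitize A) (1, 0) a = a"
  and mult_unit: "a \<in> elems (unitize A) \<Longrightarrow> amult (unitize A) a (1, 0) = a"
  by (auto simp: ascale_one ascale_zero_right mult_zero_left mult_zero_right)

lemma unit_star: "astar (unitize A) (1, 0) = (1, 0)"
  by (simp add: star_zero)

lemma one_mats: "m \<le> k \<Longrightarrow> m \<le> l \<Longrightarrow> mtx_one m \<in> mats (unitize A) k l"
  by (rule U.matsI) (auto simp: mtx_one_def zero_closed zero_prod_def)

lemma star_one: "mtx_star (unitize A) (mtx_one m) = mtx_one m"
  unfolding mtx_star_def mtx_one_def using unit_star by (auto simp: fun_eq_iff U.star_zero)

lemma one_mult:
  assumes "M \<in> mats (unitize A) m b" "m \<le> k"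
  shows "mtx_mult (unitize A) k (mtx_one m) M = M"
proof (intro ext)
  fix i j
  have "mtx_mult (unitize A) k (mtx_one m) M i j =
      (\<Sum>l<k. if l = i then (if i < m then M i j else 0) else 0)"
    unfolding mtx_mult_def mtx_one_def
    by (intro sum.cong refl) (auto simp: unit_mult U.mult_zero_left U.mats_entry[OF assms(1)] simp del: unitize_simps)
  also have "\<dots> = M i j" using assms(2) by (auto simp: U.mats_outside[OF assms(1)])
  finally show "mtx_mult (unitize A) k (mtx_one m) M i j = M i j" .
qed

lemma mult_one:
  assumes "M \<in> mats (unitize A) b m" "m \<le> k"
  shows "mtx_mult (unitize A) k M (mtx_one m) = M"
proof (intro ext)
  fix i j
  have "mtx_mult (unitize A) k M (mtx_one m) i j =
      (\<Sum>l<k. if l = j then (if j < m then M i j else 0) else 0)"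
    unfolding mtx_mult_def mtx_one_def
    by (intro sum.cong refl) (auto simp: mult_unit U.mult_zero_right U.mats_entry[OF assms(1)] simp del: unitize_simps)
  also have "\<dots> = M i j" using assms(2) by (auto simp: U.mats_outside[OF assms(1)])
  finally show "mtx_mult (unitize A) k M (mtx_one m) i j = M i j" .
qed

lemma complement_projs:
  assumes "(n, p) \<in> projs (unitize A)"
  shows "(n, mtx_one n - p) \<in> projs (unitize A)"
    "mtx_mult (unitize A) n p (mtx_one n - p) = 0" "mtx_mult (unitize A) n (mtx_one n - p) p = 0"
proof -
  note P = U.projsD[OF assms, simplified]
  note I = one_mats[of n n n, simplified]
  note s = U.mtx_star_diff[OF I P(1)] U.mtx_diff_left[OF P(1) I P(1)] U.mtx_diff_right[OF I P(1) P(1)]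
    star_one one_mult[OF P(1)] mult_one[OF P(1)] P(2,3)
  show 1: "mtx_mult (unitize A) n p (mtx_one n - p) = 0" "mtx_mult (unitize A) n (mtx_one n - p) p = 0"
    by (simp_all add: s)
  show "(n, mtx_one n - p) \<in> projs (unitize A)"
    by (rule U.projsI[OF U.diff_mats[OF I P(1)]])
      (simp_all add: s 1 U.mtx_diff_right[OF I P(1) U.diff_mats[OF I P(1)]] one_mult[OF U.diff_mats[OF I P(1)]])
qed

end

lemma star_ring_complex_alg: "star_ring complex_alg"
  by standard (simp_all add: complex_alg_def algebra_simps)

interpretation complex_alg: star_ring complex_alg
  by (rule star_ring_complex_alg)

locale star_algebra_hom = A: star_algebra A + B: star_algebra B
  for A :: "'b::real_normed_vector star_alg" and B :: "'c::real_normed_vector star_alg" +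
  fixes f :: "'b \<Rightarrow> 'c"
  assumes hom_closed: "a \<in> elems A \<Longrightarrow> f a \<in> elems B"
    and hom_add: "a \<in> elems A \<Longrightarrow> b \<in> elems A \<Longrightarrow> f (a + b) = f a + f b"
    and hom_ascale: "a \<in> elems A \<Longrightarrow> f (ascale A c a) = ascale B c (f a)"
    and hom_mult: "a \<in> elems A \<Longrightarrow> b \<in> elems A \<Longrightarrow> f (amult A a b) = amult B (f a) (f b)"
    and hom_star: "a \<in> elems A \<Longrightarrow> f (astar A a) = astar B (f a)"
    and hom_continuous: "continuous_on (elems A) f"
begin

sublocale U: star_ring_hom "unitize A" "unitize B" "map_prod id f"
proof
  fix a b assume "a \<in> elems (unitize A)" "b \<in> elems (unitize A)"
  then obtain l x m y where "a = (l, x)" "x \<in> elems A" "b = (m, y)" "y \<in> elems A" by auto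
  then show "map_prod id f a \<in> elems (unitize B)" "map_prod id f (a + b) = map_prod id f a + map_prod id f b"
    "map_prod id f (amult (unitize A) a b) = amult (unitize B) (map_prod id f a) (map_prod id f b)"
    "map_prod id f (astar (unitize A) a) = astar (unitize B) (map_prod id f a)"
    by (simp_all add: hom_closed hom_add hom_ascale hom_mult hom_star A.add_closed A.mult_closed A.ascale_closed)
qed

end

lemma (in star_algebra) star_ring_hom_fst: "star_ring_hom (unitize A) complex_alg fst"
  by unfold_locales (auto simp: complex_alg_def)

text \<open>Its extension to the unitization keeps the scalar part of an entry and discards the
  rest; it serves to form scalar parts of projections and unitaries.\<close>

lemma (in star_algebra) star_algebra_hom_zero:
  assumes "star_algebra B"
  shows "star_algebra_hom A B (\<lambda>_. 0)"
proof -
  interpret B: star_algebra B by (rule assms)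
  show ?thesis
    by unfold_locales (simp_all add: B.zero_closed B.ascale_zero_right B.mult_zero_left B.star_zero)
qed

section \<open>The kernel of the scalar character as a subgroup\<close>

context star_algebra
begin

interpretation fst: star_ring_hom "unitize A" complex_alg fst
  by (rule star_ring_hom_fst)

lemma subgroup_K0: "subgroup (carrier (K0 A)) (K00 (unitize A))"
proof -
  interpret group_hom "K00 (unitize A)" "K00 complex_alg" "K00_map complex_alg fst"
    using fst.K00_map_hom U.comm_group_K00 complex_alg.comm_group_K00
    by (simp add: group_hom_def group_hom_axioms_def comm_group.axioms(2))
  show ?thesis unfolding K0_def by (simp add: subgroup_kernel)
qed

lemma comm_group_K0: "comm_group (K0 A)"
proof -
  interpret comm_group "K00 (unitize A)" by (rule U.comm_group_K00)
  have "group (K00 (unitize A)\<lparr>carrier := carrier (K0 A)\<rparr>)" by (rule subgroup_imp_group[OF subgroup_K0])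
  moreover have "K00 (unitize A)\<lparr>carrier := carrier (K0 A)\<rparr> = K0 A" unfolding K0_def by simp
  ultimately have "group (K0 A)" by simp
  then show ?thesis
    by (rule group.group_comm_groupI)
      (use subgroup.mem_carrier[OF subgroup_K0] m_comm in \<open>auto simp: K0_def\<close>)
qed

lemma K0_carrierE:
  assumes "C \<in> carrier (K0 A)"
  obtains p q where "p \<in> projs (unitize A)" "q \<in> projs (unitize A)" "C = U.K00_class p q"
  using U.K00_carrierE[OF subgroup.mem_carrier[OF subgroup_K0 assms]] by blast

lemma mem_K0_iff: "C \<in> carrier (K0 A) \<longleftrightarrow>
    C \<in> carrier (K00 (unitize A)) \<and> K00_map complex_alg fst C = \<one>\<^bsub>K00 complex_alg\<^esub>"
  unfolding K0_def kernel_def by simp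

lemma K00_fst_class:
  "p \<in> projs (unitize A) \<Longrightarrow> q \<in> projs (unitize A) \<Longrightarrow>
     K00_map complex_alg fst (U.K00_class p q) = complex_alg.K00_class (mtx_map fst p) (mtx_map fst q)"
  by (rule fst.K00_map_class)

end

context star_algebra_hom
begin

lemma K0_map_class:
  "p \<in> projs (unitize A) \<Longrightarrow> q \<in> projs (unitize A) \<Longrightarrow>
     K0_map B f (A.U.K00_class p q) =
     B.U.K00_class (mtx_map (map_prod id f) p) (mtx_map (map_prod id f) q)"
  unfolding K0_map_def by (rule U.K00_map_class)

text \<open>The extension of \<open>f\<close> to unitizations preserves the first components of all
  entries, so the character \<open>fst\<close> has the same value before and after.\<close>

lemma K0_map_closed:
  assumes "C \<in> carrier (K0 A)"
  shows "K0_map B f C \<in> carrier (K0 B)"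
proof -
  obtain p q where C: "p \<in> projs (unitize A)" "q \<in> projs (unitize A)" "C = A.U.K00_class p q"
    using A.K0_carrierE[OF assms] .
  have "mtx_map fst (mtx_map (map_prod id f) r) = mtx_map fst r" for r :: "nat \<times> (complex \<times> 'b) mtx"
    unfolding mtx_map_def by simp
  then show ?thesis
    using assms unfolding B.mem_K0_iff A.mem_K0_iff C(3)
    by (simp add: K0_map_class C B.K00_fst_class A.K00_fst_class U.mtx_map_projs B.U.K00_class_carrier)
qed

lemma K0_map_hom: "K0_map B f \<in> hom (K0 A) (K0 B)"
proof (rule homI)
  fix x y assume "x \<in> carrier (K0 A)" "y \<in> carrier (K0 A)"
  then have "x \<in> carrier (K00 (unitize A))" "y \<in> carrier (K00 (unitize A))"
    using subgroup.mem_carrier[OF A.subgroup_K0] by blast+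
  then show "K0_map B f (x \<otimes>\<^bsub>K0 A\<^esub> y) = K0_map B f x \<otimes>\<^bsub>K0 B\<^esub> K0_map B f y"
    using U.K00_map_hom unfolding hom_def K0_def K0_map_def by simp
qed (rule K0_map_closed)

end

subsection \<open>Two corners of a homomorphism of two-by-two matrices\<close>

text \<open>The maps \<open>h b b'\<close> are the matrix components of a homomorphism from the two-by-two
  matrices over \<open>A\<close> to those over \<open>B\<close>; its two diagonal corners agree on K-theory.\<close>

locale corner_hom = A: star_algebra A + B: star_algebra B
  for A :: "'b::real_normed_vector star_alg" and B :: "'c::real_normed_vector star_alg" +
  fixes h :: "bool \<Rightarrow> bool \<Rightarrow> 'b \<Rightarrow> 'c"
  assumes h_closed: "a \<in> elems A \<Longrightarrow> h x y a \<in> elems B"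
    and h_add: "a \<in> elems A \<Longrightarrow> b \<in> elems A \<Longrightarrow> h x y (a + b) = h x y a + h x y b"
    and h_ascale: "a \<in> elems A \<Longrightarrow> h x y (ascale A c a) = ascale B c (h x y a)"
    and h_mult: "a \<in> elems A \<Longrightarrow> b \<in> elems A \<Longrightarrow> h x z (amult A a b) = amult B (h x y a) (h y z b)"
    and h_star: "a \<in> elems A \<Longrightarrow> h x y (astar A a) = astar B (h y x a)"
    and h_continuous: "continuous_on (elems A) (h x y)"
begin

lemma star_algebra_hom: "star_algebra_hom A B (h x x)"
  by unfold_locales (simp_all add: h_closed h_add h_ascale h_mult[of _ _ x x x] h_star h_continuous)

lemma corner_hom_constant: "corner_hom A B (\<lambda>_ _. h x x)"
  by unfold_locales (simp_all add: h_closed h_add h_ascale h_mult[of _ _ x x x] h_star h_continuous)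

lemma h_zero: "h x y 0 = 0"
  using h_add[OF A.zero_closed A.zero_closed] by simp

text \<open>An index is of type \<open>True\<close> from \<open>n\<close> on, and the component of
  \<open>h\<close> is chosen by the quadrant of the entry. Scalar parts are simply kept, which is
  compatible with products only if they vanish in the off-diagonal quadrants.\<close>

definition block_map :: "nat \<Rightarrow> (complex \<times> 'b) mtx \<Rightarrow> (complex \<times> 'c) mtx" where
  "block_map n M = (\<lambda>i j. map_prod id (h (n \<le> i) (n \<le> j)) (M i j))"

definition block_scalar :: "nat \<Rightarrow> (complex \<times> 'b) mtx \<Rightarrow> bool" where
  "block_scalar n M \<longleftrightarrow> (\<forall>i j. (n \<le> i) \<noteq> (n \<le> j) \<longrightarrow> fst (M i j) = 0)"

lemma block_map_mats: "M \<in> mats (unitize A) k l \<Longrightarrow> block_map n M \<in> mats (unitize B) k l"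
proof (rule B.U.matsI)
  assume M: "M \<in> mats (unitize A) k l"
  show "block_map n M i j \<in> elems (unitize B)" for i j
    using A.U.mats_entry[OF M, of i j] unfolding block_map_def
    by (cases "M i j") (simp add: h_closed)
  show "block_map n M i j = 0" if "\<not> (i < k \<and> j < l)" for i j
    using A.U.mats_outside[OF M that] unfolding block_map_def by (simp add: h_zero zero_prod_def)
qed

lemma block_map_star:
  assumes "M \<in> mats (unitize A) k l"
  shows "block_map n (mtx_star (unitize A) M) = mtx_star (unitize B) (block_map n M)"
proof (intro ext)
  fix i j show "block_map n (mtx_star (unitize A) M) i j = mtx_star (unitize B) (block_map n M) i j"
    using A.U.mats_entry[OF assms, of j i] unfolding block_map_def mtx_star_def
    by (cases "M j i") (simp add: h_star)
qed

lemma map_prod_sum: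
  "(\<And>i. i \<in> I \<Longrightarrow> g i \<in> elems (unitize A)) \<Longrightarrow>
     map_prod id (h x y) (sum g I) = (\<Sum>i\<in>I. map_prod id (h x y) (g i))"
proof (induction I rule: infinite_finite_induct)
  case (insert i I)
  have "g i \<in> elems (unitize A)" "sum g I \<in> elems (unitize A)"
    using insert.prems by (auto intro!: A.U.sum_closed simp del: unitize_simps)
  then have "snd (g i) \<in> elems A" "snd (sum g I) \<in> elems A" by (auto simp: mem_Times_iff)
  then have "map_prod id (h x y) (g i + sum g I) = map_prod id (h x y) (g i) + map_prod id (h x y) (sum g I)"
    by (simp add: prod_eq_iff h_add)
  moreover have "map_prod id (h x y) (sum g I) = (\<Sum>i\<in>I. map_prod id (h x y) (g i))"
    by (rule insert.IH) (rule insert.prems, simp)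
  ultimately show ?case by (simp only: sum.insert[OF insert.hyps])
qed (simp_all add: h_zero zero_prod_def)

text \<open>Entries \<open>(s, x)\<close> and \<open>(t, y)\<close> contribute the mixed terms
  \<open>s y\<close> and \<open>t x\<close>. To these the component of \<open>h\<close> for
  \<open>(i, j)\<close> is applied on one side, and the one for \<open>(l, j)\<close> or
  \<open>(i, l)\<close> on the other. The two components coincide unless an index crosses
  \<open>n\<close>, and then the scalar in front is zero.\<close>

lemma block_map_mult:
  assumes M: "M \<in> mats (unitize A) a k" and N: "N \<in> mats (unitize A) k b"
    and bs: "block_scalar n M" "block_scalar n N"
  shows "block_map n (mtx_mult (unitize A) k M N) = mtx_mult (unitize B) k (block_map n M) (block_map n N)"
proof (intro ext)
  fix i j
  have "map_prod id (h (n \<le> i) (n \<le> j)) (amult (unitize A) (M i l) (N l j)) =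
      amult (unitize B) (map_prod id (h (n \<le> i) (n \<le> l)) (M i l))
        (map_prod id (h (n \<le> l) (n \<le> j)) (N l j))" for l
  proof -
    obtain s x t y where xy: "M i l = (s, x)" "N l j = (t, y)" by (meson surj_pair)
    then have el: "x \<in> elems A" "y \<in> elems A"
      using A.U.mats_entry[OF M, of i l] A.U.mats_entry[OF N, of l j] by auto
    have z: "(n \<le> i) \<noteq> (n \<le> l) \<Longrightarrow> s = 0" "(n \<le> l) \<noteq> (n \<le> j) \<Longrightarrow> t = 0"
      using bs(1)[unfolded block_scalar_def, rule_format, of i l]
        bs(2)[unfolded block_scalar_def, rule_format, of l j] xy by simp_all
    have "ascale B s (h (n \<le> i) (n \<le> j) y) = ascale B s (h (n \<le> l) (n \<le> j) y)"
      by (cases "(n \<le> i) = (n \<le> l)") (simp_all add: z(1) B.ascale_zero_left h_closed el)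
    moreover have "ascale B t (h (n \<le> i) (n \<le> j) x) = ascale B t (h (n \<le> i) (n \<le> l) x)"
      by (cases "(n \<le> l) = (n \<le> j)") (simp_all add: z(2) B.ascale_zero_left h_closed el)
    ultimately show ?thesis
      using el by (simp add: xy h_add h_ascale h_mult[of x y "n \<le> i" "n \<le> j" "n \<le> l"] A.add_closed A.mult_closed A.ascale_closed)
  qed
  then show "block_map n (mtx_mult (unitize A) k M N) i j =
      mtx_mult (unitize B) k (block_map n M) (block_map n N) i j"
    unfolding block_map_def mtx_mult_def
    by (subst map_prod_sum) (simp_all add: A.U.mult_closed A.U.mats_entry[OF M] A.U.mats_entry[OF N] del: unitize_simps)
qed

lemma block_map_blk:
  "block_map n (blk n n M 0 0 N) =
     blk n n (mtx_entries (map_prod id (h False False)) M) 0 0 (mtx_entries (map_prod id (h True True)) N)"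
  unfolding block_map_def blk_def by (auto simp: fun_eq_iff h_zero zero_prod_def)

abbreviation scalar_part :: "complex \<times> 'b \<Rightarrow> complex \<times> 'b" where
  "scalar_part \<equiv> map_prod id (\<lambda>_. 0)"

sublocale scalar: star_algebra_hom A A "\<lambda>_. 0"
  by (rule A.star_algebra_hom_zero) unfold_locales

text \<open>Writing \<open>q = 1 - p\<close> and \<open>r = 1 - s\<close>, the matrix with rows \<open>(s p, s q)\<close> and \<open>(r p, r q)\<close> is the
  product of the column \<open>(s, r)\<close> and the row \<open>(p, q)\<close>, hence a partial isometry from \<open>p \<oplus> q\<close> to
  \<open>s \<oplus> r\<close>; off the diagonal its scalar part vanishes, so that \<open>block_map\<close> applies to it.\<close>

lemma mvn_block_map:
  assumes p: "(n, p) \<in> projs (unitize A)"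
  defines "s \<equiv> mtx_entries scalar_part p"
  shows "mvn (unitize B)
      (mtx_map (map_prod id (h False False)) (n, p) \<oplus>\<^sub>m
        mtx_map (map_prod id (h True True)) (n, mtx_one n - p))
      (mtx_map (map_prod id (\<lambda>_. 0)) (n, p) \<oplus>\<^sub>m mtx_map (map_prod id (\<lambda>_. 0)) (n, mtx_one n - p))"
proof -
  let ?U = "unitize A" and ?I = "mtx_one n :: (complex \<times> 'b) mtx"
  let ?m = "mtx_mult ?U n" and ?st = "mtx_star ?U"
  interpret fst: star_ring_hom ?U complex_alg fst by (rule A.star_ring_hom_fst)
  have s: "(n, s) \<in> projs ?U" using scalar.U.mtx_map_projs[OF p] unfolding mtx_map_def s_def by simp
  define q r where "q = ?I - p" and "r = ?I - s"
  note Q = A.complement_projs[OF p, folded q_def] and R = A.complement_projs[OF s, folded r_def]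
  note pm = A.U.projsD[OF p, simplified] and sm = A.U.projsD[OF s, simplified]
    and qm = A.U.projsD[OF Q(1), simplified] and rm = A.U.projsD[OF R(1), simplified]
  note mm = A.U.mult_mats
  have I: "?I \<in> mats ?U n n" by (rule A.one_mats) simp_all
  define v where "v = blk n n (?m s p) (?m s q) (?m r p) (?m r q)"
  have v: "v \<in> mats ?U (n + n) (n + n)"
    unfolding v_def by (intro A.U.blk_mats mm pm(1) sm(1) qm(1) rm(1))
  have vs: "?st v = blk n n (?m p s) (?m p r) (?m q s) (?m q r)"
    unfolding v_def A.U.blk_star
    by (simp add: A.U.mtx_star_mult[OF sm(1) pm(1)] A.U.mtx_star_mult[OF sm(1) qm(1)]
        A.U.mtx_star_mult[OF rm(1) pm(1)] A.U.mtx_star_mult[OF rm(1) qm(1)] pm(2) sm(2) qm(2) rm(2))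
  \<comment> \<open>The complementary projections \<open>c\<close> and \<open>d\<close> are a
    resolution of the identity inserted between \<open>x\<close> and \<open>y\<close>. With the pair
    \<open>s, r\<close> it evaluates \<open>v* v\<close>, with the pair \<open>p, q\<close> it
    evaluates \<open>v v*\<close>.\<close>
  have sum_mid: "?m (?m x c) (?m c y) + ?m (?m x d) (?m d y) = ?m x y"
    if x: "x \<in> mats ?U n n" and y: "y \<in> mats ?U n n" and c: "(n, c) \<in> projs ?U" and d: "d = ?I - c"
    for x y c d
  proof -
    note cm = A.U.projsD[OF c, simplified] and D = A.complement_projs[OF c, folded d]
    note dm = A.U.projsD[OF D(1), simplified]
    have mid: "?m (?m x e) (?m e y) = ?m x (?m e y)" if e: "e \<in> mats ?U n n" "?m e e = e" for e
      by (simp add: A.U.mtx_assoc[OF x e(1) mm[OF e(1) y]] A.U.mtx_assoc[OF e(1) e(1) y, symmetric] e(2))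
    have "?m x (?m c y) + ?m x (?m d y) = ?m x (?m (c + d) y)"
      by (simp add: A.U.mtx_distrib_left[OF x mm[OF cm(1) y] mm[OF dm(1) y]]
          A.U.mtx_distrib_right[OF cm(1) dm(1) y])
    moreover have "c + d = ?I" unfolding d by simp
    ultimately show ?thesis
      by (simp only: mid[OF cm(1,3)] mid[OF dm(1,3)] A.one_mult[OF y order_refl])
  qed
  have vsv: "mtx_mult ?U (n + n) (?st v) v = blk n n p 0 0 q"
    unfolding vs unfolding v_def A.U.blk_mult
    by (simp add: sum_mid[OF _ _ s r_def] pm qm Q(2,3))
  have vvs: "mtx_mult ?U (n + n) v (?st v) = blk n n s 0 0 r"
    unfolding vs unfolding v_def A.U.blk_mult
    by (simp add: sum_mid[OF _ _ p q_def] sm rm R(2,3))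
  have fs: "mtx_entries fst s = mtx_entries fst p" unfolding s_def by simp
  have fr: "mtx_entries fst r = mtx_entries fst q"
    unfolding q_def r_def s_def by simp
  \<comment> \<open>Taking first components is multiplicative and does not distinguish
    \<open>s\<close> from \<open>p\<close>, so the scalar part of \<open>s q\<close> is that of
    \<open>p q = 0\<close>; similarly \<open>r p\<close> has that of \<open>q p = 0\<close>.\<close>
  have "mtx_entries fst (?m s q) = mtx_entries fst (?m p q)"
    unfolding fst.entries_mult[OF sm(1) qm(1)] fst.entries_mult[OF pm(1) qm(1)] fs ..
  then have off: "mtx_entries fst (?m s q) = mtx_entries fst (0 :: (complex \<times> 'b) mtx)"
    unfolding Q(2) .
  have "mtx_entries fst (?m r p) = mtx_entries fst (?m q p)"
    unfolding fst.entries_mult[OF rm(1) pm(1)] fst.entries_mult[OF qm(1) pm(1)] fr ..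
  then have off2: "mtx_entries fst (?m r p) = mtx_entries fst (0 :: (complex \<times> 'b) mtx)"
    unfolding Q(3) .
  have off': "fst (?m s q i j) = 0" "fst (?m r p i j) = 0" for i j
    using fun_cong[OF fun_cong[OF off]] fun_cong[OF fun_cong[OF off2]] by simp_all
  have bs: "block_scalar n v"
    unfolding block_scalar_def v_def blk_def using off' by auto
  have bs': "block_scalar n (?st v)"
    unfolding block_scalar_def
  proof (intro allI impI)
    fix i j assume "(n \<le> i) \<noteq> (n \<le> j)"
    then have "fst (v j i) = 0" using bs unfolding block_scalar_def by blast
    then show "fst (?st v i j) = 0" unfolding mtx_star_def by (cases "v j i") simp
  qed
  let ?w = "block_map n v"
  have "mtx_mult (unitize B) (n + n) (mtx_star (unitize B) ?w) ?w = block_map n (blk n n p 0 0 q)"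
    by (simp add: vsv flip: block_map_star[OF v] block_map_mult[OF A.U.star_mats[OF v] v bs' bs])
  moreover have "mtx_mult (unitize B) (n + n) ?w (mtx_star (unitize B) ?w) = block_map n (blk n n s 0 0 r)"
    by (simp add: vvs flip: block_map_star[OF v] block_map_mult[OF v A.U.star_mats[OF v] bs bs'])
  \<comment> \<open>On purely scalar matrices all components of \<open>h\<close> act alike, so the
    target of the equivalence does not depend on \<open>h\<close>.\<close>
  moreover have "r = mtx_entries scalar_part q"
    unfolding r_def q_def s_def mtx_one_def
    by (auto simp: fun_eq_iff prod_eq_iff zero_prod_def)
  then have "mtx_entries (map_prod id (h x x)) r = mtx_entries (map_prod id (\<lambda>_. 0)) q"
      "mtx_entries (map_prod id (h x x)) s = mtx_entries (map_prod id (\<lambda>_. 0)) p" for x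
    unfolding s_def by (simp_all add: fun_eq_iff h_zero prod_eq_iff)
  ultimately show ?thesis
    unfolding mtx_map_def dsum_blk block_map_blk fst_conv snd_conv q_def[symmetric]
    by (intro B.U.mvnI[OF block_map_mats[OF v]]) simp_all
qed

text \<open>The target in \<open>mvn_block_map\<close> consists of scalar parts and is the same for
  \<open>h\<close> and for the constant family \<open>h True True\<close>. Transitivity relates the
  two sources, which share the second summand; stable equivalence disregards it.\<close>

lemma K0_map_corners:
  assumes "C \<in> carrier (K0 A)"
  shows "K0_map B (h False False) C = K0_map B (h True True) C"
proof -
  interpret const: corner_hom A B "\<lambda>_ _. h True True" by (rule corner_hom_constant)
  interpret f: star_algebra_hom A B "h False False" by (rule star_algebra_hom)
  interpret t: star_algebra_hom A B "h True True" by (rule star_algebra_hom)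
  interpret z: star_algebra_hom A B "\<lambda>_. 0" by (rule A.star_algebra_hom_zero) unfold_locales
  have "B.U.stably_mvn (mtx_map (map_prod id (h False False)) p) (mtx_map (map_prod id (h True True)) p)"
    if p: "p \<in> projs (unitize A)" for p
  proof -
    obtain n P where P: "p = (n, P)" by (cases p)
    note pn = p[unfolded P]
    note q = A.complement_projs(1)[OF pn]
    note pr = f.U.mtx_map_projs[OF pn] t.U.mtx_map_projs[OF pn] t.U.mtx_map_projs[OF q]
      z.U.mtx_map_projs[OF pn] z.U.mtx_map_projs[OF q]
    have "mvn (unitize B)
        (mtx_map (map_prod id (h False False)) (n, P) \<oplus>\<^sub>m mtx_map (map_prod id (h True True)) (n, mtx_one n - P))
        (mtx_map (map_prod id (h True True)) (n, P) \<oplus>\<^sub>m mtx_map (map_prod id (h True True)) (n, mtx_one n - P))"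
      by (rule B.U.mvn_trans[OF _ _ _ mvn_block_map[OF pn] B.U.mvn_sym[OF const.mvn_block_map[OF pn]]])
        (intro B.U.dsum_projs pr)+
    then show ?thesis unfolding B.U.stably_mvn_def P using pr by blast
  qed
  moreover obtain p q where "p \<in> projs (unitize A)" "q \<in> projs (unitize A)" "C = A.U.K00_class p q"
    using A.K0_carrierE[OF assms] .
  ultimately show ?thesis
    by (simp add: f.K0_map_class t.K0_map_class B.U.K00_class_eqI)
qed

end

section \<open>The group of stable homotopy classes of unitaries\<close>

text \<open>The coisometry that reads off the \<open>m\<close> coordinates starting at
  \<open>k\<close>; conjugation with it places an \<open>m\<close> by \<open>m\<close> block at
  position \<open>k\<close> on the diagonal.\<close>

definition shift_mtx :: "nat \<Rightarrow> nat \<Rightarrow> (complex \<times> 'b::real_normed_vector) mtx" where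
  "shift_mtx k m = (\<lambda>i j. if i < m \<and> j = k + i then (1, 0) else 0)"

definition scale_mtx :: "real \<Rightarrow> 'u::real_normed_vector mtx \<Rightarrow> 'u mtx" where
  "scale_mtx r M = (\<lambda>i j. r *\<^sub>R M i j)"

definition rotation :: "'u::real_normed_vector mtx \<Rightarrow> 'u mtx \<Rightarrow> real \<Rightarrow> 'u mtx" where
  "rotation f g s = scale_mtx (cos (pi / 2 * s)) f + scale_mtx (sin (pi / 2 * s)) g"

lemma fst_mtx_map [simp]: "fst (mtx_map h p) = fst p"
  unfolding mtx_map_def by simp

lemma rotation_0: "rotation f g 0 = f" and rotation_1: "rotation f g 1 = g"
  unfolding rotation_def scale_mtx_def by (simp_all add: fun_eq_iff)

section \<open>Scalar multiples and rotations of matrices\<close>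

context star_ring
begin

lemma scale_mats: "M \<in> mats U m n \<Longrightarrow> scale_mtx r M \<in> mats U m n"
  unfolding scale_mtx_def by (rule matsI) (auto simp: scaleR_closed mats_entry mats_outside)

lemma scale_mult_left:
  "M \<in> mats U a k \<Longrightarrow> N \<in> mats U k b \<Longrightarrow>
     mtx_mult U k (scale_mtx r M) N = scale_mtx r (mtx_mult U k M N)"
  unfolding scale_mtx_def mtx_mult_def
  by (simp add: fun_eq_iff mult_scaleR_left mats_entry scaleR_sum_right)

lemma scale_mult_right:
  "M \<in> mats U a k \<Longrightarrow> N \<in> mats U k b \<Longrightarrow>
     mtx_mult U k M (scale_mtx r N) = scale_mtx r (mtx_mult U k M N)"
  unfolding scale_mtx_def mtx_mult_def
  by (simp add: fun_eq_iff mult_scaleR_right mats_entry scaleR_sum_right)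

lemma scale_star: "M \<in> mats U a k \<Longrightarrow> mtx_star U (scale_mtx r M) = scale_mtx r (mtx_star U M)"
  unfolding scale_mtx_def mtx_star_def by (simp add: fun_eq_iff star_scaleR mats_entry)

lemma rotation_mats: "f \<in> mats U m n \<Longrightarrow> g \<in> mats U m n \<Longrightarrow> rotation f g s \<in> mats U m n"
  unfolding rotation_def by (intro add_mats scale_mats)

text \<open>Orthogonality of \<open>f\<close> and \<open>g\<close> removes the cross terms, and the
  remaining two copies of \<open>e\<close> have weights \<open>cos\<^sup>2\<close> and
  \<open>sin\<^sup>2\<close>.\<close>

lemma rotation_coisometry:
  assumes f: "f \<in> mats U m n" and g: "g \<in> mats U m n"
    and "mtx_mult U n f (mtx_star U f) = e" "mtx_mult U n g (mtx_star U g) = e"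
    and "mtx_mult U n f (mtx_star U g) = 0" "mtx_mult U n g (mtx_star U f) = 0"
  shows "mtx_mult U n (rotation f g s) (mtx_star U (rotation f g s)) = e"
proof -
  define c d where "c = cos (pi / 2 * s)" and "d = sin (pi / 2 * s)"
  have cd: "c * c + d * d = 1" unfolding c_def d_def by (simp flip: power2_eq_square)
  note sf = star_mats[OF f] and sg = star_mats[OF g]
  have "mtx_mult U n (rotation f g s) (mtx_star U (rotation f g s)) =
      scale_mtx c (scale_mtx c e) + scale_mtx d (scale_mtx d e) + scale_mtx c (scale_mtx d 0)
        + scale_mtx d (scale_mtx c 0)"
    unfolding rotation_def c_def[symmetric] d_def[symmetric]
    by (simp add: mtx_star_add[OF scale_mats[OF f] scale_mats[OF g]] scale_star[OF f] scale_star[OF g]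
        mtx_distrib_right[OF scale_mats[OF f] scale_mats[OF g] add_mats[OF scale_mats[OF sf] scale_mats[OF sg]]]
        mtx_distrib_left[OF scale_mats[OF f] scale_mats[OF sf] scale_mats[OF sg]]
        mtx_distrib_left[OF scale_mats[OF g] scale_mats[OF sf] scale_mats[OF sg]]
        scale_mult_left[OF f scale_mats[OF sf]] scale_mult_left[OF f scale_mats[OF sg]]
        scale_mult_left[OF g scale_mats[OF sf]] scale_mult_left[OF g scale_mats[OF sg]]
        scale_mult_right[OF f sf] scale_mult_right[OF f sg] scale_mult_right[OF g sf]
        scale_mult_right[OF g sg] assms(3-6) algebra_simps)
  also have "\<dots> = e"
    unfolding scale_mtx_def using cd by (simp add: fun_eq_iff flip: scaleR_left_distrib)
  finally show ?thesis .
qed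

lemma rotation_continuous: "continuous_on S (\<lambda>s. rotation f g s i j)"
  unfolding rotation_def scale_mtx_def by (auto intro!: continuous_intros)

end

context star_algebra
begin

abbreviation mm :: "nat \<Rightarrow> (complex \<times> 'b) mtx \<Rightarrow> (complex \<times> 'b) mtx \<Rightarrow> (complex \<times> 'b) mtx" where
  "mm \<equiv> mtx_mult (unitize A)"

abbreviation st :: "(complex \<times> 'b) mtx \<Rightarrow> (complex \<times> 'b) mtx" where
  "st \<equiv> mtx_star (unitize A)"

abbreviation MM :: "nat \<Rightarrow> nat \<Rightarrow> (complex \<times> 'b) mtx set" where
  "MM \<equiv> mats (unitize A)"

abbreviation I :: "nat \<Rightarrow> (complex \<times> 'b) mtx" where
  "I \<equiv> mtx_one"

lemma I_mats: "I n \<in> MM n n"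
  by (rule one_mats) simp_all

subsection \<open>Amplification along a coisometry\<close>

definition conj_mtx :: "nat \<Rightarrow> (complex \<times> 'b) mtx \<Rightarrow> (complex \<times> 'b) mtx \<Rightarrow> (complex \<times> 'b) mtx" where
  "conj_mtx m h d = mm m (st h) (mm m d h)"

lemma conj_mats: "h \<in> MM m n \<Longrightarrow> d \<in> MM m m \<Longrightarrow> conj_mtx m h d \<in> MM n n"
  unfolding conj_mtx_def by (intro U.mult_mats U.star_mats)

lemma conj_mult_general:
  assumes f: "f \<in> MM m n" and g: "g \<in> MM k n" and c: "c \<in> MM m m" and d: "d \<in> MM k k"
  shows "mm n (conj_mtx m f c) (conj_mtx k g d) = mm m (st f) (mm k (mm m c (mm n f (st g))) (mm k d g))"
proof -
  note sf = U.star_mats[OF f] and sg = U.star_mats[OF g]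
  note cf = U.mult_mats[OF c f] and dg = U.mult_mats[OF d g]
  show ?thesis unfolding conj_mtx_def
    by (simp add: U.mtx_assoc[OF sf cf U.mult_mats[OF sg dg]] U.mtx_assoc[OF cf sg dg, symmetric]
        U.mtx_assoc[OF c f sg])
qed

lemma conj_mult:
  assumes h: "h \<in> MM m n" and hh: "mm n h (st h) = I m" and c: "c \<in> MM m m" and d: "d \<in> MM m m"
  shows "mm n (conj_mtx m h c) (conj_mtx m h d) = conj_mtx m h (mm m c d)"
  unfolding conj_mult_general[OF h h c d] hh mult_one[OF c order_refl]
  unfolding conj_mtx_def by (simp add: U.mtx_assoc[OF c d h])

lemma conj_mult_orthogonal:
  assumes f: "f \<in> MM m n" and g: "g \<in> MM k n" and fg: "mm n f (st g) = 0"
    and c: "c \<in> MM m m" and d: "d \<in> MM k k"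
  shows "mm n (conj_mtx m f c) (conj_mtx k g d) = 0"
  unfolding conj_mult_general[OF f g c d] fg
  by (simp add: U.mtx_mult_zero_right[OF c] U.mtx_mult_zero_left[OF U.mult_mats[OF d g]]
      U.mtx_mult_zero_right[OF U.star_mats[OF f]])

lemma conj_add:
  assumes h: "h \<in> MM m n" and c: "c \<in> MM m m" and d: "d \<in> MM m m"
  shows "conj_mtx m h (c + d) = conj_mtx m h c + conj_mtx m h d"
  unfolding conj_mtx_def U.mtx_distrib_right[OF c d h]
  by (rule U.mtx_distrib_left[OF U.star_mats[OF h] U.mult_mats[OF c h] U.mult_mats[OF d h]])

lemma conj_star:
  assumes h: "h \<in> MM m n" and d: "d \<in> MM m m"
  shows "st (conj_mtx m h d) = conj_mtx m h (st d)"
  unfolding conj_mtx_def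
  by (simp add: U.mtx_star_mult[OF U.star_mats[OF h] U.mult_mats[OF d h]] U.mtx_star_mult[OF d h]
      U.mtx_star_star[OF h] U.mtx_assoc[OF U.star_mats[OF h] U.star_mats[OF d] h])

text \<open>For a coisometry \<open>h\<close> this is \<open>h* v h + (1 - h* h)\<close>: a copy of
  \<open>v\<close> on the range of \<open>h*\<close> and the identity on the complement. Writing it
  through \<open>v - 1\<close> reduces its algebra to that of \<open>conj_mtx\<close>.\<close>

definition amp :: "nat \<Rightarrow> nat \<Rightarrow> (complex \<times> 'b) mtx \<Rightarrow> (complex \<times> 'b) mtx \<Rightarrow> (complex \<times> 'b) mtx" where
  "amp m n h v = I n + conj_mtx m h (v - I m)"

definition coisometry :: "nat \<Rightarrow> nat \<Rightarrow> (complex \<times> 'b) mtx \<Rightarrow> bool" where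
  "coisometry m n h \<longleftrightarrow> h \<in> MM m n \<and> mm n h (st h) = I m"

lemma amp_mats: "h \<in> MM m n \<Longrightarrow> v \<in> MM m m \<Longrightarrow> amp m n h v \<in> MM n n"
  unfolding amp_def by (intro U.add_mats conj_mats U.diff_mats I_mats)

lemma one_plus_mult:
  assumes c: "c \<in> MM n n" and d: "d \<in> MM n n"
  shows "mm n (I n + c) (I n + d) = I n + c + d + mm n c d"
  unfolding U.mtx_distrib_right[OF I_mats c U.add_mats[OF I_mats d]]
    one_mult[OF U.add_mats[OF I_mats d] order_refl] U.mtx_distrib_left[OF c I_mats d]
    mult_one[OF c order_refl]
  by (simp add: algebra_simps)

text \<open>Since \<open>h h* = 1\<close>, conjugation by \<open>h\<close> is multiplicative on the
  differences \<open>c = v - 1\<close> and \<open>d = w - 1\<close>, and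
  \<open>(1 + c) (1 + d)\<close> expands in the same way before and after.\<close>

lemma amp_mult:
  assumes h: "coisometry m n h" and v: "v \<in> MM m m" and w: "w \<in> MM m m"
  shows "mm n (amp m n h v) (amp m n h w) = amp m n h (mm m v w)"
proof -
  have hm: "h \<in> MM m n" and hh: "mm n h (st h) = I m" using h unfolding coisometry_def by auto
  define c d where "c = v - I m" and "d = w - I m"
  have c: "c \<in> MM m m" and d: "d \<in> MM m m" unfolding c_def d_def by (intro U.diff_mats v w I_mats)+
  note cd = U.mult_mats[OF c d]
  have "mm m v w = I m + c + d + mm m c d"
    unfolding one_plus_mult[OF c d, symmetric] by (simp add: c_def d_def)
  then have vw: "mm m v w - I m = c + d + mm m c d" by (simp add: algebra_simps)
  show ?thesis
    unfolding amp_def c_def[symmetric] d_def[symmetric] vw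
      one_plus_mult[OF conj_mats[OF hm c] conj_mats[OF hm d]] conj_mult[OF hm hh c d]
      conj_add[OF hm U.add_mats[OF c d] cd] conj_add[OF hm c d]
    by (simp add: algebra_simps)
qed

lemma amp_star:
  assumes h: "h \<in> MM m n" and v: "v \<in> MM m m"
  shows "st (amp m n h v) = amp m n h (st v)"
  unfolding amp_def
  by (simp add: U.mtx_star_add[OF I_mats conj_mats[OF h U.diff_mats[OF v I_mats]]] star_one
      conj_star[OF h U.diff_mats[OF v I_mats]] U.mtx_star_diff[OF v I_mats])

lemma amp_one: "h \<in> MM m n \<Longrightarrow> amp m n h (I m) = I n"
  unfolding amp_def conj_mtx_def
  by (simp add: U.mtx_mult_zero_left U.mtx_mult_zero_right[OF U.star_mats])

section \<open>Unitary matrices and their amplification\<close>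

lemma unitaries_mats: "u \<in> unitaries A n \<Longrightarrow> u \<in> MM n n"
  and unitaries_left: "u \<in> unitaries A n \<Longrightarrow> mm n (st u) u = I n"
  and unitaries_right: "u \<in> unitaries A n \<Longrightarrow> mm n u (st u) = I n"
  unfolding unitaries_def by auto

lemma unitariesI:
  "u \<in> MM n n \<Longrightarrow> mm n (st u) u = I n \<Longrightarrow> mm n u (st u) = I n \<Longrightarrow> u \<in> unitaries A n"
  unfolding unitaries_def by blast

lemma one_unitaries: "I n \<in> unitaries A n"
  by (rule unitariesI) (simp_all add: I_mats star_one one_mult[OF I_mats])

lemma star_unitaries: "u \<in> unitaries A n \<Longrightarrow> st u \<in> unitaries A n"
  using unitaries_mats[of u n]
  by (intro unitariesI) (simp_all add: U.star_mats U.mtx_star_star unitaries_left unitaries_right)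

lemma mult_unitaries:
  assumes u: "u \<in> unitaries A n" and v: "v \<in> unitaries A n"
  shows "mm n u v \<in> unitaries A n"
proof (rule unitariesI)
  note um = unitaries_mats[OF u] and vm = unitaries_mats[OF v]
  note us = U.star_mats[OF um] and vs = U.star_mats[OF vm]
  show "mm n u v \<in> MM n n" by (rule U.mult_mats[OF um vm])
  show "mm n (st (mm n u v)) (mm n u v) = I n"
    by (simp add: U.mtx_star_mult[OF um vm] U.mtx_assoc[OF vs us U.mult_mats[OF um vm]]
        U.mtx_assoc[OF us um vm, symmetric] unitaries_left[OF u] unitaries_left[OF v] one_mult[OF vm])
  show "mm n (mm n u v) (st (mm n u v)) = I n"
    by (simp add: U.mtx_star_mult[OF um vm] U.mtx_assoc[OF um vm U.mult_mats[OF vs us]]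
        U.mtx_assoc[OF vm vs us, symmetric] unitaries_right[OF u] unitaries_right[OF v] one_mult[OF us])
qed

lemma amp_unitaries:
  assumes h: "coisometry m n h" and u: "u \<in> unitaries A m"
  shows "amp m n h u \<in> unitaries A n"
proof -
  have hm: "h \<in> MM m n" using h unfolding coisometry_def by blast
  note um = unitaries_mats[OF u]
  show ?thesis
    by (rule unitariesI)
      (simp_all add: amp_mats[OF hm um] amp_star[OF hm um] amp_mult[OF h U.star_mats[OF um] um]
        amp_mult[OF h um U.star_mats[OF um]] unitaries_left[OF u] unitaries_right[OF u] amp_one[OF hm])
qed

subsection \<open>Homotopies\<close>

lemma unitize_continuous_mult:
  fixes f g :: "real \<Rightarrow> complex \<times> 'b"
  assumes "continuous_on S f" "continuous_on S g"
    "\<And>s. s \<in> S \<Longrightarrow> f s \<in> elems (unitize A) \<and> g s \<in> elems (unitize A)"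
  shows "continuous_on S (\<lambda>s. amult (unitize A) (f s) (g s))"
proof -
  have eq: "amult (unitize A) (f s) (g s) = (fst (f s) * fst (g s),
      ascale A (fst (f s)) (snd (g s)) + ascale A (fst (g s)) (snd (f s)) + amult A (snd (f s)) (snd (g s)))" for s
    by (cases "f s", cases "g s") simp
  have "snd (f s) \<in> elems A" "snd (g s) \<in> elems A" if "s \<in> S" for s
    using assms(3)[OF that] by (auto simp: mem_Times_iff)
  then show ?thesis unfolding eq using assms(1,2)
    by (intro continuous_on_Pair continuous_on_mult continuous_on_add continuous_ascale continuous_mult
        continuous_on_fst continuous_on_snd) auto
qed

lemma unitize_continuous_star:
  fixes f :: "real \<Rightarrow> complex \<times> 'b"
  assumes "continuous_on S f" "\<And>s. s \<in> S \<Longrightarrow> f s \<in> elems (unitize A)"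
  shows "continuous_on S (\<lambda>s. astar (unitize A) (f s))"
proof -
  have eq: "astar (unitize A) (f s) = (cnj (fst (f s)), astar A (snd (f s)))" for s
    by (cases "f s") simp
  have "snd (f s) \<in> elems A" if "s \<in> S" for s using assms(2)[OF that] by (auto simp: mem_Times_iff)
  then show ?thesis unfolding eq using assms(1)
    by (intro continuous_on_Pair continuous_on_cnj continuous_star continuous_on_fst continuous_on_snd) auto
qed

lemma continuous_mm:
  fixes M N :: "real \<Rightarrow> (complex \<times> 'b) mtx"
  assumes "\<And>i j. continuous_on S (\<lambda>s. M s i j)" "\<And>i j. continuous_on S (\<lambda>s. N s i j)"
    "\<And>s. s \<in> S \<Longrightarrow> M s \<in> MM a k" "\<And>s. s \<in> S \<Longrightarrow> N s \<in> MM k b"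
  shows "continuous_on S (\<lambda>s. mm k (M s) (N s) i j)"
  unfolding mtx_mult_def
  by (intro continuous_on_sum unitize_continuous_mult assms(1,2) conjI)
    (use U.mats_entry[OF assms(3)] U.mats_entry[OF assms(4)] in blast)+

lemma continuous_st:
  fixes M :: "real \<Rightarrow> (complex \<times> 'b) mtx"
  assumes "\<And>i j. continuous_on S (\<lambda>s. M s i j)" "\<And>s. s \<in> S \<Longrightarrow> M s \<in> MM a k"
  shows "continuous_on S (\<lambda>s. st (M s) i j)"
  unfolding mtx_star_def
  by (intro unitize_continuous_star assms(1)) (use U.mats_entry[OF assms(2)] in blast)

lemma continuous_amp:
  fixes h v :: "real \<Rightarrow> (complex \<times> 'b) mtx"
  assumes "\<And>i j. continuous_on S (\<lambda>s. h s i j)" "\<And>i j. continuous_on S (\<lambda>s. v s i j)"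
    "\<And>s. s \<in> S \<Longrightarrow> h s \<in> MM m n" "\<And>s. s \<in> S \<Longrightarrow> v s \<in> MM m m"
  shows "continuous_on S (\<lambda>s. amp m n (h s) (v s) i j)"
proof -
  have d: "v s - I m \<in> MM m m" if "s \<in> S" for s by (intro U.diff_mats I_mats assms(4) that)
  have dc: "continuous_on S (\<lambda>s. (v s - I m) i j)" for i j
    by (simp add: continuous_on_diff assms(2))
  have "continuous_on S (\<lambda>s. conj_mtx m (h s) (v s - I m) i j)" for i j
    unfolding conj_mtx_def
    by (rule continuous_mm[where a = n and b = n])
      (intro continuous_st[where a = m and k = n] continuous_mm[where a = m and b = n] assms dc d
        U.star_mats U.mult_mats[OF d assms(3)] | assumption)+
  then show ?thesis unfolding amp_def by (simp add: continuous_on_add)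
qed

lemma homotopicI:
  fixes \<gamma> :: "real \<Rightarrow> (complex \<times> 'b) mtx"
  assumes "\<And>s. s \<in> {0..1} \<Longrightarrow> \<gamma> s \<in> unitaries A n" "\<gamma> 0 = u" "\<gamma> 1 = v"
    "\<And>i j. continuous_on {0..1} (\<lambda>s. \<gamma> s i j)"
  shows "unitary_homotopic A n u v"
  unfolding unitary_homotopic_def using assms by (intro exI[of _ \<gamma>]) simp

lemma homotopicE:
  assumes "unitary_homotopic A n u v"
  obtains \<gamma> :: "real \<Rightarrow> (complex \<times> 'b) mtx" where "\<forall>s\<in>{0..1}. \<gamma> s \<in> unitaries A n" "\<gamma> 0 = u" "\<gamma> 1 = v"
    "\<forall>i j. continuous_on {0..1} (\<lambda>s. \<gamma> s i j)"
  using assms unfolding unitary_homotopic_def by blast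

lemma homotopic_refl: "u \<in> unitaries A n \<Longrightarrow> unitary_homotopic A n u u"
  by (rule homotopicI[of "\<lambda>_. u"]) auto

lemma homotopic_sym:
  assumes "unitary_homotopic A n u v"
  shows "unitary_homotopic A n v u"
proof -
  obtain \<gamma> :: "real \<Rightarrow> _" where g: "\<forall>s\<in>{0..1}. \<gamma> s \<in> unitaries A n" "\<gamma> 0 = u" "\<gamma> 1 = v"
    "\<forall>i j. continuous_on {0..1} (\<lambda>s. \<gamma> s i j)" using homotopicE[OF assms] .
  note g = g(1)[rule_format] g(2,3) g(4)[rule_format]
  show ?thesis
  proof (rule homotopicI[of "\<lambda>s. \<gamma> (1 - s)"])
    show "continuous_on {0..1} (\<lambda>s. \<gamma> (1 - s) i j)" for i j
      by (rule continuous_on_compose2[OF g(4)]) (auto intro!: continuous_intros)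
  qed (use g in auto)
qed

lemma homotopic_trans [trans]:
  assumes "unitary_homotopic A n u v" "unitary_homotopic A n v w"
  shows "unitary_homotopic A n u w"
proof -
  obtain \<gamma> :: "real \<Rightarrow> _" where g: "\<forall>s\<in>{0..1}. \<gamma> s \<in> unitaries A n" "\<gamma> 0 = u" "\<gamma> 1 = v"
    "\<forall>i j. continuous_on {0..1} (\<lambda>s. \<gamma> s i j)" using homotopicE[OF assms(1)] .
  note g = g(1)[rule_format] g(2,3) g(4)[rule_format]
  obtain \<delta> :: "real \<Rightarrow> _" where d: "\<forall>s\<in>{0..1}. \<delta> s \<in> unitaries A n" "\<delta> 0 = v" "\<delta> 1 = w"
    "\<forall>i j. continuous_on {0..1} (\<lambda>s. \<delta> s i j)" using homotopicE[OF assms(2)] .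
  note d = d(1)[rule_format] d(2,3) d(4)[rule_format]
  show ?thesis
  proof (rule homotopicI[of "\<lambda>s. if s \<le> 1 / 2 then \<gamma> (2 * s) else \<delta> (2 * s - 1)"])
    fix i j
    have "path ((\<lambda>s. \<gamma> s i j) +++ (\<lambda>s. \<delta> s i j))"
      using g d by (intro path_join_imp) (auto simp: path_def pathfinish_def pathstart_def)
    moreover have "((\<lambda>s. \<gamma> s i j) +++ (\<lambda>s. \<delta> s i j)) =
        (\<lambda>s. (if s \<le> 1 / 2 then \<gamma> (2 * s) else \<delta> (2 * s - 1)) i j)"
      unfolding joinpaths_def by auto
    ultimately show "continuous_on {0..1} (\<lambda>s. (if s \<le> 1 / 2 then \<gamma> (2 * s) else \<delta> (2 * s - 1)) i j)"
      unfolding path_def by simp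
  qed (use g d in auto)
qed

lemma homotopic_unitaries:
  assumes "unitary_homotopic A n u v"
  shows "u \<in> unitaries A n" "v \<in> unitaries A n"
proof -
  obtain \<gamma> :: "real \<Rightarrow> _" where g: "\<forall>s\<in>{0..1}. \<gamma> s \<in> unitaries A n" "\<gamma> 0 = u" "\<gamma> 1 = v"
    "\<forall>i j. continuous_on {0..1} (\<lambda>s. \<gamma> s i j)" using homotopicE[OF assms] .
  note g = g(1)[rule_format] g(2,3) g(4)[rule_format]
  show "u \<in> unitaries A n" "v \<in> unitaries A n" using g(1)[of 0] g(1)[of 1] g(2,3) by simp_all
qed

lemma homotopic_mult:
  assumes "unitary_homotopic A n u u'" "unitary_homotopic A n v v'"
  shows "unitary_homotopic A n (mm n u v) (mm n u' v')"
proof -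
  obtain \<gamma> :: "real \<Rightarrow> _" where g: "\<forall>s\<in>{0..1}. \<gamma> s \<in> unitaries A n" "\<gamma> 0 = u" "\<gamma> 1 = u'"
    "\<forall>i j. continuous_on {0..1} (\<lambda>s. \<gamma> s i j)" using homotopicE[OF assms(1)] .
  note g = g(1)[rule_format] g(2,3) g(4)[rule_format]
  obtain \<delta> :: "real \<Rightarrow> _" where d: "\<forall>s\<in>{0..1}. \<delta> s \<in> unitaries A n" "\<delta> 0 = v" "\<delta> 1 = v'"
    "\<forall>i j. continuous_on {0..1} (\<lambda>s. \<delta> s i j)" using homotopicE[OF assms(2)] .
  note d = d(1)[rule_format] d(2,3) d(4)[rule_format]
  show ?thesis
  proof (rule homotopicI[of "\<lambda>s. mm n (\<gamma> s) (\<delta> s)"])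
    show "continuous_on {0..1} (\<lambda>s. mm n (\<gamma> s) (\<delta> s) i j)" for i j
      by (rule continuous_mm[where a = n and b = n]) (simp_all add: g d unitaries_mats)
  qed (simp_all add: g d mult_unitaries)
qed

lemma homotopic_amp:
  assumes h: "coisometry m n h" and uv: "unitary_homotopic A m u v"
  shows "unitary_homotopic A n (amp m n h u) (amp m n h v)"
proof -
  obtain \<gamma> :: "real \<Rightarrow> _" where g: "\<forall>s\<in>{0..1}. \<gamma> s \<in> unitaries A m" "\<gamma> 0 = u" "\<gamma> 1 = v"
    "\<forall>i j. continuous_on {0..1} (\<lambda>s. \<gamma> s i j)" using homotopicE[OF uv] .
  note g = g(1)[rule_format] g(2,3) g(4)[rule_format]
  have hm: "h \<in> MM m n" using h unfolding coisometry_def by blast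
  show ?thesis
  proof (rule homotopicI[of "\<lambda>s. amp m n h (\<gamma> s)"])
    show "continuous_on {0..1} (\<lambda>s. amp m n h (\<gamma> s) i j)" for i j
      by (rule continuous_amp) (simp_all add: g hm unitaries_mats)
  qed (simp_all add: g amp_unitaries[OF h])
qed

lemma rotation_amp_coisometry:
  assumes f: "coisometry m n f" and g: "coisometry m n g"
    and fg: "mm n f (st g) = 0" "mm n g (st f) = 0"
  shows "coisometry m n (rotation f g s)"
  using assms U.rotation_mats U.rotation_coisometry unfolding coisometry_def by blast

lemma rotation_amp_continuous:
  assumes "f \<in> MM m n" "g \<in> MM m n" "u \<in> MM m m"
  shows "continuous_on S (\<lambda>s. amp m n (rotation f g s) u i j)"
  by (rule continuous_amp) (simp_all add: U.rotation_continuous U.rotation_mats assms)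

text \<open>A block is moved to an orthogonal place by rotating the coisometry along which it is
  amplified; the rotated map remains a coisometry, so the path stays unitary.\<close>

lemma homotopic_rotation:
  assumes f: "coisometry m n f" and g: "coisometry m n g"
    and fg: "mm n f (st g) = 0" "mm n g (st f) = 0" and u: "u \<in> unitaries A m"
  shows "unitary_homotopic A n (amp m n f u) (amp m n g u)"
proof (rule homotopicI[of "\<lambda>s. amp m n (rotation f g s) u"])
  show "continuous_on {0..1} (\<lambda>s. amp m n (rotation f g s) u i j)" for i j
    using f g unfolding coisometry_def by (intro rotation_amp_continuous unitaries_mats[OF u]) simp_all
qed (simp_all add: rotation_0 rotation_1 amp_unitaries[OF rotation_amp_coisometry[OF f g fg] u])

subsection \<open>Shifts\<close>

lemma unit_closed: "(1, 0) \<in> elems (unitize A)"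
  by (simp add: zero_closed)

lemma shift_mats: "k + m \<le> n \<Longrightarrow> shift_mtx k m \<in> MM m n"
  by (rule U.matsI) (auto simp: shift_mtx_def zero_closed zero_prod_def)

lemma shift_mult_star:
  assumes "k + m \<le> n"
  shows "mm n (shift_mtx k m) (st (shift_mtx k' m')) i j =
     (if i < m \<and> j < m' \<and> k + i = k' + j then (1, 0) else 0)"
proof -
  have "mm n (shift_mtx k m) (st (shift_mtx k' m')) i j =
      (\<Sum>l<n. if l = k + i then (if i < m \<and> j < m' \<and> k + i = k' + j then (1, 0) else 0) else 0)"
    unfolding mtx_mult_def mtx_star_def shift_mtx_def
    by (intro sum.cong refl)
      (auto simp: U.mult_zero_left U.mult_zero_right U.star_zero unit_star U.zero_closed
        unit_mult unit_closed simp del: unitize_simps)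
  then show ?thesis using assms by auto
qed

lemma shift_coisometry: "k + m \<le> n \<Longrightarrow> coisometry m n (shift_mtx k m)"
  unfolding coisometry_def
  by (auto simp: shift_mats fun_eq_iff shift_mult_star mtx_one_def)

lemma shift_orthogonal:
  "k + m \<le> n \<Longrightarrow> k + m \<le> k' \<or> k' + m' \<le> k \<Longrightarrow> mm n (shift_mtx k m) (st (shift_mtx k' m')) = 0"
  by (auto simp: fun_eq_iff shift_mult_star)

lemma mult_shift:
  assumes "d \<in> MM a m"
  shows "mm m d (shift_mtx n m) i j = (if n \<le> j then d i (j - n) else 0)"
proof -
  have "mm m d (shift_mtx n m) i j = (\<Sum>l<m. if l = j - n then (if n \<le> j then d i (j - n) else 0) else 0)"
    unfolding mtx_mult_def shift_mtx_def
    by (intro sum.cong refl)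
      (auto simp: U.mult_zero_right mult_unit U.mats_entry[OF assms] simp del: unitize_simps)
  then show ?thesis using U.mats_outside[OF assms] by auto
qed

lemma conj_shift:
  assumes d: "d \<in> MM m m"
  shows "conj_mtx m (shift_mtx n m) d = (\<lambda>i j. if n \<le> i \<and> n \<le> j then d (i - n) (j - n) else 0)"
proof -
  note sh = shift_mats[of n m "n + m", simplified]
  note ds = U.mult_mats[OF d sh]
  have "conj_mtx m (shift_mtx n m) d = st (mm m (st (mm m d (shift_mtx n m))) (shift_mtx n m))"
    unfolding conj_mtx_def by (simp add: U.mtx_star_mult[OF U.star_mats[OF ds] sh] U.mtx_star_star[OF ds])
  also have "\<dots> = (\<lambda>i j. if n \<le> i \<and> n \<le> j then d (i - n) (j - n) else 0)"
  proof (intro ext)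
    fix i j
    have star: "st M i j = astar (unitize A) (M j i)" for M i j by (simp add: mtx_star_def)
    show "st (mm m (st (mm m d (shift_mtx n m))) (shift_mtx n m)) i j =
        (if n \<le> i \<and> n \<le> j then d (i - n) (j - n) else 0)"
      unfolding star mult_shift[OF U.star_mats[OF ds]] mult_shift[OF d]
      by (simp add: U.star_star U.star_zero U.mats_entry[OF d] del: unitize_simps)
  qed
  finally show ?thesis .
qed

text \<open>The blocks at \<open>k\<close> and at \<open>0\<close> may overlap. The move therefore
  goes through position \<open>k + m\<close>, which is disjoint from both; this is where the size
  \<open>k + 2 * m\<close> comes from.\<close>

lemma homotopic_shift:
  assumes u: "u \<in> unitaries A m" and "k + 2 * m \<le> n"
  shows "unitary_homotopic A n (amp m n (shift_mtx k m) u) (amp m n (shift_mtx 0 m) u)"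
proof -
  have le: "k + m \<le> n" "k + m + m \<le> n" "0 + m \<le> n" using assms(2) by auto
  have "unitary_homotopic A n (amp m n (shift_mtx k m) u) (amp m n (shift_mtx (k + m) m) u)"
    using le by (intro homotopic_rotation shift_coisometry shift_orthogonal u) auto
  also have "unitary_homotopic A n \<dots> (amp m n (shift_mtx 0 m) u)"
    using le by (intro homotopic_rotation shift_coisometry shift_orthogonal u) auto
  finally show ?thesis .
qed

subsection \<open>The group law\<close>

text \<open>As an amplification, the sum of \<open>u\<close> and an identity matrix inherits
  multiplicativity and homotopy invariance from \<open>amp\<close>; \<open>snd_dsum_one\<close>
  identifies it with the form used in \<open>K1_rel\<close>.\<close>

definition pad :: "nat \<Rightarrow> nat \<times> (complex \<times> 'b) mtx \<Rightarrow> (complex \<times> 'b) mtx" where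
  "pad n u = amp (fst u) n (shift_mtx 0 (fst u)) (snd u)"

lemma all_unitaries_iff: "u \<in> all_unitaries A \<longleftrightarrow> snd u \<in> unitaries A (fst u)"
  unfolding all_unitaries_def by (cases u) simp

lemma pad_eq:
  assumes "snd u \<in> MM (fst u) (fst u)"
  shows "pad n u = I n + (snd u - I (fst u))"
  unfolding pad_def amp_def conj_shift[OF U.diff_mats[OF assms I_mats]] by (simp add: fun_eq_iff)

lemma pad_unitaries: "u \<in> all_unitaries A \<Longrightarrow> fst u \<le> n \<Longrightarrow> pad n u \<in> unitaries A n"
  unfolding pad_def all_unitaries_iff by (intro amp_unitaries shift_coisometry) auto

lemma snd_dsum_one:
  assumes "u \<in> all_unitaries A" "fst u \<le> n"
  shows "snd (u \<oplus>\<^sub>m (n - fst u, mtx_one (n - fst u))) = pad n u"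
proof -
  have um: "snd u \<in> MM (fst u) (fst u)" using assms(1) unitaries_mats unfolding all_unitaries_iff by blast
  show ?thesis unfolding pad_eq[OF um] dsum_def mtx_one_def
    using assms(2) U.mats_outside[OF um] by (auto simp: fun_eq_iff)
qed

text \<open>Padding to size \<open>k\<close> and then to size \<open>n\<close> is padding to size
  \<open>n\<close>, and amplification preserves homotopies.\<close>

lemma pad_homotopic_mono:
  assumes u: "u \<in> all_unitaries A" "fst u \<le> k" and v: "v \<in> all_unitaries A" "fst v \<le> k"
    and "k \<le> n" "unitary_homotopic A k (pad k u) (pad k v)"
  shows "unitary_homotopic A n (pad n u) (pad n v)"
proof -
  have *: "amp k n (shift_mtx 0 k) (pad k w) = pad n w" if w: "w \<in> all_unitaries A" "fst w \<le> k" for w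
  proof -
    have wm: "snd w \<in> MM (fst w) (fst w)" using w unitaries_mats unfolding all_unitaries_iff by blast
    have "pad n (k, pad k w) = I n + (pad k w - I k)"
      using pad_eq[of "(k, pad k w)" n] unitaries_mats[OF pad_unitaries[OF w]] by simp
    then show ?thesis unfolding pad_eq[OF wm] unfolding pad_def by simp
  qed
  show ?thesis
    using homotopic_amp[OF shift_coisometry[of 0 k n] assms(6)] assms(5) *[OF u] *[OF v] by simp
qed

lemma K1_rel_iff:
  "(u, v) \<in> K1_rel A \<longleftrightarrow> u \<in> all_unitaries A \<and> v \<in> all_unitaries A \<and>
     (\<exists>k. fst u \<le> k \<and> fst v \<le> k \<and> unitary_homotopic A k (pad k u) (pad k v))"
  unfolding K1_rel_def by (auto simp: snd_dsum_one[of u] snd_dsum_one[of v])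

lemma equiv_K1_rel: "equiv (all_unitaries A) (K1_rel A)"
proof (rule equivI)
  show "K1_rel A \<subseteq> all_unitaries A \<times> all_unitaries A" unfolding K1_rel_def by blast
  show "refl_on (all_unitaries A) (K1_rel A)"
    by (rule refl_onI) (auto simp: K1_rel_iff intro: homotopic_refl pad_unitaries)
  show "sym (K1_rel A)"
    by (rule symI) (auto simp: K1_rel_iff intro: homotopic_sym)
  show "trans (K1_rel A)"
  proof (rule transI)
    fix u v w assume "(u, v) \<in> K1_rel A" "(v, w) \<in> K1_rel A"
    then obtain k l where un: "u \<in> all_unitaries A" "v \<in> all_unitaries A" "w \<in> all_unitaries A"
      and k: "fst u \<le> k" "fst v \<le> k" "unitary_homotopic A k (pad k u) (pad k v)"
      and l: "fst v \<le> l" "fst w \<le> l" "unitary_homotopic A l (pad l v) (pad l w)"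
      unfolding K1_rel_iff by blast
    have "unitary_homotopic A (max k l) (pad (max k l) u) (pad (max k l) w)"
      by (rule homotopic_trans[OF pad_homotopic_mono[OF un(1) k(1) un(2) k(2) _ k(3)]
            pad_homotopic_mono[OF un(2) l(1) un(3) l(2) _ l(3)]]) simp_all
    then show "(u, w) \<in> K1_rel A" unfolding K1_rel_iff using un k l by (meson le_max_iff_disj)
  qed
qed

lemma dsum_all_unitaries:
  assumes "u \<in> all_unitaries A" "v \<in> all_unitaries A"
  shows "u \<oplus>\<^sub>m v \<in> all_unitaries A"
proof -
  obtain n U m V where uv: "u = (n, U)" "v = (m, V)" by (cases u, cases v)
  have u: "U \<in> unitaries A n" and v: "V \<in> unitaries A m"
    using assms unfolding uv all_unitaries_iff by auto
  note um = unitaries_mats[OF u] and vm = unitaries_mats[OF v]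
  note z = U.mtx_star_zero U.mtx_mult_zero_left[OF um] U.mtx_mult_zero_left[OF vm]
    U.mtx_mult_zero_right[OF um] U.mtx_mult_zero_right[OF vm]
    U.mtx_mult_zero_left[OF U.star_mats[OF um]] U.mtx_mult_zero_left[OF U.star_mats[OF vm]]
    U.mtx_mult_zero_right[OF U.star_mats[OF um]] U.mtx_mult_zero_right[OF U.star_mats[OF vm]]
    U.mtx_mult_zero_left[OF U.zero_mats]
  have one: "blk n n (I n) 0 0 (I m) = I (n + m)" unfolding blk_def mtx_one_def by (auto simp: fun_eq_iff)
  show ?thesis unfolding uv dsum_blk all_unitaries_iff fst_conv snd_conv
    by (rule unitariesI[OF U.blk_mats[OF um U.zero_mats U.zero_mats vm]])
      (simp_all add: U.blk_star U.blk_mult z one unitaries_left[OF u] unitaries_right[OF u]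
        unitaries_left[OF v] unitaries_right[OF v])
qed

text \<open>The summands of \<open>u \<oplus> v\<close> commute after padding, and the second one can be rotated to the
  upper left corner: up to homotopy the direct sum is the product of the padded unitaries.\<close>

lemma pad_dsum:
  assumes u: "u \<in> all_unitaries A" and v: "v \<in> all_unitaries A" and n: "fst u + fst v \<le> n"
  shows "pad n (u \<oplus>\<^sub>m v) = mm n (pad n u) (amp (fst v) n (shift_mtx (fst u) (fst v)) (snd v))"
    "pad n (u \<oplus>\<^sub>m v) = mm n (amp (fst v) n (shift_mtx (fst u) (fst v)) (snd v)) (pad n u)"
proof -
  define c d where "c = snd u - I (fst u)" and "d = snd v - I (fst v)"
  have um: "snd u \<in> MM (fst u) (fst u)" and vm: "snd v \<in> MM (fst v) (fst v)"
    using u v unitaries_mats unfolding all_unitaries_iff by blast+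
  have c: "c \<in> MM (fst u) (fst u)" and d: "d \<in> MM (fst v) (fst v)"
    unfolding c_def d_def by (intro U.diff_mats um vm I_mats)+
  let ?f = "shift_mtx 0 (fst u)" and ?g = "shift_mtx (fst u) (fst v)"
  have f: "?f \<in> MM (fst u) n" and g: "?g \<in> MM (fst v) n" using n by (intro shift_mats; simp)+
  note cf = conj_mats[OF f c] and dg = conj_mats[OF g d]
  \<comment> \<open>The two blocks occupy disjoint ranges of coordinates, so the cross term vanishes
    in either order; hence both factorizations.\<close>
  have z: "mm n (conj_mtx (fst u) ?f c) (conj_mtx (fst v) ?g d) = 0"
      "mm n (conj_mtx (fst v) ?g d) (conj_mtx (fst u) ?f c) = 0"
    using n by (intro conj_mult_orthogonal[OF f g _ c d] conj_mult_orthogonal[OF g f _ d c] shift_orthogonal; simp)+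
  have "snd (u \<oplus>\<^sub>m v) \<in> MM (fst (u \<oplus>\<^sub>m v)) (fst (u \<oplus>\<^sub>m v))"
    using dsum_all_unitaries[OF u v] unitaries_mats unfolding all_unitaries_iff by blast
  then have "pad n (u \<oplus>\<^sub>m v) = I n + (snd (u \<oplus>\<^sub>m v) - I (fst u + fst v))"
    by (subst pad_eq) (simp_all add: dsum_def)
  also have "snd (u \<oplus>\<^sub>m v) - I (fst u + fst v) = conj_mtx (fst u) ?f c + conj_mtx (fst v) ?g d"
    unfolding conj_shift[OF c] conj_shift[OF d] unfolding c_def d_def dsum_def mtx_one_def
    using U.mats_outside[OF um] by (auto simp: fun_eq_iff)
  finally have eq: "pad n (u \<oplus>\<^sub>m v) = I n + (conj_mtx (fst u) ?f c + conj_mtx (fst v) ?g d)" .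
  show "pad n (u \<oplus>\<^sub>m v) = mm n (pad n u) (amp (fst v) n ?g (snd v))"
    "pad n (u \<oplus>\<^sub>m v) = mm n (amp (fst v) n ?g (snd v)) (pad n u)"
    unfolding eq unfolding pad_def amp_def c_def[symmetric] d_def[symmetric]
    by (simp_all add: one_plus_mult[OF cf dg] one_plus_mult[OF dg cf] z algebra_simps)
qed

text \<open>The surplus of \<open>fst v\<close> in the size, beyond what the direct sum occupies, is
  the room that \<open>homotopic_shift\<close> needs to bring the second block to the upper left
  corner.\<close>

lemma homotopic_pad_dsum:
  assumes u: "u \<in> all_unitaries A" and v: "v \<in> all_unitaries A" and n: "fst u + 2 * fst v \<le> n"
  shows "unitary_homotopic A n (pad n (u \<oplus>\<^sub>m v)) (mm n (pad n u) (pad n v))"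
    "unitary_homotopic A n (pad n (u \<oplus>\<^sub>m v)) (mm n (pad n v) (pad n u))"
proof -
  have n': "fst u + fst v \<le> n" "fst u \<le> n" using n by auto
  have h: "unitary_homotopic A n (amp (fst v) n (shift_mtx (fst u) (fst v)) (snd v)) (pad n v)"
    unfolding pad_def using homotopic_shift v n unfolding all_unitaries_iff by blast
  have r: "unitary_homotopic A n (pad n u) (pad n u)" by (intro homotopic_refl pad_unitaries u n')
  show "unitary_homotopic A n (pad n (u \<oplus>\<^sub>m v)) (mm n (pad n u) (pad n v))"
    unfolding pad_dsum(1)[OF u v n'(1)] by (rule homotopic_mult[OF r h])
  show "unitary_homotopic A n (pad n (u \<oplus>\<^sub>m v)) (mm n (pad n v) (pad n u))"
    unfolding pad_dsum(2)[OF u v n'(1)] by (rule homotopic_mult[OF h r])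
qed

abbreviation K1_class :: "nat \<times> (complex \<times> 'b) mtx \<Rightarrow> 'b K1_elt" where
  "K1_class u \<equiv> K1_rel A `` {u}"

lemma K1_class_eqI:
  assumes "u \<in> all_unitaries A" "v \<in> all_unitaries A" "fst u \<le> k" "fst v \<le> k"
    "unitary_homotopic A k (pad k u) (pad k v)"
  shows "K1_class u = K1_class v"
  by (rule equiv_class_eq[OF equiv_K1_rel]) (use assms in \<open>auto simp: K1_rel_iff\<close>)

lemma K1_class_carrier: "u \<in> all_unitaries A \<Longrightarrow> K1_class u \<in> carrier (K1 A)"
  unfolding K1_def by (simp add: quotientI)

lemma K1_carrierE:
  assumes "C \<in> carrier (K1 A)"
  obtains u where "u \<in> all_unitaries A" "C = K1_class u"
  using assms unfolding K1_def by (auto elim: quotientE)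

lemma K1_mult_class:
  assumes "u \<in> all_unitaries A" "v \<in> all_unitaries A"
  shows "K1_class u \<otimes>\<^bsub>K1 A\<^esub> K1_class v = K1_class (u \<oplus>\<^sub>m v)"
proof -
  have "K1_class (u \<oplus>\<^sub>m v) = K1_class (u' \<oplus>\<^sub>m v')" if uv: "(u, u') \<in> K1_rel A" "(v, v') \<in> K1_rel A" for u u' v v'
  proof -
    obtain k l where un: "u \<in> all_unitaries A" "u' \<in> all_unitaries A" "v \<in> all_unitaries A" "v' \<in> all_unitaries A"
      and k: "fst u \<le> k" "fst u' \<le> k" "unitary_homotopic A k (pad k u) (pad k u')"
      and l: "fst v \<le> l" "fst v' \<le> l" "unitary_homotopic A l (pad l v) (pad l v')"
      using uv unfolding K1_rel_iff by blast
    \<comment> \<open>Large enough to pad both given homotopies, and to leave the room for a shift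
      in both direct sums.\<close>
    define n where "n = k + 2 * l"
    have n: "k \<le> n" "l \<le> n" "fst u + 2 * fst v \<le> n" "fst u' + 2 * fst v' \<le> n" "fst (u \<oplus>\<^sub>m v) \<le> n" "fst (u' \<oplus>\<^sub>m v') \<le> n"
      using k l unfolding n_def dsum_def by auto
    have "unitary_homotopic A n (pad n (u \<oplus>\<^sub>m v)) (mm n (pad n u) (pad n v))"
      by (rule homotopic_pad_dsum(1)[OF un(1,3) n(3)])
    also have "unitary_homotopic A n \<dots> (mm n (pad n u') (pad n v'))"
      by (rule homotopic_mult[OF pad_homotopic_mono[OF un(1) k(1) un(2) k(2) n(1) k(3)]
            pad_homotopic_mono[OF un(3) l(1) un(4) l(2) n(2) l(3)]])
    also have "unitary_homotopic A n \<dots> (pad n (u' \<oplus>\<^sub>m v'))"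
      by (rule homotopic_sym[OF homotopic_pad_dsum(1)[OF un(2,4) n(4)]])
    finally show ?thesis
      by (intro K1_class_eqI[OF dsum_all_unitaries dsum_all_unitaries n(5,6)] un)
  qed
  then have "congruent2 (K1_rel A) (K1_rel A) (\<lambda>u v. K1_class (u \<oplus>\<^sub>m v))" by (rule congruent2I')
  from UN_equiv_class2[OF equiv_K1_rel equiv_K1_rel this assms] show ?thesis unfolding K1_def by simp
qed

text \<open>For unitaries of equal size the direct sum is homotopic, after padding, to the product.
  This provides inverses in \<open>K1 A\<close> and lets a class be split along a
  factorization.\<close>

lemma K1_class_mult:
  assumes u: "u \<in> unitaries A n" and v: "v \<in> unitaries A n"
  shows "K1_class (n, mm n u v) = K1_class (n, u) \<otimes>\<^bsub>K1 A\<^esub> K1_class (n, v)"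
proof -
  have un: "(n, u) \<in> all_unitaries A" "(n, v) \<in> all_unitaries A" "(n, mm n u v) \<in> all_unitaries A"
    using u v mult_unitaries unfolding all_unitaries_iff by auto
  \<comment> \<open>The size \<open>n + 2 * n\<close> required by \<open>homotopic_pad_dsum\<close>
    for two blocks of size \<open>n\<close>.\<close>
  have "unitary_homotopic A (3 * n) (pad (3 * n) ((n, u) \<oplus>\<^sub>m (n, v))) (mm (3 * n) (pad (3 * n) (n, u)) (pad (3 * n) (n, v)))"
    by (rule homotopic_pad_dsum(1)[OF un(1,2)]) simp
  also have "mm (3 * n) (pad (3 * n) (n, u)) (pad (3 * n) (n, v)) = pad (3 * n) (n, mm n u v)"
    unfolding pad_def by (simp add: amp_mult[OF shift_coisometry] unitaries_mats u v)
  finally have "K1_class ((n, u) \<oplus>\<^sub>m (n, v)) = K1_class (n, mm n u v)"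
    by (intro K1_class_eqI[OF dsum_all_unitaries[OF un(1,2)] un(3)]) (simp_all add: dsum_def)
  then show ?thesis by (simp add: K1_mult_class un)
qed

lemma zero_all_unitaries: "(0, I 0) \<in> all_unitaries A"
  by (simp add: all_unitaries_iff one_unitaries)

lemma K1_one: "\<one>\<^bsub>K1 A\<^esub> = K1_class (0, I 0)"
  unfolding K1_def by simp

lemma K1_class_one: "K1_class (n, I n) = \<one>\<^bsub>K1 A\<^esub>"
proof -
  have "(n, I n) \<in> all_unitaries A" by (simp add: all_unitaries_iff one_unitaries)
  moreover have "pad n (n, I n) = pad n (0, I 0)"
    unfolding pad_def by (simp add: amp_one shift_mats)
  ultimately show ?thesis unfolding K1_one
    by (intro K1_class_eqI[of _ _ n]) (simp_all add: zero_all_unitaries homotopic_refl pad_unitaries)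
qed

lemma comm_group_K1: "comm_group (K1 A)"
proof (rule comm_groupI)
  fix x y z assume "x \<in> carrier (K1 A)" "y \<in> carrier (K1 A)" "z \<in> carrier (K1 A)"
  then obtain u v w where u: "u \<in> all_unitaries A" "x = K1_class u" and v: "v \<in> all_unitaries A" "y = K1_class v"
    and w: "w \<in> all_unitaries A" "z = K1_class w" by (elim K1_carrierE)
  then show "x \<otimes>\<^bsub>K1 A\<^esub> y \<otimes>\<^bsub>K1 A\<^esub> z = x \<otimes>\<^bsub>K1 A\<^esub> (y \<otimes>\<^bsub>K1 A\<^esub> z)"
    by (simp add: K1_mult_class dsum_all_unitaries dsum_assoc)
next
  fix x y assume "x \<in> carrier (K1 A)" "y \<in> carrier (K1 A)"
  then obtain u v where u: "u \<in> all_unitaries A" "x = K1_class u" and v: "v \<in> all_unitaries A" "y = K1_class v"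
    by (elim K1_carrierE)
  then show "x \<otimes>\<^bsub>K1 A\<^esub> y \<in> carrier (K1 A)"
    by (simp add: K1_mult_class dsum_all_unitaries K1_class_carrier)
  define n where "n = 2 * fst u + 2 * fst v"
  have n: "fst u + 2 * fst v \<le> n" "fst v + 2 * fst u \<le> n" "fst (u \<oplus>\<^sub>m v) \<le> n" "fst (v \<oplus>\<^sub>m u) \<le> n"
    unfolding n_def dsum_def by auto
  have "unitary_homotopic A n (pad n (u \<oplus>\<^sub>m v)) (mm n (pad n v) (pad n u))"
    by (rule homotopic_pad_dsum(2)[OF u(1) v(1) n(1)])
  also have "unitary_homotopic A n \<dots> (pad n (v \<oplus>\<^sub>m u))"
    by (rule homotopic_sym[OF homotopic_pad_dsum(1)[OF v(1) u(1) n(2)]])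
  finally have "K1_class (u \<oplus>\<^sub>m v) = K1_class (v \<oplus>\<^sub>m u)"
    by (intro K1_class_eqI[OF dsum_all_unitaries dsum_all_unitaries n(3,4)] u v)
  then show "x \<otimes>\<^bsub>K1 A\<^esub> y = y \<otimes>\<^bsub>K1 A\<^esub> x"
    using u v by (simp add: K1_mult_class)
next
  show "\<one>\<^bsub>K1 A\<^esub> \<in> carrier (K1 A)" unfolding K1_one by (intro K1_class_carrier zero_all_unitaries)
  fix x assume "x \<in> carrier (K1 A)"
  then obtain u where u: "u \<in> all_unitaries A" "x = K1_class u" by (elim K1_carrierE)
  have "(0, I 0) \<oplus>\<^sub>m u = u" unfolding dsum_def by (cases u) (simp add: fun_eq_iff)
  then show "\<one>\<^bsub>K1 A\<^esub> \<otimes>\<^bsub>K1 A\<^esub> x = x"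
    using u K1_mult_class[OF zero_all_unitaries u(1)] by (simp add: K1_one)
  have un: "snd u \<in> unitaries A (fst u)" using u(1) unfolding all_unitaries_iff .
  have "K1_class (fst u, st (snd u)) \<otimes>\<^bsub>K1 A\<^esub> x = \<one>\<^bsub>K1 A\<^esub>"
    using K1_class_mult[OF star_unitaries[OF un] un] u(2)
    by (simp add: unitaries_left[OF un] K1_class_one)
  moreover have "K1_class (fst u, st (snd u)) \<in> carrier (K1 A)"
    by (rule K1_class_carrier) (simp add: all_unitaries_iff star_unitaries[OF un])
  ultimately show "\<exists>y\<in>carrier (K1 A). y \<otimes>\<^bsub>K1 A\<^esub> x = \<one>\<^bsub>K1 A\<^esub>" by blast
qed

end

subsection \<open>Functoriality\<close>

context star_algebra_hom
begin

lemma entries_one: "mtx_entries (map_prod id f) (mtx_one n) = mtx_one n"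
  using U.hom_zero unfolding mtx_one_def by (auto simp: fun_eq_iff zero_prod_def)

lemma entries_unitaries:
  assumes u: "u \<in> unitaries A n"
  shows "mtx_entries (map_prod id f) u \<in> unitaries B n"
proof -
  note um = A.unitaries_mats[OF u]
  show ?thesis
    by (rule B.unitariesI[OF U.entries_mats[OF um]])
      (simp_all only: A.unitaries_left[OF u] A.unitaries_right[OF u] entries_one
        flip: U.entries_star[OF um] U.entries_mult[OF A.U.star_mats[OF um] um]
          U.entries_mult[OF um A.U.star_mats[OF um]])
qed

lemma mtx_map_all_unitaries: "u \<in> all_unitaries A \<Longrightarrow> mtx_map (map_prod id f) u \<in> all_unitaries B"
  unfolding A.all_unitaries_iff B.all_unitaries_iff mtx_map_def using entries_unitaries by simp

lemma entries_pad:
  assumes "u \<in> all_unitaries A"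
  shows "mtx_entries (map_prod id f) (A.pad n u) = B.pad n (mtx_map (map_prod id f) u)"
proof -
  note um = A.unitaries_mats[OF assms[unfolded A.all_unitaries_iff]]
  note vm = B.unitaries_mats[OF mtx_map_all_unitaries[OF assms, unfolded B.all_unitaries_iff]]
  \<comment> \<open>The identity matrices of sizes \<open>n\<close> and \<open>fst u\<close> have
    different formats; they and \<open>u\<close> are read in the common format
    \<open>max n (fst u)\<close>, where additivity of the entrywise map applies.\<close>
  have o: "mtx_one k \<in> mats (unitize A) (max n (fst u)) (max n (fst u))" if "k \<in> {n, fst u}" for k
    using that by (intro A.one_mats) auto
  have um': "snd u \<in> mats (unitize A) (max n (fst u)) (max n (fst u))"
    by (rule A.U.mats_mono[OF um]) auto
  have "mtx_entries (map_prod id f) (mtx_one n + (snd u - mtx_one (fst u))) =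
      mtx_entries (map_prod id f) (mtx_one n) +
        (mtx_entries (map_prod id f) (snd u) - mtx_entries (map_prod id f) (mtx_one (fst u)))"
    by (simp only: U.entries_add[OF o A.U.diff_mats[OF um' o]] U.entries_diff[OF um' o] insertI1 insertI2 singletonI)
  then show ?thesis
    unfolding A.pad_eq[OF um] B.pad_eq[OF vm] unfolding entries_one mtx_map_def fst_conv snd_conv .
qed

lemma entries_homotopic:
  assumes "unitary_homotopic A n u v"
  shows "unitary_homotopic B n (mtx_entries (map_prod id f) u) (mtx_entries (map_prod id f) v)"
proof -
  obtain \<gamma> :: "real \<Rightarrow> _" where g: "\<forall>s\<in>{0..1}. \<gamma> s \<in> unitaries A n" "\<gamma> 0 = u" "\<gamma> 1 = v"
    "\<forall>i j. continuous_on {0..1} (\<lambda>s. \<gamma> s i j)" using A.homotopicE[OF assms] .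
  note g = g(1)[rule_format] g(2,3) g(4)[rule_format]
  show ?thesis
  proof (rule B.homotopicI[of "\<lambda>s. mtx_entries (map_prod id f) (\<gamma> s)"])
    fix i j
    have "snd (\<gamma> s i j) \<in> elems A" if "s \<in> {0..1}" for s
      using A.U.mats_entry[OF A.unitaries_mats[OF g(1)[OF that]], of i j] by (auto simp: mem_Times_iff)
    then have "continuous_on {0..1} (\<lambda>s. f (snd (\<gamma> s i j)))"
      by (intro continuous_on_compose2[OF hom_continuous continuous_on_snd[OF g(4)]]) auto
    then show "continuous_on {0..1} (\<lambda>s. map_prod id f (\<gamma> s i j))"
      unfolding map_prod_def case_prod_unfold id_apply
      by (intro continuous_on_Pair continuous_on_fst g(4))
  qed (simp_all add: g entries_unitaries)
qed

lemma K1_map_class: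
  assumes "u \<in> all_unitaries A"
  shows "K1_map B f (A.K1_class u) = B.K1_class (mtx_map (map_prod id f) u)"
proof -
  have "(\<lambda>u. B.K1_class (mtx_map (map_prod id f) u)) respects K1_rel A"
  proof (rule congruentI)
    fix u v assume "(u, v) \<in> K1_rel A"
    then obtain k where un: "u \<in> all_unitaries A" "v \<in> all_unitaries A"
      and k: "fst u \<le> k" "fst v \<le> k" "unitary_homotopic A k (A.pad k u) (A.pad k v)"
      unfolding A.K1_rel_iff by blast
    have "unitary_homotopic B k (B.pad k (mtx_map (map_prod id f) u)) (B.pad k (mtx_map (map_prod id f) v))"
      using entries_homotopic[OF k(3)] unfolding entries_pad[OF un(1)] entries_pad[OF un(2)] .
    then show "B.K1_class (mtx_map (map_prod id f) u) = B.K1_class (mtx_map (map_prod id f) v)"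
      by (rule B.K1_class_eqI[rotated -1]) (simp_all add: mtx_map_all_unitaries un k(1,2))
  qed
  from UN_equiv_class[OF A.equiv_K1_rel this assms] show ?thesis unfolding K1_map_def .
qed

lemma K1_map_hom: "K1_map B f \<in> hom (K1 A) (K1 B)"
proof (rule homI)
  fix x assume "x \<in> carrier (K1 A)"
  then obtain u where "u \<in> all_unitaries A" "x = A.K1_class u" by (rule A.K1_carrierE)
  then show "K1_map B f x \<in> carrier (K1 B)"
    by (simp add: K1_map_class mtx_map_all_unitaries B.K1_class_carrier)
next
  fix x y assume "x \<in> carrier (K1 A)" "y \<in> carrier (K1 A)"
  then obtain u v where "u \<in> all_unitaries A" "x = A.K1_class u" "v \<in> all_unitaries A" "y = A.K1_class v"
    by (elim A.K1_carrierE)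
  then show "K1_map B f (x \<otimes>\<^bsub>K1 A\<^esub> y) = K1_map B f x \<otimes>\<^bsub>K1 B\<^esub> K1_map B f y"
    by (simp add: A.K1_mult_class B.K1_mult_class K1_map_class mtx_map_all_unitaries U.mtx_map_dsum
        A.dsum_all_unitaries)
qed

end

context star_algebra
begin

lemma pad_self: "u \<in> all_unitaries A \<Longrightarrow> pad (fst u) u = snd u"
  using unitaries_mats[of "snd u" "fst u"] by (subst pad_eq) (simp_all add: all_unitaries_iff)

lemma K1_class_homotopic:
  assumes "unitary_homotopic A n u v"
  shows "K1_class (n, u) = K1_class (n, v)"
proof -
  have un: "(n, u) \<in> all_unitaries A" "(n, v) \<in> all_unitaries A"
    using homotopic_unitaries[OF assms] by (simp_all add: all_unitaries_iff)
  show ?thesis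
    using assms pad_self[OF un(1)] pad_self[OF un(2)] by (intro K1_class_eqI[OF un, of n]) simp_all
qed

end

lemma (in star_algebra_hom) entries_amp:
  assumes h: "h \<in> mats (unitize A) m n" and v: "v \<in> mats (unitize A) m m"
  shows "mtx_entries (map_prod id f) (A.amp m n h v) =
    B.amp m n (mtx_entries (map_prod id f) h) (mtx_entries (map_prod id f) v)"
proof -
  have d: "v - A.I m \<in> mats (unitize A) m m" by (intro A.U.diff_mats v A.I_mats)
  show ?thesis
    unfolding A.amp_def B.amp_def U.entries_add[OF A.I_mats A.conj_mats[OF h d]]
    unfolding A.conj_mtx_def B.conj_mtx_def
      U.entries_mult[OF A.U.star_mats[OF h] A.U.mult_mats[OF d h]] U.entries_mult[OF d h]
      U.entries_star[OF h] U.entries_diff[OF v A.I_mats] entries_one ..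
qed

section \<open>Agreement of the two corners on K-one\<close>

context corner_hom
begin

lemma block_map_one: "block_map n (mtx_one k) = mtx_one k"
  unfolding block_map_def mtx_one_def by (auto simp: fun_eq_iff h_zero zero_prod_def)

lemma block_map_unitaries:
  assumes u: "u \<in> unitaries A k" and bs: "block_scalar n u"
  shows "block_map n u \<in> unitaries B k"
proof -
  note um = A.unitaries_mats[OF u]
  have bs': "block_scalar n (mtx_star (unitize A) u)"
    unfolding block_scalar_def
  proof (intro allI impI)
    fix i j assume "(n \<le> i) \<noteq> (n \<le> j)"
    then have "fst (u j i) = 0" using bs unfolding block_scalar_def by blast
    then show "fst (mtx_star (unitize A) u i j) = 0" unfolding mtx_star_def by (cases "u j i") simp
  qed
  show ?thesis
    by (rule B.unitariesI[OF block_map_mats[OF um]])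
      (simp_all add: A.unitaries_left[OF u] A.unitaries_right[OF u] block_map_one
        flip: block_map_star[OF um] block_map_mult[OF A.U.star_mats[OF um] um bs' bs]
          block_map_mult[OF um A.U.star_mats[OF um] bs bs'])
qed

text \<open>The path \<open>w \<oplus> w\<^sup>*\<close> to \<open>1\<close> obtained by rotating \<open>w\<close> into the lower right corner has scalar part
  \<open>1\<close> throughout if \<open>w\<close> does, so that \<open>block_map\<close> applies to it.\<close>

lemma K1_corner_inverse:
  assumes w: "w \<in> unitaries A n" and sw: "mtx_entries scalar_part w = mtx_one n"
  shows "B.K1_class (mtx_map (map_prod id (h False False)) (n, w)) \<otimes>\<^bsub>K1 B\<^esub>
    B.K1_class (mtx_map (map_prod id (h True True)) (n, mtx_star (unitize A) w)) = \<one>\<^bsub>K1 B\<^esub>"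
proof -
  interpret f: star_algebra_hom A B "h False False" by (rule star_algebra_hom)
  interpret t: star_algebra_hom A B "h True True" by (rule star_algebra_hom)
  let ?N = "n + n" and ?v = "mtx_star (unitize A) w"
  let ?f = "shift_mtx 0 n :: (complex \<times> 'b) mtx" and ?g = "shift_mtx n n :: (complex \<times> 'b) mtx"
  have v: "?v \<in> unitaries A n" by (rule A.star_unitaries[OF w])
  note wm = A.unitaries_mats[OF w] and vm = A.unitaries_mats[OF v]
  have un: "(n, w) \<in> all_unitaries A" "(n, ?v) \<in> all_unitaries A"
    using w v by (simp_all add: A.all_unitaries_iff)
  have cf: "A.coisometry n ?N ?f" and cg: "A.coisometry n ?N ?g" by (intro A.shift_coisometry; simp)+
  note fm = A.shift_mats[of 0 n ?N, simplified] and gm = A.shift_mats[of n n ?N, simplified]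
  have rc: "A.coisometry n ?N (rotation ?f ?g s)" for s
    by (intro A.rotation_amp_coisometry cf cg A.shift_orthogonal; simp)
  note rm = A.U.rotation_mats[OF fm gm]
  \<comment> \<open>The factor with \<open>w*\<close> stays in the lower right corner throughout;
    when \<open>w\<close> arrives there, the product is the amplification of
    \<open>w w* = 1\<close>.\<close>
  define \<gamma> where "\<gamma> s = A.mm ?N (A.amp n ?N (rotation ?f ?g s) w) (A.amp n ?N ?g ?v)" for s
  have g0: "\<gamma> 0 = snd ((n, w) \<oplus>\<^sub>m (n, ?v))"
    using A.pad_dsum(1)[OF un, of ?N] A.pad_self[OF A.dsum_all_unitaries[OF un]]
    unfolding \<gamma>_def rotation_0 A.pad_def by (simp add: dsum_def)
  have g1: "\<gamma> 1 = mtx_one ?N"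
    unfolding \<gamma>_def rotation_1 A.amp_mult[OF cg wm vm] A.unitaries_right[OF w] by (rule A.amp_one[OF gm])
  have gu: "\<gamma> s \<in> unitaries A ?N" for s
    unfolding \<gamma>_def by (intro A.mult_unitaries A.amp_unitaries rc cg w v)
  have sr: "mtx_entries scalar_part (rotation ?f ?g s) = rotation ?f ?g s" for s
    unfolding rotation_def scale_mtx_def shift_mtx_def by (auto simp: fun_eq_iff prod_eq_iff)
  have sg: "mtx_entries scalar_part ?g = ?g"
    unfolding shift_mtx_def by (auto simp: fun_eq_iff zero_prod_def)
  have sv: "mtx_entries scalar_part ?v = mtx_one n"
    unfolding scalar.U.entries_star[OF wm] sw by (rule A.star_one)
  \<comment> \<open>Shifts and rotations are purely scalar, so the scalar part of the path results
    from replacing \<open>w\<close> and \<open>w*\<close> by their scalar parts, both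
    \<open>1\<close>.\<close>
  have "mtx_entries scalar_part (\<gamma> s) = mtx_one ?N" for s
    unfolding \<gamma>_def scalar.U.entries_mult[OF A.amp_mats[OF rm wm] A.amp_mats[OF gm vm]]
      scalar.entries_amp[OF rm wm] scalar.entries_amp[OF gm vm] sr sg sw sv A.amp_one[OF rm] A.amp_one[OF gm]
    by (rule A.one_mult[OF A.I_mats order_refl])
  then have "fst (\<gamma> s i j) = fst (mtx_one ?N i j :: complex \<times> 'b)" for s i j
    by (metis fst_map_prod id_apply)
  then have bs: "block_scalar n (\<gamma> s)" for s
    unfolding block_scalar_def mtx_one_def by auto
  have "unitary_homotopic B ?N (block_map n (\<gamma> 0)) (block_map n (\<gamma> 1))"
  proof (rule B.homotopicI[of "\<lambda>s. block_map n (\<gamma> s)"])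
    fix i j
    have "continuous_on {0..1} (\<lambda>s. \<gamma> s i j)"
      unfolding \<gamma>_def
      by (rule A.continuous_mm[where a = ?N and b = ?N])
        (simp_all add: A.rotation_amp_continuous[OF fm gm wm] A.amp_mats[OF rm wm] A.amp_mats[OF gm vm])
    moreover have "snd (\<gamma> s i j) \<in> elems A" for s
      using A.U.mats_entry[OF A.unitaries_mats[OF gu], of s i j] by (auto simp: mem_Times_iff)
    ultimately have "continuous_on {0..1} (\<lambda>s. h (n \<le> i) (n \<le> j) (snd (\<gamma> s i j)))"
      by (intro continuous_on_compose2[OF h_continuous continuous_on_snd]) auto
    then show "continuous_on {0..1} (\<lambda>s. block_map n (\<gamma> s) i j)"
      unfolding block_map_def map_prod_def case_prod_unfold id_apply
      by (intro continuous_on_Pair continuous_on_fst \<open>continuous_on {0..1} (\<lambda>s. \<gamma> s i j)\<close>)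
  qed (simp_all add: block_map_unitaries gu bs)
  then have "B.K1_class (?N, block_map n (\<gamma> 0)) = B.K1_class (?N, mtx_one ?N)"
    unfolding g1 block_map_one by (rule B.K1_class_homotopic)
  moreover have "(?N, block_map n (\<gamma> 0)) =
      mtx_map (map_prod id (h False False)) (n, w) \<oplus>\<^sub>m mtx_map (map_prod id (h True True)) (n, ?v)"
    unfolding g0 dsum_blk mtx_map_def snd_conv fst_conv block_map_blk ..
  ultimately show ?thesis
    by (simp add: B.K1_mult_class f.mtx_map_all_unitaries[OF un(1)] t.mtx_map_all_unitaries[OF un(2)]
        B.K1_class_one)
qed

text \<open>Write \<open>u = w s\<close> with \<open>s\<close> the scalar part of \<open>u\<close>,
  so that \<open>w\<close> has scalar part \<open>1\<close>. The corners agree on the scalar matrix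
  \<open>s\<close>. On \<open>w\<close>, either corner gives an inverse of the class of
  \<open>h True True\<close> applied to \<open>w*\<close>: one by \<open>K1_corner_inverse\<close>
  for \<open>h\<close>, the other by the same lemma for the constant family. Inverses are
  unique.\<close>

lemma K1_map_corners:
  assumes "C \<in> carrier (K1 A)"
  shows "K1_map B (h False False) C = K1_map B (h True True) C"
proof -
  interpret const: corner_hom A B "\<lambda>_ _. h True True" by (rule corner_hom_constant)
  interpret f: star_algebra_hom A B "h False False" by (rule star_algebra_hom)
  interpret t: star_algebra_hom A B "h True True" by (rule star_algebra_hom)
  interpret G: comm_group "K1 B" by (rule B.comm_group_K1)
  let ?f = "map_prod id (h False False) :: complex \<times> 'b \<Rightarrow> complex \<times> 'c"
  let ?t = "map_prod id (h True True) :: complex \<times> 'b \<Rightarrow> complex \<times> 'c"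
  obtain U where U: "U \<in> all_unitaries A" "C = A.K1_class U" using A.K1_carrierE[OF assms] .
  obtain n u where nu: "U = (n, u)" by (cases U)
  have u: "u \<in> unitaries A n" using U(1) unfolding nu A.all_unitaries_iff by simp
  define s where "s = mtx_entries scalar_part u"
  have s: "s \<in> unitaries A n" unfolding s_def by (rule scalar.entries_unitaries[OF u])
  define w where "w = A.mm n u (A.st s)"
  have w: "w \<in> unitaries A n" unfolding w_def by (intro A.mult_unitaries A.star_unitaries u s)
  note um = A.unitaries_mats[OF u] and sm = A.unitaries_mats[OF s] and wm = A.unitaries_mats[OF w]
  have ss: "mtx_entries scalar_part s = s" unfolding s_def by (simp add: fun_eq_iff prod_eq_iff)
  have sw: "mtx_entries scalar_part w = mtx_one n"
    unfolding w_def scalar.U.entries_mult[OF um A.U.star_mats[OF sm]] scalar.U.entries_star[OF sm] ss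
    unfolding s_def[symmetric] by (rule A.unitaries_right[OF s])
  have ws: "A.mm n w s = u"
    unfolding w_def A.U.mtx_assoc[OF um A.U.star_mats[OF sm] sm] A.unitaries_left[OF s]
    by (rule A.mult_one[OF um order_refl])
  have scal: "mtx_entries ?f s = mtx_entries ?t s"
    unfolding s_def by (simp add: fun_eq_iff prod_eq_iff h_zero)
  have un: "(n, w) \<in> all_unitaries A" "(n, A.st w) \<in> all_unitaries A" "(n, s) \<in> all_unitaries A"
    using w s A.star_unitaries[OF w] by (simp_all add: A.all_unitaries_iff)
  have split_f: "K1_map B (h False False) C = B.K1_class (n, mtx_entries ?f w) \<otimes>\<^bsub>K1 B\<^esub> B.K1_class (n, mtx_entries ?f s)"
    unfolding U(2) f.K1_map_class[OF U(1)] unfolding nu mtx_map_def fst_conv snd_conv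
      f.U.entries_mult[OF wm sm, unfolded ws]
    by (rule B.K1_class_mult[OF f.entries_unitaries[OF w] f.entries_unitaries[OF s]])
  have split_t: "K1_map B (h True True) C = B.K1_class (n, mtx_entries ?t w) \<otimes>\<^bsub>K1 B\<^esub> B.K1_class (n, mtx_entries ?t s)"
    unfolding U(2) t.K1_map_class[OF U(1)] unfolding nu mtx_map_def fst_conv snd_conv
      t.U.entries_mult[OF wm sm, unfolded ws]
    by (rule B.K1_class_mult[OF t.entries_unitaries[OF w] t.entries_unitaries[OF s]])
  note cl = B.K1_class_carrier[OF f.mtx_map_all_unitaries[OF un(1)]]
    B.K1_class_carrier[OF t.mtx_map_all_unitaries[OF un(1)]]
    B.K1_class_carrier[OF t.mtx_map_all_unitaries[OF un(2)]]
  have "B.K1_class (mtx_map ?f (n, w)) = B.K1_class (mtx_map ?t (n, w))"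
    by (rule G.right_cancel[OF cl(3,1,2), THEN iffD1])
      (simp only: K1_corner_inverse[OF w sw] const.K1_corner_inverse[OF w sw])
  then show ?thesis unfolding split_f split_t scal by (simp add: mtx_map_def)
qed

end

section \<open>Composites and identities on K-theory\<close>

lemma K_map_comp:
  assumes f: "star_algebra_hom A B f" and g: "star_algebra_hom B C g" and k: "star_algebra_hom A C k"
    and eq: "\<And>a. a \<in> elems A \<Longrightarrow> k a = g (f a)"
  shows "x \<in> carrier (K0 A) \<Longrightarrow> K0_map C k x = K0_map C g (K0_map B f x)"
    and "y \<in> carrier (K1 A) \<Longrightarrow> K1_map C k y = K1_map C g (K1_map B f y)"
proof -
  interpret f: star_algebra_hom A B f by (rule f)
  interpret g: star_algebra_hom B C g by (rule g)
  interpret k: star_algebra_hom A C k by (rule k)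
  have map: "mtx_map (map_prod id k) (n, M) = mtx_map (map_prod id g) (mtx_map (map_prod id f) (n, M))"
    if "M \<in> mats (unitize A) n n" for n M
    using f.A.U.mats_entry[OF that] unfolding mtx_map_def by (auto simp: fun_eq_iff prod_eq_iff eq mem_Times_iff)
  {
    assume "x \<in> carrier (K0 A)"
    then obtain p q where pq: "p \<in> projs (unitize A)" "q \<in> projs (unitize A)" "x = f.A.U.K00_class p q"
      by (rule f.A.K0_carrierE)
    have "mtx_map (map_prod id k) r = mtx_map (map_prod id g) (mtx_map (map_prod id f) r)"
      if "r \<in> projs (unitize A)" for r
      using map[of "snd r" "fst r"] f.A.U.projsD(1)[OF that] by simp
    then show "K0_map C k x = K0_map C g (K0_map B f x)"
      using pq by (simp add: f.K0_map_class g.K0_map_class k.K0_map_class f.U.mtx_map_projs)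
  }
  {
    assume "y \<in> carrier (K1 A)"
    then obtain u where u: "u \<in> all_unitaries A" "y = f.A.K1_class u" by (rule f.A.K1_carrierE)
    have "mtx_map (map_prod id k) u = mtx_map (map_prod id g) (mtx_map (map_prod id f) u)"
      using map[of "snd u" "fst u"] u(1) f.A.unitaries_mats[of "snd u" "fst u"]
      unfolding f.A.all_unitaries_iff by simp
    then show "K1_map C k y = K1_map C g (K1_map B f y)"
      using u by (simp add: f.K1_map_class g.K1_map_class k.K1_map_class f.mtx_map_all_unitaries)
  }
qed

text \<open>The identity is required on elements only, because conjugation by
  \<open>orth_proj H\<close> compresses operators of the type that do not live on
  \<open>H\<close>.\<close>

lemma K_map_ident:
  assumes f: "star_algebra_hom A A f" and eq: "\<And>a. a \<in> elems A \<Longrightarrow> f a = a"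
  shows "x \<in> carrier (K0 A) \<Longrightarrow> K0_map A f x = x" and "y \<in> carrier (K1 A) \<Longrightarrow> K1_map A f y = y"
proof -
  interpret f: star_algebra_hom A A f by (rule f)
  have map: "mtx_map (map_prod id f) (n, M) = (n, M)" if "M \<in> mats (unitize A) n n" for n M
    using f.A.U.mats_entry[OF that] unfolding mtx_map_def by (auto simp: fun_eq_iff prod_eq_iff eq mem_Times_iff)
  {
    assume "x \<in> carrier (K0 A)"
    then obtain p q where pq: "p \<in> projs (unitize A)" "q \<in> projs (unitize A)" "x = f.A.U.K00_class p q"
      by (rule f.A.K0_carrierE)
    have "mtx_map (map_prod id f) r = r" if "r \<in> projs (unitize A)" for r
      using map[of "snd r" "fst r"] f.A.U.projsD(1)[OF that] by simp
    then show "K0_map A f x = x" using pq by (simp add: f.K0_map_class)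
  }
  {
    assume "y \<in> carrier (K1 A)"
    then obtain u where u: "u \<in> all_unitaries A" "y = f.A.K1_class u" by (rule f.A.K1_carrierE)
    have "mtx_map (map_prod id f) u = u"
      using map[of "snd u" "fst u"] u(1) f.A.unitaries_mats[of "snd u" "fst u"]
      unfolding f.A.all_unitaries_iff by simp
    then show "K1_map A f y = y" using u by (simp add: f.K1_map_class)
  }
qed

section \<open>Discrete coarse modules\<close>

interpretation blinfun_compose: bounded_bilinear
    "blinfun_compose :: ('b::real_normed_vector \<Rightarrow>\<^sub>L 'c::real_normed_vector)
      \<Rightarrow> ('a::real_normed_vector \<Rightarrow>\<^sub>L 'b) \<Rightarrow> 'a \<Rightarrow>\<^sub>L 'c"
  by (rule bounded_bilinear_blinfun_compose)

text \<open>Fixes the gauge and the partition whose existence \<open>discrete_module\<close>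
  asserts, so that hulls by pieces and operators defined piece by piece can refer to them.\<close>

locale partitioned_module =
  fixes X :: "'a coarse" and M :: "('a, 'h::chilbert_space) cmodule" and E P
  assumes space: "coarse_space X" and module: "coarse_module X M" and gauge: "gauge_of X E"
    and partition: "partition_on (points X) P" and pieces_meas: "P \<subseteq> meas M"
    and pieces_bounded: "\<And>A. A \<in> P \<Longrightarrow> ent_bounded X E A"
    and pieces_sum: "\<And>v. v \<in> hsp M \<Longrightarrow> ((\<lambda>A. blinfun_apply (chi M A) v) has_sum v) P"
    and meas_if_pieces: "\<And>C. C \<subseteq> points X \<Longrightarrow> (\<And>A. A \<in> P \<Longrightarrow> C \<inter> A \<in> meas M) \<Longrightarrow> C \<in> meas M"

lemma partitioned_module_obtain:
  assumes "coarse_space X" "coarse_module X M" "discrete_module X M"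
  obtains E P where "partitioned_module X M E P"
proof -
  from assms(3) obtain E P where *: "gauge_of X E" "partition_on (points X) P" "P \<subseteq> meas M"
    "\<forall>A\<in>P. ent_bounded X E A" "\<forall>v\<in>hsp M. ((\<lambda>A. blinfun_apply (chi M A) v) has_sum v) P"
    "\<forall>C. C \<subseteq> points X \<and> (\<forall>A\<in>P. C \<inter> A \<in> meas M) \<longrightarrow> C \<in> meas M"
    unfolding discrete_module_def by (elim exE conjE)
  show ?thesis
    by (rule that[of E P], unfold_locales) (simp_all add: assms(1,2) *)
qed

context partitioned_module
begin

lemma E_ents: "E \<in> ents X" and E_converse: "E\<inverse> = E" and E_refl: "Id_on (points X) \<subseteq> E"
  using gauge unfolding gauge_of_def by auto

lemma hsp: "hilbert_sub (hsp M)"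
  using module unfolding coarse_module_def by blast

lemma algebra_meas: "algebra (points X) (meas M)"
  using module unfolding coarse_module_def by blast

lemma meas_subset: "A \<in> meas M \<Longrightarrow> A \<subseteq> points X"
  using algebra_meas[unfolded algebra_iff_Int] by blast

lemma meas_Int: "A \<in> meas M \<Longrightarrow> B \<in> meas M \<Longrightarrow> A \<inter> B \<in> meas M"
  using algebra_meas[unfolded algebra_iff_Int] by blast

lemma meas_compl: "A \<in> meas M \<Longrightarrow> points X - A \<in> meas M"
  using algebra_meas[unfolded algebra_iff_Int] by blast

lemma meas_empty: "{} \<in> meas M"
  using algebra_meas[unfolded algebra_iff_Int] by blast

lemma meas_points: "points X \<in> meas M"
  using meas_compl[OF meas_empty] by simp

lemma chi_projection: "A \<in> meas M \<Longrightarrow> hilbert_projection (hsp M) (chi M A)"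
  using module unfolding coarse_module_def by blast

lemma chi_bops: "A \<in> meas M \<Longrightarrow> chi M A \<in> bops (hsp M) (hsp M)"
  and chi_idem: "A \<in> meas M \<Longrightarrow> chi M A o\<^sub>L chi M A = chi M A"
  and chi_adj: "A \<in> meas M \<Longrightarrow> op_adj (chi M A) = chi M A"
  using chi_projection unfolding hilbert_projection_def by auto

lemma chi_empty: "chi M {} = 0"
  and chi_points_apply: "v \<in> hsp M \<Longrightarrow> blinfun_apply (chi M (points X)) v = v"
  and chi_Int: "A \<in> meas M \<Longrightarrow> B \<in> meas M \<Longrightarrow> chi M (A \<inter> B) = chi M A o\<^sub>L chi M B"
  and chi_Un: "A \<in> meas M \<Longrightarrow> B \<in> meas M \<Longrightarrow>
    chi M (A \<union> B) = chi M A + chi M B - (chi M A o\<^sub>L chi M B)"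
  using module unfolding coarse_module_def by blast+

lemma chi_points: "chi M (points X) = orth_proj (hsp M)"
  by (rule bops_eqI[OF hsp chi_bops[OF meas_points] orth_proj_bops[OF hsp]])
    (simp add: chi_points_apply orth_proj_id[OF hsp])

lemma chi_compl:
  assumes A: "A \<in> meas M"
  shows "chi M A + chi M (points X - A) = orth_proj (hsp M)"
proof -
  have "A \<inter> (points X - A) = {}" "A \<union> (points X - A) = points X" using meas_subset[OF A] by auto
  then show ?thesis
    using chi_Un[OF A meas_compl[OF A]] chi_Int[OF A meas_compl[OF A]] chi_empty chi_points by simp
qed

lemma compl_zero:
  assumes A: "A \<in> meas M" and t: "t \<in> bops K (hsp M)" and "chi M (points X - A) o\<^sub>L t = 0"
  shows "chi M A o\<^sub>L t = t"
proof -
  have "(chi M A + chi M (points X - A)) o\<^sub>L t = t"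
    unfolding chi_compl[OF A] by (rule bops_orth_proj_left[OF hsp t])
  then show ?thesis using assms(3) by (simp add: blinfun_compose.add_left)
qed

text \<open>A vector in the range of \<open>chi M D\<close> is the strong sum of its components over
  the pieces, and each of them vanishes.\<close>

lemma pieces_zero:
  assumes D: "D \<in> meas M" and t: "t \<in> bops K (hsp M)"
    and "\<And>A. A \<in> P \<Longrightarrow> chi M (A \<inter> D) o\<^sub>L t = 0"
  shows "chi M D o\<^sub>L t = 0"
proof (rule blinfun_eqI)
  fix v
  let ?w = "blinfun_apply (chi M D) (blinfun_apply t v)"
  have "blinfun_apply (chi M A) ?w = 0" if "A \<in> P" for A
  proof -
    have Am: "A \<in> meas M" using that pieces_meas by blast
    have "blinfun_apply (chi M A o\<^sub>L chi M D o\<^sub>L t) v = 0"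
      unfolding chi_Int[OF Am D, symmetric] assms(3)[OF that] by simp
    then show ?thesis by simp
  qed
  moreover have "((\<lambda>A. blinfun_apply (chi M A) ?w) has_sum ?w) P"
    by (rule pieces_sum) (rule bops_in[OF chi_bops[OF D]])
  ultimately have "((\<lambda>_. 0) has_sum ?w) P" by (simp cong: has_sum_cong)
  then have "?w = 0" by (rule has_sum_unique) simp
  then show "blinfun_apply (chi M D o\<^sub>L t) v = blinfun_apply 0 v" by simp
qed

text \<open>A measurable hull of an arbitrary set: discreteness makes any such union of pieces
  measurable, and it exceeds \<open>D\<close> by no more than the gauge \<open>E\<close>.\<close>

definition saturate :: "'a set \<Rightarrow> 'a set" where
  "saturate D = \<Union>{A \<in> P. A \<inter> D \<noteq> {}}"

lemma saturate_meas: "saturate D \<in> meas M"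
proof (rule meas_if_pieces)
  show "saturate D \<subseteq> points X" unfolding saturate_def using partition unfolding partition_on_def by blast
  fix A assume A: "A \<in> P"
  have "saturate D \<inter> A = (if A \<inter> D = {} then {} else A)"
  proof (cases "A \<inter> D = {}")
    case True
    have "B = A" if "B \<in> P" "B \<inter> A \<noteq> {}" for B
      using A that partition unfolding partition_on_def disjoint_def by blast
    then show ?thesis unfolding saturate_def using True by auto
  qed (use A in \<open>auto simp: saturate_def\<close>)
  then show "saturate D \<inter> A \<in> meas M" using A pieces_meas meas_empty by auto
qed

lemma subset_saturate: "points X \<inter> D \<subseteq> saturate D"
  unfolding saturate_def using partition unfolding partition_on_def by blast

lemma saturate_subset: "saturate D \<subseteq> rel_img E D"
proof
  fix y assume "y \<in> saturate D"
  then obtain A x where "A \<in> P" "y \<in> A" "x \<in> A" "x \<in> D" unfolding saturate_def by blast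
  moreover from this have "(y, x) \<in> E" using pieces_bounded unfolding ent_bounded_def by blast
  ultimately show "y \<in> rel_img E D" unfolding rel_img_def by blast
qed

lemma cbounded_saturate: "cbounded X D \<Longrightarrow> cbounded X (saturate D)"
  by (rule cbounded_subset[OF space cbounded_thicken[OF space E_ents] saturate_subset])

end

subsection \<open>Supports\<close>

lemma supp_in_mono: "supp_in M N t S \<Longrightarrow> S \<subseteq> S' \<Longrightarrow> supp_in M N t S'"
  unfolding supp_in_def separated_def rel_img_def by blast

lemma supp_in_add:
  assumes "supp_in M N s S" "supp_in M N t T"
  shows "supp_in M N (s + t) (S \<union> T)"
  unfolding supp_in_def
proof (intro ballI impI)
  fix B A assume BA: "B \<in> meas N" "A \<in> meas M" "separated (S \<union> T) B A"
  then have "separated S B A" "separated T B A" unfolding separated_def rel_img_def by blast+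
  then have "chi N B o\<^sub>L s o\<^sub>L chi M A = 0" "chi N B o\<^sub>L t o\<^sub>L chi M A = 0"
    using assms BA unfolding supp_in_def by blast+
  then show "chi N B o\<^sub>L (s + t) o\<^sub>L chi M A = 0"
    by (simp add: blinfun_compose.add_left blinfun_compose.add_right)
qed

text \<open>The image of \<open>A\<close> under \<open>S\<close> need not be measurable, but the
  complement of its hull is, and it is \<open>S\<close>-separated from \<open>A\<close>; thus
  nothing of \<open>t o\<^sub>L chi M A\<close> lies outside of the hull.\<close>

lemma supp_saturate:
  assumes M: "partitioned_module X M E P" and N: "partitioned_module Y N F Q"
    and t: "t \<in> bops (hsp M) (hsp N)" and supp: "supp_in M N t S" and A: "A \<in> meas M"
  shows "chi N (partitioned_module.saturate Q (rel_img S A)) o\<^sub>L (t o\<^sub>L chi M A) = t o\<^sub>L chi M A"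
proof -
  interpret M: partitioned_module X M E P by (rule M)
  interpret N: partitioned_module Y N F Q by (rule N)
  let ?D = "N.saturate (rel_img S A)"
  have "separated S (points Y - ?D) A" unfolding separated_def using N.subset_saturate by blast
  then have "chi N (points Y - ?D) o\<^sub>L (t o\<^sub>L chi M A) = 0"
    using supp A N.meas_compl[OF N.saturate_meas] unfolding supp_in_def by (simp add: blinfun_compose_assoc)
  then show ?thesis
    by (rule N.compl_zero[OF N.saturate_meas compose_bops[OF t M.chi_bops[OF A]]])
qed

lemma supp_in_adj:
  assumes M: "partitioned_module X M E P" and N: "partitioned_module Y N F Q"
    and t: "t \<in> bops (hsp M) (hsp N)" and supp: "supp_in M N t S"
  shows "supp_in N M (op_adj t) (S\<inverse>)"
  unfolding supp_in_def
proof (intro ballI impI)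
  interpret M: partitioned_module X M E P by (rule M)
  interpret N: partitioned_module Y N F Q by (rule N)
  fix A B assume AB: "A \<in> meas M" "B \<in> meas N" "separated (S\<inverse>) A B"
  then have "separated S B A" unfolding separated_def rel_img_def by blast
  then have "chi N B o\<^sub>L t o\<^sub>L chi M A = 0" using supp AB unfolding supp_in_def by blast
  moreover have "op_adj (chi N B o\<^sub>L t o\<^sub>L chi M A) = chi M A o\<^sub>L (op_adj t o\<^sub>L chi N B)"
    using AB bops_clin[OF t] bops_clin[OF N.chi_bops] bops_clin[OF M.chi_bops] bops_clin[OF compose_bops[OF N.chi_bops t]]
    by (simp add: op_adj_compose M.chi_adj N.chi_adj)
  ultimately show "chi M A o\<^sub>L op_adj t o\<^sub>L chi N B = 0"
    by (simp add: op_adj_zero blinfun_compose_assoc)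
qed

text \<open>The projection of the hull of the \<open>S\<close>-image of \<open>A\<close> can be
  inserted between \<open>t\<close> and \<open>s\<close> without changing the product; passing to
  the hull costs the gauge \<open>F\<close> in the middle.\<close>

lemma supp_in_compose:
  assumes M: "partitioned_module X M E P" and N: "partitioned_module Y N F Q"
    and s: "s \<in> bops (hsp M) (hsp N)" "supp_in M N s S" and t: "supp_in N L t T"
  shows "supp_in M L (t o\<^sub>L s) (T O F O S)"
  unfolding supp_in_def
proof (intro ballI impI)
  interpret M: partitioned_module X M E P by (rule M)
  interpret N: partitioned_module Y N F Q by (rule N)
  fix B A assume BA: "B \<in> meas L" "A \<in> meas M" "separated (T O F O S) B A"
  let ?D = "N.saturate (rel_img S A)"
  have "separated T B ?D"
    using BA(3) N.saturate_subset[of "rel_img S A"] unfolding separated_def rel_img_def by blast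
  then have z: "chi L B o\<^sub>L t o\<^sub>L chi N ?D = 0" using t BA N.saturate_meas unfolding supp_in_def by blast
  have "chi L B o\<^sub>L (t o\<^sub>L s) o\<^sub>L chi M A = (chi L B o\<^sub>L t) o\<^sub>L (chi N ?D o\<^sub>L (s o\<^sub>L chi M A))"
    unfolding supp_saturate[OF M N s BA(2)] by (simp add: blinfun_compose_assoc)
  also have "\<dots> = (chi L B o\<^sub>L t o\<^sub>L chi N ?D) o\<^sub>L (s o\<^sub>L chi M A)" by (simp add: blinfun_compose_assoc)
  finally show "chi L B o\<^sub>L (t o\<^sub>L s) o\<^sub>L chi M A = 0" by (simp add: z)
qed

section \<open>Roe algebras\<close>

definition roe_core :: "'a coarse \<Rightarrow> ('a, 'h::chilbert_space) cmodule \<Rightarrow> ('h \<Rightarrow>\<^sub>L 'h) set" where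
  "roe_core X M = {t \<in> bops (hsp M) (hsp M). locally_compact_op X M t \<and> controlled_propagation X M t}"

lemma elems_roe_algebra: "elems (roe_algebra X M) = closure (roe_core X M)"
  unfolding roe_algebra_def roe_core_def by simp

lemma roe_algebra_simps [simp]:
  "amult (roe_algebra X M) = (o\<^sub>L)" "ascale (roe_algebra X M) = op_scale" "astar (roe_algebra X M) = op_adj"
  unfolding roe_algebra_def by simp_all

lemma closure_closed_under2:
  fixes f :: "'x::metric_space \<Rightarrow> 'y::metric_space \<Rightarrow> 'z::metric_space"
  assumes "x \<in> closure S" "y \<in> closure T" "\<And>a b. a \<in> S \<Longrightarrow> b \<in> T \<Longrightarrow> f a b \<in> R"
    "\<And>a b. a \<longlonglongrightarrow> x \<Longrightarrow> b \<longlonglongrightarrow> y \<Longrightarrow> (\<lambda>n. f (a n) (b n)) \<longlonglongrightarrow> f x y"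
  shows "f x y \<in> closure R"
proof -
  obtain a where a: "\<forall>n. a n \<in> S" "a \<longlonglongrightarrow> x" using assms(1) unfolding closure_sequential by blast
  obtain b where b: "\<forall>n. b n \<in> T" "b \<longlonglongrightarrow> y" using assms(2) unfolding closure_sequential by blast
  show ?thesis unfolding closure_sequential
    using a b assms(3) assms(4)[OF a(2) b(2)] by (intro exI[of _ "\<lambda>n. f (a n) (b n)"]) auto
qed

lemma closure_closed_under:
  assumes "x \<in> closure S" "\<And>a. a \<in> S \<Longrightarrow> f a \<in> R" "continuous_on (closure S) f"
  shows "f x \<in> closure R"
proof -
  have "f ` closure S \<subseteq> closure R"
    using assms(2) closure_subset[of R] by (intro image_closure_subset[OF assms(3)]) auto
  then show ?thesis using assms(1) by blast
qed

context partitioned_module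
begin

lemma roe_coreI:
  assumes "t \<in> bops (hsp M) (hsp M)" "S \<in> ents X" "supp_in M M t S"
    "\<And>A. A \<in> meas M \<Longrightarrow> cbounded X A \<Longrightarrow> compact_op (hsp M) (hsp M) (chi M A o\<^sub>L t)"
    "\<And>A. A \<in> meas M \<Longrightarrow> cbounded X A \<Longrightarrow> compact_op (hsp M) (hsp M) (t o\<^sub>L chi M A)"
  shows "t \<in> roe_core X M"
  using assms unfolding roe_core_def locally_compact_op_def controlled_propagation_def by blast

lemma roe_coreE:
  assumes "t \<in> roe_core X M"
  obtains S where "t \<in> bops (hsp M) (hsp M)" "S \<in> ents X" "supp_in M M t S"
  using assms unfolding roe_core_def controlled_propagation_def by blast

lemma roe_core_compact:
  assumes "t \<in> roe_core X M" "A \<in> meas M" "cbounded X A"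
  shows "compact_op (hsp M) (hsp M) (chi M A o\<^sub>L t)" "compact_op (hsp M) (hsp M) (t o\<^sub>L chi M A)"
  using assms unfolding roe_core_def locally_compact_op_def by blast+

lemma roe_core_bops: "t \<in> roe_core X M \<Longrightarrow> t \<in> bops (hsp M) (hsp M)"
  unfolding roe_core_def by blast

lemma roe_algebra_bops: "t \<in> closure (roe_core X M) \<Longrightarrow> t \<in> bops (hsp M) (hsp M)"
  using closure_minimal[OF _ closed_bops[OF hsp, of "hsp M"], of "roe_core X M"] roe_core_bops by blast

lemma zero_roe_core: "0 \<in> roe_core X M"
  by (rule roe_coreI[OF zero_bops[OF hsp] E_ents])
    (simp_all add: supp_in_def compact_op_zero[OF hsp hsp])

lemma add_roe_core:
  assumes s: "s \<in> roe_core X M" and t: "t \<in> roe_core X M"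
  shows "s + t \<in> roe_core X M"
proof -
  obtain S where S: "s \<in> bops (hsp M) (hsp M)" "S \<in> ents X" "supp_in M M s S" using roe_coreE[OF s] .
  obtain T where T: "t \<in> bops (hsp M) (hsp M)" "T \<in> ents X" "supp_in M M t T" using roe_coreE[OF t] .
  show ?thesis
    by (rule roe_coreI[OF add_bops[OF hsp S(1) T(1)] ents_Un[OF space S(2) T(2)] supp_in_add[OF S(3) T(3)]])
      (simp_all add: blinfun_compose.add_left blinfun_compose.add_right compact_op_add[OF hsp hsp]
        roe_core_compact[OF s] roe_core_compact[OF t])
qed

lemma op_scale_compose: "op_scale c s o\<^sub>L t = op_scale c (s o\<^sub>L t)"
  by (rule blinfun_eqI) simp

lemma compose_op_scale: "clin s \<Longrightarrow> s o\<^sub>L op_scale c t = op_scale c (s o\<^sub>L t)"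
  by (rule blinfun_eqI) (simp add: clin_def)

lemma scale_roe_core:
  assumes t: "t \<in> roe_core X M"
  shows "op_scale c t \<in> roe_core X M"
proof -
  obtain T where T: "t \<in> bops (hsp M) (hsp M)" "T \<in> ents X" "supp_in M M t T" using roe_coreE[OF t] .
  have z: "op_scale c (0 :: 'h \<Rightarrow>\<^sub>L 'h) = 0" by (rule blinfun_eqI) (simp add: scaleC.zero_right)
  have "supp_in M M (op_scale c t) T"
    using T(3) unfolding supp_in_def
    by (simp add: compose_op_scale[OF bops_clin[OF chi_bops]] op_scale_compose z)
  then show ?thesis
    by (intro roe_coreI[OF scale_bops[OF hsp T(1)] T(2)])
      (simp_all add: compose_op_scale[OF bops_clin[OF chi_bops]] op_scale_compose
        compact_op_scale[OF hsp hsp] roe_core_compact[OF t])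
qed

lemma compose_roe_core:
  assumes s: "s \<in> roe_core X M" and t: "t \<in> roe_core X M"
  shows "s o\<^sub>L t \<in> roe_core X M"
proof -
  obtain S where S: "s \<in> bops (hsp M) (hsp M)" "S \<in> ents X" "supp_in M M s S" using roe_coreE[OF s] .
  obtain T where T: "t \<in> bops (hsp M) (hsp M)" "T \<in> ents X" "supp_in M M t T" using roe_coreE[OF t] .
  show ?thesis
  proof (rule roe_coreI[OF compose_bops[OF S(1) T(1)]])
    show "S O E O T \<in> ents X" by (intro ents_relcomp space S(2) T(2) E_ents)
    show "supp_in M M (s o\<^sub>L t) (S O E O T)"
      by (rule supp_in_compose[OF partitioned_module_axioms partitioned_module_axioms T(1,3) S(3)])
    fix A assume A: "A \<in> meas M" "cbounded X A"
    show "compact_op (hsp M) (hsp M) (chi M A o\<^sub>L (s o\<^sub>L t))"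
      unfolding blinfun_compose_assoc[symmetric]
      by (rule compact_op_compose_right[OF hsp hsp roe_core_compact(1)[OF s A] T(1)])
    show "compact_op (hsp M) (hsp M) (s o\<^sub>L t o\<^sub>L chi M A)"
      unfolding blinfun_compose_assoc
      by (rule compact_op_compose_left[OF hsp roe_core_compact(2)[OF t A] S(1)])
  qed
qed

lemma adj_roe_core:
  assumes t: "t \<in> roe_core X M"
  shows "op_adj t \<in> roe_core X M"
proof -
  obtain T where T: "t \<in> bops (hsp M) (hsp M)" "T \<in> ents X" "supp_in M M t T" using roe_coreE[OF t] .
  have eq: "chi M A o\<^sub>L op_adj t = op_adj (t o\<^sub>L chi M A)" "op_adj t o\<^sub>L chi M A = op_adj (chi M A o\<^sub>L t)"
    if "A \<in> meas M" for A
    using that by (simp_all add: op_adj_compose bops_clin[OF T(1)] bops_clin[OF chi_bops] chi_adj)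
  show ?thesis
    by (rule roe_coreI[OF op_adj_bops[OF hsp T(1)] ents_converse[OF space T(2)]
          supp_in_adj[OF partitioned_module_axioms partitioned_module_axioms T(1,3)]])
      (simp_all add: eq compact_op_adj[OF hsp hsp] roe_core_compact[OF t])
qed

text \<open>The operations preserve \<open>roe_core\<close> and are continuous, so they preserve its
  closure; the algebraic laws hold for complex-linear operators in general.\<close>

lemma star_algebra_roe: "star_algebra (roe_algebra X M)"
proof -
  let ?R = "closure (roe_core X M)"
  have cl: "clin t" if "t \<in> ?R" for t using bops_clin[OF roe_algebra_bops[OF that]] .
  show ?thesis
  proof (unfold_locales; unfold elems_roe_algebra roe_algebra_simps)
    show "0 \<in> ?R" using zero_roe_core closure_subset by blast
    fix a b c r x y
    assume a: "a \<in> ?R"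
    show "op_scale x a \<in> ?R" for x
      by (rule closure_closed_under[OF a], erule scale_roe_core,
          rule linear_continuous_on[OF bounded_bilinear.bounded_linear_right[OF bounded_bilinear_op_scale]])
    have r: "r *\<^sub>R a = op_scale (complex_of_real r) a"
      by (rule blinfun_eqI) (simp add: blinfun.scaleR_left scaleR_scaleC_eq)
    then show "r *\<^sub>R a \<in> ?R" using \<open>\<And>x. op_scale x a \<in> ?R\<close> by simp
    show "op_scale (complex_of_real r) a = r *\<^sub>R a" using r by simp
    show "op_adj a \<in> ?R"
      by (rule closure_closed_under[OF a], erule adj_roe_core,
          rule continuous_on_subset[OF continuous_on_op_adj]) (use cl in blast)
    show "op_adj (r *\<^sub>R a) = r *\<^sub>R op_adj a"
      by (rule op_adj_unique) (simp add: blinfun.scaleR_left cinner.scaleR_left cinner.scaleR_right cinner_op_adj[OF cl[OF a]])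
    show "op_adj (op_adj a) = a" by (rule op_adj_op_adj[OF cl[OF a]])
    show "op_scale (x + y) a = op_scale x a + op_scale y a"
      by (rule blinfun_eqI) (simp add: blinfun.add_left scaleC_add_left)
    show "op_scale x (op_scale y a) = op_scale (x * y) a"
      by (rule blinfun_eqI) (simp add: scaleC_scaleC)
    show "op_adj (op_scale x a) = op_scale (cnj x) (op_adj a)" by (rule op_adj_scale[OF cl[OF a]])
    assume b: "b \<in> ?R"
    show "a + b \<in> ?R" by (rule closure_closed_under2[OF a b add_roe_core tendsto_add])
    show "a o\<^sub>L b \<in> ?R"
      by (rule closure_closed_under2[OF a b compose_roe_core
            bounded_bilinear.tendsto[OF bounded_bilinear_blinfun_compose]])
    show "(r *\<^sub>R a) o\<^sub>L b = r *\<^sub>R (a o\<^sub>L b)" "a o\<^sub>L (r *\<^sub>R b) = r *\<^sub>R (a o\<^sub>L b)"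
      by (simp_all add: blinfun_compose.scaleR_left blinfun_compose.scaleR_right)
    show "op_adj (a + b) = op_adj a + op_adj b" by (rule op_adj_add[OF cl[OF a] cl[OF b]])
    show "op_adj (a o\<^sub>L b) = op_adj b o\<^sub>L op_adj a" by (rule op_adj_compose[OF cl[OF a] cl[OF b]])
    show "op_scale x (a + b) = op_scale x a + op_scale x b"
      by (rule blinfun_eqI) (simp add: blinfun.add_left scaleC_add_right)
    show "op_scale x a o\<^sub>L b = op_scale x (a o\<^sub>L b)" by (rule op_scale_compose)
    show "a o\<^sub>L op_scale x b = op_scale x (a o\<^sub>L b)" by (rule compose_op_scale[OF cl[OF a]])
    assume c: "c \<in> ?R"
    show "a o\<^sub>L b o\<^sub>L c = a o\<^sub>L (b o\<^sub>L c)" by (rule blinfun_compose_assoc)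
    show "a o\<^sub>L (b + c) = (a o\<^sub>L b) + (a o\<^sub>L c)" "(a + b) o\<^sub>L c = (a o\<^sub>L c) + (b o\<^sub>L c)"
      by (simp_all add: blinfun_compose.add_left blinfun_compose.add_right)
  next
    fix f g :: "real \<Rightarrow> 'h \<Rightarrow>\<^sub>L 'h" and c :: "real \<Rightarrow> complex" and S
    assume f: "continuous_on S f"
    show "continuous_on S g \<Longrightarrow> continuous_on S (\<lambda>s. f s o\<^sub>L g s)"
      by (rule bounded_bilinear.continuous_on[OF bounded_bilinear_blinfun_compose f])
    show "continuous_on S (\<lambda>s. op_adj (f s))" if "\<And>s. s \<in> S \<Longrightarrow> f s \<in> ?R"
      by (rule continuous_on_compose2[OF continuous_on_op_adj f]) (auto intro: cl that)
  next
    fix f :: "real \<Rightarrow> 'h \<Rightarrow>\<^sub>L 'h" and c :: "real \<Rightarrow> complex" and S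
    assume "continuous_on S c" "continuous_on S f"
    then show "continuous_on S (\<lambda>s. op_scale (c s) (f s))"
      by (rule bounded_bilinear.continuous_on[OF bounded_bilinear_op_scale])
  qed
qed

end

section \<open>Isometries close to a function\<close>

text \<open>One half of the covering condition: the support is bounded from above by a neighbourhood
  of the graph, but not from below.\<close>

definition near_isometry ::
    "'a coarse \<Rightarrow> 'b coarse \<Rightarrow> ('a, 'h::chilbert_space) cmodule \<Rightarrow> ('b, 'k::chilbert_space) cmodule
      \<Rightarrow> ('a \<Rightarrow> 'b) \<Rightarrow> ('h \<Rightarrow>\<^sub>L 'k) \<Rightarrow> bool" where
  "near_isometry X Y M N f t \<longleftrightarrow>
     hilbert_isometry (hsp M) (hsp N) t \<and> (\<exists>E\<in>ents Y. supp_in M N t (E O fun_rel X f))"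

lemma covering_isometry_near:
  assumes X: "coarse_space X" and Y: "coarse_space Y" and f: "controlled_fun X Y f"
    and t: "covering_isometry X Y M N (fun_class X Y f) t"
  shows "near_isometry X Y M N f t"
proof -
  obtain S where S: "S \<subseteq> points Y \<times> points X" "fun_class X Y f = coarse_class X Y S" "supp_in M N t S"
    using t unfolding covering_isometry_def is_coarse_support_def by blast
  have "S \<in> fun_class X Y f" unfolding S(2) by (rule coarse_class_self[OF X Y S(1)])
  then have "coarse_le X Y S (fun_rel X f)" unfolding coarse_class_def by blast
  then obtain E where "E \<in> ents Y" "S \<subseteq> E O fun_rel X f"
    unfolding coarse_le_fun_rel_iff[OF X Y f] by blast
  then show ?thesis
    using t supp_in_mono[OF S(3)] unfolding near_isometry_def covering_isometry_def by blast
qed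

text \<open>Between the two graphs sits the entourage \<open>F O S\<close> of \<open>Y\<close>. The
  controlled \<open>g\<close> carries it over to \<open>Z\<close>, and what is left on the right is
  the graph of \<open>g \<circ> f\<close>.\<close>

lemma near_isometry_compose:
  assumes M: "partitioned_module X M E P" and N: "partitioned_module Y N F Q" and Z: "coarse_space Z"
    and f: "f \<in> points X \<rightarrow> points Y" and g: "controlled_fun Y Z g"
    and s: "near_isometry X Y M N f s" and t: "near_isometry Y Z N L g t"
  shows "near_isometry X Z M L (g \<circ> f) (t o\<^sub>L s)"
proof -
  interpret N: partitioned_module Y N F Q by (rule N)
  obtain S where S: "S \<in> ents Y" "supp_in M N s (S O fun_rel X f)" using s unfolding near_isometry_def by blast
  obtain T where T: "T \<in> ents Z" "supp_in N L t (T O fun_rel Y g)" using t unfolding near_isometry_def by blast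
  have si: "hilbert_isometry (hsp M) (hsp N) s" and ti: "hilbert_isometry (hsp N) (hsp L) t"
    using s t unfolding near_isometry_def by auto
  have FS: "F O S \<in> ents Y" by (rule ents_relcomp[OF N.space N.E_ents S(1)])
  have "(T O fun_rel Y g) O F O S O fun_rel X f \<subseteq> (T O map_prod g g ` (F O S)) O fun_rel X (g \<circ> f)"
    using f unfolding fun_rel_def by force
  then have "supp_in M L (t o\<^sub>L s) ((T O map_prod g g ` (F O S)) O fun_rel X (g \<circ> f))"
    using supp_in_mono[OF supp_in_compose[OF M N isometry_bops[OF si] S(2) T(2)]] by blast
  moreover have "T O map_prod g g ` (F O S) \<in> ents Z"
    using g FS unfolding controlled_fun_def by (intro ents_relcomp[OF Z T(1)]) blast
  ultimately show ?thesis
    unfolding near_isometry_def using isometry_compose[OF si ti] by blast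
qed

lemma (in partitioned_module) near_isometry_id: "near_isometry X X M M id (orth_proj (hsp M))"
proof -
  have "supp_in M M (orth_proj (hsp M)) (Id_on (points X) O fun_rel X id)"
    unfolding supp_in_def
  proof (intro ballI impI)
    fix B A assume BA: "B \<in> meas M" "A \<in> meas M" "separated (Id_on (points X) O fun_rel X id) B A"
    have "B \<inter> A = {}"
    proof (rule ccontr)
      assume "B \<inter> A \<noteq> {}"
      then obtain x where x: "x \<in> B" "x \<in> A" by blast
      then have "(x, x) \<in> Id_on (points X) O fun_rel X id"
        unfolding in_relcomp_fun_rel using meas_subset[OF BA(1)] by auto
      then show False using BA(3) x unfolding separated_def rel_img_def by blast
    qed
    then have "chi M B o\<^sub>L chi M A = 0" using chi_Int[OF BA(1,2)] chi_empty by simp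
    then show "chi M B o\<^sub>L orth_proj (hsp M) o\<^sub>L chi M A = 0"
      by (simp add: bops_orth_proj_right[OF hsp chi_bops[OF BA(1)]])
  qed
  then show ?thesis
    unfolding near_isometry_def using isometry_orth_proj[OF hsp] ents_Id[OF space] by blast
qed

text \<open>Propagation stays controlled because \<open>f\<close> pushes the entourage
  \<open>E O S O E\<close> forward. Local compactness is where properness enters: cut down to a
  bounded \<open>B\<close>, the operator \<open>v\<close> sees only the hull of the preimage of a
  thickening of \<open>B\<close>. This hull is bounded, so \<open>x\<close> is compact over
  it.\<close>

lemma roe_conj_core:
  assumes M: "partitioned_module X M E P" and N: "partitioned_module Y N F Q"
    and f: "controlled_fun X Y f" "proper_fun X Y f"
    and v: "near_isometry X Y M N f v" and w: "near_isometry X Y M N f w" and x: "x \<in> roe_core X M"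
  shows "v o\<^sub>L x o\<^sub>L op_adj w \<in> roe_core Y N"
proof -
  interpret M: partitioned_module X M E P by (rule M)
  interpret N: partitioned_module Y N F Q by (rule N)
  obtain V where V: "V \<in> ents Y" "supp_in M N v (V O fun_rel X f)" using v unfolding near_isometry_def by blast
  obtain W where W: "W \<in> ents Y" "supp_in M N w (W O fun_rel X f)" using w unfolding near_isometry_def by blast
  have vb: "v \<in> bops (hsp M) (hsp N)" and wb: "w \<in> bops (hsp M) (hsp N)"
    using v w isometry_bops unfolding near_isometry_def by blast+
  note va = op_adj_bops[OF M.hsp vb] and wa = op_adj_bops[OF M.hsp wb]
  obtain S where S: "x \<in> bops (hsp M) (hsp M)" "S \<in> ents X" "supp_in M M x S" using M.roe_coreE[OF x] .
  note vs = supp_in_adj[OF M N vb V(2)] and ws = supp_in_adj[OF M N wb W(2)]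
  have bounded: "cbounded X (M.saturate (rel_img ((U O fun_rel X f)\<inverse>) B))" if "U \<in> ents Y" "cbounded Y B" for U B
  proof (rule M.cbounded_saturate)
    have "rel_img ((U O fun_rel X f)\<inverse>) B \<subseteq> {x \<in> points X. f x \<in> rel_img (U\<inverse>) B}"
      unfolding rel_img_def fun_rel_def by blast
    moreover have "cbounded X {x \<in> points X. f x \<in> rel_img (U\<inverse>) B}"
      using f(2) cbounded_thicken[OF N.space ents_converse[OF N.space that(1)] that(2)]
      unfolding proper_fun_def by blast
    ultimately show "cbounded X (rel_img ((U O fun_rel X f)\<inverse>) B)" using cbounded_subset[OF M.space] by blast
  qed
  show ?thesis
  proof (rule N.roe_coreI)
    show "v o\<^sub>L x o\<^sub>L op_adj w \<in> bops (hsp N) (hsp N)" by (intro compose_bops[OF compose_bops[OF vb S(1)] wa])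
    have ESE: "E O S O E \<in> ents X" by (intro ents_relcomp M.space M.E_ents S(2))
    show "V O map_prod f f ` (E O S O E) O W\<inverse> \<in> ents Y"
      using f(1) ESE V(1) W(1) unfolding controlled_fun_def
      by (intro ents_relcomp[OF N.space] ents_converse[OF N.space]) auto
    have "supp_in M N (v o\<^sub>L x) ((V O fun_rel X f) O E O S)" by (rule supp_in_compose[OF M M S(1,3) V(2)])
    then have "supp_in N N (v o\<^sub>L x o\<^sub>L op_adj w) (((V O fun_rel X f) O E O S) O E O (W O fun_rel X f)\<inverse>)"
      by (rule supp_in_compose[OF N M wa ws])
    moreover have "((V O fun_rel X f) O E O S) O E O (W O fun_rel X f)\<inverse> \<subseteq> V O map_prod f f ` (E O S O E) O W\<inverse>"
      unfolding fun_rel_def by force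
    ultimately show "supp_in N N (v o\<^sub>L x o\<^sub>L op_adj w) (V O map_prod f f ` (E O S O E) O W\<inverse>)"
      by (rule supp_in_mono)
  next
    fix B assume B: "B \<in> meas N" "cbounded Y B"
    let ?D = "M.saturate (rel_img ((V O fun_rel X f)\<inverse>) B)"
    note Dm = M.saturate_meas[of "rel_img ((V O fun_rel X f)\<inverse>) B"]
    \<comment> \<open>\<open>supp_saturate\<close> inserts a projection on the left of an operator;
      here it is wanted on the right of \<open>v\<close>, hence the passage through
      adjoints.\<close>
    have "op_adj (chi M ?D o\<^sub>L (op_adj v o\<^sub>L chi N B)) = op_adj (op_adj v o\<^sub>L chi N B)"
      by (simp only: supp_saturate[OF N M va vs B(1)])
    then have "chi N B o\<^sub>L v o\<^sub>L chi M ?D = chi N B o\<^sub>L v"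
      using bops_clin[OF vb] bops_clin[OF va] bops_clin[OF N.chi_bops[OF B(1)]] bops_clin[OF M.chi_bops[OF Dm]]
        bops_clin[OF compose_bops[OF va N.chi_bops[OF B(1)]]]
      by (simp add: op_adj_compose op_adj_op_adj M.chi_adj[OF Dm] N.chi_adj[OF B(1)])
    then have "chi N B o\<^sub>L (v o\<^sub>L x o\<^sub>L op_adj w) = (chi N B o\<^sub>L v) o\<^sub>L ((chi M ?D o\<^sub>L x) o\<^sub>L op_adj w)"
      by (simp flip: blinfun_compose_assoc)
    moreover have "compact_op (hsp N) (hsp N) ((chi N B o\<^sub>L v) o\<^sub>L ((chi M ?D o\<^sub>L x) o\<^sub>L op_adj w))"
      by (rule compact_op_compose_left[OF N.hsp compact_op_compose_right[OF N.hsp M.hsp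
              M.roe_core_compact(1)[OF x Dm bounded[OF V(1) B(2)]] wa] compose_bops[OF N.chi_bops[OF B(1)] vb]])
    ultimately show "compact_op (hsp N) (hsp N) (chi N B o\<^sub>L (v o\<^sub>L x o\<^sub>L op_adj w))" by simp
  next
    fix B assume B: "B \<in> meas N" "cbounded Y B"
    let ?D = "M.saturate (rel_img ((W O fun_rel X f)\<inverse>) B)"
    note Dm = M.saturate_meas[of "rel_img ((W O fun_rel X f)\<inverse>) B"]
    have "(v o\<^sub>L x o\<^sub>L op_adj w) o\<^sub>L chi N B = (v o\<^sub>L (x o\<^sub>L chi M ?D)) o\<^sub>L (op_adj w o\<^sub>L chi N B)"
      by (simp add: blinfun_compose_assoc supp_saturate[OF N M wa ws B(1)])
    moreover have "compact_op (hsp N) (hsp N) ((v o\<^sub>L (x o\<^sub>L chi M ?D)) o\<^sub>L (op_adj w o\<^sub>L chi N B))"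
      by (rule compact_op_compose_right[OF N.hsp M.hsp compact_op_compose_left[OF M.hsp
              M.roe_core_compact(2)[OF x Dm bounded[OF W(1) B(2)]] vb] compose_bops[OF wa N.chi_bops[OF B(1)]]])
    ultimately show "compact_op (hsp N) (hsp N) ((v o\<^sub>L x o\<^sub>L op_adj w) o\<^sub>L chi N B)" by simp
  qed
qed

text \<open>In a product of two components the inner factors are the adjoint of \<open>v y\<close>
  followed by \<open>v y\<close> for the same \<open>y\<close>, which is the identity of
  \<open>hsp M\<close>; so the components multiply like matrix entries.\<close>

lemma corner_hom_near:
  assumes M: "partitioned_module X M E P" and N: "partitioned_module Y N F Q"
    and f: "controlled_fun X Y f" "proper_fun X Y f" and v: "\<And>b. near_isometry X Y M N f (v b)"
  shows "corner_hom (roe_algebra X M) (roe_algebra Y N) (\<lambda>b c x. v b o\<^sub>L x o\<^sub>L op_adj (v c))"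
proof -
  interpret M: partitioned_module X M E P by (rule M)
  interpret N: partitioned_module Y N F Q by (rule N)
  interpret A: star_algebra "roe_algebra X M" by (rule M.star_algebra_roe)
  interpret B: star_algebra "roe_algebra Y N" by (rule N.star_algebra_roe)
  have iso: "hilbert_isometry (hsp M) (hsp N) (v b)" for b using v unfolding near_isometry_def by blast
  have vc: "clin (v b)" for b by (rule bops_clin[OF isometry_bops[OF iso]])
  have cont: "continuous_on S (\<lambda>x. v b o\<^sub>L x o\<^sub>L op_adj (v c))" for S b c
    by (intro bounded_bilinear.continuous_on[OF bounded_bilinear_blinfun_compose] continuous_intros)
  show ?thesis
  proof (unfold_locales; unfold elems_roe_algebra roe_algebra_simps)
    fix a b c x y z
    assume a: "a \<in> closure (roe_core X M)"
    note ab = M.roe_algebra_bops[OF a]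
    show "v x o\<^sub>L a o\<^sub>L op_adj (v y) \<in> closure (roe_core Y N)"
      by (rule closure_closed_under[OF a roe_conj_core[OF M N f v v] cont])
    show "v x o\<^sub>L op_scale c a o\<^sub>L op_adj (v y) = op_scale c (v x o\<^sub>L a o\<^sub>L op_adj (v y))"
      by (simp add: M.op_scale_compose M.compose_op_scale vc)
    show "v x o\<^sub>L op_adj a o\<^sub>L op_adj (v y) = op_adj (v y o\<^sub>L a o\<^sub>L op_adj (v x))"
      unfolding op_adj_compose[OF bops_clin[OF compose_bops[OF isometry_bops[OF iso] ab]] clin_op_adj[OF vc]]
        op_adj_compose[OF vc bops_clin[OF ab]] op_adj_op_adj[OF vc]
      by (simp add: blinfun_compose_assoc)
    assume b: "b \<in> closure (roe_core X M)"
    show "v x o\<^sub>L (a + b) o\<^sub>L op_adj (v y) = (v x o\<^sub>L a o\<^sub>L op_adj (v y)) + (v x o\<^sub>L b o\<^sub>L op_adj (v y))"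
      by (simp add: blinfun_compose.add_left blinfun_compose.add_right)
    show "v x o\<^sub>L (a o\<^sub>L b) o\<^sub>L op_adj (v z) =
        v x o\<^sub>L a o\<^sub>L op_adj (v y) o\<^sub>L (v y o\<^sub>L b o\<^sub>L op_adj (v z))"
    proof -
      have "op_adj (v y) o\<^sub>L (v y o\<^sub>L (b o\<^sub>L op_adj (v z))) = b o\<^sub>L op_adj (v z)"
        by (rule isometry_adj_cancel[OF M.hsp iso])
          (rule compose_bops[OF M.roe_algebra_bops[OF b] op_adj_bops[OF M.hsp isometry_bops[OF iso]]])
      then show ?thesis by (simp add: blinfun_compose_assoc)
    qed
  next
    show "continuous_on (closure (roe_core X M)) (\<lambda>a. v x o\<^sub>L a o\<^sub>L op_adj (v y))" for x y
      by (rule cont)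
  qed
qed

lemma Ad_star_algebra_hom:
  assumes "partitioned_module X M E P" "partitioned_module Y N F Q"
    "controlled_fun X Y f" "proper_fun X Y f" "near_isometry X Y M N f t"
  shows "star_algebra_hom (roe_algebra X M) (roe_algebra Y N) (Ad t)"
  using corner_hom.star_algebra_hom[OF corner_hom_near[OF assms(1-4), of "\<lambda>_. t"]] assms(5)
  unfolding Ad_def[abs_def] by simp

lemma Ad_K_map_eq:
  assumes "partitioned_module X M E P" "partitioned_module Y N F Q"
    "controlled_fun X Y f" "proper_fun X Y f" "near_isometry X Y M N f t" "near_isometry X Y M N f s"
  shows "x \<in> carrier (K0 (roe_algebra X M)) \<Longrightarrow> K0_map (roe_algebra Y N) (Ad t) x = K0_map (roe_algebra Y N) (Ad s) x"
    and "y \<in> carrier (K1 (roe_algebra X M)) \<Longrightarrow> K1_map (roe_algebra Y N) (Ad t) y = K1_map (roe_algebra Y N) (Ad s) y"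
proof -
  define v where "v b = (if b then s else t)" for b
  interpret corner_hom "roe_algebra X M" "roe_algebra Y N" "\<lambda>b c x. v b o\<^sub>L x o\<^sub>L op_adj (v c)"
    by (rule corner_hom_near[OF assms(1-4)]) (simp add: v_def assms(5,6))
  have Ad: "Ad t = (\<lambda>x. v False o\<^sub>L x o\<^sub>L op_adj (v False))" "Ad s = (\<lambda>x. v True o\<^sub>L x o\<^sub>L op_adj (v True))"
    unfolding Ad_def[abs_def] v_def by simp_all
  show "x \<in> carrier (K0 (roe_algebra X M)) \<Longrightarrow> K0_map (roe_algebra Y N) (Ad t) x = K0_map (roe_algebra Y N) (Ad s) x"
    "y \<in> carrier (K1 (roe_algebra X M)) \<Longrightarrow> K1_map (roe_algebra Y N) (Ad t) y = K1_map (roe_algebra Y N) (Ad s) y"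
    unfolding Ad by (rule K0_map_corners K1_map_corners; assumption)+
qed

section \<open>Existence of covering isometries\<close>

lemma infinite_if_card_ge:
  assumes "Card_order \<kappa>" "infinite (Field \<kappa>)" "\<kappa> \<le>o |B|"
  shows "infinite B"
  using card_of_ordLeq_infinite[OF ordIso_ordLeq_trans[OF card_of_Field_ordIso[OF assms(1)] assms(3)] assms(2)] .

lemma infinite_if_card_iso:
  "Card_order \<kappa> \<Longrightarrow> infinite (Field \<kappa>) \<Longrightarrow> |B| =o \<kappa> \<Longrightarrow> infinite B"
  using infinite_if_card_ge[of \<kappa> B] ordIso_symmetric ordIso_imp_ordLeq by blast

lemma finite_card_le:
  assumes "Card_order \<kappa>" "infinite (Field \<kappa>)" "finite B"
  shows "|B| \<le>o \<kappa>"
proof -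
  have "|B| \<le>o |Field \<kappa>|"
    by (rule ordLess_imp_ordLeq[OF finite_ordLess_infinite[OF card_of_Well_order card_of_Well_order]])
      (simp_all add: assms Field_card_of)
  then show ?thesis using card_of_Field_ordIso[OF assms(1)] ordLeq_ordIso_trans by blast
qed

lemma hilbert_sub_vimage:
  assumes t: "clin t" and K: "hilbert_sub K"
  shows "hilbert_sub {v. blinfun_apply t v \<in> K}"
proof -
  have "closed {v. blinfun_apply t v \<in> K}"
    using closed_vimage[OF hilbert_sub_closed[OF K]
        linear_continuous_on[OF blinfun.bounded_linear_right, of UNIV t]] by (simp add: vimage_def)
  then show ?thesis
    using K t unfolding hilbert_sub_def complex_vector.subspace_def
    by (simp add: blinfun.add_right clin_def blinfun.zero_right)
qed

context partitioned_module
begin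

lemma chi_range:
  assumes A: "A \<in> meas M"
  shows "blinfun_apply (chi M A) ` hsp M = {v. blinfun_apply (chi M A) v = v}"
proof -
  have "blinfun_apply (chi M A) (blinfun_apply (chi M A) v) = blinfun_apply (chi M A) v" for v
    using chi_idem[OF A] by (metis blinfun_apply_blinfun_compose)
  moreover have "blinfun_apply (chi M A) v \<in> hsp M" for v by (rule bops_in[OF chi_bops[OF A]])
  ultimately show ?thesis by (auto simp: image_iff) metis
qed

lemma hilbert_sub_chi_range:
  assumes A: "A \<in> meas M"
  shows "hilbert_sub (blinfun_apply (chi M A) ` hsp M)"
proof -
  have "closed {v. blinfun_apply (chi M A) v = v}"
    by (intro closed_Collect_eq continuous_intros linear_continuous_on[OF blinfun.bounded_linear_right])
  then show ?thesis
    using bops_clin[OF chi_bops[OF A]]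
    unfolding chi_range[OF A] hilbert_sub_def complex_vector.subspace_def
    by (simp add: blinfun.add_right clin_def blinfun.zero_right)
qed

lemma chi_range_subset: "A \<in> meas M \<Longrightarrow> blinfun_apply (chi M A) ` hsp M \<subseteq> hsp M"
  using bops_in[OF chi_bops] by blast

lemma chi_orthogonal:
  assumes A: "A \<in> meas M" and B: "B \<in> meas M" and "A \<inter> B = {}"
    and v: "v \<in> blinfun_apply (chi M A) ` hsp M" and w: "w \<in> blinfun_apply (chi M B) ` hsp M"
  shows "cinner v w = 0"
proof -
  have "cinner v w = cinner (blinfun_apply (chi M A) v) (blinfun_apply (chi M B) w)"
    using v w unfolding chi_range[OF A] chi_range[OF B] by simp
  also have "\<dots> = cinner v (blinfun_apply (chi M A o\<^sub>L chi M B) w)"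
    using cinner_op_adj[OF bops_clin[OF chi_bops[OF A]]] by (simp add: chi_adj[OF A])
  also have "\<dots> = 0"
    using chi_Int[OF A B, symmetric] assms(3) chi_empty by (simp add: cinner_simps)
  finally show ?thesis .
qed

text \<open>A bounded set with \<open>\<chi> \<noteq> 0\<close> of the ampleness condition meets some piece in a set with \<open>\<chi> \<noteq> 0\<close>, which
  is bounded by the same gauge and so has large rank again.\<close>

lemma ample_pieces:
  assumes ample: "ample_module \<kappa> X M"
  obtains K where "K \<in> ents X" "\<And>x. x \<in> points X \<Longrightarrow> \<exists>A\<in>P. chi M A \<noteq> 0 \<and> (\<forall>a\<in>A. (a, x) \<in> K) \<and>
    (\<exists>B. corthonormal B \<and> B \<subseteq> blinfun_apply (chi M A) ` hsp M \<and> \<kappa> \<le>o |B| )"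
proof -
  from ample obtain G where G: "gauge_of X G"
    and dense: "coarsely_dense X (\<Union>{A \<in> meas M. ent_bounded X G A \<and> chi M A \<noteq> 0})"
    and rank: "\<forall>A\<in>meas M. ent_bounded X G A \<and> chi M A \<noteq> 0 \<longrightarrow>
      \<kappa> \<le>o hilbert_rank (blinfun_apply (chi M A) ` hsp M)"
    unfolding ample_module_def by (elim exE conjE)
  define U where "U = \<Union>{A \<in> meas M. ent_bounded X G A \<and> chi M A \<noteq> 0}"
  obtain L where L: "L \<in> ents X" "points X = rel_img L U"
    using dense[folded U_def, unfolded coarsely_dense_def] by (elim conjE bexE)
  \<comment> \<open>From any point of the piece by \<open>E\<close> into its intersection with the
    bounded set, by \<open>G\<close> within that set, and by the converse of \<open>L\<close> to
    \<open>x\<close>.\<close>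
  have K: "E O G O L\<inverse> \<in> ents X"
    using G L(1) unfolding gauge_of_def by (intro ents_relcomp[OF space] ents_converse[OF space] E_ents) auto
  have "\<exists>A\<in>P. chi M A \<noteq> 0 \<and> (\<forall>a\<in>A. (a, x) \<in> E O G O L\<inverse>) \<and>
    (\<exists>B. corthonormal B \<and> B \<subseteq> blinfun_apply (chi M A) ` hsp M \<and> \<kappa> \<le>o |B| )" if x: "x \<in> points X" for x
  proof -
    obtain d D where d: "(x, d) \<in> L" "d \<in> D" "D \<in> meas M" "ent_bounded X G D" "chi M D \<noteq> 0"
      using x[unfolded L(2) rel_img_def] unfolding U_def by (elim CollectE bexE UnionE conjE)
    have "\<exists>A\<in>P. chi M (A \<inter> D) o\<^sub>L orth_proj (hsp M) \<noteq> 0"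
    proof (rule ccontr)
      assume "\<not> ?thesis"
      then have "chi M D o\<^sub>L orth_proj (hsp M) = 0"
        by (intro pieces_zero[OF d(3) orth_proj_bops[OF hsp]]) blast
      then show False using bops_orth_proj_right[OF hsp chi_bops[OF d(3)]] d(5) by simp
    qed
    then obtain A where A: "A \<in> P" and "chi M (A \<inter> D) o\<^sub>L orth_proj (hsp M) \<noteq> 0" by blast
    then have nz: "chi M (A \<inter> D) \<noteq> 0" by auto
    have Am: "A \<in> meas M" using A pieces_meas by blast
    have ADm: "A \<inter> D \<in> meas M" by (rule meas_Int[OF Am d(3)])
    have AD: "ent_bounded X G (A \<inter> D)" using d(4) unfolding ent_bounded_def by blast
    have "A \<inter> D \<noteq> {}" using nz chi_empty by auto
    then obtain c where c: "c \<in> A" "c \<in> D" by blast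
    have "(a, x) \<in> E O G O L\<inverse>" if "a \<in> A" for a
    proof -
      have "(a, c) \<in> E" "(c, d) \<in> G"
        using that c d pieces_bounded[OF A] unfolding ent_bounded_def by blast+
      then show ?thesis using d(1) by blast
    qed
    \<comment> \<open>\<open>chi M A\<close> dominates \<open>chi M (A \<inter> D)\<close>, so a
      basis of the smaller range is an orthonormal set in the larger one.\<close>
    moreover have eq: "chi M (A \<inter> D) = chi M A o\<^sub>L chi M (A \<inter> D)"
      using chi_Int[OF Am ADm] by (simp add: Int_absorb1)
    then have "chi M A \<noteq> 0" using nz by auto
    moreover obtain B where B: "orthonormal_basis (blinfun_apply (chi M (A \<inter> D)) ` hsp M) B"
        "hilbert_rank (blinfun_apply (chi M (A \<inter> D)) ` hsp M) = |B|"
      using hilbert_rank_obtain_basis[OF hilbert_sub_chi_range[OF ADm]] .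
    have "blinfun_apply (chi M (A \<inter> D)) v \<in> blinfun_apply (chi M A) ` hsp M" for v
      using bops_in[OF chi_bops[OF ADm], of v] eq by (metis blinfun_apply_blinfun_compose imageI)
    then have "B \<subseteq> blinfun_apply (chi M A) ` hsp M"
      using orthonormal_basis_subset[OF B(1)] by blast
    moreover have "\<kappa> \<le>o |B|" using rank ADm AD nz B(2) by auto
    ultimately show ?thesis using A orthonormal_basis_corthonormal[OF B(1)] by blast
  qed
  then show ?thesis using that[OF K] by blast
qed

end

text \<open>Each piece \<open>A\<close> is assigned a piece \<open>\<phi> A\<close> of
  \<open>Y\<close> near the image of \<open>A\<close>, carrying an orthonormal set of size at least
  \<open>\<kappa>\<close>. Many pieces may share one \<open>\<phi> A\<close>. But the entire basis
  \<open>B\<close> of \<open>hsp M\<close> has at most \<open>\<kappa>\<close> elements, so all of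
  \<open>B\<close> injects into each of these orthonormal sets, and vectors from different pieces
  stay apart. The support is, up to gauges, the union of the blocks
  \<open>\<phi> A \<times> A\<close>.\<close>

lemma ex_covering_isometry:
  fixes \<kappa> :: "'k rel"
  assumes \<kappa>: "Card_order \<kappa>" "infinite (Field \<kappa>)"
    and M: "partitioned_module X M E P" and N: "partitioned_module Y N F Q"
    and ampleM: "ample_module \<kappa> X M" and ampleN: "ample_module \<kappa> Y N"
    and rankM: "points X \<noteq> {} \<Longrightarrow> hilbert_rank (hsp M) =o \<kappa>" and f: "controlled_fun X Y f"
  shows "\<exists>t. covering_isometry X Y M N (fun_class X Y f) t"
proof -
  interpret M: partitioned_module X M E P by (rule M)
  interpret N: partitioned_module Y N F Q by (rule N)
  let ?RM = "\<lambda>A. blinfun_apply (chi M A) ` hsp M" and ?RN = "\<lambda>C. blinfun_apply (chi N C) ` hsp N"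
  \<comment> \<open>The pieces visible to the operator. Minimality of the support rests on finding a
    point of any competing relation in each block \<open>\<phi> A \<times> A\<close>, and this uses
    \<open>chi M A \<noteq> 0\<close>.\<close>
  define I where "I = {A \<in> P. chi M A \<noteq> 0}"
  have Pm: "A \<in> meas M" if "A \<in> P" for A using that M.pieces_meas by blast
  have Qm: "C \<in> meas N" if "C \<in> Q" for C using that N.pieces_meas by blast
  have P_disj: "A \<inter> B = {}" if "A \<in> P" "B \<in> P" "A \<noteq> B" for A B
    using that M.partition unfolding partition_on_def disjoint_def by blast
  have Q_disj: "A \<inter> B = {}" if "A \<in> Q" "B \<in> Q" "A \<noteq> B" for A B
    using that N.partition unfolding partition_on_def disjoint_def by blast
  have P_sub: "A \<subseteq> points X" "A \<noteq> {}" if "A \<in> P" for A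
    using that M.partition unfolding partition_on_def by auto
  have Q_sub: "C \<subseteq> points Y" "C \<noteq> {}" if "C \<in> Q" for C
    using that N.partition unfolding partition_on_def by auto
  obtain K where K: "K \<in> ents X" "\<And>x. x \<in> points X \<Longrightarrow> \<exists>A\<in>P. chi M A \<noteq> 0 \<and> (\<forall>a\<in>A. (a, x) \<in> K) \<and>
    (\<exists>B. corthonormal B \<and> B \<subseteq> ?RM A \<and> \<kappa> \<le>o |B| )" using M.ample_pieces[OF ampleM] by blast
  obtain L where L: "L \<in> ents Y" "\<And>y. y \<in> points Y \<Longrightarrow> \<exists>C\<in>Q. chi N C \<noteq> 0 \<and> (\<forall>c\<in>C. (c, y) \<in> L) \<and>
    (\<exists>B. corthonormal B \<and> B \<subseteq> ?RN C \<and> \<kappa> \<le>o |B| )" using N.ample_pieces[OF ampleN] by blast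
  \<comment> \<open>The piece \<open>\<phi> A\<close> is chosen near \<open>f x\<close> for one
    reference point \<open>x\<close> of \<open>A\<close>; the image of \<open>E\<close> leads from
    \<open>f x\<close> to \<open>f a\<close> for the other points \<open>a\<close>.\<close>
  define G where "G = L O map_prod f f ` E"
  have G: "G \<in> ents Y"
    unfolding G_def using f M.E_ents L(1) unfolding controlled_fun_def by (intro ents_relcomp[OF N.space]) auto
  have "\<exists>C. C \<in> Q \<and> (\<forall>c\<in>C. \<forall>a\<in>A. (c, f a) \<in> G) \<and> (\<exists>B. corthonormal B \<and> B \<subseteq> ?RN C \<and> \<kappa> \<le>o |B| )"
    if A: "A \<in> P" for A
  proof -
    obtain x where x: "x \<in> A" "x \<in> points X" using P_sub[OF A] by blast
    then have "f x \<in> points Y" using f unfolding controlled_fun_def by blast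
    then obtain C where C: "C \<in> Q" "\<forall>c\<in>C. (c, f x) \<in> L" "\<exists>B. corthonormal B \<and> B \<subseteq> ?RN C \<and> \<kappa> \<le>o |B|"
      using L(2) by blast
    have "(c, f a) \<in> G" if "c \<in> C" "a \<in> A" for c a
    proof -
      have "(x, a) \<in> E" using M.pieces_bounded[OF A] x that unfolding ent_bounded_def by blast
      then have "(f x, f a) \<in> map_prod f f ` E" by force
      with C(2)[rule_format, OF that(1)] show ?thesis unfolding G_def by (rule relcompI)
    qed
    with C show ?thesis by blast
  qed
  then obtain \<phi> where \<phi>: "\<And>A. A \<in> P \<Longrightarrow> \<phi> A \<in> Q \<and> (\<forall>c\<in>\<phi> A. \<forall>a\<in>A. (c, f a) \<in> G) \<and>
      (\<exists>B. corthonormal B \<and> B \<subseteq> ?RN (\<phi> A) \<and> \<kappa> \<le>o |B| )" by metis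
  have \<phi>Q: "\<phi> A \<in> Q" and \<phi>G: "c \<in> \<phi> A \<Longrightarrow> a \<in> A \<Longrightarrow> (c, f a) \<in> G" if "A \<in> P" for A c a
    using \<phi>[OF that] by auto
  define b where "b A = (SOME B. orthonormal_basis (?RM A) B)" for A
  have b: "orthonormal_basis (?RM A) (b A)" if "A \<in> P" for A
    unfolding b_def by (rule someI_ex[OF ex_orthonormal_basis[OF M.hilbert_sub_chi_range[OF Pm[OF that]]]])
  define B where "B = (\<Union>A\<in>P. b A)"
  have b_RM: "v \<in> ?RM A" if "A \<in> P" "v \<in> b A" for A v using orthonormal_basis_subset[OF b] that by blast
  have b_norm: "cinner v v = 1" if "A \<in> P" "v \<in> b A" for A v
    using orthonormal_basis_corthonormal[OF b[OF that(1)]] that(2) unfolding corthonormal_def by auto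
  have b_orth: "cinner v w = 0" if "A \<in> P" "A' \<in> P" "A \<noteq> A'" "v \<in> b A" "w \<in> b A'" for A A' v w
    by (rule M.chi_orthogonal[OF Pm Pm P_disj b_RM b_RM]) (use that in auto)
  \<comment> \<open>The pieces are mutually orthogonal and their projections sum strongly to the
    identity, so bases of the pieces combine to a basis of \<open>hsp M\<close>.\<close>
  have B_basis: "orthonormal_basis (hsp M) B"
    unfolding orthonormal_basis_def
  proof (intro conjI)
    show "corthonormal B"
      unfolding corthonormal_def
    proof (intro ballI)
      fix v w assume "v \<in> B" "w \<in> B"
      then obtain A A' where A: "A \<in> P" "A' \<in> P" "v \<in> b A" "w \<in> b A'" unfolding B_def by blast
      show "cinner v w = (if v = w then 1 else 0)"
      proof (cases "A = A'")
        case True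
        then show ?thesis using orthonormal_basis_corthonormal[OF b[OF A(1)]] A unfolding corthonormal_def by auto
      next
        case False
        then have "cinner v w = 0" by (rule b_orth[OF A(1,2) _ A(3,4)])
        moreover from this have "v \<noteq> w" using b_norm[OF A(1,3)] by auto
        ultimately show ?thesis by simp
      qed
    qed
    show sub: "B \<subseteq> hsp M" unfolding B_def using b_RM M.chi_range_subset[OF Pm] by blast
    show "closure (cspan B) = hsp M"
    proof
      show "closure (cspan B) \<subseteq> hsp M" by (rule closure_cspan_minimal[OF M.hsp sub])
      show "hsp M \<subseteq> closure (cspan B)"
      proof
        fix v assume v: "v \<in> hsp M"
        show "v \<in> closure (cspan B)"
        proof (rule hilbert_sub_has_sum[OF hilbert_sub_closure_cspan M.pieces_sum[OF v]])
          fix A assume A: "A \<in> P"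
          have "b A \<subseteq> closure (cspan B)" using A subset_closure_cspan[of B] unfolding B_def by blast
          then have "closure (cspan (b A)) \<subseteq> closure (cspan B)"
            by (rule closure_cspan_minimal[OF hilbert_sub_closure_cspan])
          then show "blinfun_apply (chi M A) v \<in> closure (cspan B)"
            using v unfolding orthonormal_basis_closure[OF b[OF A]] by blast
        qed
      qed
    qed
  qed
  have B_card: "|B| \<le>o \<kappa>"
  proof (cases "finite B")
    case True
    then show ?thesis by (rule finite_card_le[OF \<kappa>])
  next
    case False
    then have "points X \<noteq> {}" using P_sub unfolding B_def by force
    moreover obtain C where C: "orthonormal_basis (hsp M) C" "hilbert_rank (hsp M) = |C|"
      using hilbert_rank_obtain_basis[OF M.hsp] .
    ultimately have "|C| =o \<kappa>" using rankM by simp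
    then show ?thesis
      using orthonormal_basis_card_le[OF C(1) B_basis False] ordLeq_ordIso_trans by blast
  qed
  define D where "D C = (SOME B. corthonormal B \<and> B \<subseteq> ?RN C \<and> \<kappa> \<le>o |B| )" for C
  have D: "corthonormal (D (\<phi> A)) \<and> D (\<phi> A) \<subseteq> ?RN (\<phi> A) \<and> \<kappa> \<le>o |D (\<phi> A)|" if "A \<in> P" for A
    unfolding D_def by (rule someI_ex) (use \<phi>[OF that] in blast)
  have "\<forall>A. \<exists>\<iota>. A \<in> P \<longrightarrow> inj_on \<iota> B \<and> \<iota> ` B \<subseteq> D (\<phi> A)"
    using ordLeq_transitive[OF B_card] D card_of_ordLeq[of B] by metis
  \<comment> \<open>The injection has to depend on the target piece \<open>C\<close> and not on
    \<open>A\<close>: pieces with the same \<open>\<phi> A\<close> must share it for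
    \<open>\<gamma>\<close> to be injective.\<close>
  then have "\<forall>C. \<exists>\<iota>. C \<in> \<phi> ` P \<longrightarrow> inj_on \<iota> B \<and> \<iota> ` B \<subseteq> D C" by blast
  then obtain \<iota> where \<iota>': "\<And>C. C \<in> \<phi> ` P \<Longrightarrow> inj_on (\<iota> C) B \<and> \<iota> C ` B \<subseteq> D C" by metis
  define own where "own v = (SOME A. A \<in> P \<and> v \<in> b A)" for v
  have own: "own v \<in> P \<and> v \<in> b (own v)" if "v \<in> B" for v
    unfolding own_def by (rule someI_ex) (use that in \<open>auto simp: B_def\<close>)
  have own_eq: "own v = A" if "A \<in> P" "v \<in> b A" for A v
  proof (rule ccontr)
    assume "own v \<noteq> A"
    moreover have "v \<in> B" using that unfolding B_def by blast
    ultimately have "cinner v v = 0" using b_orth own[of v] that by blast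
    then show False using b_norm[OF that] by simp
  qed
  define \<gamma> where "\<gamma> v = \<iota> (\<phi> (own v)) v" for v
  have \<gamma>D: "\<gamma> v \<in> D (\<phi> (own v))" if "v \<in> B" for v
    unfolding \<gamma>_def using \<iota>'[of "\<phi> (own v)"] own[OF that] that by blast
  have \<gamma>R: "\<gamma> v \<in> ?RN (\<phi> (own v))" if "v \<in> B" for v
    using \<gamma>D[OF that] D[of "own v"] own[OF that] by blast
  have \<gamma>_cinner: "cinner (\<gamma> v) (\<gamma> w) = (if v = w then 1 else 0)" if v: "v \<in> B" and w: "w \<in> B" for v w
  proof (cases "\<phi> (own v) = \<phi> (own w)")
    case True
    have "inj_on (\<iota> (\<phi> (own v))) B" using \<iota>'[of "\<phi> (own v)"] own[OF v] by blast
    then have "\<gamma> v = \<gamma> w \<longleftrightarrow> v = w" unfolding \<gamma>_def True using v w by (auto dest: inj_onD)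
    then show ?thesis
      using D[of "own v"] own[OF v] \<gamma>D[OF v] \<gamma>D[OF w] unfolding True corthonormal_def by auto
  next
    case False
    have "cinner (\<gamma> v) (\<gamma> w) = 0"
      using False own[OF v] own[OF w] \<phi>Q
      by (intro N.chi_orthogonal[OF Qm Qm Q_disj \<gamma>R[OF v] \<gamma>R[OF w]]) auto
    then show ?thesis using False by auto
  qed
  have "\<exists>t. hilbert_isometry (hsp M) (hsp N) t \<and> (\<forall>v\<in>B. blinfun_apply t v = \<gamma> v)"
  proof (rule ex_isometry_of_orthonormal_bases[OF B_basis N.hsp])
    show "inj_on \<gamma> B"
      by (rule inj_onI) (metis \<gamma>_cinner zero_neq_one)
    show "corthonormal (\<gamma> ` B)" unfolding corthonormal_def
    proof (intro ballI, elim imageE)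
      fix x y v w assume "x = \<gamma> v" "v \<in> B" "y = \<gamma> w" "w \<in> B"
      then show "cinner x y = (if x = y then 1 else 0)"
        using \<gamma>_cinner[of v w] \<gamma>_cinner[of v v] by (cases "v = w") auto
    qed
    show "\<gamma> ` B \<subseteq> hsp N"
      using \<gamma>R N.chi_range_subset[OF Qm[OF \<phi>Q]] own by blast
  qed
  then obtain t where t: "hilbert_isometry (hsp M) (hsp N) t" and t\<gamma>: "\<And>v. v \<in> B \<Longrightarrow> blinfun_apply t v = \<gamma> v"
    by blast
  have tb: "t \<in> bops (hsp M) (hsp N)" by (rule isometry_bops[OF t])
  have t_piece: "chi N (\<phi> A) o\<^sub>L (t o\<^sub>L chi M A) = t o\<^sub>L chi M A" if A: "A \<in> P" for A
  proof (rule bops_eqI[OF M.hsp])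
    note Cm = Qm[OF \<phi>Q[OF A]]
    show "t o\<^sub>L chi M A \<in> bops (hsp M) (hsp N)" by (rule compose_bops[OF tb M.chi_bops[OF Pm[OF A]]])
    then show "chi N (\<phi> A) o\<^sub>L (t o\<^sub>L chi M A) \<in> bops (hsp M) (hsp N)"
      by (rule compose_bops[OF N.chi_bops[OF Cm]])
    fix v assume v: "v \<in> hsp M"
    \<comment> \<open>The vectors that \<open>t\<close> sends into the range over
      \<open>\<phi> A\<close> form a closed subspace, so it is enough that it contains the basis
      vectors of \<open>A\<close>.\<close>
    let ?K = "{v. blinfun_apply t v \<in> ?RN (\<phi> A)}"
    have K: "hilbert_sub ?K" by (rule hilbert_sub_vimage[OF bops_clin[OF tb] N.hilbert_sub_chi_range[OF Cm]])
    have "b A \<subseteq> ?K"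
    proof
      fix w assume w: "w \<in> b A"
      then have "w \<in> B" using A unfolding B_def by blast
      then show "w \<in> ?K" using t\<gamma> \<gamma>R own_eq[OF A w] by auto
    qed
    then have "?RM A \<subseteq> ?K"
      using closure_cspan_minimal[OF K] orthonormal_basis_closure[OF b[OF A]] by blast
    then have "blinfun_apply t (blinfun_apply (chi M A) v) \<in> ?RN (\<phi> A)" using v by blast
    then show "blinfun_apply (chi N (\<phi> A) o\<^sub>L (t o\<^sub>L chi M A)) v = blinfun_apply (t o\<^sub>L chi M A) v"
      unfolding N.chi_range[OF Cm] by simp
  qed
  define S where "S = (\<Union>A\<in>I. \<phi> A \<times> A)"
  have IP: "A \<in> P" if "A \<in> I" for A using that unfolding I_def by blast
  have S_sub: "S \<subseteq> points Y \<times> points X"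
    unfolding S_def using P_sub(1)[OF IP] Q_sub(1)[OF \<phi>Q[OF IP]] by blast
  have supp: "supp_in M N t S"
    unfolding supp_in_def
  proof (intro ballI impI)
    fix B' A' assume BA: "B' \<in> meas N" "A' \<in> meas M" "separated S B' A'"
    \<comment> \<open>The decomposition into pieces of \<open>X\<close> acts on the right here,
      while \<open>pieces_zero\<close> works on the left; the adjoint is tested instead.\<close>
    let ?s = "op_adj (chi N B' o\<^sub>L t)"
    have sb: "chi N B' o\<^sub>L t \<in> bops (hsp M) (hsp N)" by (rule compose_bops[OF N.chi_bops[OF BA(1)] tb])
    have zero: "(chi N B' o\<^sub>L t) o\<^sub>L chi M (A \<inter> A') = 0" if A: "A \<in> P" for A
    proof (cases "A \<inter> A' = {} \<or> chi M A = 0")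
      case True
      then show ?thesis using M.chi_Int[OF Pm[OF A] BA(2)] M.chi_empty by auto
    next
      case False
      then have "A \<in> I" "A \<inter> A' \<noteq> {}" using A unfolding I_def by auto
      then have "B' \<inter> \<phi> A = {}" using BA(3) unfolding separated_def rel_img_def S_def by blast
      then have z: "chi N B' o\<^sub>L chi N (\<phi> A) = 0"
        using N.chi_Int[OF BA(1) Qm[OF \<phi>Q[OF A]]] N.chi_empty by simp
      have "(chi N B' o\<^sub>L t) o\<^sub>L chi M (A \<inter> A') = chi N B' o\<^sub>L ((t o\<^sub>L chi M A) o\<^sub>L chi M A')"
        unfolding M.chi_Int[OF Pm[OF A] BA(2)] by (simp add: blinfun_compose_assoc)
      also have "\<dots> = (chi N B' o\<^sub>L chi N (\<phi> A)) o\<^sub>L ((t o\<^sub>L chi M A) o\<^sub>L chi M A')"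
        by (subst t_piece[OF A, symmetric]) (simp add: blinfun_compose_assoc)
      finally show ?thesis by (simp add: z)
    qed
    have adj: "op_adj (chi N B' o\<^sub>L t o\<^sub>L chi M C) = chi M C o\<^sub>L ?s" if "C \<in> meas M" for C
      by (simp add: op_adj_compose[OF bops_clin[OF sb] bops_clin[OF M.chi_bops[OF that]]] M.chi_adj[OF that])
    have "chi M A' o\<^sub>L ?s = 0"
    proof (rule M.pieces_zero[OF BA(2) op_adj_bops[OF M.hsp sb]])
      fix A assume A: "A \<in> P"
      show "chi M (A \<inter> A') o\<^sub>L ?s = 0"
        unfolding adj[OF M.meas_Int[OF Pm[OF A] BA(2)], symmetric] zero[OF A] by (rule op_adj_zero)
    qed
    then have "op_adj (op_adj (chi N B' o\<^sub>L t o\<^sub>L chi M A')) = 0"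
      unfolding adj[OF BA(2)] by (simp add: op_adj_zero)
    then show "chi N B' o\<^sub>L t o\<^sub>L chi M A' = 0"
      using op_adj_op_adj[OF bops_clin[OF compose_bops[OF sb M.chi_bops[OF BA(2)]]]] by simp
  qed
  have "S \<subseteq> G O fun_rel X f"
  proof
    fix q assume "q \<in> S"
    then obtain A z a where "A \<in> I" "z \<in> \<phi> A" "a \<in> A" "q = (z, a)" unfolding S_def by blast
    then show "q \<in> G O fun_rel X f"
      using \<phi>G[OF IP, of A z a] P_sub(1)[OF IP, of A] in_relcomp_fun_rel[of z a G X f] by blast
  qed
  then have le1: "coarse_le X Y S (fun_rel X f)"
    unfolding coarse_le_fun_rel_iff[OF M.space N.space f] using G by blast
  have le2: "coarse_le X Y (fun_rel X f) S"
  proof -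
    \<comment> \<open>Near \<open>x\<close> there is a piece \<open>A\<close> with
      \<open>chi M A \<noteq> 0\<close>. For \<open>a\<close> in \<open>A\<close> and
      \<open>z\<close> in \<open>\<phi> A\<close> the path leads from \<open>f x\<close> to
      \<open>f a\<close>, on to \<open>z\<close>, through \<open>S\<close> to \<open>a\<close>, and
      by \<open>K\<close> to \<open>x\<close>.\<close>
    have "fun_rel X f \<subseteq> (map_prod f f ` K\<inverse> O G\<inverse>) O S O K"
    proof
      fix p assume "p \<in> fun_rel X f"
      then obtain x where x: "x \<in> points X" "p = (f x, x)" unfolding fun_rel_def by blast
      obtain A where A: "A \<in> P" "chi M A \<noteq> 0" "\<forall>a\<in>A. (a, x) \<in> K" using K(2)[OF x(1)] by blast
      obtain a z where az: "a \<in> A" "z \<in> \<phi> A" using P_sub(2)[OF A(1)] Q_sub(2)[OF \<phi>Q[OF A(1)]] by blast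
      have "(z, a) \<in> S" unfolding S_def I_def using A az by blast
      moreover have "(f a, z) \<in> G\<inverse>" using \<phi>G[OF A(1) az(2,1)] by simp
      moreover have ax: "(a, x) \<in> K" using A(3) az(1) by blast
      then have "map_prod f f (x, a) \<in> map_prod f f ` K\<inverse>" by (intro imageI) simp
      then have "(f x, f a) \<in> map_prod f f ` K\<inverse>" by simp
      ultimately show "p \<in> (map_prod f f ` K\<inverse> O G\<inverse>) O S O K"
        unfolding x(2) using ax by (intro relcompI)
    qed
    moreover have "map_prod f f ` K\<inverse> O G\<inverse> \<in> ents Y"
      using f ents_converse[OF M.space K(1)] ents_converse[OF N.space G]
      unfolding controlled_fun_def by (intro ents_relcomp[OF N.space]) auto
    ultimately show ?thesis unfolding coarse_le_def using K(1) by (intro bexI)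
  qed
  \<comment> \<open>If the block \<open>\<phi> A \<times> A\<close> were \<open>R\<close>-separated,
    then \<open>t o\<^sub>L chi M A\<close> would vanish, and so would \<open>chi M A\<close>, as
    \<open>t\<close> is isometric. Hence \<open>R\<close> meets every block of \<open>S\<close>, and
    a block lies within the gauges of any of its points.\<close>
  have minimal: "coarse_le X Y S R" if R: "supp_in M N t R" for R
  proof -
    have "S \<subseteq> F O R O E"
    proof
      fix p assume "p \<in> S"
      then obtain A z a where A: "A \<in> I" "z \<in> \<phi> A" "a \<in> A" "p = (z, a)" unfolding S_def by blast
      note AP = IP[OF A(1)]
      have "\<not> separated R (\<phi> A) A"
      proof
        assume "separated R (\<phi> A) A"
        then have "t o\<^sub>L chi M A = 0"
          using R[unfolded supp_in_def, rule_format, OF Qm[OF \<phi>Q[OF AP]] Pm[OF AP]] t_piece[OF AP]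
          by (simp add: blinfun_compose_assoc)
        have "chi M A = 0"
        proof (rule blinfun_eqI)
          fix v
          have "norm (blinfun_apply (chi M A) v) = norm (blinfun_apply (t o\<^sub>L chi M A) v)"
            using t bops_in[OF M.chi_bops[OF Pm[OF AP]]] unfolding hilbert_isometry_def by simp
          then show "blinfun_apply (chi M A) v = blinfun_apply 0 v"
            using \<open>t o\<^sub>L chi M A = 0\<close> by simp
        qed
        then show False using A(1) unfolding I_def by blast
      qed
      then obtain y x where yx: "(y, x) \<in> R" "y \<in> \<phi> A" "x \<in> A" unfolding separated_def rel_img_def by blast
      have "(z, y) \<in> F" "(x, a) \<in> E"
        using A yx N.pieces_bounded[OF \<phi>Q[OF AP]] M.pieces_bounded[OF AP] unfolding ent_bounded_def by blast+
      then show "p \<in> F O R O E" unfolding A(4) by (rule relcompI[OF _ relcompI[OF yx(1)]])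
    qed
    then show ?thesis unfolding coarse_le_def using M.E_ents N.E_ents by (intro bexI)
  qed
  have "fun_class X Y f = coarse_class X Y S" by (rule coarse_class_eqI[OF M.space N.space le2 le1])
  then have "is_coarse_support X Y M N t (fun_class X Y f)"
    unfolding is_coarse_support_def by (intro exI[of _ S] conjI allI impI S_sub supp minimal) auto
  then show ?thesis unfolding covering_isometry_def using t by blast
qed

section \<open>Existence of modules\<close>

lemma orth_proj_expansion:
  assumes B: "orthonormal_basis H B"
  shows "((\<lambda>b. cinner v b *\<^sub>C b) has_sum blinfun_apply (orth_proj H) v) B"
proof -
  note H = orthonormal_basis_hilbert_sub[OF B]
  have "cinner (blinfun_apply (orth_proj H) v) b = cinner v b" if "b \<in> B" for b
    using orth_proj_orthogonal[OF H, of b v] orthonormal_basis_subset[OF B] that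
    by (auto simp: cinner.diff_left)
  then show ?thesis
    using orthonormal_expansion[OF B orth_proj_in[OF H, of v]] by (simp cong: has_sum_cong)
qed

lemma op_adj_orth_proj:
  assumes H: "hilbert_sub H"
  shows "op_adj (orth_proj H) = orth_proj H"
proof (rule op_adj_unique)
  fix v w
  let ?P = "blinfun_apply (orth_proj H)"
  have "cinner (v - ?P v) (?P w) = 0" "cinner (w - ?P w) (?P v) = 0"
    by (intro orth_proj_orthogonal orth_proj_in H)+
  then have "cinner (v - ?P v) (?P w) = 0" "cinner (?P v) (w - ?P w) = 0"
    using cinner_eq_zero_commute by blast+
  then show "cinner (?P v) w = cinner v (?P w)" by (simp add: cinner.diff_left cinner.diff_right)
qed

text \<open>The module of an orthonormal set \<open>B\<close> whose elements \<open>b\<close> are placed at the points \<open>p b\<close>.\<close>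

locale based_module =
  fixes X :: "'a coarse" and B :: "'h::chilbert_space set" and p :: "'h \<Rightarrow> 'a" and \<kappa> :: "'k rel"
  assumes X: "coarse_space X" and B: "corthonormal B" and p: "p \<in> B \<rightarrow> points X"
    and \<kappa>: "Card_order \<kappa>" "infinite (Field \<kappa>)"
    and fibres: "\<And>b. b \<in> B \<Longrightarrow> \<kappa> \<le>o |{c \<in> B. p c = p b}|"
begin

definition over :: "'a set \<Rightarrow> 'h set" where
  "over A = {b \<in> B. p b \<in> A}"

definition sub :: "'a set \<Rightarrow> 'h set" where
  "sub A = closure (cspan (over A))"

definition based :: "('a, 'h) cmodule" where
  "based = \<lparr>meas = Pow (points X), hsp = closure (cspan B), chi = (\<lambda>A. orth_proj (sub A))\<rparr>"

lemma based_simps [simp]: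
  "meas based = Pow (points X)" "hsp based = closure (cspan B)" "chi based A = orth_proj (sub A)"
  unfolding based_def by simp_all

lemma over_points: "over (points X) = B"
  unfolding over_def using p by auto

lemma hilbert_sub_sub: "hilbert_sub (sub A)"
  unfolding sub_def by (rule hilbert_sub_closure_cspan)

lemma basis_sub: "orthonormal_basis (sub A) (over A)"
  unfolding orthonormal_basis_def sub_def
  using corthonormal_subset[OF B, of "over A"] subset_closure_cspan[of "over A"] by (auto simp: over_def)

lemma sub_mono: "A \<subseteq> A' \<Longrightarrow> sub A \<subseteq> sub A'"
  unfolding sub_def
  by (intro closure_cspan_minimal hilbert_sub_closure_cspan order_trans[OF _ subset_closure_cspan])
    (auto simp: over_def)

lemma sub_points: "sub (points X) = closure (cspan B)"
  unfolding sub_def over_points ..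

text \<open>All projections are diagonal in \<open>B\<close> with eigenvalues \<open>0\<close> and
  \<open>1\<close>; through \<open>eq_if_coefficients\<close> the Boolean identities become
  statements about these.\<close>

lemma coefficient:
  assumes "b \<in> B"
  shows "cinner (blinfun_apply (orth_proj (sub A)) v) b = (if p b \<in> A then cinner v b else 0)"
proof (cases "p b \<in> A")
  case True
  then have "b \<in> over A" using assms unfolding over_def by simp
  then have "b \<in> sub A" unfolding sub_def by (rule subsetD[OF subset_closure_cspan])
  then show ?thesis using True orth_proj_orthogonal[OF hilbert_sub_sub, of b A v] by (simp add: cinner.diff_left)
next
  case False
  have 0: "cinner b w = 0" if "w \<in> sub A" for w
  proof (rule orthogonal_closure_cspan[of "over A"])
    show "cinner b s = 0" if "s \<in> over A" for s
    proof -
      have "s \<in> B" "b \<noteq> s" using that False unfolding over_def by auto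
      then show ?thesis using B[unfolded corthonormal_def, rule_format, OF assms] by simp
    qed
  qed (use that in \<open>simp add: sub_def\<close>)
  then show ?thesis
    using False iffD1[OF cinner_eq_zero_commute 0[OF orth_proj_in[OF hilbert_sub_sub, of A v]]] by simp
qed

lemma eq_if_coefficients:
  assumes "v \<in> closure (cspan B)" "w \<in> closure (cspan B)" "\<And>b. b \<in> B \<Longrightarrow> cinner v b = cinner w b"
  shows "v = w"
proof -
  have "cinner (v - w) (v - w) = 0"
    by (rule orthogonal_closure_cspan[of B])
      (simp_all add: assms cinner.diff_left hilbert_sub_diff[OF hilbert_sub_closure_cspan])
  then show ?thesis by (simp add: cinner_self_zero)
qed

lemma proj_in: "A \<subseteq> points X \<Longrightarrow> blinfun_apply (orth_proj (sub A)) v \<in> closure (cspan B)"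
  using orth_proj_in[OF hilbert_sub_sub] sub_mono sub_points by blast

lemma chi_Int: "A \<subseteq> points X \<Longrightarrow> C \<subseteq> points X \<Longrightarrow>
    orth_proj (sub (A \<inter> C)) = orth_proj (sub A) o\<^sub>L orth_proj (sub C)"
  by (intro blinfun_eqI eq_if_coefficients) (auto simp: coefficient intro: proj_in)

lemma chi_Un: "A \<subseteq> points X \<Longrightarrow> C \<subseteq> points X \<Longrightarrow>
    orth_proj (sub (A \<union> C)) = orth_proj (sub A) + orth_proj (sub C) - (orth_proj (sub A) o\<^sub>L orth_proj (sub C))"
  by (intro blinfun_eqI eq_if_coefficients)
    (auto simp: coefficient blinfun.add_left blinfun.diff_left cinner_simps
      intro!: proj_in hilbert_sub_diff[OF hilbert_sub_closure_cspan] hilbert_sub_add[OF hilbert_sub_closure_cspan])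

lemma chi_bops: "A \<subseteq> points X \<Longrightarrow> orth_proj (sub A) \<in> bops (closure (cspan B)) (closure (cspan B))"
  by (intro bopsI orth_proj_clin hilbert_sub_sub proj_in orth_proj_zero) (use sub_mono sub_points in blast)+

lemma chi_range: "A \<subseteq> points X \<Longrightarrow> blinfun_apply (orth_proj (sub A)) ` closure (cspan B) = sub A"
proof
  assume "A \<subseteq> points X"
  then have le: "sub A \<subseteq> closure (cspan B)" using sub_mono[of A "points X"] sub_points by simp
  show "sub A \<subseteq> blinfun_apply (orth_proj (sub A)) ` closure (cspan B)"
  proof
    fix v assume v: "v \<in> sub A"
    show "v \<in> blinfun_apply (orth_proj (sub A)) ` closure (cspan B)"
      by (rule image_eqI[OF _ subsetD[OF le v]]) (simp add: orth_proj_id[OF hilbert_sub_sub v])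
  qed
qed (use orth_proj_in[OF hilbert_sub_sub] in blast)

lemma over_nonempty: "orth_proj (sub A) \<noteq> 0 \<Longrightarrow> over A \<noteq> {}"
proof
  assume "orth_proj (sub A) \<noteq> 0" "over A = {}"
  then have "sub A = {0}" unfolding sub_def by simp
  then have "blinfun_apply (orth_proj (sub A)) v = 0" for v
    using orth_proj_in[OF hilbert_sub_sub, of A v] by simp
  then have "orth_proj (sub A) = 0" by (intro blinfun_eqI) simp
  then show False using \<open>orth_proj (sub A) \<noteq> 0\<close> by simp
qed

text \<open>One basis vector over \<open>A\<close> brings along the whole fibre of \<open>p\<close>
  through it, and that already has at least \<open>\<kappa>\<close> elements.\<close>

lemma rank_sub:
  assumes "over A \<noteq> {}"
  shows "\<kappa> \<le>o hilbert_rank (sub A)"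
proof -
  obtain b where b: "b \<in> B" "p b \<in> A" using assms unfolding over_def by blast
  have "{c \<in> B. p c = p b} \<subseteq> over A" using b unfolding over_def by auto
  then have le: "\<kappa> \<le>o |over A|" using fibres[OF b(1)] card_of_mono1 ordLeq_transitive by blast
  obtain C where C: "orthonormal_basis (sub A) C" "hilbert_rank (sub A) = |C|"
    using hilbert_rank_obtain_basis[OF hilbert_sub_sub] .
  show ?thesis unfolding C(2)
    by (rule ordLeq_transitive[OF le orthonormal_basis_card_le[OF C(1) basis_sub infinite_if_card_ge[OF \<kappa> le]]])
qed

text \<open>The expansion of \<open>v\<close> in \<open>B\<close> is reindexed by pairs of a piece
  and a basis vector over it, and then summed piece by piece.\<close>

lemma chi_partition:
  assumes P: "partition_on (points X) P" and v: "v \<in> closure (cspan B)"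
  shows "((\<lambda>A. blinfun_apply (orth_proj (sub A)) v) has_sum v) P"
proof -
  have basis: "orthonormal_basis (closure (cspan B)) B" using basis_sub[of "points X"] by (simp add: over_points sub_points)
  have "bij_betw snd (Sigma P over) B"
    unfolding bij_betw_def
  proof
    show "inj_on snd (Sigma P over)"
    proof (rule inj_onI, clarsimp simp: over_def)
      fix A A' b assume "A \<in> P" "A' \<in> P" "p b \<in> A" "p b \<in> A'"
      then show "A = A'" using disjointD[OF partition_onD2[OF P], of A A'] by blast
    qed
    show "snd ` Sigma P over = B"
    proof
      show "snd ` Sigma P over \<subseteq> B" unfolding over_def by auto
      show "B \<subseteq> snd ` Sigma P over"
      proof
        fix b assume b: "b \<in> B"
        then have "p b \<in> points X" using p by auto
        then have "p b \<in> \<Union>P" using partition_onD1[OF P] by simp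
        then obtain A where "A \<in> P" "p b \<in> A" by blast
        then have "(A, b) \<in> Sigma P over" using b unfolding over_def by simp
        then show "b \<in> snd ` Sigma P over" by (rule image_eqI[rotated]) simp
      qed
    qed
  qed
  then have "((\<lambda>x. cinner v (snd x) *\<^sub>C snd x) has_sum v) (Sigma P over)"
    using orthonormal_expansion[OF basis v] has_sum_reindex_bij_betw[of snd "Sigma P over" B "\<lambda>b. cinner v b *\<^sub>C b" v] by simp
  then show ?thesis
    by (rule has_sum_SigmaD) (simp add: orth_proj_expansion[OF basis_sub])
qed

text \<open>The net \<open>r\<close> supplies all the data: the gauge relates points with equal
  value of \<open>r\<close>, the pieces are the fibres of \<open>r\<close>, and ampleness holds
  because basis vectors sit at every point of the image of \<open>r\<close>, which is coarsely dense
  since \<open>r\<close> is close to the identity.\<close>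

lemma roe_module:
  assumes r: "close_fun X X r id" and pr: "p ` B = r ` points X"
    and rank: "points X \<noteq> {} \<Longrightarrow> |B| =o \<kappa>"
  shows "roe_module \<kappa> X based"
proof -
  define R where "R = (\<lambda>x. (r x, x)) ` points X"
  have R: "R \<in> ents X" using r unfolding close_fun_def R_def by simp
  have rX: "r x \<in> points X" if "x \<in> points X" for x
    using ents_subset[OF X R] that unfolding R_def by blast
  define E where "E = R\<inverse> O R"
  have E_iff: "(x, y) \<in> E \<longleftrightarrow> x \<in> points X \<and> y \<in> points X \<and> r x = r y" for x y
    unfolding E_def R_def by auto
  have gauge: "gauge_of X E"
    unfolding gauge_of_def
  proof (intro conjI)
    show "E \<in> ents X" unfolding E_def by (intro ents_relcomp ents_converse X R)
    show "E\<inverse> = E" using E_iff by auto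
    show "Id_on (points X) \<subseteq> E" using E_iff by auto
  qed
  define P where "P = (\<lambda>i. {x \<in> points X. r x = i}) ` r ` points X"
  have P: "partition_on (points X) P"
    unfolding partition_on_def disjoint_def P_def by auto
  have single: "ent_bounded X E {p b}" "b \<in> sub {p b}" "over {p b} \<noteq> {}" if "b \<in> B" for b
    using that p E_iff subset_closure_cspan[of "over {p b}"] unfolding ent_bounded_def sub_def over_def by auto
  have "coarse_module X based"
    unfolding coarse_module_def based_simps
  proof (intro conjI ballI exI[of _ E] gauge)
    show "algebra (points X) (Pow (points X))" by (simp add: algebra_Pow)
    show "hilbert_sub (closure (cspan B))" by (rule hilbert_sub_closure_cspan)
    show "hilbert_projection (closure (cspan B)) (orth_proj (sub A))" if "A \<in> Pow (points X)" for A
      unfolding hilbert_projection_def using that chi_bops op_adj_orth_proj[OF hilbert_sub_sub] chi_Int[of A A] by simp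
    show "orth_proj (sub {}) = 0"
      using over_nonempty[of "{}"] unfolding over_def by blast
    show "blinfun_apply (orth_proj (sub (points X))) v = v" if "v \<in> closure (cspan B)" for v
      using that orth_proj_id[OF hilbert_sub_sub] unfolding sub_points by (metis sub_points hilbert_sub_sub orth_proj_id)
    show "orth_proj (sub (A \<inter> C)) = orth_proj (sub A) o\<^sub>L orth_proj (sub C)"
      "orth_proj (sub (A \<union> C)) = orth_proj (sub A) + orth_proj (sub C) - (orth_proj (sub A) o\<^sub>L orth_proj (sub C))"
      if "A \<in> Pow (points X)" "C \<in> Pow (points X)" for A C
      using that chi_Int chi_Un by auto
    let ?S = "\<Union>A\<in>{A \<in> Pow (points X). ent_bounded X E A}. blinfun_apply (orth_proj (sub A)) ` closure (cspan B)"
    show "closure (cspan ?S) = closure (cspan B)"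
    proof
      show "closure (cspan ?S) \<subseteq> closure (cspan B)"
        by (intro closure_cspan_minimal hilbert_sub_closure_cspan) (use proj_in in blast)
      have "b \<in> ?S" if b: "b \<in> B" for b
      proof -
        have pb: "{p b} \<subseteq> points X" using p b by auto
        have "b \<in> blinfun_apply (orth_proj (sub {p b})) ` closure (cspan B)"
          using single(2)[OF b] unfolding chi_range[OF pb] .
        then show ?thesis using pb single(1)[OF b] by blast
      qed
      then show "closure (cspan B) \<subseteq> closure (cspan ?S)"
        by (intro closure_cspan_minimal hilbert_sub_closure_cspan order_trans[OF _ subset_closure_cspan]) blast
    qed
  qed
  moreover have "discrete_module X based"
    unfolding discrete_module_def based_simps
  proof (intro exI[of _ E] exI[of _ P] conjI ballI gauge P allI impI)
    show "P \<subseteq> Pow (points X)" unfolding P_def by auto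
    show "ent_bounded X E A" if "A \<in> P" for A
      using that unfolding P_def ent_bounded_def by (auto simp: E_iff)
    show "((\<lambda>A. blinfun_apply (orth_proj (sub A)) v) has_sum v) P" if "v \<in> closure (cspan B)" for v
      by (rule chi_partition[OF P that])
  qed simp
  moreover have "ample_module \<kappa> X based"
    unfolding ample_module_def based_simps
  proof (intro exI[of _ E] conjI ballI impI gauge)
    let ?U = "\<Union>{A \<in> Pow (points X). ent_bounded X E A \<and> orth_proj (sub A) \<noteq> 0}"
    have "r x \<in> ?U" if x: "x \<in> points X" for x
    proof -
      obtain b where b: "b \<in> B" "r x = p b" using pr x by blast
      have "cinner b b = 1" using b(1) B unfolding corthonormal_def by simp
      then have "b \<noteq> 0" by (auto simp: cinner_simps)
      then have "orth_proj (sub {p b}) \<noteq> 0"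
        using orth_proj_id[OF hilbert_sub_sub single(2)[OF b(1)]] by auto
      then show ?thesis using single(1)[OF b(1)] rX[OF x] b(2) by auto
    qed
    then have "points X \<subseteq> rel_img (R\<inverse>) ?U"
      unfolding rel_img_def R_def by (intro subsetI CollectI bexI[of _ "r _"]) auto
    moreover have "rel_img (R\<inverse>) ?U \<subseteq> points X" unfolding rel_img_def R_def by auto
    ultimately have "points X = rel_img (R\<inverse>) ?U" by (rule equalityI)
    moreover have "?U \<subseteq> points X" by blast
    ultimately show "coarsely_dense X ?U"
      unfolding coarsely_dense_def by (intro conjI bexI[OF _ ents_converse[OF X R]])
    fix A assume "A \<in> Pow (points X)" "ent_bounded X E A \<and> orth_proj (sub A) \<noteq> 0"
    then show "\<kappa> \<le>o hilbert_rank (blinfun_apply (orth_proj (sub A)) ` closure (cspan B))"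
      using rank_sub over_nonempty by (simp add: chi_range)
  qed
  moreover have "hilbert_rank (closure (cspan B)) =o \<kappa>" if ne: "points X \<noteq> {}"
  proof -
    have basis: "orthonormal_basis (closure (cspan B)) B" using basis_sub[of "points X"] by (simp add: over_points sub_points)
    obtain C where C: "orthonormal_basis (closure (cspan B)) C" "hilbert_rank (closure (cspan B)) = |C|"
      using hilbert_rank_obtain_basis[OF hilbert_sub_closure_cspan] .
    have inf: "infinite B" by (rule infinite_if_card_iso[OF \<kappa> rank[OF ne]])
    have 1: "|B| \<le>o |C|" by (rule orthonormal_basis_card_le[OF C(1) basis inf])
    have 2: "|C| \<le>o |B|"
      by (rule orthonormal_basis_card_le[OF basis C(1) card_of_ordLeq_infinite[OF 1 inf]])
    have "|C| =o |B|" using 1 2 by (simp add: ordIso_iff_ordLeq)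
    then show ?thesis unfolding C(2) using rank[OF ne] by (rule ordIso_transitive)
  qed
  ultimately show ?thesis unfolding roe_module_def by simp
qed

end

text \<open>The net has at most \<open>\<kappa>\<close> points, so \<open>B\<close> is in bijection
  with the product of the net and \<open>B\<close>. Placing a basis vector at its first component
  puts \<open>\<kappa>\<close> vectors over every point of the net.\<close>

lemma ex_roe_module:
  fixes \<kappa> :: "'k rel" and X :: "'a coarse"
  assumes \<kappa>: "Card_order \<kappa>" "infinite (Field \<kappa>)" and X: "coarse_space X" "coarse_card X \<le>o \<kappa>"
    and B: "corthonormal (B :: 'h::chilbert_space set)" "|B| =o \<kappa>"
  shows "\<exists>M :: ('a, 'h) cmodule. roe_module \<kappa> X M"
proof -
  obtain r where r: "r ` points X \<subseteq> points X" "|r ` points X| \<le>o \<kappa>" "close_fun X X r id"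
    using coarse_card_obtain_net[OF X] by blast
  show ?thesis
  proof (cases "points X = {}")
    \<comment> \<open>With an empty net the product would be empty while \<open>B\<close> is
      infinite, so the empty space receives the zero module.\<close>
    case True
    interpret based_module X "{} :: 'h set" "\<lambda>_. undefined" \<kappa>
      by unfold_locales (simp_all add: X \<kappa> corthonormal_def)
    have "roe_module \<kappa> X based" by (rule roe_module[OF r(3)]) (simp_all add: True)
    then show ?thesis by blast
  next
    case False
    have inf: "infinite B" by (rule infinite_if_card_iso[OF \<kappa> B(2)])
    have "|r ` points X| \<le>o |B|" by (rule ordLeq_ordIso_trans[OF r(2) ordIso_symmetric[OF B(2)]])
    then have "|B| =o |r ` points X \<times> B|"
      using card_of_Times_infinite_simps(4)[OF inf, of "r ` points X"] False by blast
    then obtain g where g: "bij_betw g B (r ` points X \<times> B)" using card_of_ordIso by blast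
    interpret based_module X B "fst \<circ> g" \<kappa>
    proof
      have gB: "fst (g c) \<in> r ` points X" if "c \<in> B" for c
        using bij_betwE[OF g] that by (simp add: mem_Times_iff)
      show "fst \<circ> g \<in> B \<rightarrow> points X" using gB r(1) by (intro Pi_I) auto
      fix b assume b: "b \<in> B"
      let ?F = "{c \<in> B. (fst \<circ> g) c = (fst \<circ> g) b}"
      note gb = gB[OF b]
      have inv: "g (inv_into B g (fst (g b), c)) = (fst (g b), c)" if "c \<in> B" for c
        by (rule bij_betw_inv_into_right[OF g]) (use gb that in simp)
      have "inj_on (\<lambda>c. inv_into B g (fst (g b), c)) B"
      proof (rule inj_onI)
        fix c d assume cd: "c \<in> B" "d \<in> B" and eq: "inv_into B g (fst (g b), c) = inv_into B g (fst (g b), d)"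
        show "c = d"
          using trans[OF inv[OF cd(1), symmetric] trans[OF arg_cong[OF eq, of g] inv[OF cd(2)]]] by simp
      qed
      moreover have "(\<lambda>c. inv_into B g (fst (g b), c)) ` B \<subseteq> ?F"
      proof
        fix d assume "d \<in> (\<lambda>c. inv_into B g (fst (g b), c)) ` B"
        then obtain c where c: "c \<in> B" "d = inv_into B g (fst (g b), c)" by blast
        have mem: "(fst (g b), c) \<in> r ` points X \<times> B" using gb c(1) by simp
        have "g d = (fst (g b), c)" unfolding c(2) by (rule inv[OF c(1)])
        moreover have "d \<in> B" unfolding c(2) using g mem by (simp add: bij_betw_def inv_into_into)
        ultimately show "d \<in> ?F" by simp
      qed
      ultimately have "|B| \<le>o |?F|" using card_of_ordLeq[of B ?F] by blast
      then show "\<kappa> \<le>o |?F|" by (rule ordIso_ordLeq_trans[OF ordIso_symmetric[OF B(2)]])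
    qed (simp_all add: X \<kappa> B)
    have "(fst \<circ> g) ` B = r ` points X"
    proof -
      have "(fst \<circ> g) ` B = fst ` (r ` points X \<times> B)" unfolding bij_betw_imp_surj_on[OF g, symmetric] by (simp only: image_comp)
      moreover have "B \<noteq> {}" using inf by auto
      ultimately show ?thesis unfolding \<open>(fst \<circ> g) ` B = _\<close> by (simp only: fst_image_times if_False)
    qed
    then have "roe_module \<kappa> X based" by (rule roe_module[OF r(3)]) (rule assms(6))
    then show ?thesis by blast
  qed
qed

section \<open>The functor\<close>

definition K_alg :: "'a coarse \<Rightarrow> ('a, 'h::chilbert_space) cmodule
    \<Rightarrow> ((complex \<times> ('h \<Rightarrow>\<^sub>L 'h)) K0_elt, ('h \<Rightarrow>\<^sub>L 'h) K1_elt) graded" where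
  "K_alg X M = (K0 (roe_algebra X M), K1 (roe_algebra X M))"

text \<open>Unlike in \<open>K_Roe_map\<close>, source and target may live in different types of
  Hilbert space vectors, as the comparison of two choices of modules requires.\<close>

definition K_Ad :: "'b coarse \<Rightarrow> ('b, 'k::chilbert_space) cmodule \<Rightarrow> ('h::chilbert_space \<Rightarrow>\<^sub>L 'k)
    \<Rightarrow> ((complex \<times> ('h \<Rightarrow>\<^sub>L 'h)) K0_elt \<Rightarrow> (complex \<times> ('k \<Rightarrow>\<^sub>L 'k)) K0_elt)
      \<times> (('h \<Rightarrow>\<^sub>L 'h) K1_elt \<Rightarrow> ('k \<Rightarrow>\<^sub>L 'k) K1_elt)" where
  "K_Ad Y N t = (K0_map (roe_algebra Y N) (Ad t), K1_map (roe_algebra Y N) (Ad t))"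

definition roe_object :: "'k rel \<Rightarrow> 'a coarse \<Rightarrow> ('a, 'h::chilbert_space) cmodule \<Rightarrow> bool" where
  "roe_object \<kappa> X M \<longleftrightarrow> coarse_space X \<and> roe_module \<kappa> X M"

lemma roe_object_obtain:
  assumes "roe_object \<kappa> X M"
  obtains E P where "partitioned_module X M E P"
proof -
  have "coarse_space X" "coarse_module X M" "discrete_module X M"
    using assms unfolding roe_object_def roe_module_def by simp_all
  then obtain E P where "partitioned_module X M E P" by (rule partitioned_module_obtain)
  then show ?thesis by (rule that)
qed

lemma roe_object_space: "roe_object \<kappa> X M \<Longrightarrow> coarse_space X"
  unfolding roe_object_def by simp

lemma Ad_compose:
  assumes "clin t" "clin s"
  shows "Ad (t o\<^sub>L s) x = Ad t (Ad s x)"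
  unfolding Ad_def op_adj_compose[OF assms] by (simp add: blinfun_compose_assoc)

lemma near_isometry_clin: "near_isometry X Y M N f t \<Longrightarrow> clin t"
  unfolding near_isometry_def by (elim conjE) (rule bops_clin[OF isometry_bops])

lemma graded_ab_group_K_alg:
  assumes "roe_object \<kappa> X M"
  shows "graded_ab_group (K_alg X M)"
proof -
  obtain E P where "partitioned_module X M E P" by (rule roe_object_obtain[OF assms])
  then interpret partitioned_module X M E P .
  interpret star_algebra "roe_algebra X M" by (rule star_algebra_roe)
  show ?thesis unfolding graded_ab_group_def K_alg_def using comm_group_K0 comm_group_K1 by simp
qed

lemma K_Ad_hom:
  assumes X: "roe_object \<kappa> X M" and Y: "roe_object \<kappa> Y N" and F: "proper_coarse_map X Y F"
    and t: "covering_isometry X Y M N F t"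
  shows "K_Ad Y N t \<in> graded_hom (K_alg X M) (K_alg Y N)"
proof -
  note c = roe_object_space[OF X] roe_object_space[OF Y]
  obtain E P where M: "partitioned_module X M E P" by (rule roe_object_obtain[OF X])
  obtain E' P' where N: "partitioned_module Y N E' P'" by (rule roe_object_obtain[OF Y])
  obtain f where f: "controlled_fun X Y f" "proper_fun X Y f" "F = fun_class X Y f"
    by (rule proper_coarse_map_obtain_fun[OF c F])
  interpret star_algebra_hom "roe_algebra X M" "roe_algebra Y N" "Ad t"
    by (rule Ad_star_algebra_hom[OF M N f(1,2) covering_isometry_near[OF c f(1) t[unfolded f(3)]]])
  show ?thesis unfolding graded_hom_def K_Ad_def K_alg_def using K0_map_hom K1_map_hom by simp
qed

text \<open>Both \<open>t o\<^sub>L s\<close> and \<open>u\<close> are near the composite function,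
  so they induce the same maps, and conjugation by a product is a composite of conjugations. The
  modules are arbitrary, so that functoriality, invertibility of the comparison maps and naturality
  are all instances.\<close>

lemma K_Ad_comp:
  assumes X: "roe_object \<kappa> X M" and Y: "roe_object \<kappa> Y N" and Z: "roe_object \<kappa> Z L"
    and F: "proper_coarse_map X Y F" and G: "proper_coarse_map Y Z G"
    and s: "covering_isometry X Y M N F s" and t: "covering_isometry Y Z N L G t"
    and u: "covering_isometry X Z M L (coarse_comp X Y Z G F) u"
  shows "graded_eq (K_alg X M) (K_Ad Z L u) (graded_comp (K_Ad Z L t) (K_Ad Y N s))"
proof -
  note cX = roe_object_space[OF X] and cY = roe_object_space[OF Y] and cZ = roe_object_space[OF Z]
  obtain E P where M: "partitioned_module X M E P" by (rule roe_object_obtain[OF X])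
  obtain E' P' where N: "partitioned_module Y N E' P'" by (rule roe_object_obtain[OF Y])
  obtain E'' P'' where L: "partitioned_module Z L E'' P''" by (rule roe_object_obtain[OF Z])
  obtain f where f: "controlled_fun X Y f" "proper_fun X Y f" "F = fun_class X Y f"
    by (rule proper_coarse_map_obtain_fun[OF cX cY F])
  obtain g where g: "controlled_fun Y Z g" "proper_fun Y Z g" "G = fun_class Y Z g"
    by (rule proper_coarse_map_obtain_fun[OF cY cZ G])
  have fX: "f \<in> points X \<rightarrow> points Y" using f(1) unfolding controlled_fun_def by blast
  note gf = controlled_fun_comp[OF f(1) g(1)] proper_fun_comp[OF f(2) g(2) fX]
  note s' = covering_isometry_near[OF cX cY f(1) s[unfolded f(3)]]
  note t' = covering_isometry_near[OF cY cZ g(1) t[unfolded g(3)]]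
  have u': "near_isometry X Z M L (g \<circ> f) u"
    by (rule covering_isometry_near[OF cX cZ gf(1) u[unfolded f(3) g(3) coarse_comp_fun_class[OF cX cY cZ f(1) g(1)]]])
  note ts = near_isometry_compose[OF M N cZ fX g(1) s' t']
  note eq = Ad_K_map_eq[OF M L gf u' ts]
  have Ad: "Ad (t o\<^sub>L s) x = Ad t (Ad s x)" for x
    by (rule Ad_compose[OF near_isometry_clin[OF t'] near_isometry_clin[OF s']])
  note comp = K_map_comp[OF Ad_star_algebra_hom[OF M N f(1,2) s'] Ad_star_algebra_hom[OF N L g(1,2) t']
      Ad_star_algebra_hom[OF M L gf ts] Ad]
  show ?thesis
    unfolding graded_eq_def graded_comp_def K_Ad_def K_alg_def by (simp add: eq comp)
qed

lemma K_Ad_id: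
  assumes X: "roe_object \<kappa> X M" and u: "covering_isometry X X M M (coarse_id X) u"
  shows "graded_eq (K_alg X M) (K_Ad X M u) (id, id)"
proof -
  note cX = roe_object_space[OF X]
  obtain E P where M: "partitioned_module X M E P" by (rule roe_object_obtain[OF X])
  interpret partitioned_module X M E P by (rule M)
  note i = controlled_fun_id[OF cX] proper_fun_id[of X]
  note eq = Ad_K_map_eq[OF M M i covering_isometry_near[OF cX cX i(1) u[unfolded coarse_id_fun_class]] near_isometry_id]
  have "Ad (orth_proj (hsp M)) x = x" if "x \<in> elems (roe_algebra X M)" for x
  proof -
    have x: "x \<in> bops (hsp M) (hsp M)" using that unfolding elems_roe_algebra by (rule roe_algebra_bops)
    show ?thesis unfolding Ad_def
      using bops_orth_proj_left[OF hsp x] bops_orth_proj_right[OF hsp x] by (simp add: op_adj_orth_proj[OF hsp])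
  qed
  note ident = K_map_ident[OF Ad_star_algebra_hom[OF M M i near_isometry_id] this]
  show ?thesis unfolding graded_eq_def K_Ad_def K_alg_def by (simp add: eq ident)
qed

lemma ex_covering:
  assumes \<kappa>: "Card_order \<kappa>" "infinite (Field \<kappa>)" and X: "roe_object \<kappa> X M" and Y: "roe_object \<kappa> Y N"
    and F: "proper_coarse_map X Y F"
  shows "\<exists>t. covering_isometry X Y M N F t"
proof -
  obtain E P where M: "partitioned_module X M E P" by (rule roe_object_obtain[OF X])
  obtain E' P' where N: "partitioned_module Y N E' P'" by (rule roe_object_obtain[OF Y])
  obtain f where f: "controlled_fun X Y f" "proper_fun X Y f" "F = fun_class X Y f"
    by (rule proper_coarse_map_obtain_fun[OF roe_object_space[OF X] roe_object_space[OF Y] F])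
  show ?thesis unfolding f(3)
    by (rule ex_covering_isometry[OF \<kappa> M N _ _ _ f(1)])
      (use X Y in \<open>simp_all add: roe_object_def roe_module_def\<close>)
qed

lemma proper_coarse_map_id: "coarse_space X \<Longrightarrow> proper_coarse_map X X (coarse_id X)"
  by (simp add: coarse_id_fun_class proper_fun_class_iff controlled_fun_id proper_fun_id)

lemma K_Ad_inverse:
  assumes \<kappa>: "Card_order \<kappa>" "infinite (Field \<kappa>)" and M: "roe_object \<kappa> X M" and N: "roe_object \<kappa> X N"
    and u: "covering_isometry X X M N (coarse_id X) u" and w: "covering_isometry X X N M (coarse_id X) w"
  shows "graded_eq (K_alg X M) (graded_comp (K_Ad X M w) (K_Ad X N u)) (id, id)"
proof -
  note X = roe_object_space[OF M] and i = proper_coarse_map_id[OF roe_object_space[OF M]]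
  obtain c where c: "covering_isometry X X M M (coarse_id X) c" using ex_covering[OF \<kappa> M M i] by (elim exE)
  have "coarse_comp X X X (coarse_id X) (coarse_id X) = coarse_id X"
    using i by (simp add: coarse_comp_id[OF X X] proper_coarse_map_def)
  then have "graded_eq (K_alg X M) (K_Ad X M c) (graded_comp (K_Ad X M w) (K_Ad X N u))"
    using K_Ad_comp[OF M N M i i u w, of c] c by simp
  then show ?thesis using K_Ad_id[OF M c] unfolding graded_eq_def by simp
qed

text \<open>Covering isometries of the identity exist in both directions. Neither need be
  surjective; that the induced maps are inverse to each other comes from comparing their composites
  with an isometry of one module covering the identity.\<close>

lemma K_Ad_iso:
  assumes \<kappa>: "Card_order \<kappa>" "infinite (Field \<kappa>)" and M: "roe_object \<kappa> X M" and N: "roe_object \<kappa> X N"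
    and u: "covering_isometry X X M N (coarse_id X) u"
  shows "K_Ad X N u \<in> graded_iso (K_alg X M) (K_alg X N)"
proof -
  note i = proper_coarse_map_id[OF roe_object_space[OF M]]
  obtain w where w: "covering_isometry X X N M (coarse_id X) w" using ex_covering[OF \<kappa> N M i] by (elim exE)
  note hom = K_Ad_hom[OF M N i u] K_Ad_hom[OF N M i w]
  note inv = K_Ad_inverse[OF \<kappa> M N u w] K_Ad_inverse[OF \<kappa> N M w u]
  have "bij_betw (fst (K_Ad X N u)) (carrier (fst (K_alg X M))) (carrier (fst (K_alg X N)))"
    by (rule bij_betw_byWitness[where f' = "fst (K_Ad X M w)"])
      (use hom inv in \<open>auto simp: graded_eq_def graded_comp_def graded_hom_def hom_def Pi_iff mem_Times_iff\<close>)
  moreover have "bij_betw (snd (K_Ad X N u)) (carrier (snd (K_alg X M))) (carrier (snd (K_alg X N)))"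
    by (rule bij_betw_byWitness[where f' = "snd (K_Ad X M w)"])
      (use hom inv in \<open>auto simp: graded_eq_def graded_comp_def graded_hom_def hom_def Pi_iff mem_Times_iff\<close>)
  ultimately show ?thesis
    using hom(1) unfolding graded_iso_def graded_hom_def iso_def by (simp add: mem_Times_iff)
qed

section \<open>The functor and its independence of the choices\<close>

lemma K_Roe_eq: "K_Roe M X = K_alg X (M X)"
  unfolding K_Roe_def K_alg_def ..

lemma K_Roe_map_eq: "K_Roe_map M t X Y f = K_Ad Y (M Y) (t X Y f)"
  unfolding K_Roe_map_def K_Ad_def ..

lemma coarse_cat_simps [simp]:
  "X \<in> Ob (coarse_cat \<kappa>) \<longleftrightarrow> coarse_space X \<and> coarse_card X \<le>o \<kappa>"
  "f \<in> Hom (coarse_cat \<kappa>) X Y \<longleftrightarrow> proper_coarse_map X Y f"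
  "Idn (coarse_cat \<kappa>) = coarse_id" "Comp (coarse_cat \<kappa>) = coarse_comp"
  unfolding coarse_cat_def by simp_all

lemma roe_choiceD:
  assumes "roe_choice \<kappa> M t"
  shows "X \<in> Ob (coarse_cat \<kappa>) \<Longrightarrow> roe_object \<kappa> X (M X)"
    and "X \<in> Ob (coarse_cat \<kappa>) \<Longrightarrow> Y \<in> Ob (coarse_cat \<kappa>) \<Longrightarrow> f \<in> Hom (coarse_cat \<kappa>) X Y \<Longrightarrow>
      covering_isometry X Y (M X) (M Y) f (t X Y f)"
  using assms unfolding roe_choice_def roe_object_def by auto

text \<open>The set \<open>B\<close> ensures that the type \<open>'h\<close> has room for modules of
  rank \<open>\<kappa>\<close>; the choices are then made space by space and map by map.\<close>

lemma ex_roe_choice: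
  fixes \<kappa> :: "'k rel"
  assumes \<kappa>: "Card_order \<kappa>" "infinite (Field \<kappa>)" and B: "corthonormal (B :: 'h::chilbert_space set)" "|B| =o \<kappa>"
  shows "\<exists>(M :: 'a coarse \<Rightarrow> ('a, 'h) cmodule) t. roe_choice \<kappa> M t"
proof -
  define M :: "'a coarse \<Rightarrow> ('a, 'h) cmodule" where "M X = (SOME M. roe_module \<kappa> X M)" for X
  define t where "t X Y f = (SOME t. covering_isometry X Y (M X) (M Y) f t)" for X Y f
  have M: "roe_object \<kappa> X (M X)" if "X \<in> Ob (coarse_cat \<kappa>)" for X
    unfolding roe_object_def M_def
    using that by (auto intro!: someI_ex[OF ex_roe_module[OF \<kappa> _ _ B]])
  have "covering_isometry X Y (M X) (M Y) f (t X Y f)"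
    if "X \<in> Ob (coarse_cat \<kappa>)" "Y \<in> Ob (coarse_cat \<kappa>)" "f \<in> Hom (coarse_cat \<kappa>) X Y" for X Y f
    unfolding t_def by (rule someI_ex[OF ex_covering[OF \<kappa> M M]]) (use that in simp_all)
  then have "roe_choice \<kappa> M t" unfolding roe_choice_def using M unfolding roe_object_def by simp
  then show ?thesis by (intro exI)
qed

lemma graded_functor_K_Roe:
  fixes M :: "'a coarse \<Rightarrow> ('a, 'h::chilbert_space) cmodule"
  assumes c: "roe_choice \<kappa> M t"
  shows "graded_functor (coarse_cat \<kappa>) (K_Roe M) (K_Roe_map M t)"
proof -
  interpret category "coarse_cat \<kappa> :: ('a coarse, ('a \<times> 'a) set set) category" by (rule category_coarse_cat)
  note obj = roe_choiceD(1)[OF c] and cov = roe_choiceD(2)[OF c]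
  show ?thesis
  proof (unfold_locales; unfold K_Roe_eq K_Roe_map_eq)
    fix X :: "'a coarse" assume X: "X \<in> Ob (coarse_cat \<kappa>)"
    show "graded_ab_group (K_alg X (M X))" by (rule graded_ab_group_K_alg[OF obj[OF X]])
    show "graded_eq (K_alg X (M X)) (K_Ad X (M X) (t X X (Idn (coarse_cat \<kappa>) X))) (id, id)"
      using K_Ad_id[OF obj[OF X]] cov[OF X X id_in[OF X]] by simp
  next
    fix X Y :: "'a coarse" and f assume a: "X \<in> Ob (coarse_cat \<kappa>)" "Y \<in> Ob (coarse_cat \<kappa>)" "f \<in> Hom (coarse_cat \<kappa>) X Y"
    show "K_Ad Y (M Y) (t X Y f) \<in> graded_hom (K_alg X (M X)) (K_alg Y (M Y))"
      by (rule K_Ad_hom[OF obj obj _ cov]) (use a in simp_all)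
  next
    fix X Y Z :: "'a coarse" and f g
    assume a: "X \<in> Ob (coarse_cat \<kappa>)" "Y \<in> Ob (coarse_cat \<kappa>)" "Z \<in> Ob (coarse_cat \<kappa>)"
      "f \<in> Hom (coarse_cat \<kappa>) X Y" "g \<in> Hom (coarse_cat \<kappa>) Y Z"
    show "graded_eq (K_alg X (M X)) (K_Ad Z (M Z) (t X Z (Comp (coarse_cat \<kappa>) X Y Z g f)))
        (graded_comp (K_Ad Z (M Z) (t Y Z g)) (K_Ad Y (M Y) (t X Y f)))"
      by (rule K_Ad_comp[OF obj obj obj _ _ cov cov])
        (use a cov[OF a(1,3) comp_in[OF a]] in simp_all)
  qed
qed

lemma naturally_isomorphic_K_Roe:
  fixes \<kappa> :: "'k rel" and M :: "'a coarse \<Rightarrow> ('a, 'h::chilbert_space) cmodule"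
    and M' :: "'a coarse \<Rightarrow> ('a, 'g::chilbert_space) cmodule"
  assumes \<kappa>: "Card_order \<kappa>" "infinite (Field \<kappa>)" and c: "roe_choice \<kappa> M t" and c': "roe_choice \<kappa> M' t'"
  shows "naturally_isomorphic (coarse_cat \<kappa>) (K_Roe M) (K_Roe_map M t) (K_Roe M') (K_Roe_map M' t')"
proof -
  note obj = roe_choiceD(1)[OF c] roe_choiceD(1)[OF c'] and cov = roe_choiceD(2)[OF c] roe_choiceD(2)[OF c']
  define u where "u X = (SOME u. covering_isometry X X (M X) (M' X) (coarse_id X) u)" for X
  have u: "covering_isometry X X (M X) (M' X) (coarse_id X) (u X)" if "X \<in> Ob (coarse_cat \<kappa>)" for X
    unfolding u_def
    by (rule someI_ex[OF ex_covering[OF \<kappa> obj(1) obj(2) proper_coarse_map_id]]) (use that in simp_all)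
  have nat: "graded_eq (K_alg X (M X)) (graded_comp (K_Ad Y (M' Y) (u Y)) (K_Ad Y (M Y) (t X Y f)))
      (graded_comp (K_Ad Y (M' Y) (t' X Y f)) (K_Ad X (M' X) (u X)))"
    if X: "X \<in> Ob (coarse_cat \<kappa>)" and Y: "Y \<in> Ob (coarse_cat \<kappa>)" and f: "f \<in> Hom (coarse_cat \<kappa>) X Y" for X Y f
  proof -
    have f': "proper_coarse_map X Y f" and sp: "coarse_space X" "coarse_space Y" using X Y f by simp_all
    note i = proper_coarse_map_id[OF sp(1)] proper_coarse_map_id[OF sp(2)]
    \<comment> \<open>Both ways around the square are induced by isometries near the same function,
      so each is compared with one isometry \<open>v\<close> from \<open>M X\<close> to
      \<open>M' Y\<close> covering \<open>f\<close>.\<close>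
    obtain v where v: "covering_isometry X Y (M X) (M' Y) f v"
      using ex_covering[OF \<kappa> obj(1)[OF X] obj(2)[OF Y] f'] by (elim exE)
    have id: "coarse_comp X Y Y (coarse_id Y) f = f" "coarse_comp X X Y f (coarse_id X) = f"
      using f' by (simp_all add: coarse_comp_id[OF sp] proper_coarse_map_def)
    have "graded_eq (K_alg X (M X)) (K_Ad Y (M' Y) v) (graded_comp (K_Ad Y (M' Y) (u Y)) (K_Ad Y (M Y) (t X Y f)))"
      by (rule K_Ad_comp[OF obj(1)[OF X] obj(1)[OF Y] obj(2)[OF Y] f' i(2) cov(1)[OF X Y f] u[OF Y]])
        (simp add: id v)
    moreover have "graded_eq (K_alg X (M X)) (K_Ad Y (M' Y) v) (graded_comp (K_Ad Y (M' Y) (t' X Y f)) (K_Ad X (M' X) (u X)))"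
      by (rule K_Ad_comp[OF obj(1)[OF X] obj(2)[OF X] obj(2)[OF Y] i(1) f' u[OF X] cov(2)[OF X Y f]])
        (simp add: id v)
    ultimately show ?thesis unfolding graded_eq_def by simp
  qed
  show ?thesis
    unfolding naturally_isomorphic_def K_Roe_eq K_Roe_map_eq
    by (intro exI[of _ "\<lambda>X. K_Ad X (M' X) (u X)"] conjI ballI nat K_Ad_iso[OF \<kappa> obj(1) obj(2) u])
qed

text \<open>The first conjunct guarantees that choices exist, so that the other two are not vacuous.
  The two choices in the last one may use different types \<open>'h\<close> and \<open>'g\<close> of
  Hilbert space vectors.\<close>

theorem theorem8p17:
  fixes \<kappa> :: "'k rel"
  assumes "Card_order \<kappa>" and "infinite (Field \<kappa>)"
  shows "((\<exists>B :: 'h::chilbert_space set. corthonormal B \<and> |B| =o \<kappa>) \<longrightarrow>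
           (\<exists>(M :: 'a coarse \<Rightarrow> ('a, 'h) cmodule) t. roe_choice \<kappa> M t)) \<and>
         (\<forall>(M :: 'a coarse \<Rightarrow> ('a, 'h) cmodule) t.
           roe_choice \<kappa> M t \<longrightarrow>
             graded_functor (coarse_cat \<kappa>) (K_Roe M) (K_Roe_map M t)) \<and>
         (\<forall>(M :: 'a coarse \<Rightarrow> ('a, 'h) cmodule) t
            (M' :: 'a coarse \<Rightarrow> ('a, 'g::chilbert_space) cmodule) t'.
           roe_choice \<kappa> M t \<and> roe_choice \<kappa> M' t' \<longrightarrow>
             naturally_isomorphic (coarse_cat \<kappa>)
               (K_Roe M) (K_Roe_map M t) (K_Roe M') (K_Roe_map M' t'))"
proof (intro conjI allI impI)
  assume "\<exists>B :: 'h set. corthonormal B \<and> |B| =o \<kappa>"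
  then obtain B :: "'h set" where "corthonormal B" "|B| =o \<kappa>" by (elim exE conjE)
  then show "\<exists>(M :: 'a coarse \<Rightarrow> ('a, 'h) cmodule) t. roe_choice \<kappa> M t" by (rule ex_roe_choice[OF assms])
next
  fix M :: "'a coarse \<Rightarrow> ('a, 'h) cmodule" and t
  assume "roe_choice \<kappa> M t"
  then show "graded_functor (coarse_cat \<kappa>) (K_Roe M) (K_Roe_map M t)" by (rule graded_functor_K_Roe)
next
  fix M :: "'a coarse \<Rightarrow> ('a, 'h) cmodule" and t and M' :: "'a coarse \<Rightarrow> ('a, 'g) cmodule" and t'
  assume "roe_choice \<kappa> M t \<and> roe_choice \<kappa> M' t'"
  then show "naturally_isomorphic (coarse_cat \<kappa>) (K_Roe M) (K_Roe_map M t) (K_Roe M') (K_Roe_map M' t')"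
    by (elim conjE) (rule naturally_isomorphic_K_Roe[OF assms])
qed

end
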